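(* The unnamed stratification functor $S^?:(\mathcal{C}\mathrm{tx}^?)^{\mathrm{op}}\to\mathcal{F}\mathrm{in}\widehat{\mathbb{O}}$, from the opposite of the syntactic category of system $\mathrm{OPTSET}^?$ to the category of finite opetopic sets, is an equivalence of categories.
   Context: **Higher addresses.** $\mathbb{A}_0=\{*\}$ (also $*=[]$, with $*\cdot*=*$), $\mathbb{A}_{n+1}$ = finite lists of elements of $\mathbb{A}_n$, written in brackets; $[p]\cdot[q]=[pq]$ is concatenation; $[p[q]]=[p]\cdot[[q]]$. **Opetopes.** Sets $\mathbb{O}_n$ are defined by induction with, for $\omega\in\mathbb{O}_n$, $n\ge1$, a set $\omega^\bullet\subset\mathbb{A}_{n-1}$ of node addresses, sources $\mathsf{s}_{[p]}\omega\in\mathbb{O}_{n-1}$ ($[p]\in\omega^\bullet$) and target $\mathsf{t}\omega\in\mathbb{O}_{n-1}$. $\mathbb{O}_0=\{\mathrm{pt}\}$, $\mathbb{O}_1=\{\blacksquare\}$, $\blacksquare^\bullet=\{*\}$, $\mathsf{s}_*\blacksquare=\mathsf{t}\blacksquare=\mathrm{pt}$. For $n\ge2$ an $n$-opetope is (an isomorphism class of) a finite rooted tree $\omega$ with nodes labelled in $\mathbb{O}_{n-1}$ and edges labelled in $\mathbb{O}_{n-2}$, such that the input edges of a node labelled $\psi$ are indexed by $\psi^\bullet$, the input edge $[q]$ is labelled $\mathsf{s}_{[q]}\psi$, and its output edge is labelled $\mathsf{t}\psi$. The root edge has address $[]$; the $[q]$-input edge of a node of address $[p]$ has address $[p[q]]$;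 a node has the address of its output edge. $\omega^\bullet$, $\omega^|$ are the sets of node and leaf addresses; $\mathsf{s}_{[p]}\omega$ is the label of the node at $[p]$. $\mathsf{I}_\phi$ ($\phi\in\mathbb{O}_{n-2}$) is the tree with one edge labelled $\phi$ and no node (degenerate); $\mathsf{Y}_\psi$ ($\psi\in\mathbb{O}_{n-1}$) is the corolla with one node labelled $\psi$. $\omega\circ_{[l]}\omega'$ is the grafting of the root of $\omega'$ on the leaf $[l]$ of $\omega$ (edge labels must agree). Targets and readdressing bijections $\wp_\omega:\omega^|\to(\mathsf{t}\omega)^\bullet$: if $n=2$, $\mathsf{t}\omega=\blacksquare$ and $\wp_\omega$ sends the unique leaf to $*$. If $n\ge3$: $\mathsf{t}\mathsf{I}_\phi=\mathsf{Y}_\phi$, $\wp[]=[]$; $\mathsf{t}\mathsf{Y}_\psi=\psi$, $\wp[[q]]=[q]$; and, with $[r]=\wp_\nu[l]$, $\mathsf{t}(\nu\circ_{[l]}\mathsf{Y}_\psi)$ is obtained from the tree $\mathsf{t}\nu$ by replacing its node at $[r]$ by the tree $\psi$, gluing each leaf $[k]$ of $\psi$ to the input $\wp_\psi[k]$ of that node; $\wp[l[q]]=[r]\cdot[q]$ for $[q]\in\psi^\bullet$, and for a leaf $[l']\neq[l]$ of $\nu$, $\wp[l']=[r]\cdot\wp_\psi^{-1}[e]\cdot[r']$ if $\wp_\nu[l']=[r[e]r']$, and $\wp[l']=\wp_\nu[l']$ otherwise. **Opetopic sets.** The category $\mathbb{O}$ has the opetopes as objects, generating morphisms $\mathsf{t}:\mathsf{t}\omega\to\omega$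 and $\mathsf{s}_{[p]}:\mathsf{s}_{[p]}\omega\to\omega$ ($\dim\omega\ge1$, $[p]\in\omega^\bullet$), and relations, for $\dim\omega\ge2$ (equalities of composites into $\omega$): (Inner) $\mathsf{s}_{[p]}\circ\mathsf{s}_{[q]}=\mathsf{s}_{[p[q]]}\circ\mathsf{t}$ for $[p[q]]\in\omega^\bullet$; (Glob1) $\mathsf{t}\circ\mathsf{t}=\mathsf{s}_{[]}\circ\mathsf{t}$ for $\omega$ nondegenerate; (Glob2) $\mathsf{t}\circ\mathsf{s}_{\wp_\omega[p[q]]}=\mathsf{s}_{[p]}\circ\mathsf{s}_{[q]}$ for $\omega$ nondegenerate, $[p[q]]\in\omega^|$; (Degen) $\mathsf{t}\circ\mathsf{t}=\mathsf{t}\circ\mathsf{s}_{[]}$ for $\omega$ degenerate. $\widehat{\mathbb{O}}$ is the category of presheaves of sets on $\mathbb{O}$ (opetopic sets); $\mathcal{F}\mathrm{in}\widehat{\mathbb{O}}$ is the full subcategory of those $X$ with $\sum_\omega X_\omega$ finite. **Preopetopes.** $\mathbb{P}_{-1}=\{\varnothing\}$, $\mathbb{P}_0=\{\mathrm{pt}\}$; for $n\ge1$, an $n$-preopetope is either a nonempty finite set of assignments $\mathbf{p}=\{[p_1]\leftarrow\mathbf{q}_1,\dots,[p_k]\leftarrow\mathbf{q}_k\}$ with pairwise distinct $[p_i]\in\mathbb{A}_{n-1}$ and $\mathbf{q}_i\in\mathbb{P}_{n-1}$, or (for $n\ge2$) a degenerate preopetope $\{\!\{\mathbf{q}$ with $\mathbf{q}\in\mathbb{P}_{n-2}$.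 For a nondegenerate $n$-preopetope $\mathbf{p}=\{[p_1]\leftarrow\mathbf{q}_1,\dots,[p_k]\leftarrow\mathbf{q}_k\}$, $\mathbf{p}^\bullet=\{[p_1],\dots,[p_k]\}$, $\mathsf{s}_{[p_i]}\mathbf{p}=\mathbf{q}_i$, and (for $n\ge2$) $\mathbf{p}^|$ is the set of $[p[q]]$ with $[p]\in\mathbf{p}^\bullet$, $[q]\in(\mathsf{s}_{[p]}\mathbf{p})^\bullet$, $[p[q]]\notin\mathbf{p}^\bullet$. If $\mathbf{p}$ is degenerate, $\mathbf{p}^\bullet=\varnothing$, $\mathbf{p}^|=\{[]\}$; $\mathrm{pt}^\bullet=\mathrm{pt}^|=\varnothing$. $\blacksquare=\{*\leftarrow\mathrm{pt}\}$. For $[r]\in\mathbf{p}^|$, $\mathbf{p}\,\tilde\circ_{[r]}\mathbf{q}$ is $\mathbf{p}$ with $[r]\leftarrow\mathbf{q}$ added. A sequent is $\Gamma\vdash\mathbf{p}\to\mathbf{t}$ with $\mathbf{p}\in\mathbb{P}_n$, $\mathbf{t}\in\mathbb{P}_{n-1}$, and $\Gamma$ a finite set of pairs $\frac{[l]}{[q]}$, $[l]\in\mathbf{p}^|$, $[q]\in\mathbf{t}^\bullet$. Substitution: let $\mathbf{t}=\{[t_1]\leftarrow\mathbf{w}_1,\dots,[t_l]\leftarrow\mathbf{w}_l\}$ and let $\Upsilon\vdash\mathbf{q}\to\mathbf{u}$ be a sequent with $\dim\mathbf{q}=\dim\mathbf{t}$. If $l=1$ and $\mathbf{q}$ is degenerate,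 $\mathbf{t}\,\square_{[t_i]}\mathbf{q}=\mathbf{q}$. If $l\ge2$ and $\mathbf{q}$ is degenerate, it is $\{\chi[t_j]\leftarrow\mathbf{w}_j\}_{j\ne i}$ with $\chi[t_j]=[t_ix]$ if $[t_j]=[t_i[]x]$, else $[t_j]$. If $\mathbf{q}=\{[q_1]\leftarrow\mathbf{v}_1,\dots,[q_k]\leftarrow\mathbf{v}_k\}$, it consists of $[t_iq_m]\leftarrow\mathbf{v}_m$ ($1\le m\le k$) and $\chi[t_j]\leftarrow\mathbf{w}_j$ ($j\ne i$) with $\chi[t_j]=[t_iax]$ if $[t_j]=[t_i[b]x]$ for some $\frac{[a]}{[b]}\in\Upsilon$, else $[t_j]$. **Rules of $\mathrm{OPT}^?$.** `point`: $\vdash\mathrm{pt}\to\varnothing$. `degen`: from $\Gamma\vdash\mathbf{p}\to\mathbf{t}$ derive $\frac{[]}{[]}\vdash\{\!\{\mathbf{p}\to\{[]\leftarrow\mathbf{p}\}$. `shift`: from $\Gamma\vdash\mathbf{p}\to\mathbf{t}$ with $\mathbf{p}^\bullet=\{[p_1],\dots,[p_k]\}$ derive $\frac{[[p_1]]}{[p_1]},\dots,\frac{[[p_k]]}{[p_k]}\vdash\{[]\leftarrow\mathbf{p}\}\to\mathbf{p}$. `graft`: from $\Gamma,\frac{[p[q]]}{[r]}\vdash\mathbf{p}\to\mathbf{t}$ and $\Upsilon\vdash\mathbf{q}\to\mathbf{u}$, where $\dim\mathbf{p}=n\ge2$, $\dim\mathbf{q}=n-1$, $\mathbf{q}^\bullet=\{[s_1],\dots,[s_l]\}$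 and $\mathsf{s}_{[q]}\mathsf{s}_{[p]}\mathbf{p}=\mathbf{u}$, derive $\Gamma',\frac{[p[q][s_1]]}{[rs_1]},\dots,\frac{[p[q][s_l]]}{[rs_l]}\vdash\mathbf{p}\,\tilde\circ_{[p[q]]}\mathbf{q}\to\mathbf{t}\,\square_{[r]}\mathbf{q}$, where $\Gamma'$ consists of $\frac{[a]}{[rxr']}$ for $\frac{[a]}{[r[y]r']}\in\Gamma$ with $\frac{[x]}{[y]}\in\Upsilon$, and of the other pairs of $\Gamma$ unchanged. $\mathbb{P}_n^{\checkmark}$ is the set of $\mathbf{p}\in\mathbb{P}_n$ for which some sequent $\Gamma\vdash\mathbf{p}\to\mathbf{t}$ is derivable; $\Gamma,\mathbf{t}$ are then unique; $\mathsf{t}\mathbf{p}=\mathbf{t}$ and $\wp_{\mathbf{p}}:\mathbf{p}^|\to\mathbf{t}^\bullet$ is the bijection with graph $\Gamma$. The bijection $[\![-]\!]^?:\mathbb{O}_n\to\mathbb{P}_n^{\checkmark}$ is given by $\mathrm{pt}\mapsto\mathrm{pt}$, $\blacksquare\mapsto\blacksquare$, $[\![\mathsf{I}_\phi]\!]^?=\{\!\{[\![\phi]\!]^?$, $[\![\mathsf{Y}_\psi]\!]^?=\{[]\leftarrow[\![\psi]\!]^?\}$, $[\![\nu\circ_{[l]}\mathsf{Y}_\psi]\!]^?=[\![\nu]\!]^?\,\tilde\circ_{[l]}[\![\psi]\!]^?$. **System $\mathrm{OPTSET}^?$.** Contexts are finite sets of typings $x:T$ of variables, where $T$ is $\mathrm{pt}$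 or $\mathbf{P}\to z$ with $\mathbf{P}$ a pasting diagram and $z$ a variable. Judgments: "$\Gamma$ context" and "$\Gamma\vdash\mathbf{P}$". Each variable $x$ gets a shape $x^\natural\in\mathbb{P}^{\checkmark}$. The empty context is a context. `point`: from $\Gamma$ context derive $\Gamma,x:\mathrm{pt}$ context ($x$ fresh); $x^\natural=\mathrm{pt}$. `degen`: from $\Gamma,x:T$ context derive $\Gamma,x:T\vdash\{\!\{x$; its shape is $(\{\!\{x)^\natural=\{\!\{x^\natural$. `graft`: given a nondegenerate $\mathbf{p}=\{[p_1]\leftarrow\psi_1,\dots,[p_k]\leftarrow\psi_k\}\in\mathbb{P}^{\checkmark}$ and variables $x_i:T_i$ ($1\le i\le k$, repetitions allowed) of a context with $x_i^\natural=\psi_i$ and (Inner) $\mathsf{t}x_j=\mathsf{s}_{[q]}x_i$ whenever $[p_j]=[p_i[q]]$, derive in that context the pasting diagram $\mathbf{P}=\{[p_1]\leftarrow x_1,\dots,[p_k]\leftarrow x_k\}$; $\mathbf{P}^\natural=\mathbf{p}$, $\mathsf{s}_{[p_i]}\mathbf{P}=x_i$. `shift`: from $\Gamma\vdash\mathbf{P}$ with $\mathbf{P}^\natural=\mathbf{p}$ and a variable $x$ of $\Gamma$ with $x^\natural=\mathsf{t}\mathbf{p}$ such that, when $\dim\mathbf{p}\ge2$ (so $x:\mathbf{Q}\to a$ for some $\mathbf{Q},a$): (Glob1) if $\mathbf{p}$ is nondegenerate, $\mathsf{t}\mathsf{s}_{[]}\mathbf{P}=\mathsf{t}x$; (Glob2)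 if $\mathbf{p}$ is nondegenerate, $\mathsf{s}_{[q]}\mathsf{s}_{[p]}\mathbf{P}=\mathsf{s}_{\wp_{\mathbf{p}}[p[q]]}x$ for all $[p[q]]\in\mathbf{p}^|$; (Degen) if $\mathbf{p}$ is degenerate, $\mathbf{Q}=\{[]\leftarrow a\}$: derive $\Gamma,y:\mathbf{P}\to x$ context ($y$ fresh), with $y^\natural=\mathbf{p}$, $\mathsf{s}y=\mathbf{P}$, $\mathsf{s}_{[p]}y=\mathsf{s}_{[p]}\mathbf{P}$, $\mathsf{t}y=x$. **The category $\mathcal{C}\mathrm{tx}^?$** has derivable contexts as objects; a morphism $\Upsilon\to\Gamma=(x_1:T_1,\dots,x_k:T_k)$ (listed in an order of introduction) is a sequence $(\sigma_1,\dots,\sigma_k)$ of variables of $\Upsilon$ with $\sigma_i:T_i[\sigma_1/x_1]\cdots[\sigma_{i-1}/x_{i-1}]\in\Upsilon$ for $1\le i\le k$. **The functor $S^?$.** $S^?\Gamma_\omega=\{x\in\Gamma\mid x^\natural=[\![\omega]\!]^?\}$; for $x:\mathbf{P}\to z$ the target map sends $x$ to $z$ and the $[p]$-source map sends $x$ to $\mathsf{s}_{[p]}\mathbf{P}$. For a morphism $\sigma=(\sigma_1,\dots,\sigma_k):\Upsilon\to\Gamma=(x_1:T_1,\dots,x_k:T_k)$ of $\mathcal{C}\mathrm{tx}^?$, $S^?\sigma:S^?\Gamma\to S^?\Upsilon$ sends $x_i$ to $\sigma_i$.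
   Formalization: In rule shift, condition (Degen) also requires the degenerate pasting diagram to be P = {{a, with a the target of x (so x : {[] ← a} → a); with only Q = {[] ← a} the functor would not be full. *)

theory Defs
  imports Main "HOL-Library.FuncSet" "HOL-Library.Finite_Map"
begin

section \<open>Categories, functors, equivalences\<close>

record ('o, 'm) cat =
  Obj :: "'o set"
  Mor :: "'m set"
  Dom :: "'m \<Rightarrow> 'o"
  Cod :: "'m \<Rightarrow> 'o"
  Ident :: "'o \<Rightarrow> 'm"
  Comp :: "'m \<Rightarrow> 'm \<Rightarrow> 'm"  \<comment> \<open>\<open>Comp C g f\<close> is \<open>g\<close> after \<open>f\<close>\<close>

definition in_hom :: "('o, 'm) cat \<Rightarrow> 'm \<Rightarrow> 'o \<Rightarrow> 'o \<Rightarrow> bool" where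
  "in_hom C f a b \<longleftrightarrow> f \<in> Mor C \<and> Dom C f = a \<and> Cod C f = b"

definition is_category :: "('o, 'm) cat \<Rightarrow> bool" where
  "is_category C \<longleftrightarrow>
     (\<forall>f\<in>Mor C. Dom C f \<in> Obj C \<and> Cod C f \<in> Obj C) \<and>
     (\<forall>a\<in>Obj C. in_hom C (Ident C a) a a) \<and>
     (\<forall>f g a b c. in_hom C f a b \<longrightarrow> in_hom C g b c \<longrightarrow> in_hom C (Comp C g f) a c) \<and>
     (\<forall>f a b. in_hom C f a b \<longrightarrow> Comp C f (Ident C a) = f \<and> Comp C (Ident C b) f = f) \<and>
     (\<forall>f g h a b c d. in_hom C f a b \<longrightarrow> in_hom C g b c \<longrightarrow> in_hom C h c d \<longrightarrow>
        Comp C h (Comp C g f) = Comp C (Comp C h g) f)"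

definition op_cat :: "('o, 'm) cat \<Rightarrow> ('o, 'm) cat" where
  "op_cat C = \<lparr>Obj = Obj C, Mor = Mor C, Dom = Cod C, Cod = Dom C, Ident = Ident C,
     Comp = (\<lambda>g f. Comp C f g)\<rparr>"

definition full_subcat :: "('o, 'm) cat \<Rightarrow> ('o \<Rightarrow> bool) \<Rightarrow> ('o, 'm) cat" where
  "full_subcat C P = C\<lparr>Obj := {a \<in> Obj C. P a}, Mor := {f \<in> Mor C. P (Dom C f) \<and> P (Cod C f)}\<rparr>"

record ('o, 'm, 'p, 'n) functr =
  on_obj :: "'o \<Rightarrow> 'p"
  on_mor :: "'m \<Rightarrow> 'n"

definition is_functor ::
    "('o, 'm) cat \<Rightarrow> ('p, 'n) cat \<Rightarrow> ('o, 'm, 'p, 'n) functr \<Rightarrow> bool" where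
  "is_functor C D F \<longleftrightarrow>
     (\<forall>a\<in>Obj C. on_obj F a \<in> Obj D \<and> on_mor F (Ident C a) = Ident D (on_obj F a)) \<and>
     (\<forall>f a b. in_hom C f a b \<longrightarrow> in_hom D (on_mor F f) (on_obj F a) (on_obj F b)) \<and>
     (\<forall>f g a b c. in_hom C f a b \<longrightarrow> in_hom C g b c \<longrightarrow>
        on_mor F (Comp C g f) = Comp D (on_mor F g) (on_mor F f))"

definition id_functor :: "('o, 'm, 'o, 'm) functr" where
  "id_functor = \<lparr>on_obj = (\<lambda>a. a), on_mor = (\<lambda>f. f)\<rparr>"

definition comp_functor ::
    "('p, 'n, 'q, 'r) functr \<Rightarrow> ('o, 'm, 'p, 'n) functr \<Rightarrow> ('o, 'm, 'q, 'r) functr" where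
  "comp_functor G F = \<lparr>on_obj = on_obj G \<circ> on_obj F, on_mor = on_mor G \<circ> on_mor F\<rparr>"

definition is_nat_trans :: "('o, 'm) cat \<Rightarrow> ('p, 'n) cat \<Rightarrow> ('o, 'm, 'p, 'n) functr \<Rightarrow>
    ('o, 'm, 'p, 'n) functr \<Rightarrow> ('o \<Rightarrow> 'n) \<Rightarrow> bool" where
  "is_nat_trans C D F G \<eta> \<longleftrightarrow>
     (\<forall>a\<in>Obj C. in_hom D (\<eta> a) (on_obj F a) (on_obj G a)) \<and>
     (\<forall>f a b. in_hom C f a b \<longrightarrow> Comp D (\<eta> b) (on_mor F f) = Comp D (on_mor G f) (\<eta> a))"

definition is_iso :: "('o, 'm) cat \<Rightarrow> 'm \<Rightarrow> bool" where
  "is_iso C f \<longleftrightarrow> f \<in> Mor C \<and>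
     (\<exists>g. in_hom C g (Cod C f) (Dom C f) \<and>
        Comp C g f = Ident C (Dom C f) \<and> Comp C f g = Ident C (Cod C f))"

definition is_nat_iso :: "('o, 'm) cat \<Rightarrow> ('p, 'n) cat \<Rightarrow> ('o, 'm, 'p, 'n) functr \<Rightarrow>
    ('o, 'm, 'p, 'n) functr \<Rightarrow> ('o \<Rightarrow> 'n) \<Rightarrow> bool" where
  "is_nat_iso C D F G \<eta> \<longleftrightarrow> is_nat_trans C D F G \<eta> \<and> (\<forall>a\<in>Obj C. is_iso D (\<eta> a))"

definition is_equivalence ::
    "('o, 'm) cat \<Rightarrow> ('p, 'n) cat \<Rightarrow> ('o, 'm, 'p, 'n) functr \<Rightarrow> bool" where
  "is_equivalence C D F \<longleftrightarrow>
     is_category C \<and> is_category D \<and> is_functor C D F \<and>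
     (\<exists>G \<eta> \<epsilon>. is_functor D C G \<and>
        is_nat_iso C C id_functor (comp_functor G F) \<eta> \<and>
        is_nat_iso D D (comp_functor F G) id_functor \<epsilon>)"

text \<open>Sets whose elements come from the type \<open>'a\<close>. Morphisms are triples domain, map, codomain,
  with the map extensional, so that equality of morphisms is equality of functions.\<close>

definition set_cat :: "('a set, 'a set \<times> ('a \<Rightarrow> 'a) \<times> 'a set) cat" where
  "set_cat = \<lparr>Obj = UNIV,
     Mor = {(A, f, B) | A f B. f \<in> A \<rightarrow>\<^sub>E B},
     Dom = (\<lambda>(A, f, B). A),
     Cod = (\<lambda>(A, f, B). B),
     Ident = (\<lambda>A. (A, \<lambda>x\<in>A. x, A)),
     Comp = (\<lambda>(B, g, D) (A, f, B'). (A, compose A g f, D))\<rparr>"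

definition functor_cat :: "('o, 'm) cat \<Rightarrow> ('p, 'n) cat \<Rightarrow>
    (('o, 'm, 'p, 'n) functr,
     ('o, 'm, 'p, 'n) functr \<times> ('o \<Rightarrow> 'n) \<times> ('o, 'm, 'p, 'n) functr) cat" where
  "functor_cat C D =
    (let functors = {F. is_functor C D F \<and> on_obj F \<in> extensional (Obj C) \<and>
                        on_mor F \<in> extensional (Mor C)}
     in \<lparr>Obj = functors,
         Mor = {(F, \<eta>, G) | F \<eta> G. F \<in> functors \<and> G \<in> functors \<and>
                  is_nat_trans C D F G \<eta> \<and> \<eta> \<in> extensional (Obj C)},
         Dom = (\<lambda>(F, \<eta>, G). F),
         Cod = (\<lambda>(F, \<eta>, G). G),
         Ident = (\<lambda>F. (F, \<lambda>a\<in>Obj C. Ident D (on_obj F a), F)),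
         Comp = (\<lambda>(G, \<theta>, H) (F, \<eta>, G'). (F, \<lambda>a\<in>Obj C. Comp D (\<theta> a) (\<eta> a), H))\<rparr>)"


section \<open>Higher addresses\<close>

text \<open>\<open>Addr [a\<^sub>1, \<dots>, a\<^sub>k]\<close> is the bracketed list. The address \<open>*\<close> is identified with the empty
  list, so \<open>Addr []\<close> belongs to every \<open>addresses n\<close>; the address \<open>[p[q]]\<close> is \<open>p \<cdot> Addr [q]\<close>.\<close>

datatype addr = Addr (entries: "addr list")

primrec addresses :: "nat \<Rightarrow> addr set" where
  "addresses 0 = {Addr []}"
| "addresses (Suc n) = {Addr l | l. set l \<subseteq> addresses n}"

definition acat :: "addr \<Rightarrow> addr \<Rightarrow> addr"  (infixl \<open>\<cdot>\<close> 70) where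
  "a \<cdot> b = Addr (entries a @ entries b)"

abbreviation nil_addr :: addr  (\<open>\<epsilon>\<close>) where
  "\<epsilon> \<equiv> Addr []"

text \<open>Readdressing after substitution at \<open>r\<close>: the address \<open>[r[y]s]\<close> becomes \<open>[r x s]\<close> for a pair
  \<open>(x, y)\<close> of \<open>\<Upsilon>\<close> (the graph of a bijection from leaves to nodes of the target), and every
  other address is kept.\<close>

definition readdress :: "addr \<Rightarrow> (addr \<times> addr) set \<Rightarrow> addr \<Rightarrow> addr" where
  "readdress r \<Upsilon> b =
     (if \<exists>x y s. (x, y) \<in> \<Upsilon> \<and> b = r \<cdot> Addr [y] \<cdot> s
      then THE c. \<exists>x y s. (x, y) \<in> \<Upsilon> \<and> b = r \<cdot> Addr [y] \<cdot> s \<and> c = r \<cdot> x \<cdot> s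
      else b)"

definition fmap_of_graph :: "('k \<times> 'b) set \<Rightarrow> ('k, 'b) fmap" where
  "fmap_of_graph S = (THE m. \<forall>k v. fmlookup m k = Some v \<longleftrightarrow> (k, v) \<in> S)"


section \<open>Opetopes\<close>

text \<open>A finite rooted tree with labelled nodes and edges is either a single edge \<open>OEdge \<phi>\<close>, or
  \<open>ONode \<psi> ts\<close>: a root node labelled \<open>\<psi>\<close> whose input edges are indexed by the domain of \<open>ts\<close>,
  with the subtree \<open>ts q\<close> standing on the input \<open>q\<close>. As inputs are indexed, two such
  trees are isomorphic iff they are equal. Edge labels are recorded at leaves only: an edge that is
  the output of a node labelled \<open>\<psi>\<close> is labelled by the target of \<open>\<psi>\<close>.\<close>

datatype opet = OPoint | OArrow | OEdge opet | ONode opet "(addr, opet) fmap"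

fun subtree :: "opet \<Rightarrow> addr list \<Rightarrow> opet option" where
  "subtree \<omega> [] = Some \<omega>"
| "subtree (ONode \<psi> ts) (q # a) = Option.bind (fmlookup ts q) (\<lambda>c. subtree c a)"
| "subtree _ (q # a) = None"

definition nodes :: "opet \<Rightarrow> addr set" where
  "nodes \<omega> = (if \<omega> = OArrow then {\<epsilon>}
              else {Addr a | a \<psi> ts. subtree \<omega> a = Some (ONode \<psi> ts)})"

definition leaves :: "opet \<Rightarrow> addr set" where
  "leaves \<omega> = {Addr a | a \<phi>. subtree \<omega> a = Some (OEdge \<phi>)}"

definition src :: "opet \<Rightarrow> addr \<Rightarrow> opet" where
  "src \<omega> p = (if \<omega> = OArrow then OPoint
              else THE \<psi>. \<exists>ts. subtree \<omega> (entries p) = Some (ONode \<psi> ts))"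

definition corolla :: "opet \<Rightarrow> opet" where
  "corolla \<psi> = ONode \<psi> (fmap_of_graph {(q, OEdge (src \<psi> q)) | q. q \<in> nodes \<psi>})"

text \<open>Replace the subtree at a given address; at a leaf this is grafting.\<close>

fun plug :: "opet \<Rightarrow> addr list \<Rightarrow> opet \<Rightarrow> opet" where
  "plug \<omega> [] \<omega>' = \<omega>'"
| "plug (ONode \<psi> ts) (q # a) \<omega>' =
     (case fmlookup ts q of
        Some c \<Rightarrow> ONode \<psi> (fmupd q (plug c a \<omega>') ts)
      | None \<Rightarrow> ONode \<psi> ts)"
| "plug \<omega> (q # a) \<omega>' = \<omega>"

text \<open>Put on every leaf of a tree the tree given by a function of the leaf address.\<close>

primrec glue :: "opet \<Rightarrow> (addr list \<Rightarrow> opet) \<Rightarrow> opet" where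
  "glue OPoint = (\<lambda>f. OPoint)"
| "glue OArrow = (\<lambda>f. OArrow)"
| "glue (OEdge \<phi>) = (\<lambda>f. f [])"
| "glue (ONode \<psi> ts) =
     (\<lambda>f. ONode \<psi> (fmmap_keys (\<lambda>q g. g (\<lambda>a. f (q # a))) (fmmap glue ts)))"

text \<open>Replace the node of \<open>\<tau>\<close> at \<open>r\<close> by the tree \<open>\<psi>\<close>, gluing the leaf \<open>k\<close> of \<open>\<psi>\<close> to the input
  \<open>V k\<close> of that node.\<close>

definition substitute :: "opet \<Rightarrow> addr \<Rightarrow> opet \<Rightarrow> (addr \<times> addr) set \<Rightarrow> opet" where
  "substitute \<tau> r \<psi> V =
     (case subtree \<tau> (entries r) of
        Some (ONode \<rho> ts) \<Rightarrow>
          plug \<tau> (entries r) (glue \<psi> (\<lambda>k. the (fmlookup ts (THE e. (Addr k, e) \<in> V))))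
      | _ \<Rightarrow> \<tau>)"

text \<open>\<open>opetope n \<omega>\<close>: \<open>\<omega>\<close> is an \<open>n\<close>-opetope. \<open>root_edge \<omega> \<phi>\<close>: the root edge of the tree \<open>\<omega>\<close>
  is labelled \<open>\<phi>\<close>. \<open>target \<omega> \<tau> W\<close>: \<open>\<tau>\<close> is the target of \<open>\<omega>\<close>, and \<open>W\<close> is the graph of the
  readdressing bijection from the leaves of \<open>\<omega>\<close> to the nodes of \<open>\<tau>\<close>.\<close>

inductive opetope :: "nat \<Rightarrow> opet \<Rightarrow> bool"
  and root_edge :: "opet \<Rightarrow> opet \<Rightarrow> bool"
  and target :: "opet \<Rightarrow> opet \<Rightarrow> (addr \<times> addr) set \<Rightarrow> bool" where
  opetope_point: "opetope 0 OPoint"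
| opetope_arrow: "opetope 1 OArrow"
| opetope_edge: "opetope n \<phi> \<Longrightarrow> opetope (n + 2) (OEdge \<phi>)"
| opetope_node: "\<lbrakk>opetope (n + 1) \<psi>; fmdom' ts = nodes \<psi>;
     \<forall>q c. fmlookup ts q = Some c \<longrightarrow> opetope (n + 2) c \<and> root_edge c (src \<psi> q)\<rbrakk>
   \<Longrightarrow> opetope (n + 2) (ONode \<psi> ts)"
| root_edge_edge: "root_edge (OEdge \<phi>) \<phi>"
| root_edge_node: "target \<psi> \<phi> V \<Longrightarrow> root_edge (ONode \<psi> ts) \<phi>"
| target_arrow: "target OArrow OPoint {}"
| target_two: "opetope 2 \<omega> \<Longrightarrow> target \<omega> OArrow {(l, \<epsilon>) | l. l \<in> leaves \<omega>}"
| target_edge: "\<lbrakk>opetope n \<phi>; n \<ge> 1\<rbrakk> \<Longrightarrow> target (OEdge \<phi>) (corolla \<phi>) {(\<epsilon>, \<epsilon>)}"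
| target_corolla: "\<lbrakk>opetope n \<psi>; n \<ge> 2\<rbrakk>
   \<Longrightarrow> target (corolla \<psi>) \<psi> {(Addr [q], q) | q. q \<in> nodes \<psi>}"
| target_graft: "\<lbrakk>opetope (n + 1) \<nu>; n \<ge> 2; \<nu> = ONode \<chi> ts; opetope n \<psi>;
     subtree \<nu> l = Some (OEdge \<phi>); target \<psi> \<phi> V; target \<nu> \<tau> W; (Addr l, r) \<in> W\<rbrakk>
   \<Longrightarrow> target (plug \<nu> l (corolla \<psi>)) (substitute \<tau> r \<psi> V)
        ({(Addr l \<cdot> Addr [q], r \<cdot> q) | q. q \<in> nodes \<psi>} \<union>
         {(l', readdress r V a) | l' a. (l', a) \<in> W \<and> l' \<noteq> Addr l})"

definition tgt :: "opet \<Rightarrow> opet" where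
  "tgt \<omega> = (THE \<tau>. \<exists>W. target \<omega> \<tau> W)"

definition wp :: "opet \<Rightarrow> addr \<Rightarrow> addr" where
  "wp \<omega> l = (THE a. \<exists>\<tau> W. target \<omega> \<tau> W \<and> (l, a) \<in> W)"


section \<open>The category of opetopes and opetopic sets\<close>

datatype gen = GTgt opet | GSrc opet addr

fun gen_ok :: "gen \<Rightarrow> bool" where
  "gen_ok (GTgt \<omega>) \<longleftrightarrow> (\<exists>n\<ge>1. opetope n \<omega>)"
| "gen_ok (GSrc \<omega> p) \<longleftrightarrow> (\<exists>n\<ge>1. opetope n \<omega>) \<and> p \<in> nodes \<omega>"

fun gen_dom :: "gen \<Rightarrow> opet" where
  "gen_dom (GTgt \<omega>) = tgt \<omega>"
| "gen_dom (GSrc \<omega> p) = src \<omega> p"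

fun gen_cod :: "gen \<Rightarrow> opet" where
  "gen_cod (GTgt \<omega>) = \<omega>"
| "gen_cod (GSrc \<omega> p) = \<omega>"

text \<open>\<open>is_path \<alpha> u \<omega>\<close>: the list \<open>u = [g\<^sub>1, \<dots>, g\<^sub>k]\<close> denotes a formal composite
  \<open>g\<^sub>1 \<circ> \<cdots> \<circ> g\<^sub>k\<close> of generators from \<open>\<alpha>\<close> to \<open>\<omega>\<close>.\<close>

inductive is_path :: "opet \<Rightarrow> gen list \<Rightarrow> opet \<Rightarrow> bool" where
  "opetope n \<omega> \<Longrightarrow> is_path \<omega> [] \<omega>"
| "\<lbrakk>gen_ok g; is_path \<alpha> u (gen_dom g)\<rbrakk> \<Longrightarrow> is_path \<alpha> (g # u) (gen_cod g)"

definition degenerate :: "opet \<Rightarrow> bool" where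
  "degenerate \<omega> \<longleftrightarrow> (\<exists>\<phi>. \<omega> = OEdge \<phi>)"

inductive opet_rel :: "gen list \<Rightarrow> gen list \<Rightarrow> bool" where
  Inner: "\<lbrakk>opetope n \<omega>; n \<ge> 2; p \<in> nodes \<omega>; p \<cdot> Addr [q] \<in> nodes \<omega>\<rbrakk>
   \<Longrightarrow> opet_rel [GSrc \<omega> p, GSrc (src \<omega> p) q]
                [GSrc \<omega> (p \<cdot> Addr [q]), GTgt (src \<omega> (p \<cdot> Addr [q]))]"
| Glob1: "\<lbrakk>opetope n \<omega>; n \<ge> 2; \<not> degenerate \<omega>\<rbrakk>
   \<Longrightarrow> opet_rel [GTgt \<omega>, GTgt (tgt \<omega>)] [GSrc \<omega> \<epsilon>, GTgt (src \<omega> \<epsilon>)]"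
| Glob2: "\<lbrakk>opetope n \<omega>; n \<ge> 2; \<not> degenerate \<omega>; p \<in> nodes \<omega>; p \<cdot> Addr [q] \<in> leaves \<omega>\<rbrakk>
   \<Longrightarrow> opet_rel [GTgt \<omega>, GSrc (tgt \<omega>) (wp \<omega> (p \<cdot> Addr [q]))]
                [GSrc \<omega> p, GSrc (src \<omega> p) q]"
| Degen: "\<lbrakk>opetope n \<omega>; n \<ge> 2; degenerate \<omega>\<rbrakk>
   \<Longrightarrow> opet_rel [GTgt \<omega>, GTgt (tgt \<omega>)] [GTgt \<omega>, GSrc (tgt \<omega>) \<epsilon>]"

inductive path_eq :: "opet \<Rightarrow> opet \<Rightarrow> gen list \<Rightarrow> gen list \<Rightarrow> bool" for \<alpha> \<omega> where
  path_eq_refl: "is_path \<alpha> u \<omega> \<Longrightarrow> path_eq \<alpha> \<omega> u u"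
| path_eq_sym: "path_eq \<alpha> \<omega> u v \<Longrightarrow> path_eq \<alpha> \<omega> v u"
| path_eq_trans: "path_eq \<alpha> \<omega> u v \<Longrightarrow> path_eq \<alpha> \<omega> v w \<Longrightarrow> path_eq \<alpha> \<omega> u w"
| path_eq_rel: "\<lbrakk>opet_rel u v; is_path \<alpha> (a @ u @ b) \<omega>; is_path \<alpha> (a @ v @ b) \<omega>\<rbrakk>
   \<Longrightarrow> path_eq \<alpha> \<omega> (a @ u @ b) (a @ v @ b)"

type_synonym opet_mor = "opet \<times> gen list set \<times> opet"

definition opet_cat :: "(opet, opet_mor) cat" where
  "opet_cat = \<lparr>Obj = {\<omega>. \<exists>n. opetope n \<omega>},
     Mor = {(\<alpha>, K, \<omega>) | \<alpha> K \<omega>. K \<in> {u. is_path \<alpha> u \<omega>} // {(u, v). path_eq \<alpha> \<omega> u v}},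
     Dom = (\<lambda>(\<alpha>, K, \<omega>). \<alpha>),
     Cod = (\<lambda>(\<alpha>, K, \<omega>). \<omega>),
     Ident = (\<lambda>\<omega>. (\<omega>, {v. path_eq \<omega> \<omega> [] v}, \<omega>)),
     Comp = (\<lambda>(\<beta>, K, \<omega>) (\<alpha>, L, \<beta>').
               (\<alpha>, {w. \<exists>u\<in>K. \<exists>v\<in>L. path_eq \<alpha> \<omega> (u @ v) w}, \<omega>))\<rparr>"

type_synonym 'a presheaf = "(opet, opet_mor, 'a set, 'a set \<times> ('a \<Rightarrow> 'a) \<times> 'a set) functr"

type_synonym 'a presheaf_mor =
  "'a presheaf \<times> (opet \<Rightarrow> 'a set \<times> ('a \<Rightarrow> 'a) \<times> 'a set) \<times> 'a presheaf"

definition opetopic_sets :: "('a presheaf, 'a presheaf_mor) cat" where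
  "opetopic_sets = functor_cat (op_cat opet_cat) set_cat"

definition fin_opetopic_sets :: "('a presheaf, 'a presheaf_mor) cat" where
  "fin_opetopic_sets =
     full_subcat opetopic_sets (\<lambda>X. finite (SIGMA \<omega>:Obj opet_cat. on_obj X \<omega>))"


section \<open>Preopetopes and the unnamed sequent calculus\<close>

text \<open>\<open>PEmpty\<close> is the unique preopetope of dimension \<open>-1\<close>; \<open>preopetope n\<close> covers the
  dimensions \<open>n \<ge> 0\<close>.\<close>

datatype popet = PEmpty | PPoint | PDegen popet | PAssign "(addr, popet) fmap"

inductive preopetope :: "nat \<Rightarrow> popet \<Rightarrow> bool" where
  "preopetope 0 PPoint"
| "\<lbrakk>m \<noteq> fmempty; fmdom' m \<subseteq> addresses n; \<forall>p q. fmlookup m p = Some q \<longrightarrow> preopetope n q\<rbrakk>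
   \<Longrightarrow> preopetope (n + 1) (PAssign m)"
| "preopetope n q \<Longrightarrow> preopetope (n + 2) (PDegen q)"

fun pnodes :: "popet \<Rightarrow> addr set" where
  "pnodes (PAssign m) = fmdom' m"
| "pnodes _ = {}"

fun psrc :: "popet \<Rightarrow> addr \<Rightarrow> popet option" where
  "psrc (PAssign m) p = fmlookup m p"
| "psrc _ p = None"

fun pleaves :: "popet \<Rightarrow> addr set" where
  "pleaves (PAssign m) =
     {p \<cdot> Addr [q] | p q f. fmlookup m p = Some f \<and> q \<in> pnodes f \<and> p \<cdot> Addr [q] \<notin> fmdom' m}"
| "pleaves (PDegen q) = {\<epsilon>}"
| "pleaves _ = {}"

fun psubst :: "popet \<Rightarrow> addr \<Rightarrow> popet \<Rightarrow> (addr \<times> addr) set \<Rightarrow> popet" where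
  "psubst (PAssign ts) r (PDegen f) \<Upsilon> =
     (if fmdom' ts = {r} then PDegen f
      else PAssign (fmap_of_graph
             {(readdress r {(\<epsilon>, \<epsilon>)} a, w) | a w. fmlookup ts a = Some w \<and> a \<noteq> r}))"
| "psubst (PAssign ts) r (PAssign qs) \<Upsilon> =
     PAssign (fmap_of_graph
       ({(r \<cdot> a, v) | a v. fmlookup qs a = Some v} \<union>
        {(readdress r \<Upsilon> a, w) | a w. fmlookup ts a = Some w \<and> a \<noteq> r}))"
| "psubst t r _ \<Upsilon> = t"

text \<open>\<open>sequent \<Gamma> p t\<close>: the sequent \<open>\<Gamma> \<turnstile> p \<rightarrow> t\<close> is derivable.\<close>

inductive sequent :: "(addr \<times> addr) set \<Rightarrow> popet \<Rightarrow> popet \<Rightarrow> bool" where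
  seq_point: "sequent {} PPoint PEmpty"
| seq_degen: "sequent \<Gamma> p t \<Longrightarrow> sequent {(\<epsilon>, \<epsilon>)} (PDegen p) (PAssign (fmupd \<epsilon> p fmempty))"
| seq_shift: "sequent \<Gamma> p t
   \<Longrightarrow> sequent {(Addr [a], a) | a. a \<in> pnodes p} (PAssign (fmupd \<epsilon> p fmempty)) p"
| seq_graft: "\<lbrakk>sequent (insert (a \<cdot> Addr [b], r) \<Gamma>) (PAssign m) t; (a \<cdot> Addr [b], r) \<notin> \<Gamma>;
     sequent \<Upsilon> q u; preopetope (n + 1) (PAssign m); n \<ge> 1; preopetope n q;
     a \<cdot> Addr [b] \<in> pleaves (PAssign m);
     fmlookup m a = Some f; psrc f b = Some u\<rbrakk>
   \<Longrightarrow> sequent ((\<lambda>(c, d). (c, readdress r \<Upsilon> d)) ` \<Gamma> \<union>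
                {(a \<cdot> Addr [b] \<cdot> Addr [s], r \<cdot> s) | s. s \<in> pnodes q})
         (PAssign (fmupd (a \<cdot> Addr [b]) q m)) (psubst t r q \<Upsilon>)"

definition valid_popet :: "popet \<Rightarrow> bool" where
  "valid_popet p \<longleftrightarrow> (\<exists>\<Gamma> t. sequent \<Gamma> p t)"

text \<open>A tree can be built by grafting corollas in several orders, so the bijection from opetopes to
  valid preopetopes is first given as a relation.\<close>

inductive encodes :: "opet \<Rightarrow> popet \<Rightarrow> bool" where
  "encodes OPoint PPoint"
| "encodes OArrow (PAssign (fmupd \<epsilon> PPoint fmempty))"
| "encodes \<phi> f \<Longrightarrow> encodes (OEdge \<phi>) (PDegen f)"
| "encodes \<psi> f \<Longrightarrow> encodes (corolla \<psi>) (PAssign (fmupd \<epsilon> f fmempty))"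
| "\<lbrakk>encodes \<nu> (PAssign m); subtree \<nu> l = Some (OEdge (tgt \<psi>)); encodes \<psi> f\<rbrakk>
   \<Longrightarrow> encodes (plug \<nu> l (corolla \<psi>)) (PAssign (fmupd (Addr l) f m))"

definition enc :: "opet \<Rightarrow> popet" where
  "enc \<omega> = (THE p. encodes \<omega> p)"


section \<open>The unnamed type theory for opetopic sets\<close>

datatype 'v pd = PdDegen 'v | PdGraft "(addr, 'v) fmap"

datatype 'v ty = TPoint | TArrow "'v pd" 'v

text \<open>A set of typings of pairwise distinct variables is represented as a partial map.\<close>

type_synonym 'v ctx = "'v \<Rightarrow> 'v ty option"

definition var_src :: "'v ctx \<Rightarrow> addr \<Rightarrow> 'v \<Rightarrow> 'v option" where
  "var_src \<Gamma> p x = (case \<Gamma> x of Some (TArrow (PdGraft m) z) \<Rightarrow> fmlookup m p | _ \<Rightarrow> None)"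

definition var_tgt :: "'v ctx \<Rightarrow> 'v \<Rightarrow> 'v option" where
  "var_tgt \<Gamma> x = (case \<Gamma> x of Some (TArrow P z) \<Rightarrow> Some z | _ \<Rightarrow> None)"

inductive var_shape :: "'v ctx \<Rightarrow> 'v \<Rightarrow> popet \<Rightarrow> bool"
  and pd_shape :: "'v ctx \<Rightarrow> 'v pd \<Rightarrow> popet \<Rightarrow> bool" for \<Gamma> where
  "\<Gamma> x = Some TPoint \<Longrightarrow> var_shape \<Gamma> x PPoint"
| "\<Gamma> x = Some (TArrow P z) \<Longrightarrow> pd_shape \<Gamma> P p \<Longrightarrow> var_shape \<Gamma> x p"
| "var_shape \<Gamma> x p \<Longrightarrow> pd_shape \<Gamma> (PdDegen x) (PDegen p)"
| "\<lbrakk>fmdom' m = fmdom' k;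
    \<forall>p x f. fmlookup m p = Some x \<longrightarrow> fmlookup k p = Some f \<longrightarrow> var_shape \<Gamma> x f\<rbrakk>
   \<Longrightarrow> pd_shape \<Gamma> (PdGraft m) (PAssign k)"

text \<open>\<open>ctxt V \<Gamma>\<close>: \<open>\<Gamma>\<close> is derivable as a context, with variables taken from \<open>V\<close>.
  \<open>pasting V \<Gamma> P\<close>: the judgment \<open>\<Gamma> \<turnstile> P\<close> is derivable.

  In the condition for a degenerate pasting diagram \<open>\<lbrace>\<lbrace>z\<close> with target \<open>x : Q \<rightarrow> a\<close>, besides
  \<open>Q = {[] \<leftarrow> a}\<close> the variable \<open>z\<close> has to be \<open>a\<close>. Without that identification the
  stratification functor would not be full: for \<open>z, a : pt\<close>, \<open>x : {* \<leftarrow> a} \<rightarrow> a\<close>,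
  \<open>y : \<lbrace>\<lbrace>z \<rightarrow> x\<close>, the presheaf forgets \<open>z\<close> as a face of \<open>y\<close> and has an endomorphism moving
  only \<open>z\<close>, to \<open>a\<close>.\<close>

inductive ctxt :: "'v set \<Rightarrow> 'v ctx \<Rightarrow> bool"
  and pasting :: "'v set \<Rightarrow> 'v ctx \<Rightarrow> 'v pd \<Rightarrow> bool" for V where
  ctxt_empty: "ctxt V Map.empty"
| ctxt_point: "\<lbrakk>ctxt V \<Gamma>; x \<in> V; x \<notin> dom \<Gamma>\<rbrakk> \<Longrightarrow> ctxt V (\<Gamma>(x \<mapsto> TPoint))"
| pasting_degen: "\<lbrakk>ctxt V \<Gamma>; x \<in> dom \<Gamma>\<rbrakk> \<Longrightarrow> pasting V \<Gamma> (PdDegen x)"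
| pasting_graft: "\<lbrakk>ctxt V \<Gamma>; valid_popet (PAssign k); fmran' m \<subseteq> dom \<Gamma>;
     pd_shape \<Gamma> (PdGraft m) (PAssign k);
     \<comment> \<open>Inner\<close>
     \<forall>p q xi xj. fmlookup m p = Some xi \<longrightarrow> fmlookup m (p \<cdot> Addr [q]) = Some xj \<longrightarrow>
       (\<exists>z. var_tgt \<Gamma> xj = Some z \<and> var_src \<Gamma> q xi = Some z)\<rbrakk>
   \<Longrightarrow> pasting V \<Gamma> (PdGraft m)"
| ctxt_shift: "\<lbrakk>pasting V \<Gamma> P; pd_shape \<Gamma> P p; sequent W p t; x \<in> dom \<Gamma>; var_shape \<Gamma> x t;
     \<comment> \<open>Glob1 and Glob2\<close>
     \<forall>n m. n \<ge> 2 \<longrightarrow> preopetope n p \<longrightarrow> P = PdGraft m \<longrightarrow>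
       (\<exists>x0 z. fmlookup m \<epsilon> = Some x0 \<and> var_tgt \<Gamma> x0 = Some z \<and> var_tgt \<Gamma> x = Some z) \<and>
       (\<forall>a b r. a \<in> fmdom' m \<longrightarrow> (a \<cdot> Addr [b], r) \<in> W \<longrightarrow>
         (\<exists>xa z. fmlookup m a = Some xa \<and> var_src \<Gamma> b xa = Some z \<and> var_src \<Gamma> r x = Some z));
     \<comment> \<open>Degen\<close>
     \<forall>n z. n \<ge> 2 \<longrightarrow> preopetope n p \<longrightarrow> P = PdDegen z \<longrightarrow>
       (\<exists>a. \<Gamma> x = Some (TArrow (PdGraft (fmupd \<epsilon> a fmempty)) a) \<and> z = a);
     y \<in> V; y \<notin> dom \<Gamma>\<rbrakk>
   \<Longrightarrow> ctxt V (\<Gamma>(y \<mapsto> TArrow P x))"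

text \<open>A morphism from \<open>\<Upsilon>\<close> to \<open>\<Gamma>\<close> is the family of variables \<open>\<sigma> x\<close> of \<open>\<Upsilon>\<close>, for \<open>x\<close> in \<open>\<Gamma>\<close>.
  Every variable of a type in \<open>\<Gamma>\<close> is introduced before that type is used, so
  substituting all of \<open>\<sigma>\<close> at once by \<open>map_ty \<sigma>\<close> replaces exactly the variables introduced
  earlier.\<close>

definition is_ctx_mor :: "'v ctx \<Rightarrow> ('v \<Rightarrow> 'v) \<Rightarrow> 'v ctx \<Rightarrow> bool" where
  "is_ctx_mor \<Upsilon> \<sigma> \<Gamma> \<longleftrightarrow> (\<forall>x T. \<Gamma> x = Some T \<longrightarrow> \<Upsilon> (\<sigma> x) = Some (map_ty \<sigma> T))"

type_synonym 'v ctx_mor = "'v ctx \<times> ('v \<Rightarrow> 'v) \<times> 'v ctx"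

definition ctx_cat :: "'v set \<Rightarrow> ('v ctx, 'v ctx_mor) cat" where
  "ctx_cat V = \<lparr>Obj = {\<Gamma>. ctxt V \<Gamma>},
     Mor = {(\<Upsilon>, \<sigma>, \<Gamma>) | \<Upsilon> \<sigma> \<Gamma>. ctxt V \<Upsilon> \<and> ctxt V \<Gamma> \<and> is_ctx_mor \<Upsilon> \<sigma> \<Gamma> \<and>
              \<sigma> \<in> extensional (dom \<Gamma>)},
     Dom = (\<lambda>(\<Upsilon>, \<sigma>, \<Gamma>). \<Upsilon>),
     Cod = (\<lambda>(\<Upsilon>, \<sigma>, \<Gamma>). \<Gamma>),
     Ident = (\<lambda>\<Gamma>. (\<Gamma>, \<lambda>x\<in>dom \<Gamma>. x, \<Gamma>)),
     Comp = (\<lambda>(\<Gamma>, \<tau>, \<Delta>) (\<Upsilon>, \<sigma>, \<Gamma>'). (\<Upsilon>, \<lambda>x\<in>dom \<Delta>. \<sigma> (\<tau> x), \<Delta>))\<rparr>"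


section \<open>The stratification functor\<close>

definition strat_set :: "'v ctx \<Rightarrow> opet \<Rightarrow> 'v set" where
  "strat_set \<Gamma> \<omega> = {x \<in> dom \<Gamma>. var_shape \<Gamma> x (enc \<omega>)}"

fun gen_act :: "'v ctx \<Rightarrow> gen \<Rightarrow> 'v \<Rightarrow> 'v" where
  "gen_act \<Gamma> (GTgt \<omega>) x = the (var_tgt \<Gamma> x)"
| "gen_act \<Gamma> (GSrc \<omega> p) x = the (var_src \<Gamma> p x)"

text \<open>Contravariance: \<open>g\<^sub>1 \<circ> \<cdots> \<circ> g\<^sub>k\<close> acts by \<open>g\<^sub>1\<close> first.\<close>

primrec path_act :: "'v ctx \<Rightarrow> gen list \<Rightarrow> 'v \<Rightarrow> 'v" where
  "path_act \<Gamma> [] x = x"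
| "path_act \<Gamma> (g # u) x = path_act \<Gamma> u (gen_act \<Gamma> g x)"

definition strat_obj :: "'v ctx \<Rightarrow> 'v presheaf" where
  "strat_obj \<Gamma> = \<lparr>
     on_obj = (\<lambda>\<omega>\<in>Obj opet_cat. strat_set \<Gamma> \<omega>),
     on_mor = (\<lambda>f\<in>Mor opet_cat. case f of (\<alpha>, K, \<omega>) \<Rightarrow>
       (strat_set \<Gamma> \<omega>,
        \<lambda>x\<in>strat_set \<Gamma> \<omega>. path_act \<Gamma> (SOME u. u \<in> K) x,
        strat_set \<Gamma> \<alpha>))\<rparr>"

definition strat_mor :: "'v ctx_mor \<Rightarrow> 'v presheaf_mor" where
  "strat_mor = (\<lambda>(\<Upsilon>, \<sigma>, \<Gamma>).
     (strat_obj \<Gamma>,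
      \<lambda>\<omega>\<in>Obj opet_cat. (strat_set \<Gamma> \<omega>, \<lambda>x\<in>strat_set \<Gamma> \<omega>. \<sigma> x, strat_set \<Upsilon> \<omega>),
      strat_obj \<Upsilon>))"

definition stratification ::
    "('v ctx, 'v ctx_mor, 'v presheaf, 'v presheaf_mor) functr" where
  "stratification = \<lparr>on_obj = strat_obj, on_mor = strat_mor\<rparr>"

end

theory Submission
  imports Defs
begin

text \<open>
  All combinatorics is done on the side of preopetopes. The key point is that substitutions at
  different addresses commute and that nested ones associate, and that the readdressings follow suit.
  Hence any topmost node of a preopetope can be made the last one to be grafted, so that the derivable
  sequent of a preopetope is unique; the same commutation shows that the target of \<open>t\<close> is unchanged by
  a substitution in \<open>t\<close>, which gives the globular identities. Trees are encoded as preopetopes by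
  collecting the labels of their nodes; this carries grafting to grafting and targets to targets, so
  the relations of the category of opetopes become the side conditions of the rules for contexts.

  Each variable of a context has the shape of exactly one opetope, and its type is determined by its
  faces. Therefore a natural transformation between stratifications is the same as a morphism of
  contexts. Conversely, after naming the cells of a finite opetopic set by variables, adding them one by
  one in order of dimension derives a context with the given stratification.
\<close>

section \<open>Addresses\<close>

text \<open>Substitution in a target \<open>t\<close> is well behaved only if readdressing is
  bijective, while the target of a derivable sequent is itself produced by substitutions one
  dimension lower. Hence two statements are proved together by induction on the dimension:
  regularity (bijective readdressing, globular identities) and substitutivity (substituting in
  \<open>t\<close> keeps its target). Regularity in dimension \<open>n + 1\<close> uses both in
  dimension \<open>n\<close>; substitutivity in dimension \<open>n + 1\<close> uses regularity there
  and substitutivity in dimension \<open>n\<close>. The exceptional case throughout is a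
  substitution that removes the only node of \<open>t\<close>: the result is then a degenerate
  preopetope, which is not determined by its labelled addresses, so equalities between results need
  an extra argument there. On trees the target is a relation that admits any order of grafting. That
  it is a function is imported from the uniqueness of sequents, through the injectivity of
  \<open>popet_of\<close>.\<close>

lemma acat_Addr [simp]: "Addr a \<cdot> Addr b = Addr (a @ b)"
  by (simp add: acat_def)

lemma acat_assoc [simp]: "a \<cdot> b \<cdot> c = a \<cdot> (b \<cdot> c)"
  by (simp add: acat_def)

lemma acat_nil [simp]: "\<epsilon> \<cdot> a = a" "a \<cdot> \<epsilon> = a"
  by (simp_all add: acat_def)

lemma acat_cancel [simp]: "a \<cdot> b = a \<cdot> c \<longleftrightarrow> b = c" "b \<cdot> a = c \<cdot> a \<longleftrightarrow> b = c"
  by (cases a; cases b; cases c; simp)+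

lemma acat_cancel_self [simp]: "a \<cdot> b = a \<longleftrightarrow> b = \<epsilon>" "a = a \<cdot> b \<longleftrightarrow> b = \<epsilon>"
  by (cases a; cases b; simp)+

lemma acat_eq_nil [simp]: "a \<cdot> b = \<epsilon> \<longleftrightarrow> a = \<epsilon> \<and> b = \<epsilon>" "\<epsilon> = a \<cdot> b \<longleftrightarrow> a = \<epsilon> \<and> b = \<epsilon>"
  by (cases a; cases b; auto)+

lemma acat_entry_eq [simp]:
  "Addr [x] \<cdot> a = Addr [y] \<cdot> b \<longleftrightarrow> x = y \<and> a = b"
  "a \<cdot> Addr [x] = b \<cdot> Addr [y] \<longleftrightarrow> a = b \<and> x = y"
  "Addr [x] \<cdot> a = Addr [y] \<longleftrightarrow> x = y \<and> a = \<epsilon>"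
  "Addr [y] = Addr [x] \<cdot> a \<longleftrightarrow> x = y \<and> a = \<epsilon>"
  by (cases a; cases b; auto)+

text \<open>Levi's lemma for words. Comparability of prefixes and the antichain property of leaves
  in the form \<open>leaf_prefix_eq\<close> both come from it.\<close>

lemma acat_eq_acat_conv:
  "a \<cdot> b = c \<cdot> d \<longleftrightarrow> (\<exists>e. (a = c \<cdot> e \<and> e \<cdot> b = d) \<or> (a \<cdot> e = c \<and> b = e \<cdot> d))"
  (is "?L \<longleftrightarrow> ?R")
proof
  assume ?L
  moreover obtain a' b' c' d' where "a = Addr a'" "b = Addr b'" "c = Addr c'" "d = Addr d'"
    by (metis addr.exhaust)
  ultimately obtain e where "(a' = c' @ e \<and> e @ b' = d') \<or> (a' @ e = c' \<and> b' = e @ d')"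
    by (auto simp: append_eq_append_conv2)
  then show ?R
    using \<open>a = _\<close> \<open>b = _\<close> \<open>c = _\<close> \<open>d = _\<close> by (intro exI[of _ "Addr e"]) auto
qed auto

lemma acat_comparable: "a \<cdot> b = c \<cdot> d \<Longrightarrow> (\<exists>e. a = c \<cdot> e) \<or> (\<exists>e. c = a \<cdot> e)"
  by (auto simp only: acat_eq_acat_conv)

lemma addr_cases_first [case_names nil entry]:
  obtains "a = \<epsilon>" | y s where "a = Addr [y] \<cdot> s"
proof (cases a)
  case (Addr l)
  then show ?thesis
  proof (cases l)
    case (Cons y s)
    then show ?thesis using that(2)[of y "Addr s"] Addr by simp
  qed (use that(1) in simp)
qed

lemma addr_cases_last [case_names nil entry]:
  obtains "a = \<epsilon>" | y s where "a = s \<cdot> Addr [y]"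
proof (cases a)
  case (Addr l)
  then show ?thesis
  proof (cases l rule: rev_cases)
    case (snoc s y)
    then show ?thesis using that(2)[of "Addr s" y] Addr by simp
  qed (use that(1) in simp)
qed

lemma addr_rev_induct [case_names nil entry]:
  assumes "P \<epsilon>" "\<And>s y. P s \<Longrightarrow> P (s \<cdot> Addr [y])"
  shows "P a"
proof (cases a)
  case (Addr l)
  moreover have "P (Addr l)"
  proof (induction l rule: rev_induct)
    case (snoc y l)
    then show ?case using assms(2)[of "Addr l" y] by simp
  qed (use assms in simp)
  ultimately show ?thesis by simp
qed

text \<open>Position of an address \<open>b\<close> relative to a node \<open>a\<close>: equal,
  reached through an input \<open>y\<close> of \<open>a\<close>, or not above \<open>a\<close>.
  Readdressing at \<open>a\<close> is computed along this trichotomy.\<close>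

lemma entry_position:
  obtains "a = b" | y s where "b = a \<cdot> (Addr [y] \<cdot> s)" | "\<And>z. b \<noteq> a \<cdot> z"
proof (cases "\<exists>z. b = a \<cdot> z")
  case True
  then obtain z where "b = a \<cdot> z" ..
  then show ?thesis using that(1,2) by (cases z rule: addr_cases_first) auto
qed (use that(3) in blast)

text \<open>The definite description in \<open>readdress\<close> is meaningful because the first
  entry after \<open>r\<close> determines \<open>y\<close> and \<open>s\<close>, and injectivity of
  \<open>snd\<close> then determines \<open>x\<close>.\<close>

lemma readdress_in:
  assumes "inj_on snd \<Upsilon>" "(x, y) \<in> \<Upsilon>"
  shows "readdress r \<Upsilon> (r \<cdot> (Addr [y] \<cdot> s)) = r \<cdot> (x \<cdot> s)"
proof -
  have "x' = x" if "(x', y) \<in> \<Upsilon>" for x'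
    using inj_onD[OF assms(1) _ that assms(2)] by simp
  moreover define b where "b = r \<cdot> (Addr [y] \<cdot> s)"
  ultimately have b: "y' = y \<and> s' = s \<and> x' = x"
    if "(x', y') \<in> \<Upsilon>" "b = r \<cdot> Addr [y'] \<cdot> s'" for x' y' s'
    using that by auto
  have ex: "\<exists>x' y' s'. (x', y') \<in> \<Upsilon> \<and> b = r \<cdot> Addr [y'] \<cdot> s'"
    using assms(2) b_def by (intro exI[of _ x] exI[of _ y] exI[of _ s]) simp
  have "(THE c. \<exists>x' y' s'. (x', y') \<in> \<Upsilon> \<and> b = r \<cdot> Addr [y'] \<cdot> s' \<and> c = r \<cdot> x' \<cdot> s')
      = r \<cdot> x \<cdot> s"
  proof (rule the_equality)
    show "\<exists>x' y' s'. (x', y') \<in> \<Upsilon> \<and> b = r \<cdot> Addr [y'] \<cdot> s' \<and> r \<cdot> x \<cdot> s = r \<cdot> x' \<cdot> s'"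
      using assms(2) b_def by (intro exI[of _ x] exI[of _ y] exI[of _ s]) simp
  next
    fix c assume "\<exists>x' y' s'. (x', y') \<in> \<Upsilon> \<and> b = r \<cdot> Addr [y'] \<cdot> s' \<and> c = r \<cdot> x' \<cdot> s'"
    then obtain x' y' s' where "(x', y') \<in> \<Upsilon>" "b = r \<cdot> Addr [y'] \<cdot> s'" "c = r \<cdot> x' \<cdot> s'"
      by (elim exE conjE)
    with b show "c = r \<cdot> x \<cdot> s" by simp
  qed
  then have "readdress r \<Upsilon> b = r \<cdot> x \<cdot> s"
    unfolding readdress_def if_P[OF ex] .
  then show ?thesis unfolding b_def by simp
qed

lemma readdress_out:
  assumes "\<And>y s. y \<in> snd ` \<Upsilon> \<Longrightarrow> b \<noteq> r \<cdot> (Addr [y] \<cdot> s)"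
  shows "readdress r \<Upsilon> b = b"
  using assms unfolding readdress_def by force

text \<open>Readdressing is equivariant under translation by \<open>r\<close>, so a substitution
  inside a pasted copy can be computed in the original and moved.\<close>

lemma readdress_prefix:
  assumes "inj_on snd \<Upsilon>"
  shows "readdress (r \<cdot> s) \<Upsilon> (r \<cdot> a) = r \<cdot> readdress s \<Upsilon> a"
proof (cases "\<exists>x y z. (x, y) \<in> \<Upsilon> \<and> a = s \<cdot> (Addr [y] \<cdot> z)")
  case True
  then obtain x y z where "(x, y) \<in> \<Upsilon>" "a = s \<cdot> (Addr [y] \<cdot> z)" by blast
  then show ?thesis
    using readdress_in[OF assms, of x y s z] readdress_in[OF assms, of x y "r \<cdot> s" z] by simp
next
  case False
  then have "readdress s \<Upsilon> a = a" by (intro readdress_out) force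
  moreover have "readdress (r \<cdot> s) \<Upsilon> (r \<cdot> a) = r \<cdot> a"
    using False by (intro readdress_out) force
  ultimately show ?thesis by simp
qed

text \<open>A finite functional relation is the graph of a finite map, and only one; this is what
  gives the definite description in \<open>fmap_of_graph\<close> its value. Each use of
  \<open>fmap_of_graph\<close> therefore comes with a finiteness and a functionality
  argument.\<close>

lemma fmap_of_graph_lookup:
  assumes "finite S" "\<And>k v v'. (k, v) \<in> S \<Longrightarrow> (k, v') \<in> S \<Longrightarrow> v = v'"
  shows "fmlookup (fmap_of_graph S) k = Some v \<longleftrightarrow> (k, v) \<in> S"
proof -
  \<comment> \<open>The map is first built as a partial function with values chosen by
    \<open>SOME\<close>; functionality of \<open>S\<close> makes the choice harmless.\<close>
  define f where "f k = (if k \<in> fst ` S then Some (SOME v. (k, v) \<in> S) else None)" for k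
  have f: "f k = Some v \<longleftrightarrow> (k, v) \<in> S" for k v
  proof
    assume "f k = Some v"
    then have "k \<in> fst ` S" "v = (SOME v. (k, v) \<in> S)"
      unfolding f_def by (auto split: if_splits)
    then show "(k, v) \<in> S" by (auto intro: someI)
  next
    assume kv: "(k, v) \<in> S"
    then have "(k, SOME v. (k, v) \<in> S) \<in> S" by (rule someI)
    then have "(SOME v. (k, v) \<in> S) = v" using assms(2) kv by blast
    then show "f k = Some v" unfolding f_def using kv by (simp add: image_iff) force
  qed
  have "dom f \<subseteq> fst ` S" unfolding f_def by (auto split: if_splits)
  then have "finite (dom f)" using assms(1) finite_surj by blast
  then have ex: "\<forall>k v. fmlookup (Abs_fmap f) k = Some v \<longleftrightarrow> (k, v) \<in> S"
    using f by (simp add: Abs_fmap_inverse)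
  have uniq: "m = Abs_fmap f" if "\<forall>k v. fmlookup m k = Some v \<longleftrightarrow> (k, v) \<in> S" for m
  proof (rule fmap_ext)
    fix k show "fmlookup m k = fmlookup (Abs_fmap f) k"
      using that[rule_format, of k] ex[rule_format, of k]
      by (cases "fmlookup m k"; cases "fmlookup (Abs_fmap f) k") (metis option.distinct(1) option.inject)+
  qed
  have "fmap_of_graph S = Abs_fmap f"
    unfolding fmap_of_graph_def using ex uniq by (rule the_equality)
  then show ?thesis using ex by simp
qed

section \<open>Preopetopes as trees of addresses\<close>

abbreviation pcorolla :: "popet \<Rightarrow> popet" where
  "pcorolla f \<equiv> PAssign (fmupd \<epsilon> f fmempty)"

lemma mem_pnodes: "a \<in> pnodes p \<longleftrightarrow> (\<exists>f. psrc p a = Some f)"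
  by (cases p) (auto simp: fmlookup_dom'_iff)

lemma finite_pnodes [simp]: "finite (pnodes p)"
  by (cases p) auto

lemma psrc_pnodes: "psrc p a = Some f \<Longrightarrow> a \<in> pnodes p"
  by (auto simp: mem_pnodes)

lemma PAssign_eqI: "(\<And>a. psrc (PAssign m) a = psrc (PAssign m') a) \<Longrightarrow> m = m'"
  by (auto intro: fmap_ext)

text \<open>Only the shape of a tree is recorded: the parent must be a node with the given input.
  Labels need not agree along the edge.\<close>

definition treelike :: "popet \<Rightarrow> bool" where
  "treelike p \<longleftrightarrow> (\<forall>a b. a \<cdot> Addr [b] \<in> pnodes p \<longrightarrow> (\<exists>f. psrc p a = Some f \<and> b \<in> pnodes f))"

text \<open>An edge has the address of the node whose output it is, or of the leaf that it
  is.\<close>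

definition pedges :: "popet \<Rightarrow> addr set" where
  "pedges p = pnodes p \<union> pleaves p"

lemma treelike_edge_parent:
  assumes "treelike p" "a \<cdot> Addr [b] \<in> pedges p"
  shows "\<exists>f. psrc p a = Some f \<and> b \<in> pnodes f"
  using assms unfolding treelike_def pedges_def by (cases p) auto

lemma treelike_edge_split:
  "treelike p \<Longrightarrow> a \<cdot> (Addr [b] \<cdot> z) \<in> pedges p \<Longrightarrow> \<exists>f. psrc p a = Some f \<and> b \<in> pnodes f"
proof (induction z rule: addr_rev_induct)
  case nil
  then show ?case using treelike_edge_parent by simp
next
  case (entry s y)
  then have "a \<cdot> (Addr [b] \<cdot> s) \<in> pnodes p"
    using treelike_edge_parent[of p "a \<cdot> (Addr [b] \<cdot> s)" y] by (auto simp: mem_pnodes)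
  then show ?case using entry unfolding pedges_def by blast
qed

lemma treelike_prefix: "treelike p \<Longrightarrow> a \<cdot> z \<in> pnodes p \<Longrightarrow> a \<in> pnodes p"
proof (cases z rule: addr_cases_first)
  case (entry y s)
  assume "treelike p" "a \<cdot> z \<in> pnodes p"
  with entry show ?thesis
    using treelike_edge_split[of p a y s] by (auto simp: mem_pnodes pedges_def)
qed simp

lemma treelike_root: "treelike p \<Longrightarrow> pnodes p \<noteq> {} \<Longrightarrow> \<epsilon> \<in> pnodes p"
  using treelike_prefix[of p \<epsilon>] by auto

lemma pleaves_disjoint: "a \<in> pleaves p \<Longrightarrow> a \<notin> pnodes p"
  by (cases p) auto

lemma leaf_not_prefix: "treelike p \<Longrightarrow> a \<in> pleaves p \<Longrightarrow> a \<cdot> z \<notin> pnodes p"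
  using treelike_prefix pleaves_disjoint by blast

lemma leaf_antichain:
  assumes "treelike p" "a \<in> pleaves p" "a \<cdot> z \<in> pleaves p"
  shows "z = \<epsilon>"
proof (cases z rule: addr_cases_last)
  case (entry y s)
  then have "a \<cdot> s \<in> pnodes p"
    using treelike_edge_parent[of p "a \<cdot> s" y] assms by (auto simp: pedges_def mem_pnodes)
  then show ?thesis using leaf_not_prefix assms by blast
qed

text \<open>Leaves form an antichain, so an address passes through at most one of them. This makes
  readdressing past the leaves of a substituted tree reversible.\<close>

lemma leaf_prefix_eq:
  assumes "treelike p" "a \<in> pleaves p" "b \<in> pleaves p" "a \<cdot> z = b \<cdot> w"
  shows "a = b \<and> z = w"
proof -
  obtain e where "(a = b \<cdot> e \<and> e \<cdot> z = w) \<or> (a \<cdot> e = b \<and> z = e \<cdot> w)"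
    using assms(4) unfolding acat_eq_acat_conv by blast
  then show ?thesis
    using leaf_antichain[OF assms(1,2), of e] leaf_antichain[OF assms(1,3), of e] assms(2,3) by auto
qed

section \<open>Substitution in preopetopes\<close>

text \<open>The data are stated without derivability, so that the locale is available inside the
  induction that establishes regularity. \<open>shape_q\<close> leaves out \<open>PPoint\<close> and
  \<open>PEmpty\<close>, and for a degenerate \<open>q\<close> it fixes \<open>\<Upsilon>\<close> to
  the graph that \<open>psubst\<close> hard-codes in that clause.\<close>

locale substitution =
  fixes t :: popet and r :: addr and q :: popet and \<Upsilon> :: "(addr \<times> addr) set" and u :: popet
  assumes treelike_t: "treelike t" and treelike_q: "treelike q"
    and src_r: "psrc t r = Some u"
    and inj_fst: "inj_on fst \<Upsilon>" and inj_snd: "inj_on snd \<Upsilon>"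
    and fst_eq: "fst ` \<Upsilon> = pleaves q" and snd_eq: "snd ` \<Upsilon> = pnodes u"
    and shape_q: "(\<exists>f. q = PDegen f \<and> \<Upsilon> = {(\<epsilon>, \<epsilon>)}) \<or> (\<exists>m. q = PAssign m \<and> pnodes q \<noteq> {})"
begin

abbreviation \<rho> :: "addr \<Rightarrow> addr" where
  "\<rho> \<equiv> readdress r \<Upsilon>"

lemma r_node: "r \<in> pnodes t"
  using src_r by (rule psrc_pnodes)

lemma leaf_fst: "(x, y) \<in> \<Upsilon> \<Longrightarrow> x \<in> pleaves q"
  using fst_eq by force

text \<open>An edge above \<open>r\<close> leaves \<open>r\<close> through an input of its label
  \<open>u\<close>, because \<open>t\<close> is treelike; \<open>\<Upsilon>\<close> then names the
  leaf of \<open>q\<close> through which it runs after the substitution.\<close>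

lemma position:
  assumes "b \<in> pedges t"
  obtains "b = r" | x y s where "(x, y) \<in> \<Upsilon>" "b = r \<cdot> (Addr [y] \<cdot> s)" "\<rho> b = r \<cdot> (x \<cdot> s)"
  | "\<And>z. b \<noteq> r \<cdot> z" "\<rho> b = b"
proof (cases rule: entry_position[of r b])
  case (2 y s)
  then have "y \<in> snd ` \<Upsilon>"
    using assms treelike_edge_split[OF treelike_t, of r y s] src_r snd_eq by auto
  then obtain x where "(x, y) \<in> \<Upsilon>" by auto
  then show ?thesis using that(2) 2 readdress_in[OF inj_snd] by blast
next
  case 3
  then show ?thesis using that(3) readdress_out by metis
qed (use that in auto)

lemma \<rho>_r [simp]: "\<rho> r = r"
  by (rule readdress_out) simp

text \<open>Beyond a leaf \<open>a\<close> there is no node, so \<open>r\<close> cannot lie there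
  and the suffix \<open>z\<close> is carried along. It serves for what is put on top of
  \<open>a\<close> later.\<close>

lemma \<rho>_leaf:
  assumes "a \<in> pleaves t"
  shows "\<rho> (a \<cdot> z) = \<rho> a \<cdot> z"
proof -
  have "a \<in> pedges t" using assms by (simp add: pedges_def)
  then show ?thesis
  proof (cases rule: position)
    case 1
    then show ?thesis using pleaves_disjoint[OF assms] r_node by simp
  next
    case (2 x y s)
    then show ?thesis using readdress_in[OF inj_snd 2(1), of r "s \<cdot> z"] by simp
  next
    case 3
    have "a \<cdot> z \<noteq> r \<cdot> w" for w
    proof
      assume "a \<cdot> z = r \<cdot> w"
      then obtain e where "r = a \<cdot> e" using acat_comparable 3(1) by blast
      then show False using leaf_not_prefix[OF treelike_t assms] r_node by simp
    qed
    then have "\<rho> (a \<cdot> z) = a \<cdot> z" by (intro readdress_out) blast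
    then show ?thesis using 3 by simp
  qed
qed

text \<open>A moved edge starts with \<open>r\<close> followed by a leaf of \<open>q\<close>, and no
  node of \<open>q\<close> is at or above a leaf; an unmoved edge does not extend \<open>r\<close>.
  So old and new nodes do not collide.\<close>

lemma \<rho>_fresh:
  assumes "b \<in> pedges t" "b \<noteq> r" "s \<in> pnodes q"
  shows "\<rho> b \<noteq> r \<cdot> s"
  using assms(1)
proof (cases rule: position)
  case (2 x y s')
  then show ?thesis
    using leaf_not_prefix[OF treelike_q leaf_fst] assms(3) by auto
qed (use assms(2) in auto)

text \<open>A moved edge keeps a leaf of \<open>q\<close> as a prefix after \<open>r\<close>; leaves
  form an antichain, so leaf and suffix are recovered, and \<open>inj_fst\<close> recovers the input
  of \<open>u\<close>. Moved and unmoved edges differ in whether they extend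
  \<open>r\<close>.\<close>

lemma \<rho>_inj:
  assumes b: "b \<in> pedges t" "b \<noteq> r" and b': "b' \<in> pedges t" "b' \<noteq> r" and eq: "\<rho> b = \<rho> b'"
  shows "b = b'"
  using b(1)
proof (cases rule: position)
  case 1
  then show ?thesis using b(2) by simp
next
  case A: (2 x y s)
  show ?thesis using b'(1)
  proof (cases rule: position)
    case B: (2 x' y' s')
    then have "x \<cdot> s = x' \<cdot> s'" using A eq by simp
    then have "x = x'" "s = s'" using leaf_prefix_eq[OF treelike_q] A(1) B(1) leaf_fst by blast+
    moreover have "y = y'" using inj_onD[OF inj_fst _ A(1) B(1)] \<open>x = x'\<close> by simp
    ultimately show ?thesis using A B by simp
  next
    case B: 3
    then have "b' = r \<cdot> (x \<cdot> s)" using A(3) eq by simp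
    then show ?thesis using B(1) by blast
  qed (use b' in simp)
next
  case A: 3
  show ?thesis using b'(1)
  proof (cases rule: position)
    case B: (2 x y s)
    then have "b = r \<cdot> (x \<cdot> s)" using A(2) eq by simp
    then show ?thesis using A(1) by blast
  qed (use A eq b' in simp_all)
qed

text \<open>One description of the entries of the result that covers all clauses of
  \<open>psubst\<close>. It is empty exactly when a degenerate \<open>q\<close> replaces the only
  node of \<open>t\<close>.\<close>

definition graph :: "(addr \<times> popet) set" where
  "graph = {(r \<cdot> a, v) | a v. psrc q a = Some v} \<union> {(\<rho> a, w) | a w. psrc t a = Some w \<and> a \<noteq> r}"

lemma graph_functional: "(k, v) \<in> graph \<Longrightarrow> (k, v') \<in> graph \<Longrightarrow> v = v'"
proof -
  have fresh: "r \<cdot> s \<noteq> \<rho> b" if "psrc q s = Some v" "psrc t b = Some w" "b \<noteq> r" for s b v w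
    using \<rho>_fresh[of b s] that by (auto simp: pedges_def mem_pnodes)
  have inj: "b = b'" if "\<rho> b = \<rho> b'" "psrc t b = Some w" "b \<noteq> r" "psrc t b' = Some w'" "b' \<noteq> r"
    for b b' w w'
    using \<rho>_inj[of b b'] that by (auto simp: pedges_def mem_pnodes)
  have cases: "(\<exists>s. k = r \<cdot> s \<and> psrc q s = Some w) \<or> (\<exists>b. k = \<rho> b \<and> psrc t b = Some w \<and> b \<noteq> r)"
    if "(k, w) \<in> graph" for w
    using that unfolding graph_def by blast
  assume k: "(k, v) \<in> graph" "(k, v') \<in> graph"
  show ?thesis
    using cases[OF k(1)] cases[OF k(2)]
  proof (elim disjE exE conjE)
    fix b b' assume "k = \<rho> b" "psrc t b = Some v" "b \<noteq> r" "k = \<rho> b'" "psrc t b' = Some v'" "b' \<noteq> r"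
    then show ?thesis using inj[of b b' v v'] by simp
  next
    fix s b assume "k = r \<cdot> s" "psrc q s = Some v" "k = \<rho> b" "psrc t b = Some v'" "b \<noteq> r"
    then show ?thesis using fresh[of s v b v'] by simp
  next
    fix s b assume "k = \<rho> b" "psrc t b = Some v" "b \<noteq> r" "k = r \<cdot> s" "psrc q s = Some v'"
    then show ?thesis using fresh[of s v' b v] by simp
  qed simp
qed

lemma finite_graph: "finite graph"
proof -
  have "graph \<subseteq> (\<lambda>a. (r \<cdot> a, the (psrc q a))) ` pnodes q \<union> (\<lambda>a. (\<rho> a, the (psrc t a))) ` pnodes t"
    unfolding graph_def by (force simp: image_iff mem_pnodes)
  then show ?thesis by (rule finite_subset) simp
qed

lemma psubst_eq:
  "psubst t r q \<Upsilon> = (if graph = {} then q else PAssign (fmap_of_graph graph))"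
proof -
  obtain ts where t: "t = PAssign ts" using src_r by (cases t) auto
  show ?thesis using shape_q
  proof (elim disjE exE conjE)
    fix f assume q: "q = PDegen f" "\<Upsilon> = {(\<epsilon>, \<epsilon>)}"
    have g: "graph = {(\<rho> a, w) | a w. psrc t a = Some w \<and> a \<noteq> r}"
      unfolding graph_def unfolding q(1) by simp
    have "graph = {} \<longleftrightarrow> pnodes t = {r}"
    proof
      assume "graph = {}"
      then have "a = r" if "psrc t a = Some w" for a w
        using that unfolding g by blast
      then show "pnodes t = {r}" using r_node mem_pnodes by blast
    next
      assume "pnodes t = {r}"
      then have "a = r" if "psrc t a = Some w" for a w
        using that psrc_pnodes by blast
      then show "graph = {}" unfolding g by blast
    qed
    then have "graph = {} \<longleftrightarrow> fmdom' ts = {r}" by (simp add: t)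
    moreover have "graph = {(readdress r {(\<epsilon>, \<epsilon>)} a, w) | a w. fmlookup ts a = Some w \<and> a \<noteq> r}"
      unfolding g unfolding q t by simp
    ultimately show ?thesis by (simp add: t q(1))
  next
    fix m assume q: "q = PAssign m" "pnodes q \<noteq> {}"
    then have "graph \<noteq> {}" unfolding graph_def by (auto simp: fmlookup_dom'_iff)
    moreover have "psubst t r q \<Upsilon> = PAssign (fmap_of_graph graph)"
      unfolding graph_def unfolding q t by simp
    ultimately show ?thesis by simp
  qed
qed

text \<open>It also holds when the graph is empty, since the result is then the degenerate
  \<open>q\<close>, which has no sources. Later computations use this form instead of the clauses of
  \<open>psubst\<close>.\<close>

lemma psrc_psubst:
  "psrc (psubst t r q \<Upsilon>) a = Some v \<longleftrightarrow>
    (\<exists>s. a = r \<cdot> s \<and> psrc q s = Some v) \<or> (\<exists>b. a = \<rho> b \<and> b \<noteq> r \<and> psrc t b = Some v)"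
proof -
  have "psrc (psubst t r q \<Upsilon>) a = Some v \<longleftrightarrow> (a, v) \<in> graph"
  proof (cases "graph = {}")
    case True
    then have "psrc q a = None" for a
      unfolding graph_def by (cases "psrc q a") auto
    then show ?thesis using True psubst_eq by simp
  next
    case False
    then show ?thesis
      using psubst_eq fmap_of_graph_lookup[OF finite_graph graph_functional] by simp
  qed
  then show ?thesis unfolding graph_def by auto
qed

text \<open>Sources determine an assignment but not a degenerate preopetope. The second case
  isolates the only way out of the assignments.\<close>

lemma psubst_cases:
  obtains m where "psubst t r q \<Upsilon> = PAssign m" "pnodes (psubst t r q \<Upsilon>) \<noteq> {}"
  | f where "psubst t r q \<Upsilon> = q" "q = PDegen f" "\<Upsilon> = {(\<epsilon>, \<epsilon>)}" "pnodes t = {r}"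
proof (cases "graph = {}")
  case True
  have "psrc q a = None" for a
    using True unfolding graph_def by (cases "psrc q a") auto
  then have "pnodes q = {}" using mem_pnodes by (metis equals0I option.distinct(1))
  then obtain f where "q = PDegen f" "\<Upsilon> = {(\<epsilon>, \<epsilon>)}" using shape_q by blast
  moreover have "a = r" if "psrc t a = Some w" for a w
    using True that unfolding graph_def by blast
  then have "pnodes t = {r}" using r_node mem_pnodes by blast
  ultimately show ?thesis using that(2) True psubst_eq by simp
next
  case False
  then obtain k v where "(k, v) \<in> graph" by auto
  then have "psrc (psubst t r q \<Upsilon>) k = Some v"
    using psubst_eq False fmap_of_graph_lookup[OF finite_graph graph_functional] by simp
  then have "k \<in> pnodes (psubst t r q \<Upsilon>)" by (rule psrc_pnodes)
  then show ?thesis using that(1) psubst_eq False by auto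
qed

lemma psubst_PAssign:
  assumes "psrc (psubst t r q \<Upsilon>) a = Some v"
  shows "\<exists>m. psubst t r q \<Upsilon> = PAssign m"
  using assms by (cases "psubst t r q \<Upsilon>") auto

lemma pnodes_psubst: "pnodes (psubst t r q \<Upsilon>) = (\<lambda>s. r \<cdot> s) ` pnodes q \<union> \<rho> ` (pnodes t - {r})"
  unfolding set_eq_iff Un_iff image_iff Bex_def Diff_iff mem_pnodes psrc_psubst by blast

lemma psrc_psubst_in: "psrc q s = Some v \<Longrightarrow> psrc (psubst t r q \<Upsilon>) (r \<cdot> s) = Some v"
  by (auto simp: psrc_psubst)

lemma psrc_psubst_out: "b \<noteq> r \<Longrightarrow> psrc t b = Some v \<Longrightarrow> psrc (psubst t r q \<Upsilon>) (\<rho> b) = Some v"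
  by (auto simp: psrc_psubst)

end

section \<open>Commutation and associativity of substitution\<close>

lemma readdress_nested:
  assumes "substitution t r q \<Upsilon> u" "substitution t r' q' \<Upsilon>' u'" "r \<noteq> r'" "s \<in> pnodes q"
  shows "readdress (readdress r \<Upsilon> r') \<Upsilon>' (r \<cdot> s) = readdress r' \<Upsilon>' r \<cdot> s"
proof -
  interpret A: substitution t r q \<Upsilon> u by fact
  interpret B: substitution t r' q' \<Upsilon>' u' by fact
  have r: "r \<in> pedges t" and r': "r' \<in> pedges t"
    using A.r_node B.r_node by (auto simp: pedges_def)
  show ?thesis using r
  proof (cases rule: B.position)
    case 1
    then show ?thesis using assms(3) by simp
  next
    case (2 x y z)
    \<comment> \<open>Here \<open>r\<close> lies above \<open>r'\<close>, so the substitution at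
      \<open>r\<close> does not move \<open>r'\<close>.\<close>
    then have "A.\<rho> r' = r'" by (intro readdress_out) auto
    then show ?thesis using 2 readdress_in[OF B.inj_snd 2(1)] by simp
  next
    case 3
    \<comment> \<open>If \<open>r'\<close> is moved by the first substitution, its new address runs
      through a leaf of \<open>q\<close>, and the node \<open>s\<close> of \<open>q\<close> is not
      above a leaf. So the pasted copy of \<open>q\<close> stays where it is.\<close>
    have "A.\<rho> r' \<cdot> (Addr [y] \<cdot> z) \<noteq> r \<cdot> s" for y z using r'
    proof (cases rule: A.position)
      case (2 x' y' s')
      then show ?thesis
        using leaf_not_prefix[OF A.treelike_q A.leaf_fst[OF 2(1)]] assms(4) by auto
    next
      case A3: 3
      then show ?thesis using 3 acat_comparable by fastforce
    qed (use assms(3) in auto)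
    then have "readdress (A.\<rho> r') \<Upsilon>' (r \<cdot> s) = r \<cdot> s"
      by (intro readdress_out) metis
    then show ?thesis using 3 by simp
  qed
qed

lemma readdress_self [simp]: "readdress r \<Upsilon> r = r"
  by (rule readdress_out) simp

text \<open>Of two distinct nodes, one is not above the other. Here \<open>r\<close> is not above
  \<open>r'\<close>, so the substitution at \<open>r'\<close> fixes \<open>r\<close>, and the
  right-hand side needs no correction of \<open>r\<close>.\<close>

lemma readdress_commute_aux:
  assumes "substitution t r q \<Upsilon> u" "substitution t r' q' \<Upsilon>' u'"
    and not_below: "\<And>z. r \<noteq> r' \<cdot> z" and b: "b \<in> pedges t"
  shows "readdress (readdress r \<Upsilon> r') \<Upsilon>' (readdress r \<Upsilon> b) = readdress r \<Upsilon> (readdress r' \<Upsilon>' b)"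
proof -
  interpret A: substitution t r q \<Upsilon> u by fact
  interpret B: substitution t r' q' \<Upsilon>' u' by fact
  have r': "r' \<in> pedges t" using B.r_node by (simp add: pedges_def)
  have B_r: "B.\<rho> r = r" using not_below by (intro readdress_out)
  show ?thesis using r'
  proof (cases rule: A.position)
    case 1
    then show ?thesis using not_below[of \<epsilon>] by simp
  next
    \<comment> \<open>\<open>r'\<close> sits above \<open>r\<close> on the branch of the input
      \<open>y'\<close>; the first substitution moves it on top of the leaf \<open>x'\<close> of
      \<open>q\<close>.\<close>
    case R: (2 x' y' s')
    show ?thesis using b
    proof (cases rule: A.position)
      case 1
      have "readdress (r \<cdot> (x' \<cdot> s')) \<Upsilon>' r = r" by (rule readdress_out) simp
      then show ?thesis using 1 R B_r by simp
    next
      case b2: (2 x y s)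
      show ?thesis using b
      proof (cases rule: B.position)
        case 1
        then show ?thesis by simp
      next
        case (2 x2 y2 s2)
        \<comment> \<open>An edge above \<open>r'\<close> leaves \<open>r\<close> through the same
          input as \<open>r'\<close>, so the two readdressings change disjoint parts of its
          address.\<close>
        then have "y = y'" "s = s' \<cdot> (Addr [y2] \<cdot> s2)" using b2(2) R(2) by simp_all
        moreover from this have "x = x'" using inj_onD[OF A.inj_snd _ b2(1) R(1)] by simp
        ultimately show ?thesis
          using 2 b2 R readdress_in[OF B.inj_snd 2(1), of "r \<cdot> (x' \<cdot> s')" s2]
            readdress_in[OF A.inj_snd R(1), of r "s' \<cdot> (x2 \<cdot> s2)"] by simp
      next
        case 3
        \<comment> \<open>A collision after the move would, by the antichain of leaves, already be
          one before it.\<close>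
        have "r \<cdot> (x \<cdot> s) \<noteq> r \<cdot> (x' \<cdot> s') \<cdot> (Addr [y2] \<cdot> z)" for y2 z
        proof
          assume "r \<cdot> (x \<cdot> s) = r \<cdot> (x' \<cdot> s') \<cdot> (Addr [y2] \<cdot> z)"
          then have "x \<cdot> s = x' \<cdot> (s' \<cdot> (Addr [y2] \<cdot> z))" by simp
          then have "x = x'" "s = s' \<cdot> (Addr [y2] \<cdot> z)"
            using leaf_prefix_eq[OF A.treelike_q A.leaf_fst[OF b2(1)] A.leaf_fst[OF R(1)]] by blast+
          moreover from this have "y = y'" using inj_onD[OF A.inj_fst _ b2(1) R(1)] by simp
          ultimately have "b = r' \<cdot> (Addr [y2] \<cdot> z)" using b2 R by simp
          then show False using 3 by blast
        qed
        then have "readdress (r \<cdot> (x' \<cdot> s')) \<Upsilon>' (r \<cdot> (x \<cdot> s)) = r \<cdot> (x \<cdot> s)"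
          by (intro readdress_out)
        then show ?thesis using b2 R 3 by simp
      qed
    next
      case b3: 3
      have "B.\<rho> b = b" using b3(1) R(2) by (intro readdress_out) auto
      moreover have "readdress (r \<cdot> (x' \<cdot> s')) \<Upsilon>' b = b" using b3(1) by (intro readdress_out) auto
      ultimately show ?thesis using b3 R by simp
    qed
  next
    case R: 3
    \<comment> \<open>Neither node is above the other, so no address extends both, and the two
      readdressings act on disjoint sets of edges.\<close>
    have inc: "r \<cdot> z \<noteq> r' \<cdot> w" for z w
      using acat_comparable[of r z r' w] not_below R(1) by blast
    show ?thesis using b
    proof (cases rule: A.position)
      case 1
      then show ?thesis using R B_r by simp
    next
      case (2 x y s)
      have "B.\<rho> (r \<cdot> z) = r \<cdot> z" for z using inc by (intro readdress_out)
      then show ?thesis using 2 R by simp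
    next
      case b3: 3
      show ?thesis using b
      proof (cases rule: B.position)
        case 1
        then show ?thesis using R by simp
      next
        case (2 x2 y2 s2)
        have "A.\<rho> (r' \<cdot> z) = r' \<cdot> z" for z using inc by (intro readdress_out) metis
        then show ?thesis using 2 b3 R by simp
      next
        case 3
        then show ?thesis using b3 R by simp
      qed
    qed
  qed
qed

lemma readdress_commute:
  assumes "substitution t r q \<Upsilon> u" "substitution t r' q' \<Upsilon>' u'" "r \<noteq> r'" "b \<in> pedges t"
  shows "readdress (readdress r \<Upsilon> r') \<Upsilon>' (readdress r \<Upsilon> b) =
    readdress (readdress r' \<Upsilon>' r) \<Upsilon> (readdress r' \<Upsilon>' b)"
proof (cases "\<exists>z. r = r' \<cdot> z")
  case True
  then have nb: "r' \<noteq> r \<cdot> w" for w using assms(3) by auto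
  then have "readdress r \<Upsilon> r' = r'" by (intro readdress_out)
  then show ?thesis using readdress_commute_aux[OF assms(2,1) nb assms(4)] by simp
next
  case False
  then have nb: "r \<noteq> r' \<cdot> w" for w by blast
  then have "readdress r' \<Upsilon>' r = r" by (intro readdress_out)
  then show ?thesis using readdress_commute_aux[OF assms(1,2) nb assms(4)] by simp
qed

text \<open>The form is chosen to be symmetric: each of the copies of \<open>q\<close> and
  \<open>q'\<close> sits at its node as moved by the other substitution. Exchanging the roles
  changes only the third alternative, which \<open>readdress_commute\<close> repairs.\<close>

lemma psrc_psubst_twice:
  assumes "substitution t r q \<Upsilon> u" "substitution t r' q' \<Upsilon>' u'" "r \<noteq> r'"
    and "substitution (psubst t r' q' \<Upsilon>') (readdress r' \<Upsilon>' r) q \<Upsilon> u"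
  shows "psrc (psubst (psubst t r' q' \<Upsilon>') (readdress r' \<Upsilon>' r) q \<Upsilon>) a = Some v \<longleftrightarrow>
    (\<exists>s. a = readdress r' \<Upsilon>' r \<cdot> s \<and> psrc q s = Some v) \<or>
    (\<exists>s. a = readdress r \<Upsilon> r' \<cdot> s \<and> psrc q' s = Some v) \<or>
    (\<exists>b. a = readdress (readdress r' \<Upsilon>' r) \<Upsilon> (readdress r' \<Upsilon>' b) \<and> b \<noteq> r \<and> b \<noteq> r' \<and> psrc t b = Some v)"
    (is "?L \<longleftrightarrow> ?Q \<or> ?Q' \<or> ?T")
proof -
  interpret A: substitution t r q \<Upsilon> u by fact
  interpret B: substitution t r' q' \<Upsilon>' u' by fact
  interpret C: substitution "psubst t r' q' \<Upsilon>'" "readdress r' \<Upsilon>' r" q \<Upsilon> u by fact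
  have r: "r \<in> pedges t" using A.r_node by (simp add: pedges_def)
  have Q': "readdress (B.\<rho> r) \<Upsilon> (r' \<cdot> s) = A.\<rho> r' \<cdot> s \<and> r' \<cdot> s \<noteq> B.\<rho> r" if "psrc q' s = Some v" for s
    using readdress_nested[OF assms(2,1) assms(3)[symmetric] psrc_pnodes[OF that]]
      B.\<rho>_fresh[OF r assms(3) psrc_pnodes[OF that]] by simp
  have T: "B.\<rho> c \<noteq> B.\<rho> r" if "c \<noteq> r" "c \<noteq> r'" "psrc t c = Some v" for c
    using B.\<rho>_inj[of c r] that r assms(3) psrc_pnodes[OF that(3)] by (auto simp: pedges_def)
  have "?L \<longleftrightarrow> ?Q \<or> (\<exists>b. a = readdress (B.\<rho> r) \<Upsilon> b \<and> b \<noteq> B.\<rho> r \<and>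
      ((\<exists>s. b = r' \<cdot> s \<and> psrc q' s = Some v) \<or> (\<exists>c. b = B.\<rho> c \<and> c \<noteq> r' \<and> psrc t c = Some v)))"
    unfolding C.psrc_psubst B.psrc_psubst ..
  also have "\<dots> \<longleftrightarrow> ?Q \<or> ?Q' \<or> ?T"
  proof (intro disj_cong[OF refl] iffI)
    assume "\<exists>b. a = readdress (B.\<rho> r) \<Upsilon> b \<and> b \<noteq> B.\<rho> r \<and>
      ((\<exists>s. b = r' \<cdot> s \<and> psrc q' s = Some v) \<or> (\<exists>c. b = B.\<rho> c \<and> c \<noteq> r' \<and> psrc t c = Some v))"
    then show "?Q' \<or> ?T" using Q' by metis
  next
    assume "?Q' \<or> ?T"
    then show "\<exists>b. a = readdress (B.\<rho> r) \<Upsilon> b \<and> b \<noteq> B.\<rho> r \<and>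
      ((\<exists>s. b = r' \<cdot> s \<and> psrc q' s = Some v) \<or> (\<exists>c. b = B.\<rho> c \<and> c \<noteq> r' \<and> psrc t c = Some v))"
      using Q' T by metis
  qed
  finally show ?thesis .
qed

lemma popet_eqI:
  assumes "\<And>a v. psrc p a = Some v \<longleftrightarrow> psrc p' a = Some v"
    and "p = PAssign m" "p' = PAssign m'"
  shows "p = p'"
proof -
  have "psrc (PAssign m) a = psrc (PAssign m') a" for a
    using assms(1)[of a] unfolding assms(2,3) by (metis option.exhaust)
  then show ?thesis unfolding assms(2,3) by (simp add: PAssign_eqI)
qed

text \<open>Both sides have the same sources by \<open>psrc_psubst_twice\<close>. This decides
  unless both results are degenerate; then one side is \<open>q\<close> and the other
  \<open>q'\<close>, and \<open>degen\<close> supplies their equality.\<close>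

lemma psubst_commute:
  assumes A: "substitution t r q \<Upsilon> u" and B: "substitution t r' q' \<Upsilon>' u'" and ne: "r \<noteq> r'"
    and C: "substitution (psubst t r' q' \<Upsilon>') (readdress r' \<Upsilon>' r) q \<Upsilon> u"
    and D: "substitution (psubst t r q \<Upsilon>) (readdress r \<Upsilon> r') q' \<Upsilon>' u'"
    and degen: "pnodes q = {} \<Longrightarrow> pnodes q' = {} \<Longrightarrow> pnodes t = {r, r'} \<Longrightarrow> q = q'"
  shows "psubst (psubst t r' q' \<Upsilon>') (readdress r' \<Upsilon>' r) q \<Upsilon> =
    psubst (psubst t r q \<Upsilon>) (readdress r \<Upsilon> r') q' \<Upsilon>'" (is "?p = ?p'")
proof -
  interpret A: substitution t r q \<Upsilon> u by fact
  interpret B: substitution t r' q' \<Upsilon>' u' by fact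
  interpret C: substitution "psubst t r' q' \<Upsilon>'" "readdress r' \<Upsilon>' r" q \<Upsilon> u by fact
  interpret D: substitution "psubst t r q \<Upsilon>" "readdress r \<Upsilon> r'" q' \<Upsilon>' u' by fact
  have comm: "readdress (B.\<rho> r) \<Upsilon> (B.\<rho> b) = readdress (A.\<rho> r') \<Upsilon>' (A.\<rho> b)" if "psrc t b = Some v" for b v
    using readdress_commute[OF A B ne, of b] psrc_pnodes[OF that] by (simp add: pedges_def)
  have eq: "psrc ?p a = Some v \<longleftrightarrow> psrc ?p' a = Some v" for a v
  proof -
    have "(\<exists>b. a = readdress (B.\<rho> r) \<Upsilon> (B.\<rho> b) \<and> b \<noteq> r \<and> b \<noteq> r' \<and> psrc t b = Some v) \<longleftrightarrow>
        (\<exists>b. a = readdress (A.\<rho> r') \<Upsilon>' (A.\<rho> b) \<and> b \<noteq> r' \<and> b \<noteq> r \<and> psrc t b = Some v)"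
      by (intro iff_exI) (use comm in auto)
    then show ?thesis
      unfolding psrc_psubst_twice[OF A B ne C] psrc_psubst_twice[OF B A ne[symmetric] D] by blast
  qed
  then have nodes: "pnodes ?p = pnodes ?p'" by (simp add: mem_pnodes set_eq_iff)
  show ?thesis
  proof (cases "pnodes ?p = {}")
    case True
    obtain f where q: "?p = q" "q = PDegen f" "pnodes (psubst t r' q' \<Upsilon>') = {B.\<rho> r}"
      using True by (cases rule: C.psubst_cases) auto
    obtain g where q': "?p' = q'" "q' = PDegen g"
      using True nodes by (cases rule: D.psubst_cases) auto
    \<comment> \<open>A degenerate result means that nothing of \<open>t\<close> is left once both
      nodes are removed.\<close>
    have "pnodes t \<subseteq> {r, r'}"
    proof
      fix c assume c: "c \<in> pnodes t"
      then have "c \<noteq> r' \<Longrightarrow> B.\<rho> c = B.\<rho> r" using q(3) unfolding B.pnodes_psubst by blast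
      then show "c \<in> {r, r'}" using B.\<rho>_inj[of c r] c A.r_node ne by (auto simp: pedges_def)
    qed
    then have "pnodes t = {r, r'}" using A.r_node B.r_node by auto
    then show ?thesis using degen q q' by simp
  next
    case False
    then obtain m where "?p = PAssign m"
      by (cases rule: C.psubst_cases) auto
    moreover obtain m' where "?p' = PAssign m'"
      using False nodes by (cases rule: D.psubst_cases) auto
    ultimately show ?thesis using popet_eqI[of ?p ?p', OF eq] by blast
  qed
qed

text \<open>An edge above \<open>r\<close> runs through a leaf of \<open>q\<close>. Substituting in
  \<open>q\<close> moves that leaf along \<open>\<Phi>\<close>, and \<open>\<Theta>'\<close> is
  \<open>\<Theta>\<close> with its leaves moved in this way.\<close>

lemma readdress_assoc:
  assumes A: "substitution t r q \<Theta> u" and B: "substitution q s v \<Phi> y"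
    and D: "substitution t r (psubst q s v \<Phi>) \<Theta>' u'"
    and \<Theta>': "\<Theta>' = (\<lambda>(c, d). (readdress s \<Phi> c, d)) ` \<Theta>"
    and c: "c \<in> pedges t"
  shows "readdress (r \<cdot> s) \<Phi> (readdress r \<Theta> c) = readdress r \<Theta>' c"
proof -
  interpret A: substitution t r q \<Theta> u by fact
  interpret B: substitution q s v \<Phi> y by fact
  interpret D: substitution t r "psubst q s v \<Phi>" \<Theta>' u' by fact
  show ?thesis using c
  proof (cases rule: A.position)
    case 1
    have "readdress (r \<cdot> s) \<Phi> r = r" by (rule readdress_out) simp
    then show ?thesis using 1 by simp
  next
    case (2 x y z)
    have "readdress (r \<cdot> s) \<Phi> (A.\<rho> c) = r \<cdot> (B.\<rho> x \<cdot> z)"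
      using 2(3) readdress_prefix[OF B.inj_snd, of r s "x \<cdot> z"] B.\<rho>_leaf[OF A.leaf_fst[OF 2(1)]] by simp
    moreover have "(B.\<rho> x, y) \<in> \<Theta>'" using 2(1) unfolding \<Theta>' by force
    ultimately show ?thesis using 2(2) readdress_in[OF D.inj_snd] by simp
  next
    case 3
    have "readdress (r \<cdot> s) \<Phi> c = c" using 3(1) by (intro readdress_out) auto
    moreover have "readdress r \<Theta>' c = c" using 3(1) by (intro readdress_out) auto
    ultimately show ?thesis using 3 by simp
  qed
qed

text \<open>The result has three kinds of nodes, coming from \<open>v\<close>, from \<open>q\<close>
  and from \<open>t\<close>, and both orders give them the same addresses. If no node is left, both
  sides collapse to \<open>v\<close>.\<close>

lemma psubst_assoc:
  assumes A: "substitution t r q \<Theta> u" and B: "substitution q s v \<Phi> y"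
    and C: "substitution (psubst t r q \<Theta>) (r \<cdot> s) v \<Phi> y"
    and D: "substitution t r (psubst q s v \<Phi>) \<Theta>' u'"
    and \<Theta>': "\<Theta>' = (\<lambda>(c, d). (readdress s \<Phi> c, d)) ` \<Theta>"
  shows "psubst (psubst t r q \<Theta>) (r \<cdot> s) v \<Phi> = psubst t r (psubst q s v \<Phi>) \<Theta>'" (is "?p = ?p'")
proof -
  interpret A: substitution t r q \<Theta> u by fact
  interpret B: substitution q s v \<Phi> y by fact
  interpret C: substitution "psubst t r q \<Theta>" "r \<cdot> s" v \<Phi> y by fact
  interpret D: substitution t r "psubst q s v \<Phi>" \<Theta>' u' by fact
  have out: "readdress (r \<cdot> s) \<Phi> (A.\<rho> c) = D.\<rho> c" "A.\<rho> c \<noteq> r \<cdot> s" if "c \<noteq> r" "psrc t c = Some w" for c w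
    using readdress_assoc[OF A B D \<Theta>', of c] A.\<rho>_fresh[OF _ that(1) B.r_node] psrc_pnodes[OF that(2)]
    by (simp_all add: pedges_def)
  have inner: "readdress (r \<cdot> s) \<Phi> (r \<cdot> b) = r \<cdot> B.\<rho> b" for b
    by (rule readdress_prefix[OF B.inj_snd])
  have eq: "psrc ?p a = Some w \<longleftrightarrow> psrc ?p' a = Some w" for a w
  proof -
    have "psrc ?p a = Some w \<longleftrightarrow> (\<exists>e. a = r \<cdot> (s \<cdot> e) \<and> psrc v e = Some w) \<or>
        (\<exists>b. a = r \<cdot> B.\<rho> b \<and> b \<noteq> s \<and> psrc q b = Some w) \<or>
        (\<exists>c. a = D.\<rho> c \<and> c \<noteq> r \<and> psrc t c = Some w)"
    proof -
      have "(\<exists>b. a = readdress (r \<cdot> s) \<Phi> b \<and> b \<noteq> r \<cdot> s \<and>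
          ((\<exists>e. b = r \<cdot> e \<and> psrc q e = Some w) \<or> (\<exists>c. b = A.\<rho> c \<and> c \<noteq> r \<and> psrc t c = Some w))) \<longleftrightarrow>
        (\<exists>e. a = readdress (r \<cdot> s) \<Phi> (r \<cdot> e) \<and> r \<cdot> e \<noteq> r \<cdot> s \<and> psrc q e = Some w) \<or>
        (\<exists>c. a = readdress (r \<cdot> s) \<Phi> (A.\<rho> c) \<and> A.\<rho> c \<noteq> r \<cdot> s \<and> c \<noteq> r \<and> psrc t c = Some w)"
        by blast
      also have "(\<exists>c. a = readdress (r \<cdot> s) \<Phi> (A.\<rho> c) \<and> A.\<rho> c \<noteq> r \<cdot> s \<and> c \<noteq> r \<and> psrc t c = Some w)
        \<longleftrightarrow> (\<exists>c. a = D.\<rho> c \<and> c \<noteq> r \<and> psrc t c = Some w)"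
        by (intro iff_exI) (use out in auto)
      finally show ?thesis
        unfolding C.psrc_psubst A.psrc_psubst acat_assoc inner acat_cancel by simp
    qed
    also have "\<dots> \<longleftrightarrow> psrc ?p' a = Some w"
      unfolding D.psrc_psubst B.psrc_psubst by blast
    finally show ?thesis .
  qed
  then have nodes: "pnodes ?p = pnodes ?p'" by (simp add: mem_pnodes set_eq_iff)
  show ?thesis
  proof (cases "pnodes ?p = {}")
    case True
    have "?p = v" using True by (cases rule: C.psubst_cases) auto
    have "?p' = psubst q s v \<Phi>" using True nodes by (cases rule: D.psubst_cases) auto
    then have "pnodes (psubst q s v \<Phi>) = {}" using True nodes by simp
    then have "psubst q s v \<Phi> = v" by (cases rule: B.psubst_cases) auto
    then show ?thesis using \<open>?p = v\<close> \<open>?p' = _\<close> by simp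
  next
    case False
    then obtain m where "?p = PAssign m"
      by (cases rule: C.psubst_cases) auto
    moreover obtain m' where "?p' = PAssign m'"
      using False nodes by (cases rule: D.psubst_cases) auto
    ultimately show ?thesis using popet_eqI[of ?p ?p', OF eq] by blast
  qed
qed

section \<open>Derivable sequents\<close>

text \<open>The context in the conclusion of \<open>seq_graft\<close>, computed from a context that
  still contains the pair \<open>(c, r)\<close>.\<close>

definition graft_graph ::
    "(addr \<times> addr) set \<Rightarrow> addr \<Rightarrow> addr \<Rightarrow> (addr \<times> addr) set \<Rightarrow> popet \<Rightarrow> (addr \<times> addr) set" where
  "graft_graph \<Gamma> c r \<Upsilon> q = (\<lambda>(x, d). (x, readdress r \<Upsilon> d)) ` (\<Gamma> - {(c, r)}) \<union>
     {(c \<cdot> Addr [s], r \<cdot> s) | s. s \<in> pnodes q}"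

lemma mem_graft_graph:
  "(x, d) \<in> graft_graph \<Gamma> c r \<Upsilon> q \<longleftrightarrow>
    (\<exists>d'. (x, d') \<in> \<Gamma> \<and> (x, d') \<noteq> (c, r) \<and> d = readdress r \<Upsilon> d') \<or>
    (\<exists>s. s \<in> pnodes q \<and> x = c \<cdot> Addr [s] \<and> d = r \<cdot> s)"
  unfolding graft_graph_def by force

lemma sequent_graft:
  assumes "sequent \<Gamma> (PAssign m) t" "(c, r) \<in> \<Gamma>" "sequent \<Upsilon> q u" "preopetope (n + 1) (PAssign m)"
    "n \<ge> 1" "preopetope n q" "c = a \<cdot> Addr [b]" "c \<in> pleaves (PAssign m)"
    "fmlookup m a = Some f" "psrc f b = Some u"
  shows "sequent (graft_graph \<Gamma> c r \<Upsilon> q) (PAssign (fmupd c q m)) (psubst t r q \<Upsilon>)"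
proof -
  have "insert (a \<cdot> Addr [b], r) (\<Gamma> - {(c, r)}) = \<Gamma>" using assms(2,7) by auto
  then have "sequent ((\<lambda>(c, d). (c, readdress r \<Upsilon> d)) ` (\<Gamma> - {(c, r)}) \<union>
                {(a \<cdot> Addr [b] \<cdot> Addr [s], r \<cdot> s) | s. s \<in> pnodes q})
         (PAssign (fmupd (a \<cdot> Addr [b]) q m)) (psubst t r q \<Upsilon>)"
    using assms by (intro seq_graft[where n = n and f = f and u = u]) auto
  then show ?thesis unfolding graft_graph_def assms(7) .
qed

text \<open>Rule induction with the pair \<open>(c, r)\<close> left inside \<open>\<Gamma>\<close>,
  so that the induction hypothesis speaks of the whole context of the premise, as regularity
  does.\<close>

lemma sequent_graft_induct [consumes 1, case_names point degen shift graft]: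
  assumes "sequent \<Gamma> p t"
    and "P {} PPoint PEmpty"
    and "\<And>\<Gamma> p t. sequent \<Gamma> p t \<Longrightarrow> P \<Gamma> p t \<Longrightarrow> P {(\<epsilon>, \<epsilon>)} (PDegen p) (pcorolla p)"
    and "\<And>\<Gamma> p t. sequent \<Gamma> p t \<Longrightarrow> P \<Gamma> p t \<Longrightarrow> P {(Addr [a], a) | a. a \<in> pnodes p} (pcorolla p) p"
    and "\<And>\<Gamma> m t c r \<Upsilon> q u n a b f. sequent \<Gamma> (PAssign m) t \<Longrightarrow> P \<Gamma> (PAssign m) t \<Longrightarrow> (c, r) \<in> \<Gamma> \<Longrightarrow>
      sequent \<Upsilon> q u \<Longrightarrow> P \<Upsilon> q u \<Longrightarrow> preopetope (Suc n) (PAssign m) \<Longrightarrow> n \<ge> 1 \<Longrightarrow> preopetope n q \<Longrightarrow>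
      c = a \<cdot> Addr [b] \<Longrightarrow> c \<in> pleaves (PAssign m) \<Longrightarrow> fmlookup m a = Some f \<Longrightarrow> psrc f b = Some u \<Longrightarrow>
      P (graft_graph \<Gamma> c r \<Upsilon> q) (PAssign (fmupd c q m)) (psubst t r q \<Upsilon>)"
  shows "P \<Gamma> p t"
  using assms(1)
proof (induct rule: sequent.induct)
  case (seq_graft a b r \<Gamma> m t \<Upsilon> q u n f)
  have "insert (a \<cdot> Addr [b], r) \<Gamma> - {(a \<cdot> Addr [b], r)} = \<Gamma>" using seq_graft(3) by auto
  then have "graft_graph (insert (a \<cdot> Addr [b], r) \<Gamma>) (a \<cdot> Addr [b]) r \<Upsilon> q =
     (\<lambda>(c, d). (c, readdress r \<Upsilon> d)) ` \<Gamma> \<union> {(a \<cdot> Addr [b] \<cdot> Addr [s], r \<cdot> s) | s. s \<in> pnodes q}"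
    unfolding graft_graph_def by simp
  moreover have "P (graft_graph (insert (a \<cdot> Addr [b], r) \<Gamma>) (a \<cdot> Addr [b]) r \<Upsilon> q)
     (PAssign (fmupd (a \<cdot> Addr [b]) q m)) (psubst t r q \<Upsilon>)"
    using seq_graft by (intro assms(5)[where n = n and a = a and b = b and f = f and u = u]) auto
  ultimately show ?case by simp
qed (use assms in blast)+

section \<open>Dimension and shape of derivable preopetopes\<close>

lemma preopetope_PPoint_iff [simp]: "preopetope n PPoint \<longleftrightarrow> n = 0"
  by (auto elim: preopetope.cases intro: preopetope.intros)

lemma preopetope_PDegen_iff: "preopetope n (PDegen q) \<longleftrightarrow> (\<exists>k. n = Suc (Suc k) \<and> preopetope k q)"
proof
  assume "preopetope n (PDegen q)"
  then show "\<exists>k. n = Suc (Suc k) \<and> preopetope k q" by cases auto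
qed (auto intro: preopetope.intros(3)[of _ q, simplified])

lemma preopetope_PAssign_iff:
  "preopetope n (PAssign m) \<longleftrightarrow> (\<exists>k. n = Suc k \<and> pnodes (PAssign m) \<noteq> {} \<and>
     pnodes (PAssign m) \<subseteq> addresses k \<and> (\<forall>a f. psrc (PAssign m) a = Some f \<longrightarrow> preopetope k f))"
    (is "_ \<longleftrightarrow> ?R")
proof -
  have ne: "m \<noteq> fmempty \<longleftrightarrow> fmdom' m \<noteq> {}"
    by (metis fmdom'_empty fmrestrict_set_dom fmrestrict_set_null)
  show ?thesis
  proof
    assume "preopetope n (PAssign m)"
    then show ?R by cases (auto simp: ne)
  next
    assume ?R
    then show "preopetope n (PAssign m)"
      using preopetope.intros(2)[of m] ne by auto
  qed
qed

lemma not_preopetope_PEmpty [simp]: "\<not> preopetope n PEmpty"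
  by (auto elim: preopetope.cases)

lemma preopetope_src: "preopetope n p \<Longrightarrow> psrc p a = Some f \<Longrightarrow> \<exists>k. n = Suc k \<and> preopetope k f"
  by (cases p) (auto simp: preopetope_PAssign_iff)

lemma preopetope_unique: "preopetope n p \<Longrightarrow> preopetope n' p \<Longrightarrow> n = n'"
proof (induction arbitrary: n' rule: preopetope.induct)
  case (2 m n)
  then obtain a f where f: "fmlookup m a = Some f" by (metis fmap_ext fmempty_lookup not_None_eq)
  then obtain k where "n' = Suc k" "preopetope k f"
    using 2(4) preopetope_src[of n' "PAssign m" a f] by auto
  then show ?case using 2(3) f by auto
next
  case (3 n q)
  obtain k where "n' = Suc (Suc k)" "preopetope k q" using 3(3) preopetope_PDegen_iff by blast
  then show ?case using 3(2) by simp
qed simp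

text \<open>A shared source pins down the dimension. This transfers dimensions between preopetopes
  that differ by adding or removing nodes.\<close>

lemma preopetope_same_dim:
  assumes "preopetope n p" "preopetope n' p'" "psrc p a = Some f" "psrc p' a' = Some f"
  shows "n = n'"
proof -
  obtain k where "n = Suc k" "preopetope k f" using preopetope_src assms(1,3) by blast
  moreover obtain k' where "n' = Suc k'" "preopetope k' f" using preopetope_src assms(2,4) by blast
  ultimately show ?thesis using preopetope_unique by blast
qed

lemma Nil_in_addresses [simp]: "\<epsilon> \<in> addresses n"
  by (cases n) auto

lemma acat_in_addresses: "a \<in> addresses (Suc n) \<Longrightarrow> b \<in> addresses n \<Longrightarrow> a \<cdot> Addr [b] \<in> addresses (Suc n)"
  by auto

lemma preopetope_pcorolla: "preopetope n p \<Longrightarrow> preopetope (Suc n) (pcorolla p)"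
  by (simp add: preopetope_PAssign_iff)

lemma sequent_preopetope: "sequent \<Gamma> p t \<Longrightarrow> \<exists>n. preopetope n p"
proof (induct rule: sequent_graft_induct)
  case point
  show ?case by simp
next
  case (degen \<Gamma> p t)
  then show ?case by (auto simp: preopetope_PDegen_iff)
next
  case (shift \<Gamma> p t)
  then show ?case using preopetope_pcorolla by blast
next
  case (graft \<Gamma> m t c r \<Upsilon> q u n a b f)
  obtain k where k: "n = Suc k" using \<open>n \<ge> 1\<close> by (cases n) auto
  have m: "pnodes (PAssign m) \<subseteq> addresses n" "\<And>a f. psrc (PAssign m) a = Some f \<Longrightarrow> preopetope n f"
    using graft(6) by (auto simp: preopetope_PAssign_iff)
  then have "preopetope n f" using graft by simp
  moreover have "b \<in> pnodes f" using graft psrc_pnodes by blast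
  moreover from this obtain m' where "f = PAssign m'" by (cases f) auto
  ultimately have "b \<in> addresses k" by (auto simp: preopetope_PAssign_iff k)
  moreover have "a \<in> addresses n" using m(1) graft(11) by (auto simp: fmlookup_dom'_iff)
  ultimately have "c \<in> addresses n" using graft(9) k acat_in_addresses by simp
  then have "preopetope (Suc n) (PAssign (fmupd c q m))"
    using m graft(8) by (auto simp: preopetope_PAssign_iff)
  then show ?case by blast
qed

lemma sequent_treelike: "sequent \<Gamma> p t \<Longrightarrow> treelike p"
proof (induct rule: sequent_graft_induct)
  case (graft \<Gamma> m t c r \<Upsilon> q u n a b f)
  have new: "\<not> (\<exists>z. c \<cdot> z \<in> pnodes (PAssign m))"
    using leaf_not_prefix graft by blast
  show ?case unfolding treelike_def
  proof (intro allI impI)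
    fix a' b' assume ab: "a' \<cdot> Addr [b'] \<in> pnodes (PAssign (fmupd c q m))"
    show "\<exists>f. psrc (PAssign (fmupd c q m)) a' = Some f \<and> b' \<in> pnodes f"
    proof (cases "a' \<cdot> Addr [b'] = c")
      case True
      then have "a' = a" "b' = b" using graft(9) by auto
      moreover have "a \<noteq> c" using graft(9) by simp
      ultimately show ?thesis using graft(11,12) psrc_pnodes by auto
    next
      case False
      then have "a' \<cdot> Addr [b'] \<in> pnodes (PAssign m)" using ab by simp
      moreover from this have "a' \<noteq> c" using new by auto
      ultimately show ?thesis using graft(2) unfolding treelike_def by auto
    qed
  qed
qed (auto simp: treelike_def)

lemma sequent_PDegen:
  "sequent \<Gamma> (PDegen f) t \<Longrightarrow> \<Gamma> = {(\<epsilon>, \<epsilon>)} \<and> t = pcorolla f \<and> (\<exists>\<Gamma>' t'. sequent \<Gamma>' f t')"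
  by (erule sequent.cases) auto

lemma pcorolla_eq_iff [simp]: "fmupd \<epsilon> f fmempty = fmupd \<epsilon> g fmempty \<longleftrightarrow> f = g"
  by (metis fmupd_lookup option.inject)

lemma sequent_pcorolla:
  assumes "sequent \<Gamma> (pcorolla f) t"
  shows "t = f \<and> \<Gamma> = {(Addr [a], a) | a. a \<in> pnodes f} \<and> (\<exists>\<Gamma>' t'. sequent \<Gamma>' f t')"
  using assms
proof (cases rule: sequent.cases)
  case (seq_graft a b r \<Gamma> m t \<Upsilon> q u n g)
  \<comment> \<open>A grafted node has a nonempty address, whereas the only node address of a
    corolla is \<open>\<epsilon>\<close>.\<close>
  have "fmdom' (fmupd (a \<cdot> Addr [b]) q m) = fmdom' (fmupd \<epsilon> f fmempty)"
    using seq_graft(2) by simp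
  then have "a \<cdot> Addr [b] \<in> {\<epsilon>}" by (simp del: acat_eq_nil)
  then show ?thesis by simp
qed auto

lemma sequent_PPoint: "sequent \<Gamma> PPoint t \<longleftrightarrow> \<Gamma> = {} \<and> t = PEmpty"
  by (auto elim: sequent.cases intro: seq_point)

lemma not_sequent_PEmpty [simp]: "\<not> sequent \<Gamma> PEmpty t"
  by (auto elim: sequent.cases)

text \<open>This is (Inner) on the side of preopetopes. The side condition of
  \<open>seq_graft\<close>, met when the upper of the two nodes was added, persists because later
  graftings leave existing labels alone.\<close>

lemma sequent_inner:
  "sequent \<Gamma> p t \<Longrightarrow> psrc p a' = Some f' \<Longrightarrow> psrc p (a' \<cdot> Addr [b']) = Some g \<Longrightarrow>
    \<exists>\<Upsilon> u. sequent \<Upsilon> g u \<and> psrc f' b' = Some u"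
proof (induct rule: sequent_graft_induct)
  case (graft \<Gamma> m t c r \<Upsilon> q u n a b f)
  have "treelike (PAssign m)" using graft(1) by (rule sequent_treelike)
  then have new: "c \<cdot> z \<notin> pnodes (PAssign m)" for z
    using leaf_not_prefix graft(10) by blast
  show ?case
  proof (cases "a' \<cdot> Addr [b'] = c")
    case True
    then have "a' = a" "b' = b" "a \<noteq> c" using graft(9) by auto
    then show ?thesis using graft True by auto
  next
    case False
    then have *: "psrc (PAssign m) (a' \<cdot> Addr [b']) = Some g" using graft(14) by (metis fmupd_lookup psrc.simps(1))
    then have "a' \<noteq> c" using new[of "Addr [b']"] psrc_pnodes by metis
    then show ?thesis using graft * by simp
  qed
qed (auto split: if_splits)

text \<open>Regularity collects the facts about a derivable sequent that amount to (Glob1) and (Glob2),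
  together with the bijectivity of the readdressing.\<close>

definition regular :: "(addr \<times> addr) set \<Rightarrow> popet \<Rightarrow> popet \<Rightarrow> bool" where
  "regular \<Gamma> p t \<longleftrightarrow> inj_on fst \<Gamma> \<and> inj_on snd \<Gamma> \<and> fst ` \<Gamma> = pleaves p \<and> snd ` \<Gamma> = pnodes t \<and>
     (\<forall>a b r f. (a \<cdot> Addr [b], r) \<in> \<Gamma> \<longrightarrow> psrc p a = Some f \<longrightarrow> psrc f b = psrc t r) \<and>
     (\<forall>n. preopetope (Suc n) p \<longrightarrow> preopetope n t) \<and>
     (p \<noteq> PPoint \<longrightarrow> (\<exists>\<Delta> w. sequent \<Delta> t w \<and> (\<forall>f. psrc p \<epsilon> = Some f \<longrightarrow> (\<exists>\<Delta>'. sequent \<Delta>' f w))))"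

definition regular_upto :: "nat \<Rightarrow> bool" where
  "regular_upto k \<longleftrightarrow>
     (\<forall>n\<le>k. \<forall>\<Gamma> p t. preopetope n p \<longrightarrow> sequent \<Gamma> p t \<longrightarrow> regular \<Gamma> p t)"

text \<open>The leaves of \<open>t\<close> are moved while their images in the target
  \<open>w\<close> stay, so \<open>w\<close> itself is unchanged. The bound on the dimension allows
  one induction for this and \<open>regular_upto\<close>.\<close>

definition substitutive_upto :: "nat \<Rightarrow> bool" where
  "substitutive_upto k \<longleftrightarrow> (\<forall>n\<le>k. \<forall>\<Gamma> t w \<Upsilon> q u r. preopetope n t \<longrightarrow> preopetope n q \<longrightarrow>
     sequent \<Gamma> t w \<longrightarrow> sequent \<Upsilon> q u \<longrightarrow> psrc t r = Some u \<longrightarrow>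
     sequent ((\<lambda>(c, d). (readdress r \<Upsilon> c, d)) ` \<Gamma>) (psubst t r q \<Upsilon>) w)"

lemma regular_uptoD:
  "regular_upto k \<Longrightarrow> n \<le> k \<Longrightarrow> preopetope n p \<Longrightarrow> sequent \<Gamma> p t \<Longrightarrow> regular \<Gamma> p t"
  unfolding regular_upto_def by blast

lemma regular_fst_unique: "regular \<Gamma> p t \<Longrightarrow> (x, d) \<in> \<Gamma> \<Longrightarrow> (x, d') \<in> \<Gamma> \<Longrightarrow> d = d'"
  using inj_onD[of fst \<Gamma> "(x, d)" "(x, d')"] unfolding regular_def by simp

lemma regular_snd_unique: "regular \<Gamma> p t \<Longrightarrow> (x, d) \<in> \<Gamma> \<Longrightarrow> (x', d) \<in> \<Gamma> \<Longrightarrow> x = x'"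
  using inj_onD[of snd \<Gamma> "(x, d)" "(x', d)"] unfolding regular_def by simp

lemma regular_leaf: "regular \<Gamma> p t \<Longrightarrow> (x, d) \<in> \<Gamma> \<Longrightarrow> x \<in> pleaves p"
  unfolding regular_def by (metis fst_conv image_eqI)

lemma regular_node: "regular \<Gamma> p t \<Longrightarrow> (x, d) \<in> \<Gamma> \<Longrightarrow> d \<in> pnodes t"
  unfolding regular_def by (metis snd_conv image_eqI)

lemma regular_source:
  "regular \<Gamma> p t \<Longrightarrow> (a \<cdot> Addr [b], r) \<in> \<Gamma> \<Longrightarrow> psrc p a = Some f \<Longrightarrow> psrc f b = psrc t r"
  unfolding regular_def by blast

lemma regular_dim: "regular \<Gamma> p t \<Longrightarrow> preopetope (Suc n) p \<Longrightarrow> preopetope n t"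
  unfolding regular_def by blast

lemma regular_target: "regular \<Gamma> p t \<Longrightarrow> p \<noteq> PPoint \<Longrightarrow> \<exists>\<Delta> w. sequent \<Delta> t w"
  unfolding regular_def by blast

lemma regular_target_treelike: "regular \<Gamma> p t \<Longrightarrow> p \<noteq> PPoint \<Longrightarrow> treelike t"
  using regular_target sequent_treelike by blast

text \<open>Regularity of the sequent of \<open>q\<close> provides the bijection between its leaves
  and the inputs of \<open>u\<close>. That \<open>t\<close> has a source forces a positive
  dimension, which excludes the point as \<open>q\<close>.\<close>

lemma substitutionI:
  assumes "regular_upto k" "n \<le> k" "preopetope n t" "preopetope n q" "treelike t"
    "sequent \<Upsilon> q u" "psrc t r = Some u"
  shows "substitution t r q \<Upsilon> u"
proof -
  have reg: "regular \<Upsilon> q u" using assms regular_uptoD by blast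
  obtain j where "n = Suc j" using preopetope_src[OF assms(3,7)] by blast
  then have "(\<exists>f. q = PDegen f \<and> \<Upsilon> = {(\<epsilon>, \<epsilon>)}) \<or> (\<exists>m. q = PAssign m \<and> pnodes q \<noteq> {})"
    using assms(4,6) by (cases q) (auto simp: preopetope_PAssign_iff dest: sequent_PDegen)
  then show ?thesis
    using reg assms(5,7) sequent_treelike[OF assms(6)] unfolding regular_def by unfold_locales auto
qed

text \<open>Regularity turns the side condition of \<open>seq_graft\<close>, which looks two levels
  down into \<open>m\<close>, into a condition on the node \<open>r\<close> of the target, where the
  substitution takes place.\<close>

lemma graft_step:
  assumes N: "regular_upto k" "Suc n \<le> k" and p: "preopetope (Suc n) (PAssign m)" "sequent \<Gamma> (PAssign m) t"
    and cr: "(c, r) \<in> \<Gamma>" and q: "preopetope n q" "sequent \<Upsilon> q u" "psrc t r = Some u"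
  shows "sequent (graft_graph \<Gamma> c r \<Upsilon> q) (PAssign (fmupd c q m)) (psubst t r q \<Upsilon>)"
proof -
  have reg: "regular \<Gamma> (PAssign m) t" using regular_uptoD[OF N p] .
  then have leaf: "c \<in> pleaves (PAssign m)" using cr regular_leaf by blast
  then obtain a b f where c: "c = a \<cdot> Addr [b]" "fmlookup m a = Some f" by auto
  then have "psrc f b = Some u" using regular_source[OF reg] cr q(3) by auto
  moreover from this have "n \<ge> 1" using preopetope_src[of n f b u] p(1) c(2) by (auto simp: preopetope_PAssign_iff)
  ultimately show ?thesis
    using sequent_graft[OF p(2) cr q(2) _ _ q(1) c(1) leaf c(2)] p(1) by simp
qed

section \<open>Exchange of graftings and uniqueness of sequents\<close>

lemma graft_graph_twice:
  assumes inj: "inj_on fst \<Gamma>" and "(c, r) \<in> \<Gamma>" "(c', r') \<in> \<Gamma>" "c \<noteq> c'"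
    and "\<And>s. s \<in> pnodes q \<Longrightarrow> c \<cdot> Addr [s] \<noteq> c'"
  shows "(x, d) \<in> graft_graph (graft_graph \<Gamma> c r \<Upsilon> q) c' (readdress r \<Upsilon> r') \<Upsilon>' q' \<longleftrightarrow>
    (\<exists>d'. (x, d') \<in> \<Gamma> \<and> x \<noteq> c \<and> x \<noteq> c' \<and> d = readdress (readdress r \<Upsilon> r') \<Upsilon>' (readdress r \<Upsilon> d')) \<or>
    (\<exists>s. s \<in> pnodes q \<and> x = c \<cdot> Addr [s] \<and> d = readdress (readdress r \<Upsilon> r') \<Upsilon>' (r \<cdot> s)) \<or>
    (\<exists>s. s \<in> pnodes q' \<and> x = c' \<cdot> Addr [s] \<and> d = readdress r \<Upsilon> r' \<cdot> s)"
proof -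
  have fst: "d = d'" if "(x, d) \<in> \<Gamma>" "(x, d') \<in> \<Gamma>" for x d d'
    using inj_onD[OF inj _ that] by simp
  \<comment> \<open>As the context is functional, removing a pair amounts to removing its
    leaf.\<close>
  have 1: "(x, d) \<noteq> (c, r) \<longleftrightarrow> x \<noteq> c" "(x, d) \<noteq> (c', r') \<longleftrightarrow> x \<noteq> c'" if "(x, d) \<in> \<Gamma>" for x d
    using that fst assms(2,3) by auto
  have "((x, d') \<in> graft_graph \<Gamma> c r \<Upsilon> q \<and> (x, d') \<noteq> (c', readdress r \<Upsilon> r')) \<longleftrightarrow>
      (\<exists>e. (x, e) \<in> \<Gamma> \<and> x \<noteq> c \<and> x \<noteq> c' \<and> d' = readdress r \<Upsilon> e) \<or>
      (\<exists>s. s \<in> pnodes q \<and> x = c \<cdot> Addr [s] \<and> d' = r \<cdot> s)" for d'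
    unfolding mem_graft_graph using 1 assms(3-5) fst by (metis prod.inject)
  note * = this
  show ?thesis
    unfolding mem_graft_graph[of x d "graft_graph \<Gamma> c r \<Upsilon> q"] conj_assoc[symmetric] * by blast
qed

lemma graft_graph_commute:
  assumes "substitution t r q \<Upsilon> u" "substitution t r' q' \<Upsilon>' u'"
    and reg: "regular \<Gamma> p t" "treelike p" and c: "(c, r) \<in> \<Gamma>" "(c', r') \<in> \<Gamma>" "c \<noteq> c'" "r \<noteq> r'"
  shows "graft_graph (graft_graph \<Gamma> c r \<Upsilon> q) c' (readdress r \<Upsilon> r') \<Upsilon>' q' =
    graft_graph (graft_graph \<Gamma> c' r' \<Upsilon>' q') c (readdress r' \<Upsilon>' r) \<Upsilon> q"
proof -
  have inj: "inj_on fst \<Gamma>" using reg(1) unfolding regular_def by blast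
  have leaf: "c \<in> pleaves p" "c' \<in> pleaves p" using regular_leaf[OF reg(1)] c by blast+
  have ne: "c \<cdot> Addr [s] \<noteq> c'" "c' \<cdot> Addr [s] \<noteq> c" for s
    using leaf_antichain[OF reg(2) leaf(1), of "Addr [s]"] leaf_antichain[OF reg(2) leaf(2), of "Addr [s]"]
      leaf by auto
  have comm: "readdress (readdress r \<Upsilon> r') \<Upsilon>' (readdress r \<Upsilon> d) =
      readdress (readdress r' \<Upsilon>' r) \<Upsilon> (readdress r' \<Upsilon>' d)" if "(x, d) \<in> \<Gamma>" for x d
    using readdress_commute[OF assms(1,2) c(4)] regular_node[OF reg(1) that] by (simp add: pedges_def)
  have nest: "readdress (readdress r \<Upsilon> r') \<Upsilon>' (r \<cdot> s) = readdress r' \<Upsilon>' r \<cdot> s" if "s \<in> pnodes q" for s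
    using readdress_nested[OF assms(1,2) c(4) that] .
  have nest': "readdress (readdress r' \<Upsilon>' r) \<Upsilon> (r' \<cdot> s) = readdress r \<Upsilon> r' \<cdot> s" if "s \<in> pnodes q'" for s
    using readdress_nested[OF assms(2,1) c(4)[symmetric] that] .
  have "(x, d) \<in> graft_graph (graft_graph \<Gamma> c r \<Upsilon> q) c' (readdress r \<Upsilon> r') \<Upsilon>' q' \<longleftrightarrow>
    (x, d) \<in> graft_graph (graft_graph \<Gamma> c' r' \<Upsilon>' q') c (readdress r' \<Upsilon>' r) \<Upsilon> q" for x d
  proof -
    have "(\<exists>d'. (x, d') \<in> \<Gamma> \<and> x \<noteq> c \<and> x \<noteq> c' \<and> d = readdress (readdress r \<Upsilon> r') \<Upsilon>' (readdress r \<Upsilon> d')) \<longleftrightarrow>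
      (\<exists>d'. (x, d') \<in> \<Gamma> \<and> x \<noteq> c' \<and> x \<noteq> c \<and> d = readdress (readdress r' \<Upsilon>' r) \<Upsilon> (readdress r' \<Upsilon>' d'))"
      by (intro iff_exI) (use comm in auto)
    moreover have "(\<exists>s. s \<in> pnodes q \<and> x = c \<cdot> Addr [s] \<and> d = readdress (readdress r \<Upsilon> r') \<Upsilon>' (r \<cdot> s)) \<longleftrightarrow>
      (\<exists>s. s \<in> pnodes q \<and> x = c \<cdot> Addr [s] \<and> d = readdress r' \<Upsilon>' r \<cdot> s)"
      by (intro iff_exI) (use nest in auto)
    moreover have "(\<exists>s. s \<in> pnodes q' \<and> x = c' \<cdot> Addr [s] \<and> d = readdress (readdress r' \<Upsilon>' r) \<Upsilon> (r' \<cdot> s)) \<longleftrightarrow>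
      (\<exists>s. s \<in> pnodes q' \<and> x = c' \<cdot> Addr [s] \<and> d = readdress r \<Upsilon> r' \<cdot> s)"
      by (intro iff_exI) (use nest' in auto)
    moreover note graft_graph_twice[where x = x and d = d and q' = q' and \<Upsilon> = \<Upsilon> and \<Upsilon>' = \<Upsilon>' and q = q,
      OF inj c(1-3) ne(1)]
    moreover note graft_graph_twice[where x = x and d = d and q' = q and \<Upsilon> = \<Upsilon>' and \<Upsilon>' = \<Upsilon> and q = q',
      OF inj c(2,1) c(3)[symmetric] ne(2)]
    ultimately show ?thesis by argo
  qed
  then show ?thesis by auto
qed

lemma fmupd_eq_fmupdD:
  assumes "fmupd c q m = fmupd c q' m'" "c \<notin> fmdom' m" "c \<notin> fmdom' m'"
  shows "q = q' \<and> m = m'"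
proof
  show "q = q'" using assms(1) by (metis fmupd_lookup option.inject)
  show "m = m'"
  proof (rule fmap_ext)
    fix x show "fmlookup m x = fmlookup m' x"
      using arg_cong[OF assms(1), of "\<lambda>m. fmlookup m x"]
        fmdom'_notD[OF assms(2)] fmdom'_notD[OF assms(3)]
      by (cases "x = c") auto
  qed
qed

lemma treelike_two_nodes:
  assumes "treelike t" "pnodes t = {r, r'}" "r \<noteq> r'" "r \<noteq> \<epsilon>"
  shows "r' = \<epsilon> \<and> (\<exists>b. r = Addr [b])"
proof -
  have "\<epsilon> \<in> pnodes t" using treelike_root assms(1,2) by blast
  then have r': "r' = \<epsilon>" using assms by auto
  obtain a b where ab: "r = a \<cdot> Addr [b]" using assms(4) by (cases r rule: addr_cases_last) auto
  then have "a \<in> pnodes t" using treelike_prefix[OF assms(1), of a "Addr [b]"] assms(2) by auto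
  then have "a = \<epsilon>" using ab r' assms(2) by auto
  then show ?thesis using r' ab by simp
qed

text \<open>The two nodes are adjacent, and (Inner) at the edge between them compares the target of
  the upper label with the only source of the lower one. This discharges the exceptional case of
  \<open>psubst_commute\<close>, where the pieces substituted are the degenerate preopetopes on
  \<open>f\<close> and \<open>g\<close>.\<close>

lemma degenerate_pair:
  assumes "sequent \<Delta> t w" "pnodes t = {r, r'}" "r \<noteq> r'"
    "psrc t r = Some (pcorolla f)" "psrc t r' = Some (pcorolla g)"
  shows "f = g"
proof -
  have tl: "treelike t" using assms(1) by (rule sequent_treelike)
  have *: "f = g" if h: "r \<noteq> \<epsilon>" "pnodes t = {r, r'}" "r \<noteq> r'"
    "psrc t r = Some (pcorolla f)" "psrc t r' = Some (pcorolla g)" for r r' f g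
  proof -
    obtain b where b: "r' = \<epsilon>" "r = Addr [b]" using treelike_two_nodes[OF tl h(2,3,1)] by blast
    then obtain \<Upsilon> u where u: "sequent \<Upsilon> (pcorolla f) u" "psrc (pcorolla g) b = Some u"
      using sequent_inner[OF assms(1), of \<epsilon> "pcorolla g" b "pcorolla f"] h(4,5) by auto
    then show ?thesis using sequent_pcorolla[OF u(1)] by (auto split: if_splits)
  qed
  show ?thesis
  proof (cases "r = \<epsilon>")
    case True
    then show ?thesis using *[of r' r g f] assms by (simp add: insert_commute)
  next
    case False
    then show ?thesis using *[of r r' f g] assms by simp
  qed
qed

lemma psubst_commute_sequent:
  assumes "regular_upto k" "n \<le> k" and t: "preopetope n t" "sequent \<Delta> t w"
    and q: "preopetope n q" "sequent \<Upsilon> q u" "psrc t r = Some u"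
    and q': "preopetope n q'" "sequent \<Upsilon>' q' u'" "psrc t r' = Some u'" and ne: "r \<noteq> r'"
    and tl: "treelike (psubst t r q \<Upsilon>)" "treelike (psubst t r' q' \<Upsilon>')"
    and dim: "preopetope n (psubst t r q \<Upsilon>)" "preopetope n (psubst t r' q' \<Upsilon>')"
  shows "psubst (psubst t r' q' \<Upsilon>') (readdress r' \<Upsilon>' r) q \<Upsilon> =
    psubst (psubst t r q \<Upsilon>) (readdress r \<Upsilon> r') q' \<Upsilon>'"
proof -
  note sub = substitutionI[OF assms(1,2)]
  have A: "substitution t r q \<Upsilon> u" using sub[OF t(1) q(1) sequent_treelike[OF t(2)] q(2,3)] .
  have B: "substitution t r' q' \<Upsilon>' u'" using sub[OF t(1) q'(1) sequent_treelike[OF t(2)] q'(2,3)] .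
  interpret A: substitution t r q \<Upsilon> u by fact
  interpret B: substitution t r' q' \<Upsilon>' u' by fact
  have C: "substitution (psubst t r' q' \<Upsilon>') (readdress r' \<Upsilon>' r) q \<Upsilon> u"
    using sub[OF dim(2) q(1) tl(2) q(2) B.psrc_psubst_out[OF ne q(3)]] .
  have D: "substitution (psubst t r q \<Upsilon>) (readdress r \<Upsilon> r') q' \<Upsilon>' u'"
    using sub[OF dim(1) q'(1) tl(1) q'(2) A.psrc_psubst_out[OF ne[symmetric] q'(3)]] .
  show ?thesis
  proof (rule psubst_commute[OF A B ne C D])
    assume e: "pnodes q = {}" "pnodes q' = {}" "pnodes t = {r, r'}"
    obtain f where f: "q = PDegen f" using A.shape_q e(1) by auto
    obtain g where g: "q' = PDegen g" using B.shape_q e(2) by auto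
    have "u = pcorolla f" "u' = pcorolla g"
      using sequent_PDegen q(2) q'(2) f g by blast+
    then show "q = q'"
      using degenerate_pair[OF t(2) e(3) ne, of f g] q(3) q'(3) f g by simp
  qed
qed

text \<open>A topmost node can be made the last one to be grafted.\<close>

lemma sequent_remove_top:
  assumes N: "regular_upto k"
  shows "sequent \<Gamma> p t \<Longrightarrow> preopetope n p \<Longrightarrow> n \<le> k \<Longrightarrow> psrc p l = Some q \<Longrightarrow> l \<noteq> \<epsilon> \<Longrightarrow>
    (\<And>b. l \<cdot> Addr [b] \<notin> pnodes p) \<Longrightarrow>
    \<exists>m \<Gamma>\<^sub>0 t\<^sub>0 r \<Upsilon> u. p = PAssign (fmupd l q m) \<and> l \<notin> fmdom' m \<and> sequent \<Gamma>\<^sub>0 (PAssign m) t\<^sub>0 \<and>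
      (l, r) \<in> \<Gamma>\<^sub>0 \<and> sequent \<Upsilon> q u \<and> psrc t\<^sub>0 r = Some u \<and>
      \<Gamma> = graft_graph \<Gamma>\<^sub>0 l r \<Upsilon> q \<and> t = psubst t\<^sub>0 r q \<Upsilon>"
proof (induct arbitrary: n rule: sequent_graft_induct)
  case (graft \<Gamma> m t l' r' \<Upsilon>' q' u' n' a' b' f')
  note N' = N \<open>n \<le> k\<close>
  have l': "l' \<notin> fmdom' m" using pleaves_disjoint[OF graft(10)] by simp
  have dim: "n = Suc n'"
  proof -
    have "psrc (PAssign (fmupd l' q' m)) l' = Some q'" by simp
    then obtain k where "n = Suc k" "preopetope k q'" using preopetope_src graft(13) by blast
    then show ?thesis using preopetope_unique graft(8) by blast
  qed
  have reg: "regular \<Gamma> (PAssign m) t" using regular_uptoD[OF N' _ graft(1)] graft(6) dim by simp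
  have u': "psrc t r' = Some u'" using regular_source[OF reg, of a' b' r' f'] graft by auto
  show ?case
  proof (cases "l = l'")
    case True
    then have "q = q'" using graft(15) by simp
    then show ?thesis using True l' graft(1,3,4) u' by blast
  next
    \<comment> \<open>The node \<open>l\<close> was grafted earlier. The induction hypothesis makes
      it the last grafting before that of \<open>l'\<close>, and then these two are
      exchanged.\<close>
    case False
    have "psrc (PAssign m) l = Some q" using graft(15) False by simp
    moreover have top: "l \<cdot> Addr [b] \<notin> pnodes (PAssign m)" "l \<cdot> Addr [b] \<noteq> l'" for b
      using graft(17)[of b] by auto
    ultimately obtain m\<^sub>0 \<Gamma>\<^sub>0 t\<^sub>0 r \<Upsilon> u where
      m\<^sub>0: "m = fmupd l q m\<^sub>0" "l \<notin> fmdom' m\<^sub>0" "sequent \<Gamma>\<^sub>0 (PAssign m\<^sub>0) t\<^sub>0" "(l, r) \<in> \<Gamma>\<^sub>0"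
      and u: "sequent \<Upsilon> q u" "psrc t\<^sub>0 r = Some u"
      and res: "\<Gamma> = graft_graph \<Gamma>\<^sub>0 l r \<Upsilon> q" "t = psubst t\<^sub>0 r q \<Upsilon>"
      using graft(2)[of n] graft(6,14,16) dim by auto
    have q: "preopetope n' q" using graft(6) m\<^sub>0(1) preopetope_src[of "Suc n'" "PAssign m" l q] by simp
    \<comment> \<open>Since \<open>l\<close> is topmost, \<open>l'\<close> is not one of the leaves
      opened by grafting at \<open>l\<close>; so it was a leaf before and has an image
      there.\<close>
    obtain r\<^sub>0 where r\<^sub>0: "(l', r\<^sub>0) \<in> \<Gamma>\<^sub>0" "r' = readdress r \<Upsilon> r\<^sub>0"
      using graft(3) top(2) unfolding res(1) mem_graft_graph by auto
    obtain j where j: "preopetope j (PAssign m\<^sub>0)" using sequent_preopetope m\<^sub>0(3) by blast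
    then obtain c f where "psrc (PAssign m\<^sub>0) c = Some f"
      unfolding preopetope_PAssign_iff using mem_pnodes by (metis all_not_in_conv)
    moreover from this have "c \<noteq> l" using m\<^sub>0(2) psrc_pnodes[of "PAssign m\<^sub>0" c f] by auto
    moreover note j
    ultimately have cf: "psrc (PAssign m\<^sub>0) c = Some f" "c \<noteq> l" and j: "preopetope j (PAssign m\<^sub>0)" by blast+
    then have "psrc (PAssign m) c = Some f" unfolding m\<^sub>0(1) by simp
    then have j: "preopetope (Suc n') (PAssign m\<^sub>0)"
      using preopetope_same_dim[OF j graft(6)] cf j by blast
    have reg0: "regular \<Gamma>\<^sub>0 (PAssign m\<^sub>0) t\<^sub>0" using regular_uptoD[OF N' _ m\<^sub>0(3)] j dim by simp
    have t\<^sub>0: "preopetope n' t\<^sub>0" using regular_dim[OF reg0 j] .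
    obtain \<Delta> w where w: "sequent \<Delta> t\<^sub>0 w" using regular_target[OF reg0] by blast
    have ne: "r \<noteq> r\<^sub>0" using regular_snd_unique[OF reg0 m\<^sub>0(4)] r\<^sub>0(1) False by blast
    have "n' \<le> k" using dim graft(14) by simp
    note sub = substitutionI[OF N \<open>n' \<le> k\<close>]
    have A: "substitution t\<^sub>0 r q \<Upsilon> u" using sub[OF t\<^sub>0 q sequent_treelike[OF w] u] .
    obtain v where v: "psrc t\<^sub>0 r\<^sub>0 = Some v" using regular_node[OF reg0 r\<^sub>0(1)] mem_pnodes by blast
    then have "psrc t r' = Some v"
      using substitution.psrc_psubst_out[OF A ne[symmetric] v] unfolding res(2) r\<^sub>0(2) by simp
    then have u'0: "psrc t\<^sub>0 r\<^sub>0 = Some u'" using v u' by simp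
    have B: "substitution t\<^sub>0 r\<^sub>0 q' \<Upsilon>' u'" using sub[OF t\<^sub>0 graft(8) sequent_treelike[OF w] graft(4) u'0] .
    have dimk: "Suc n' \<le> k" using dim graft(14) by simp
    \<comment> \<open>The sequent in which \<open>l'\<close> is grafted and \<open>l\<close> is
      still missing.\<close>
    define \<Gamma>\<^sub>1 where "\<Gamma>\<^sub>1 = graft_graph \<Gamma>\<^sub>0 l' r\<^sub>0 \<Upsilon>' q'"
    define t\<^sub>1 where "t\<^sub>1 = psubst t\<^sub>0 r\<^sub>0 q' \<Upsilon>'"
    have s1: "sequent \<Gamma>\<^sub>1 (PAssign (fmupd l' q' m\<^sub>0)) t\<^sub>1"
      unfolding \<Gamma>\<^sub>1_def t\<^sub>1_def using graft_step[OF N dimk j m\<^sub>0(3) r\<^sub>0(1) graft(8,4) u'0] .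
    have in1: "(l, readdress r\<^sub>0 \<Upsilon>' r) \<in> \<Gamma>\<^sub>1"
      unfolding \<Gamma>\<^sub>1_def mem_graft_graph using m\<^sub>0(4) False by blast
    have src1: "psrc t\<^sub>1 (readdress r\<^sub>0 \<Upsilon>' r) = Some u"
      unfolding t\<^sub>1_def using substitution.psrc_psubst_out[OF B ne u(2)] .
    have p1: "preopetope (Suc n') (PAssign (fmupd l' q' m\<^sub>0))"
    proof -
      obtain i where i: "preopetope i (PAssign (fmupd l' q' m\<^sub>0))" using sequent_preopetope s1 by blast
      have "psrc (PAssign (fmupd l' q' m\<^sub>0)) l' = Some q'" "psrc (PAssign (fmupd l' q' m)) l' = Some q'" by simp_all
      then show ?thesis using preopetope_same_dim[OF i graft(13)] i dim by blast
    qed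
    have reg1: "regular \<Gamma>\<^sub>1 (PAssign (fmupd l' q' m\<^sub>0)) t\<^sub>1" using regular_uptoD[OF N dimk p1 s1] .
    have tl1: "treelike t\<^sub>1" "treelike t"
      using regular_target_treelike reg1 reg by blast+
    have d1: "preopetope n' t\<^sub>1" "preopetope n' t" using regular_dim reg1 p1 reg graft(6) by blast+
    have comm: "psubst t\<^sub>1 (readdress r\<^sub>0 \<Upsilon>' r) q \<Upsilon> = psubst t r' q' \<Upsilon>'"
      using psubst_commute_sequent[OF N \<open>n' \<le> k\<close> t\<^sub>0 w q u graft(8,4) u'0 ne] tl1 d1
      unfolding t\<^sub>1_def res(2) r\<^sub>0(2) by blast
    have "l \<noteq> l'" "l \<notin> fmdom' (fmupd l' q' m\<^sub>0)" using False m\<^sub>0(2) by auto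
    moreover have "PAssign (fmupd l' q' m) = PAssign (fmupd l q (fmupd l' q' m\<^sub>0))"
      unfolding m\<^sub>0(1) using False by (auto intro: fmap_ext)
    moreover have "graft_graph \<Gamma> l' r' \<Upsilon>' q' = graft_graph \<Gamma>\<^sub>1 l (readdress r\<^sub>0 \<Upsilon>' r) \<Upsilon> q"
      unfolding res(1) \<Gamma>\<^sub>1_def r\<^sub>0(2)
      using graft_graph_commute[OF A B reg0 sequent_treelike[OF m\<^sub>0(3)] m\<^sub>0(4) r\<^sub>0(1) False ne] .
    ultimately show ?thesis using s1 in1 u(1) src1 comm by metis
  qed
qed (auto split: if_splits)

text \<open>The node \<open>c\<close> grafted last in one derivation is topmost, so by
  \<open>sequent_remove_top\<close> every other derivation can be taken to end with it as well; the
  premises agree by induction.\<close>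

lemma sequent_unique_upto:
  assumes N: "regular_upto k"
  shows "sequent \<Gamma> p t \<Longrightarrow> preopetope n p \<Longrightarrow> n \<le> k \<Longrightarrow> sequent \<Gamma>' p t' \<Longrightarrow> \<Gamma>' = \<Gamma> \<and> t' = t"
proof (induct arbitrary: n \<Gamma>' t' rule: sequent_graft_induct)
  case point
  then show ?case by (simp add: sequent_PPoint)
next
  case (degen \<Gamma> p t)
  then show ?case using sequent_PDegen by blast
next
  case (shift \<Gamma> p t)
  then show ?case using sequent_pcorolla by blast
next
  case (graft \<Gamma> m t c r \<Upsilon> q u n' a b f)
  have c: "c \<notin> fmdom' m" using pleaves_disjoint[OF graft(10)] by simp
  have dim: "n = Suc n'"
  proof -
    have "psrc (PAssign (fmupd c q m)) c = Some q" by simp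
    then obtain k where "n = Suc k" "preopetope k q" using preopetope_src graft(13) by blast
    then show ?thesis using preopetope_unique graft(8) by blast
  qed
  have tl: "treelike (PAssign m)" using graft(1) by (rule sequent_treelike)
  have top: "c \<cdot> Addr [b] \<notin> pnodes (PAssign (fmupd c q m))" for b
    using leaf_not_prefix[OF tl graft(10), of "Addr [b]"] by simp
  obtain m\<^sub>0 \<Gamma>\<^sub>0 t\<^sub>0 r\<^sub>0 \<Upsilon>\<^sub>0 u\<^sub>0 where
    m\<^sub>0: "fmupd c q m = fmupd c q m\<^sub>0" "c \<notin> fmdom' m\<^sub>0" "sequent \<Gamma>\<^sub>0 (PAssign m\<^sub>0) t\<^sub>0" "(c, r\<^sub>0) \<in> \<Gamma>\<^sub>0"
    and u: "sequent \<Upsilon>\<^sub>0 q u\<^sub>0"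
    and res: "\<Gamma>' = graft_graph \<Gamma>\<^sub>0 c r\<^sub>0 \<Upsilon>\<^sub>0 q" "t' = psubst t\<^sub>0 r\<^sub>0 q \<Upsilon>\<^sub>0"
    using sequent_remove_top[OF N graft(15,13,14), of c q] top graft(9) by auto
  have "m\<^sub>0 = m" using fmupd_eq_fmupdD[OF m\<^sub>0(1) c m\<^sub>0(2)] by simp
  then have e: "\<Gamma>\<^sub>0 = \<Gamma>" "t\<^sub>0 = t"
    using graft(2)[of "Suc n'" \<Gamma>\<^sub>0 t\<^sub>0] graft(6,14) dim m\<^sub>0(3) by auto
  have "\<Upsilon>\<^sub>0 = \<Upsilon>" using graft(5)[of n' \<Upsilon>\<^sub>0 u\<^sub>0] graft(8,14) dim u by auto
  moreover have "r\<^sub>0 = r"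
    using regular_fst_unique[OF regular_uptoD[OF N _ graft(6,1)]] graft(3,14) m\<^sub>0(4) dim e by blast
  ultimately show ?case using res e by simp
qed

section \<open>Substitution preserves the target\<close>

lemma pnodes_nonempty: "pnodes p \<noteq> {} \<longleftrightarrow> (\<exists>a v. psrc p a = Some v)"
  unfolding ex_in_conv[symmetric] mem_pnodes ..

lemma readdress_unit: "readdress r {(Addr [a], a) | a. a \<in> A} b = b"
proof (cases "\<exists>y s. y \<in> A \<and> b = r \<cdot> (Addr [y] \<cdot> s)")
  case True
  then obtain y s where "y \<in> A" "b = r \<cdot> (Addr [y] \<cdot> s)" by blast
  then show ?thesis
    using readdress_in[of "{(Addr [a], a) | a. a \<in> A}" "Addr [y]" y r s] by (auto simp: inj_on_def)
next
  case False
  then show ?thesis by (intro readdress_out) auto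
qed

text \<open>Together with \<open>psubst_pcorolla\<close> this says that corollas are units for
  substitution on both sides.\<close>

lemma psubst_unit:
  assumes "substitution t r (pcorolla f) {(Addr [a], a) | a. a \<in> pnodes f} f"
  shows "psubst t r (pcorolla f) {(Addr [a], a) | a. a \<in> pnodes f} = t"
proof -
  interpret substitution t r "pcorolla f" "{(Addr [a], a) | a. a \<in> pnodes f}" f by fact
  obtain m where m: "psubst t r (pcorolla f) {(Addr [a], a) | a. a \<in> pnodes f} = PAssign m"
    by (cases rule: psubst_cases) auto
  obtain m' where m': "t = PAssign m'" using src_r by (cases t) auto
  show ?thesis
  proof (rule popet_eqI[OF _ m m'])
    fix a v
    show "psrc (psubst t r (pcorolla f) {(Addr [a], a) | a. a \<in> pnodes f}) a = Some v \<longleftrightarrow> psrc t a = Some v"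
      unfolding psrc_psubst readdress_unit using src_r by (cases "a = r") auto
  qed
qed

lemma psubst_pcorolla:
  assumes "substitution (pcorolla u) \<epsilon> q \<Upsilon> u"
  shows "psubst (pcorolla u) \<epsilon> q \<Upsilon> = q"
proof -
  interpret substitution "pcorolla u" \<epsilon> q \<Upsilon> u by fact
  have eq: "psrc (psubst (pcorolla u) \<epsilon> q \<Upsilon>) a = Some v \<longleftrightarrow> psrc q a = Some v" for a v
    unfolding psrc_psubst by auto
  show ?thesis
  proof (cases rule: psubst_cases)
    case (1 m)
    then have "pnodes q \<noteq> {}" unfolding pnodes_nonempty eq by blast
    then obtain m' where "q = PAssign m'" using shape_q by auto
    then show ?thesis using popet_eqI[OF eq 1(1)] by blast
  qed
qed

lemma (in substitution) psubst_dim: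
  assumes "preopetope n t" "preopetope n q" "preopetope j (psubst t r q \<Upsilon>)"
  shows "j = n"
proof (cases rule: psubst_cases)
  case (1 m)
  then obtain a v where v: "psrc (psubst t r q \<Upsilon>) a = Some v" unfolding pnodes_nonempty by blast
  then show ?thesis
    unfolding psrc_psubst using preopetope_same_dim[OF assms(3) _ v] assms(1,2) by blast
next
  case 2
  then show ?thesis using assms preopetope_unique by metis
qed

text \<open>The rule \<open>seq_graft\<close> adds a single node; here a whole tree \<open>q\<close>
  of the same dimension is put on the leaf \<open>r\<close>, by induction on the derivation of
  \<open>q\<close>. On targets this is the substitution of the target of \<open>q\<close>, and
  \<open>psubst_assoc\<close> carries the induction. It is needed to substitute \<open>q\<close> for
  the node that was grafted last.\<close>

lemma sequent_graft_tree:
  assumes N: "regular_upto k" "Suc n \<le> k" and S: "substitutive_upto n"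
    and p: "preopetope (Suc n) (PAssign m)" "sequent \<Gamma> (PAssign m) t" "(r, r\<^sub>1) \<in> \<Gamma>"
  shows "sequent \<Upsilon> q v \<Longrightarrow> preopetope (Suc n) q \<Longrightarrow> sequent \<Phi> v w \<Longrightarrow> psrc t r\<^sub>1 = Some w \<Longrightarrow>
    \<exists>m'. sequent ((\<lambda>(c, d). (c, readdress r\<^sub>1 \<Phi> d)) ` (\<Gamma> - {(r, r\<^sub>1)}) \<union> (\<lambda>(c, d). (r \<cdot> c, r\<^sub>1 \<cdot> d)) ` \<Upsilon>)
        (PAssign m') (psubst t r\<^sub>1 v \<Phi>) \<and>
      (\<forall>a x. fmlookup m' a = Some x \<longleftrightarrow> fmlookup m a = Some x \<or> (\<exists>s. a = r \<cdot> s \<and> psrc q s = Some x))"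
proof (induct arbitrary: \<Phi> w rule: sequent_graft_induct)
  case point
  then show ?case by simp
next
  case (degen \<Upsilon> f f')
  have reg: "regular \<Gamma> (PAssign m) t" using regular_uptoD[OF N p(1,2)] .
  have t: "preopetope n t" "treelike t"
    using regular_dim[OF reg p(1)] regular_target_treelike[OF reg] by blast+
  \<comment> \<open>An edge put on a leaf changes nothing, and its target is a corolla, a unit for
    substitution.\<close>
  have w: "w = f" "\<Phi> = {(Addr [a], a) | a. a \<in> pnodes f}"
    using sequent_pcorolla[OF degen(4)] by blast+
  have "preopetope n (pcorolla f)"
    using degen(3) by (auto simp: preopetope_PDegen_iff intro: preopetope_pcorolla)
  then have sub: "substitution t r\<^sub>1 (pcorolla f) \<Phi> w"
    using substitutionI[OF N(1) _ t(1) _ t(2) degen(4,5)] N(2) by simp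
  have "(\<lambda>(c, d). (c, readdress r\<^sub>1 \<Phi> d)) ` (\<Gamma> - {(r, r\<^sub>1)}) \<union> (\<lambda>(c, d). (r \<cdot> c, r\<^sub>1 \<cdot> d)) ` {(\<epsilon>, \<epsilon>)} = \<Gamma>"
    unfolding w readdress_unit using p(3) by auto
  moreover have "psubst t r\<^sub>1 (pcorolla f) \<Phi> = t"
    using psubst_unit sub unfolding w by blast
  ultimately show ?case using p(2) by (intro exI[of _ m]) simp
next
  case (shift \<Upsilon> v v')
  have reg: "regular \<Gamma> (PAssign m) t" using regular_uptoD[OF N p(1,2)] .
  have r: "r \<notin> fmdom' m" using pleaves_disjoint[OF regular_leaf[OF reg p(3)]] by simp
  have "preopetope n v" using shift(3) by (simp add: preopetope_PAssign_iff)
  then have "sequent (graft_graph \<Gamma> r r\<^sub>1 \<Phi> v) (PAssign (fmupd r v m)) (psubst t r\<^sub>1 v \<Phi>)"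
    using graft_step[OF N p _ shift(4,5)] by simp
  moreover have "graft_graph \<Gamma> r r\<^sub>1 \<Phi> v = (\<lambda>(c, d). (c, readdress r\<^sub>1 \<Phi> d)) ` (\<Gamma> - {(r, r\<^sub>1)}) \<union>
      (\<lambda>(c, d). (r \<cdot> c, r\<^sub>1 \<cdot> d)) ` {(Addr [a], a) | a. a \<in> pnodes v}"
    unfolding graft_graph_def by auto
  ultimately show ?case
    using fmdom'_notD[OF r] by (intro exI[of _ "fmupd r v m"]) auto
next
  case (graft \<Upsilon> mq v\<^sub>0 l s \<Upsilon>' v' y n' a b f)
  have reg: "regular \<Gamma> (PAssign m) t" using regular_uptoD[OF N p(1,2)] .
  have leaf: "r \<in> pleaves (PAssign m)" using regular_leaf[OF reg p(3)] .
  have t: "preopetope n t" "treelike t"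
    using regular_dim[OF reg p(1)] regular_target_treelike[OF reg] by blast+
  have "preopetope n v'" using preopetope_src[OF graft(13), of l v'] by simp
  then have n': "n' = n" using preopetope_unique graft(8) by blast
  have regq: "regular \<Upsilon> (PAssign mq) v\<^sub>0" using regular_uptoD[OF N _ graft(1)] graft(6) n' by simp
  have v\<^sub>0: "preopetope n v\<^sub>0" using regular_dim[OF regq] graft(6) n' by simp
  obtain \<Phi>\<^sub>0 w\<^sub>0 where w\<^sub>0: "sequent \<Phi>\<^sub>0 v\<^sub>0 w\<^sub>0" using regular_target[OF regq] by blast
  have y: "psrc v\<^sub>0 s = Some y" using regular_source[OF regq, of a b s f] graft by auto
  have "sequent (graft_graph \<Upsilon> l s \<Upsilon>' v') (PAssign (fmupd l v' mq)) (psubst v\<^sub>0 s v' \<Upsilon>')"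
    using graft_step[OF N _ graft(1,3) graft(8)[unfolded n'] graft(4) y] graft(6) n' by simp
  then have v: "preopetope n (psubst v\<^sub>0 s v' \<Upsilon>')"
    using regular_dim[OF regular_uptoD[OF N graft(13)]] graft(13) by blast
  \<comment> \<open>By substitutivity in dimension \<open>n\<close> the targets of
    \<open>psubst v\<^sub>0 s v' \<Upsilon>'\<close> and of \<open>v\<^sub>0\<close> agree, so the
    induction hypothesis applies at a node with the same label \<open>w\<close>.\<close>
  have "sequent ((\<lambda>(c, d). (readdress s \<Upsilon>' c, d)) ` \<Phi>\<^sub>0) (psubst v\<^sub>0 s v' \<Upsilon>') w\<^sub>0"
    using S v\<^sub>0 w\<^sub>0 graft(4,8) y n' unfolding substitutive_upto_def by blast
  then have w: "w = w\<^sub>0" "\<Phi> = (\<lambda>(c, d). (readdress s \<Upsilon>' c, d)) ` \<Phi>\<^sub>0"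
    using sequent_unique_upto[OF N(1) _ v _ graft(14)] N(2) by simp_all
  define \<Gamma>' where "\<Gamma>' = (\<lambda>(c, d). (c, readdress r\<^sub>1 \<Phi>\<^sub>0 d)) ` (\<Gamma> - {(r, r\<^sub>1)}) \<union>
    (\<lambda>(c, d). (r \<cdot> c, r\<^sub>1 \<cdot> d)) ` \<Upsilon>"
  obtain m' where m': "sequent \<Gamma>' (PAssign m') (psubst t r\<^sub>1 v\<^sub>0 \<Phi>\<^sub>0)"
    and m'_lookup: "\<And>a x. fmlookup m' a = Some x \<longleftrightarrow>
      fmlookup m a = Some x \<or> (\<exists>s. a = r \<cdot> s \<and> psrc (PAssign mq) s = Some x)"
    using graft(2)[OF _ w\<^sub>0] graft(6,15) n' w unfolding \<Gamma>'_def by auto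
  have in_\<Gamma>': "(r \<cdot> l, r\<^sub>1 \<cdot> s) \<in> \<Gamma>'" unfolding \<Gamma>'_def using graft(3) by force
  have pm': "preopetope (Suc n) (PAssign m')"
  proof -
    obtain j where j: "preopetope j (PAssign m')" using sequent_preopetope m' by blast
    obtain a x where "psrc (PAssign m) a = Some x"
      using p(1) unfolding preopetope_PAssign_iff using mem_pnodes by (metis all_not_in_conv)
    moreover from this have "psrc (PAssign m') a = Some x" using m'_lookup by simp
    ultimately show ?thesis using preopetope_same_dim[OF p(1) j] j by blast
  qed
  have reg': "regular \<Gamma>' (PAssign m') (psubst t r\<^sub>1 v\<^sub>0 \<Phi>\<^sub>0)" using regular_uptoD[OF N pm' m'] .
  have t': "preopetope n (psubst t r\<^sub>1 v\<^sub>0 \<Phi>\<^sub>0)" "treelike (psubst t r\<^sub>1 v\<^sub>0 \<Phi>\<^sub>0)"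
    using regular_dim[OF reg' pm'] regular_target_treelike[OF reg'] by blast+
  have "n \<le> k" using N(2) by simp
  note sub = substitutionI[OF N(1) \<open>n \<le> k\<close>]
  have A: "substitution t r\<^sub>1 v\<^sub>0 \<Phi>\<^sub>0 w" using sub[OF t(1) v\<^sub>0 t(2) w\<^sub>0] graft(15) w by simp
  have B: "substitution v\<^sub>0 s v' \<Upsilon>' y" using sub[OF v\<^sub>0 _ sequent_treelike[OF w\<^sub>0] graft(4) y] graft(8) n' by simp
  interpret A: substitution t r\<^sub>1 v\<^sub>0 \<Phi>\<^sub>0 w by fact
  interpret B: substitution v\<^sub>0 s v' \<Upsilon>' y by fact
  have src: "psrc (psubst t r\<^sub>1 v\<^sub>0 \<Phi>\<^sub>0) (r\<^sub>1 \<cdot> s) = Some y" using A.psrc_psubst_in[OF y] .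
  have C: "substitution (psubst t r\<^sub>1 v\<^sub>0 \<Phi>\<^sub>0) (r\<^sub>1 \<cdot> s) v' \<Upsilon>' y"
    using sub[OF t'(1) _ t'(2) graft(4) src] graft(8) n' by simp
  have D: "substitution t r\<^sub>1 (psubst v\<^sub>0 s v' \<Upsilon>') \<Phi> w" using sub[OF t(1) v t(2) graft(14,15)] .
  have target: "psubst (psubst t r\<^sub>1 v\<^sub>0 \<Phi>\<^sub>0) (r\<^sub>1 \<cdot> s) v' \<Upsilon>' = psubst t r\<^sub>1 (psubst v\<^sub>0 s v' \<Upsilon>') \<Phi>"
    by (rule psubst_assoc[OF A B C D w(2)])
  \<comment> \<open>For pairs coming from \<open>\<Gamma>\<close> the two successive readdressings
    combine into one along \<open>\<Phi>\<close>, and the images avoid the node of the second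
    substitution.\<close>
  have old: "readdress (r\<^sub>1 \<cdot> s) \<Upsilon>' (A.\<rho> d) = readdress r\<^sub>1 \<Phi> d \<and> A.\<rho> d \<noteq> r\<^sub>1 \<cdot> s"
    if "(x, d) \<in> \<Gamma>" "(x, d) \<noteq> (r, r\<^sub>1)" for x d
  proof -
    have "d \<noteq> r\<^sub>1" using regular_snd_unique[OF reg p(3)] that by blast
    moreover have "d \<in> pedges t" using regular_node[OF reg that(1)] by (simp add: pedges_def)
    ultimately show ?thesis using readdress_assoc[OF A B D w(2)] A.\<rho>_fresh B.r_node by blast
  qed
  have new: "readdress (r\<^sub>1 \<cdot> s) \<Upsilon>' (r\<^sub>1 \<cdot> d) = r\<^sub>1 \<cdot> B.\<rho> d" for d
    by (rule readdress_prefix[OF B.inj_snd])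
  have "graft_graph \<Gamma>' (r \<cdot> l) (r\<^sub>1 \<cdot> s) \<Upsilon>' v' =
    (\<lambda>(c, d). (c, readdress r\<^sub>1 \<Phi> d)) ` (\<Gamma> - {(r, r\<^sub>1)}) \<union>
    (\<lambda>(c, d). (r \<cdot> c, r\<^sub>1 \<cdot> d)) ` graft_graph \<Upsilon> l s \<Upsilon>' v'" (is "?L = ?R")
  proof (intro set_eqI, clarify)
    fix x d
    have "(x, d) \<in> ?R \<longleftrightarrow> (\<exists>d'. (x, d') \<in> \<Gamma> \<and> (x, d') \<noteq> (r, r\<^sub>1) \<and> d = readdress r\<^sub>1 \<Phi> d') \<or>
      (\<exists>c d'. (c, d') \<in> \<Upsilon> \<and> (c, d') \<noteq> (l, s) \<and> x = r \<cdot> c \<and> d = r\<^sub>1 \<cdot> B.\<rho> d') \<or>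
      (\<exists>e. e \<in> pnodes v' \<and> x = r \<cdot> (l \<cdot> Addr [e]) \<and> d = r\<^sub>1 \<cdot> (s \<cdot> e))"
      unfolding graft_graph_def image_Un by force
    moreover have "(x, d) \<in> ?L \<longleftrightarrow>
      (\<exists>d'. (x, d') \<in> \<Gamma>' \<and> (x, d') \<noteq> (r \<cdot> l, r\<^sub>1 \<cdot> s) \<and> d = readdress (r\<^sub>1 \<cdot> s) \<Upsilon>' d') \<or>
      (\<exists>e. e \<in> pnodes v' \<and> x = r \<cdot> (l \<cdot> Addr [e]) \<and> d = r\<^sub>1 \<cdot> (s \<cdot> e))"
      unfolding mem_graft_graph by simp
    moreover have "(\<exists>d'. (x, d') \<in> \<Gamma>' \<and> (x, d') \<noteq> (r \<cdot> l, r\<^sub>1 \<cdot> s) \<and> d = readdress (r\<^sub>1 \<cdot> s) \<Upsilon>' d') \<longleftrightarrow>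
      (\<exists>d'. (x, d') \<in> \<Gamma> \<and> (x, d') \<noteq> (r, r\<^sub>1) \<and> d = readdress r\<^sub>1 \<Phi> d') \<or>
      (\<exists>c d'. (c, d') \<in> \<Upsilon> \<and> (c, d') \<noteq> (l, s) \<and> x = r \<cdot> c \<and> d = r\<^sub>1 \<cdot> B.\<rho> d')" (is "?P \<longleftrightarrow> ?Q1 \<or> ?Q2")
    proof
      assume ?P
      then obtain d' where d': "(x, d') \<in> \<Gamma>'" "(x, d') \<noteq> (r \<cdot> l, r\<^sub>1 \<cdot> s)" "d = readdress (r\<^sub>1 \<cdot> s) \<Upsilon>' d'"
        by blast
      from d'(1) consider e where "(x, e) \<in> \<Gamma>" "(x, e) \<noteq> (r, r\<^sub>1)" "d' = A.\<rho> e"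
        | c e where "(c, e) \<in> \<Upsilon>" "x = r \<cdot> c" "d' = r\<^sub>1 \<cdot> e"
        unfolding \<Gamma>'_def by auto
      then show "?Q1 \<or> ?Q2"
      proof cases
        case 1
        then show ?thesis using old d'(3) by blast
      next
        case 2
        then have "(c, e) \<noteq> (l, s)" using d'(2) by auto
        then show ?thesis using 2 d'(3) new by blast
      qed
    next
      assume "?Q1 \<or> ?Q2"
      then show ?P
      proof (elim disjE exE conjE)
        fix e assume e: "(x, e) \<in> \<Gamma>" "(x, e) \<noteq> (r, r\<^sub>1)" "d = readdress r\<^sub>1 \<Phi> e"
        then have "(x, A.\<rho> e) \<in> \<Gamma>'" unfolding \<Gamma>'_def by force
        then show ?P using old[OF e(1,2)] e(3) by (intro exI[of _ "A.\<rho> e"]) simp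
      next
        fix c e assume e: "(c, e) \<in> \<Upsilon>" "(c, e) \<noteq> (l, s)" "x = r \<cdot> c" "d = r\<^sub>1 \<cdot> B.\<rho> e"
        then have "(x, r\<^sub>1 \<cdot> e) \<in> \<Gamma>'" unfolding \<Gamma>'_def by force
        then show ?P using e new by (intro exI[of _ "r\<^sub>1 \<cdot> e"]) auto
      qed
    qed
    ultimately show "(x, d) \<in> ?L \<longleftrightarrow> (x, d) \<in> ?R" by argo
  qed
  moreover have "sequent (graft_graph \<Gamma>' (r \<cdot> l) (r\<^sub>1 \<cdot> s) \<Upsilon>' v') (PAssign (fmupd (r \<cdot> l) v' m'))
      (psubst (psubst t r\<^sub>1 v\<^sub>0 \<Phi>\<^sub>0) (r\<^sub>1 \<cdot> s) v' \<Upsilon>')"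
    using graft_step[OF N pm' m' in_\<Gamma>' _ graft(4) src] graft(8) n' by simp
  moreover have "fmlookup (fmupd (r \<cdot> l) v' m') a = Some x \<longleftrightarrow> fmlookup m a = Some x \<or>
      (\<exists>s. a = r \<cdot> s \<and> psrc (PAssign (fmupd l v' mq)) s = Some x)" for a x
  proof (cases "a = r \<cdot> l")
    case True
    \<comment> \<open>Nothing of \<open>m\<close> lies above its leaf \<open>r\<close>, so the new
      entry overwrites nothing.\<close>
    have "fmlookup m (r \<cdot> l) = None"
      using leaf_not_prefix[OF sequent_treelike[OF p(2)] leaf, of l] by (simp add: fmdom'_notD)
    then show ?thesis using True by auto
  next
    case False
    then show ?thesis using m'_lookup by auto
  qed
  ultimately show ?case unfolding target by (intro exI[of _ "fmupd (r \<cdot> l) v' m'"]) simp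
qed

lemma regular_graft_graph_unique:
  assumes "regular \<Gamma> p t" "(c, r) \<in> \<Gamma>" "(x, d) \<in> \<Gamma>"
  shows "(x, d) \<noteq> (c, r) \<longleftrightarrow> x \<noteq> c" "(x, d) \<noteq> (c, r) \<longleftrightarrow> d \<noteq> r"
  using regular_fst_unique[OF assms(1)] regular_snd_unique[OF assms(1)] assms(2,3) by blast+

text \<open>Induction on the derivation of \<open>t\<close>. If \<open>r\<close> is the node grafted
  last, a whole tree takes its place by \<open>sequent_graft_tree\<close>; otherwise the last
  grafting is repeated on the moved leaf after applying the induction hypothesis.\<close>

lemma substitutive_step:
  assumes N: "regular_upto (Suc n)" and S: "substitutive_upto n"
    and q: "preopetope (Suc n) q" "sequent \<Upsilon> q u"
  shows "sequent \<Gamma> t w \<Longrightarrow> preopetope (Suc n) t \<Longrightarrow> psrc t r = Some u \<Longrightarrow>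
    sequent ((\<lambda>(c, d). (readdress r \<Upsilon> c, d)) ` \<Gamma>) (psubst t r q \<Upsilon>) w"
proof (induct rule: sequent_graft_induct)
  case (shift \<Gamma> t w)
  have r: "r = \<epsilon>" "t = u" using shift(4) by (auto split: if_splits)
  have "treelike (pcorolla u)" by (auto simp: treelike_def)
  then have sub: "substitution (pcorolla u) \<epsilon> q \<Upsilon> u"
    using substitutionI[OF N order_refl shift(3) q(1) _ q(2)] shift(4) r by simp
  interpret substitution "pcorolla u" \<epsilon> q \<Upsilon> u by fact
  have *: "readdress \<epsilon> \<Upsilon> (Addr [a]) = x" if "(x, a) \<in> \<Upsilon>" for x a
    using readdress_in[OF inj_snd that, of \<epsilon> \<epsilon>] by simp
  have "(\<lambda>(c, d). (readdress \<epsilon> \<Upsilon> c, d)) ` {(Addr [a], a) | a. a \<in> pnodes u} = \<Upsilon>"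
  proof (intro set_eqI, clarify)
    fix x a
    have "(x, a) \<in> (\<lambda>(c, d). (readdress \<epsilon> \<Upsilon> c, d)) ` {(Addr [a], a) | a. a \<in> pnodes u} \<longleftrightarrow>
      a \<in> pnodes u \<and> x = readdress \<epsilon> \<Upsilon> (Addr [a])" by auto
    also have "\<dots> \<longleftrightarrow> (x, a) \<in> \<Upsilon>" unfolding snd_eq[symmetric] using * by force
    finally show "(x, a) \<in> (\<lambda>(c, d). (readdress \<epsilon> \<Upsilon> c, d)) ` {(Addr [a], a) | a. a \<in> pnodes u} \<longleftrightarrow>
      (x, a) \<in> \<Upsilon>" .
  qed
  then show ?case using psubst_pcorolla[OF sub] q(2) unfolding r by simp
next
  case (graft \<Gamma> m t c r\<^sub>1 \<Phi> v y n' a b f)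
  have "preopetope n v" using preopetope_src[OF graft(13), of c v] by simp
  then have n': "n' = n" using preopetope_unique graft(8) by blast
  note pm = graft(6)[unfolded n'] and pv = graft(8)[unfolded n']
  have reg: "regular \<Gamma> (PAssign m) t" using regular_uptoD[OF N order_refl pm graft(1)] .
  have c: "c \<notin> fmdom' m" using pleaves_disjoint[OF graft(10)] by simp
  have tl: "treelike (PAssign m)" using sequent_treelike graft(1) by blast
  have y: "psrc t r\<^sub>1 = Some y" using regular_source[OF reg, of a b r\<^sub>1 f] graft by auto
  have full: "sequent (graft_graph \<Gamma> c r\<^sub>1 \<Phi> v) (PAssign (fmupd c v m)) (psubst t r\<^sub>1 v \<Phi>)"
    using graft_step[OF N order_refl pm graft(1,3) pv graft(4) y] .
  have B: "substitution (PAssign (fmupd c v m)) r q \<Upsilon> u"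
    using substitutionI[OF N order_refl graft(13) q(1) sequent_treelike[OF full] q(2) graft(14)] .
  interpret B: substitution "PAssign (fmupd c v m)" r q \<Upsilon> u by fact
  show ?case
  proof (cases "r = c")
    case True
    then have u: "u = v" using graft(14) by simp
    obtain m' where m': "sequent ((\<lambda>(c, d). (c, readdress r\<^sub>1 \<Phi> d)) ` (\<Gamma> - {(c, r\<^sub>1)}) \<union>
        (\<lambda>(e, d). (c \<cdot> e, r\<^sub>1 \<cdot> d)) ` \<Upsilon>) (PAssign m') (psubst t r\<^sub>1 v \<Phi>)"
      and lookup: "\<And>a x. fmlookup m' a = Some x \<longleftrightarrow> fmlookup m a = Some x \<or> (\<exists>s. a = c \<cdot> s \<and> psrc q s = Some x)"
      using sequent_graft_tree[OF N order_refl S pm graft(1,3) q(2,1), of \<Phi> y] graft(4) y u by auto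
    \<comment> \<open>\<open>c\<close> was a leaf of \<open>m\<close>, so no other edge of
      \<open>m\<close> extends it and none is moved.\<close>
    have out: "B.\<rho> x = x" if "x \<in> pedges (PAssign m)" "x \<noteq> c" for x
    proof -
      have "x \<noteq> c \<cdot> z" for z
        using that leaf_not_prefix[OF tl graft(10)] leaf_antichain[OF tl graft(10)]
        unfolding pedges_def by (metis Un_iff acat_nil(2))
      then show ?thesis unfolding True by (intro readdress_out)
    qed
    have "(\<exists>b. x = B.\<rho> b \<and> b \<noteq> r \<and> psrc (PAssign (fmupd c v m)) b = Some z) \<longleftrightarrow> fmlookup m x = Some z" for x z
    proof
      assume "\<exists>b. x = B.\<rho> b \<and> b \<noteq> r \<and> psrc (PAssign (fmupd c v m)) b = Some z"
      then obtain b where "x = B.\<rho> b" "b \<noteq> c" "fmlookup m b = Some z" using True by auto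
      moreover from this have "b \<in> pedges (PAssign m)" by (simp add: pedges_def fmdom'I)
      ultimately show "fmlookup m x = Some z" using out by simp
    next
      assume z: "fmlookup m x = Some z"
      then have "x \<in> pedges (PAssign m)" "x \<noteq> c" using c by (auto simp: pedges_def fmdom'I)
      then show "\<exists>b. x = B.\<rho> b \<and> b \<noteq> r \<and> psrc (PAssign (fmupd c v m)) b = Some z"
        using out z True by (intro exI[of _ x]) simp
    qed
    then have eq: "psrc (PAssign m') x = Some z \<longleftrightarrow> psrc (psubst (PAssign (fmupd c v m)) r q \<Upsilon>) x = Some z" for x z
      unfolding B.psrc_psubst using lookup[of x z] True by auto
    obtain x z where "psrc (PAssign m) x = Some z"
      using pm unfolding preopetope_PAssign_iff pnodes_nonempty by blast
    then have "psrc (psubst (PAssign (fmupd c v m)) r q \<Upsilon>) x = Some z"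
      using eq[of x z] lookup[of x z] by simp
    then obtain m'' where "psubst (PAssign (fmupd c v m)) r q \<Upsilon> = PAssign m''"
      using B.psubst_PAssign by blast
    then have res: "PAssign m' = psubst (PAssign (fmupd c v m)) r q \<Upsilon>" using popet_eqI[OF eq refl] by blast
    have "(\<lambda>(c, d). (B.\<rho> c, d)) ` graft_graph \<Gamma> c r\<^sub>1 \<Phi> v =
      (\<lambda>(c, d). (c, readdress r\<^sub>1 \<Phi> d)) ` (\<Gamma> - {(c, r\<^sub>1)}) \<union> (\<lambda>(e, d). (c \<cdot> e, r\<^sub>1 \<cdot> d)) ` \<Upsilon>"
    proof -
      have "(\<lambda>(c, d). (B.\<rho> c, d)) ` (\<lambda>(x, d). (x, readdress r\<^sub>1 \<Phi> d)) ` (\<Gamma> - {(c, r\<^sub>1)}) =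
          (\<lambda>(c, d). (c, readdress r\<^sub>1 \<Phi> d)) ` (\<Gamma> - {(c, r\<^sub>1)})"
        unfolding image_image
      proof (intro image_cong refl)
        fix z assume "z \<in> \<Gamma> - {(c, r\<^sub>1)}"
        then obtain x d where "(x, d) \<in> \<Gamma>" "(x, d) \<noteq> (c, r\<^sub>1)" and z: "z = (x, d)" by (cases z) auto
        then have "x \<in> pedges (PAssign m)" "x \<noteq> c"
          using regular_leaf[OF reg] regular_graft_graph_unique(1)[OF reg graft(3)]
          unfolding pedges_def by blast+
        then show "(case case z of (x, d) \<Rightarrow> (x, readdress r\<^sub>1 \<Phi> d) of (c, d) \<Rightarrow> (B.\<rho> c, d)) =
            (case z of (c, d) \<Rightarrow> (c, readdress r\<^sub>1 \<Phi> d))" using out z by simp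
      qed
      moreover have "(\<lambda>(c, d). (B.\<rho> c, d)) ` {(c \<cdot> Addr [s], r\<^sub>1 \<cdot> s) | s. s \<in> pnodes v} =
          (\<lambda>(e, d). (c \<cdot> e, r\<^sub>1 \<cdot> d)) ` \<Upsilon>"
      proof -
        have *: "B.\<rho> (c \<cdot> Addr [s]) = c \<cdot> e" if "(e, s) \<in> \<Upsilon>" for e s
          using readdress_in[OF B.inj_snd that, of c \<epsilon>] True by simp
        have "{(c \<cdot> Addr [s], r\<^sub>1 \<cdot> s) | s. s \<in> pnodes v} = (\<lambda>(e, s). (c \<cdot> Addr [s], r\<^sub>1 \<cdot> s)) ` \<Upsilon>"
          unfolding B.snd_eq[unfolded u, symmetric] by force
        moreover have "(\<lambda>(c, d). (B.\<rho> c, d)) ` (\<lambda>(e, s). (c \<cdot> Addr [s], r\<^sub>1 \<cdot> s)) ` \<Upsilon> =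
            (\<lambda>(e, d). (c \<cdot> e, r\<^sub>1 \<cdot> d)) ` \<Upsilon>"
          unfolding image_image by (intro image_cong refl) (use * in auto)
        ultimately show ?thesis by simp
      qed
      ultimately show ?thesis unfolding graft_graph_def image_Un by simp
    qed
    then show ?thesis using m' res by simp
  next
    case False
    have ru: "psrc (PAssign m) r = Some u" using graft(14) False by simp
    have A: "substitution (PAssign m) r q \<Upsilon> u"
      using substitutionI[OF N order_refl pm q(1) tl q(2) ru] .
    interpret A: substitution "PAssign m" r q \<Upsilon> u by fact
    define \<Gamma>' where "\<Gamma>' = (\<lambda>(c, d). (A.\<rho> c, d)) ` \<Gamma>"
    have IH: "sequent \<Gamma>' (psubst (PAssign m) r q \<Upsilon>) t"
      unfolding \<Gamma>'_def using graft(2)[OF pm ru] .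
    have in_\<Gamma>': "(A.\<rho> c, r\<^sub>1) \<in> \<Gamma>'" unfolding \<Gamma>'_def using graft(3) by force
    have cz: "A.\<rho> (c \<cdot> z) = A.\<rho> c \<cdot> z" for z using A.\<rho>_leaf[OF graft(10)] .
    show ?thesis
    proof (cases rule: A.psubst_cases)
      case (1 m\<^sub>1)
      obtain j where j: "preopetope j (psubst (PAssign m) r q \<Upsilon>)" using sequent_preopetope IH by blast
      then have pm\<^sub>1: "preopetope (Suc n) (PAssign m\<^sub>1)" using A.psubst_dim[OF pm q(1) j] 1 by simp
      have "sequent (graft_graph \<Gamma>' (A.\<rho> c) r\<^sub>1 \<Phi> v) (PAssign (fmupd (A.\<rho> c) v m\<^sub>1)) (psubst t r\<^sub>1 v \<Phi>)"
        using graft_step[OF N order_refl pm\<^sub>1 _ in_\<Gamma>' pv graft(4) y] IH 1 by simp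
      moreover have "graft_graph \<Gamma>' (A.\<rho> c) r\<^sub>1 \<Phi> v = (\<lambda>(c, d). (A.\<rho> c, d)) ` graft_graph \<Gamma> c r\<^sub>1 \<Phi> v"
      proof -
        have "\<Gamma>' - {(A.\<rho> c, r\<^sub>1)} = (\<lambda>(c, d). (A.\<rho> c, d)) ` (\<Gamma> - {(c, r\<^sub>1)})"
          unfolding \<Gamma>'_def using regular_graft_graph_unique(2)[OF reg graft(3)] by auto
        then have "(\<lambda>(x, d). (x, readdress r\<^sub>1 \<Phi> d)) ` (\<Gamma>' - {(A.\<rho> c, r\<^sub>1)}) =
          (\<lambda>(c, d). (A.\<rho> c, d)) ` (\<lambda>(x, d). (x, readdress r\<^sub>1 \<Phi> d)) ` (\<Gamma> - {(c, r\<^sub>1)})"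
          by (simp add: image_image case_prod_unfold)
        moreover have "{(A.\<rho> c \<cdot> Addr [s], r\<^sub>1 \<cdot> s) | s. s \<in> pnodes v} =
          (\<lambda>(c, d). (A.\<rho> c, d)) ` {(c \<cdot> Addr [s], r\<^sub>1 \<cdot> s) | s. s \<in> pnodes v}"
          using cz by (auto simp: image_iff)
        ultimately show ?thesis unfolding graft_graph_def image_Un by simp
      qed
      moreover have "PAssign (fmupd (A.\<rho> c) v m\<^sub>1) = psubst (PAssign (fmupd c v m)) r q \<Upsilon>"
      proof -
        have cc: "psrc (psubst (PAssign (fmupd c v m)) r q \<Upsilon>) (A.\<rho> c) = Some v"
          using B.psrc_psubst_out[of c v] False by simp
        have eq: "psrc (PAssign (fmupd (A.\<rho> c) v m\<^sub>1)) x = Some z \<longleftrightarrow>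
            psrc (psubst (PAssign (fmupd c v m)) r q \<Upsilon>) x = Some z" for x z
        proof (cases "x = A.\<rho> c")
          case True
          then show ?thesis using cc by simp
        next
          case xc: False
          have "psrc (PAssign (fmupd (A.\<rho> c) v m\<^sub>1)) x = Some z \<longleftrightarrow> psrc (psubst (PAssign m) r q \<Upsilon>) x = Some z"
            using xc 1 by simp
          also have "\<dots> \<longleftrightarrow> psrc (psubst (PAssign (fmupd c v m)) r q \<Upsilon>) x = Some z"
          proof -
            have "(x = A.\<rho> b \<and> b \<noteq> r \<and> psrc (PAssign m) b = Some z) \<longleftrightarrow>
              (x = A.\<rho> b \<and> b \<noteq> r \<and> psrc (PAssign (fmupd c v m)) b = Some z)" for b
              using xc fmdom'_notD[OF c] by (cases "b = c") auto
            then show ?thesis unfolding A.psrc_psubst B.psrc_psubst by blast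
          qed
          finally show ?thesis .
        qed
        obtain m'' where "psubst (PAssign (fmupd c v m)) r q \<Upsilon> = PAssign m''"
          using B.psubst_PAssign[OF cc] by blast
        then show ?thesis using popet_eqI[OF eq refl] by blast
      qed
      ultimately show ?thesis by simp
    next
      \<comment> \<open>The substitution in \<open>m\<close> collapses to a degenerate preopetope,
        on which the rule \<open>seq_graft\<close> cannot act. Then \<open>m\<close> is the corolla
        on the corolla of \<open>g\<close>, and the result is the corolla of \<open>v\<close>, which
        \<open>seq_shift\<close> derives.\<close>
      case (2 g)
      have r: "r = \<epsilon>" using treelike_root[OF tl] 2(4) by auto
      have m: "m = fmupd \<epsilon> u fmempty"
      proof (rule PAssign_eqI)
        fix a show "psrc (PAssign m) a = psrc (pcorolla u) a"
          using ru r 2(4) fmdom'_notD[of a m] by (cases "a = \<epsilon>") auto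
      qed
      have u: "u = pcorolla g" using sequent_PDegen q(2) 2(2) by blast
      have "t = u" "\<Gamma> = {(Addr [a], a) | a. a \<in> pnodes u}"
        using sequent_pcorolla graft(1) m by blast+
      then have \<Gamma>: "t = pcorolla g" "\<Gamma> = {(Addr [\<epsilon>], \<epsilon>)}" unfolding u by auto
      then have cr: "c = Addr [\<epsilon>]" "r\<^sub>1 = \<epsilon>" using graft(3) by auto
      have pt: "preopetope n t" using regular_dim[OF reg pm] .
      have "substitution (pcorolla g) \<epsilon> v \<Phi> y"
        using substitutionI[OF N _ pt pv regular_target_treelike[OF reg] graft(4) y] \<Gamma>(1) cr by simp
      then have w: "psubst t r\<^sub>1 v \<Phi> = v"
        using psubst_pcorolla substitution.src_r unfolding \<Gamma>(1) cr by fastforce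
      have \<rho>: "B.\<rho> (Addr [\<epsilon>] \<cdot> z) = z" for z
        using readdress_in[OF B.inj_snd, of \<epsilon> \<epsilon> \<epsilon> z] 2(3) r by simp
      then have \<rho>': "B.\<rho> (Addr [\<epsilon>]) = \<epsilon>" using \<rho>[of \<epsilon>] by simp
      have cc: "psrc (psubst (PAssign (fmupd c v m)) r q \<Upsilon>) \<epsilon> = Some v"
        using B.psrc_psubst_out[of c v] False \<rho>' cr by simp
      have eq: "psrc (pcorolla v) x = Some z \<longleftrightarrow> psrc (psubst (PAssign (fmupd c v m)) r q \<Upsilon>) x = Some z" for x z
      proof -
        have "psrc q s = None" for s unfolding 2(2) by simp
        moreover have "b \<noteq> r \<and> psrc (PAssign (fmupd c v m)) b = Some z \<longleftrightarrow> b = c \<and> z = v" for b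
          unfolding r m cr by auto
        ultimately have "psrc (psubst (PAssign (fmupd c v m)) r q \<Upsilon>) x = Some z \<longleftrightarrow> x = B.\<rho> c \<and> z = v"
          unfolding B.psrc_psubst by simp
        then show ?thesis unfolding cr(1) \<rho>' by auto
      qed
      obtain m'' where "psubst (PAssign (fmupd c v m)) r q \<Upsilon> = PAssign m''"
        using B.psubst_PAssign[OF cc] by blast
      then have res: "psubst (PAssign (fmupd c v m)) r q \<Upsilon> = pcorolla v" using popet_eqI[OF eq refl] by simp
      have "(\<lambda>(c, d). (B.\<rho> c, d)) ` graft_graph \<Gamma> c r\<^sub>1 \<Phi> v = {(Addr [a], a) | a. a \<in> pnodes v}"
      proof -
        have "graft_graph \<Gamma> c r\<^sub>1 \<Phi> v = (\<lambda>s. (Addr [\<epsilon>, s], s)) ` pnodes v"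
          unfolding graft_graph_def \<Gamma>(2) cr by auto
        moreover have "B.\<rho> (Addr [\<epsilon>, a]) = Addr [a]" for a using \<rho>[of "Addr [a]"] by simp
        ultimately show ?thesis by (simp add: image_image setcompr_eq_image)
      qed
      then show ?thesis unfolding res w using seq_shift[OF graft(4)] by simp
    qed
  qed
qed auto

section \<open>Regularity is preserved by the rules\<close>

lemma pleavesI:
  assumes "fmlookup m a = Some f" "b \<in> pnodes f" "a \<cdot> Addr [b] \<notin> fmdom' m"
  shows "a \<cdot> Addr [b] \<in> pleaves (PAssign m)"
  unfolding pleaves.simps using assms by blast

text \<open>The new node uses up the leaf \<open>c\<close> and opens one leaf for each of its
  inputs; as nothing of \<open>m\<close> lies above \<open>c\<close>, none of these inputs is
  already occupied.\<close>

lemma pleaves_fmupd: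
  assumes "treelike (PAssign m)" "c \<in> pleaves (PAssign m)"
  shows "pleaves (PAssign (fmupd c q m)) = (pleaves (PAssign m) - {c}) \<union> {c \<cdot> Addr [s] | s. s \<in> pnodes q}"
proof -
  have c: "c \<cdot> z \<notin> fmdom' m" for z using leaf_not_prefix[OF assms, of z] by simp
  then have "c \<notin> fmdom' m" by (metis acat_nil(2))
  show ?thesis
  proof (intro equalityI subsetI)
    fix x assume "x \<in> pleaves (PAssign (fmupd c q m))"
    then obtain a b f where x: "x = a \<cdot> Addr [b]" "fmlookup (fmupd c q m) a = Some f" "b \<in> pnodes f"
      "x \<notin> fmdom' (fmupd c q m)" by auto
    show "x \<in> (pleaves (PAssign m) - {c}) \<union> {c \<cdot> Addr [s] | s. s \<in> pnodes q}"
    proof (cases "a = c")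
      case False
      then have "fmlookup m a = Some f" "x \<notin> fmdom' m" "x \<noteq> c" using x(2,4) by auto
      then show ?thesis using pleavesI[of m a f b] x(1,3) by blast
    qed (use x in auto)
  next
    fix x assume "x \<in> (pleaves (PAssign m) - {c}) \<union> {c \<cdot> Addr [s] | s. s \<in> pnodes q}"
    then consider "x \<in> pleaves (PAssign m)" "x \<noteq> c" | s where "x = c \<cdot> Addr [s]" "s \<in> pnodes q" by blast
    then show "x \<in> pleaves (PAssign (fmupd c q m))"
    proof cases
      case 1
      then obtain a b f where x: "x = a \<cdot> Addr [b]" "fmlookup m a = Some f" "b \<in> pnodes f" "x \<notin> fmdom' m" by auto
      moreover from this have "a \<noteq> c" using \<open>c \<notin> fmdom' m\<close> fmdom'I by metis
      ultimately have "fmlookup (fmupd c q m) a = Some f" "x \<notin> fmdom' (fmupd c q m)" using 1(2) by auto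
      then show ?thesis using pleavesI[of "fmupd c q m" a f b] x(1,3) by blast
    next
      case 2
      then have "fmlookup (fmupd c q m) c = Some q" "x \<notin> fmdom' (fmupd c q m)" using c[of "Addr [s]"] by auto
      then show ?thesis using pleavesI[of "fmupd c q m" c q s] 2 by blast
    qed
  qed
qed

lemma mem_fst_image: "x \<in> fst ` R \<longleftrightarrow> (\<exists>y. (x, y) \<in> R)"
  and mem_snd_image: "y \<in> snd ` R \<longleftrightarrow> (\<exists>x. (x, y) \<in> R)"
  by force+

lemma regular_point: "regular {} PPoint PEmpty"
  by (simp add: regular_def)

lemma regular_pcorolla:
  assumes "sequent \<Gamma> p t"
  shows "regular {(Addr [a], a) | a. a \<in> pnodes p} (pcorolla p) p"
proof -
  have "pleaves (pcorolla p) = (\<lambda>a. Addr [a]) ` pnodes p"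
    by (auto split: if_splits)
  moreover have "psrc f b = psrc p r" if "(a \<cdot> Addr [b], r) \<in> {(Addr [a], a) | a. a \<in> pnodes p}"
    "psrc (pcorolla p) a = Some f" for a b r f
    using that by (auto split: if_splits)
  moreover have "preopetope n p" if "preopetope (Suc n) (pcorolla p)" for n
    using preopetope_src[OF that, of \<epsilon> p] by simp
  ultimately show ?thesis
    unfolding regular_def using assms by (auto simp: inj_on_def image_iff)
qed

lemma regular_degen:
  assumes "sequent \<Gamma> p t"
  shows "regular {(\<epsilon>, \<epsilon>)} (PDegen p) (pcorolla p)"
proof -
  have "preopetope n (pcorolla p)" if "preopetope (Suc n) (PDegen p)" for n
    using that preopetope_pcorolla by (auto simp: preopetope_PDegen_iff)
  then show ?thesis
    unfolding regular_def using seq_shift[OF assms] by auto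
qed

text \<open>\<open>dim\<close> and \<open>target\<close> are hypotheses because they come from
  substitutivity one dimension lower. The rest is a case analysis on the two kinds of pairs in
  \<open>graft_graph\<close>, which are kept apart by the antichain of leaves and by
  \<open>\<rho>_fresh\<close>.\<close>

lemma regular_graft:
  assumes reg: "regular \<Gamma> (PAssign m) t" "treelike (PAssign m)" and cr: "(c, r) \<in> \<Gamma>"
    and sub: "substitution t r q \<Upsilon> u"
    and dim: "\<And>k. preopetope (Suc k) (PAssign (fmupd c q m)) \<Longrightarrow> preopetope k (psubst t r q \<Upsilon>)"
    and target: "\<And>\<Delta> w. sequent \<Delta> t w \<Longrightarrow> \<exists>\<Delta>'. sequent \<Delta>' (psubst t r q \<Upsilon>) w"
  shows "regular (graft_graph \<Gamma> c r \<Upsilon> q) (PAssign (fmupd c q m)) (psubst t r q \<Upsilon>)"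
proof -
  interpret substitution t r q \<Upsilon> u by fact
  have leaf: "c \<in> pleaves (PAssign m)" using regular_leaf[OF reg(1) cr] .
  note unique = regular_graft_graph_unique[OF reg(1) cr]
  have old_ne: "x \<noteq> c \<cdot> Addr [s]" if "(x, d) \<in> \<Gamma>" for x d s
    using leaf_antichain[OF reg(2) leaf, of "Addr [s]"] regular_leaf[OF reg(1) that] by auto
  have edge: "d \<in> pedges t" if "(x, d) \<in> \<Gamma>" for x d
    using regular_node[OF reg(1) that] by (simp add: pedges_def)
  have "inj_on fst (graft_graph \<Gamma> c r \<Upsilon> q)"
  proof (rule inj_onI, clarsimp)
    fix x d d' assume "(x, d) \<in> graft_graph \<Gamma> c r \<Upsilon> q" "(x, d') \<in> graft_graph \<Gamma> c r \<Upsilon> q"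
    then show "d = d'"
      unfolding mem_graft_graph
    proof (elim disjE exE conjE)
      fix e e' assume "(x, e) \<in> \<Gamma>" "(x, e') \<in> \<Gamma>" "d = \<rho> e" "d' = \<rho> e'"
      then show ?thesis using regular_fst_unique[OF reg(1)] by blast
    next
      fix e s assume "(x, e) \<in> \<Gamma>" "x = c \<cdot> Addr [s]"
      then show ?thesis using old_ne by blast
    next
      fix e s assume "(x, e) \<in> \<Gamma>" "x = c \<cdot> Addr [s]"
      then show ?thesis using old_ne by blast
    qed simp
  qed
  moreover have "inj_on snd (graft_graph \<Gamma> c r \<Upsilon> q)"
  proof (rule inj_onI, clarsimp)
    fix x x' d assume "(x, d) \<in> graft_graph \<Gamma> c r \<Upsilon> q" "(x', d) \<in> graft_graph \<Gamma> c r \<Upsilon> q"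
    then show "x = x'"
      unfolding mem_graft_graph
    proof (elim disjE exE conjE)
      fix e e' assume e: "(x, e) \<in> \<Gamma>" "(x, e) \<noteq> (c, r)" "d = \<rho> e"
        and e': "(x', e') \<in> \<Gamma>" "(x', e') \<noteq> (c, r)" "d = \<rho> e'"
      then have "e = e'" using \<rho>_inj[of e e'] edge unique by auto
      then show ?thesis using e e' regular_snd_unique[OF reg(1)] by blast
    next
      fix e s assume "(x, e) \<in> \<Gamma>" "(x, e) \<noteq> (c, r)" "d = \<rho> e" "s \<in> pnodes q" "d = r \<cdot> s"
      then show ?thesis using \<rho>_fresh[of e s] edge unique by auto
    next
      fix e s assume "(x', e) \<in> \<Gamma>" "(x', e) \<noteq> (c, r)" "d = \<rho> e" "s \<in> pnodes q" "d = r \<cdot> s"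
      then show ?thesis using \<rho>_fresh[of e s] edge unique by auto
    qed simp
  qed
  moreover have "fst ` graft_graph \<Gamma> c r \<Upsilon> q = pleaves (PAssign (fmupd c q m))"
  proof -
    have 1: "x \<in> fst ` graft_graph \<Gamma> c r \<Upsilon> q \<longleftrightarrow>
        (x \<in> fst ` \<Gamma> \<and> x \<noteq> c) \<or> (\<exists>s. s \<in> pnodes q \<and> x = c \<cdot> Addr [s])" for x
      unfolding mem_fst_image mem_graft_graph using unique(1) by blast
    have 2: "fst ` \<Gamma> = pleaves (PAssign m)" using reg(1) unfolding regular_def by blast
    show ?thesis
      unfolding pleaves_fmupd[OF reg(2) leaf]
      by (rule set_eqI) (simp only: 1 2 Un_iff Diff_iff singleton_iff mem_Collect_eq, blast)
  qed
  moreover have "snd ` graft_graph \<Gamma> c r \<Upsilon> q = pnodes (psubst t r q \<Upsilon>)"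
  proof -
    have 1: "d \<in> snd ` graft_graph \<Gamma> c r \<Upsilon> q \<longleftrightarrow>
        (\<exists>e. e \<in> snd ` \<Gamma> \<and> e \<noteq> r \<and> d = \<rho> e) \<or> (\<exists>s. s \<in> pnodes q \<and> d = r \<cdot> s)" for d
      unfolding mem_snd_image mem_graft_graph using unique(2) by blast
    have 2: "snd ` \<Gamma> = pnodes t" using reg(1) unfolding regular_def by blast
    show ?thesis
    proof (rule set_eqI)
      fix d show "d \<in> snd ` graft_graph \<Gamma> c r \<Upsilon> q \<longleftrightarrow> d \<in> pnodes (psubst t r q \<Upsilon>)"
        unfolding pnodes_psubst 1 2 unfolding Un_iff Diff_iff singleton_iff image_iff Bex_def by blast
    qed
  qed
  moreover have "psrc f b = psrc (psubst t r q \<Upsilon>) d"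
    if "(a \<cdot> Addr [b], d) \<in> graft_graph \<Gamma> c r \<Upsilon> q" "psrc (PAssign (fmupd c q m)) a = Some f" for a b d f
    using that(1) unfolding mem_graft_graph
  proof (elim disjE exE conjE)
    fix e assume e: "(a \<cdot> Addr [b], e) \<in> \<Gamma>" "(a \<cdot> Addr [b], e) \<noteq> (c, r)" "d = \<rho> e"
    then have "psrc (PAssign m) a = Some f" using old_ne that(2) by (auto split: if_splits)
    then have "psrc f b = psrc t e" using regular_source[OF reg(1) e(1)] by simp
    moreover obtain v where "psrc t e = Some v" using regular_node[OF reg(1) e(1)] mem_pnodes by blast
    moreover have "e \<noteq> r" using unique e(1,2) by blast
    ultimately show ?thesis using psrc_psubst_out e(3) by simp
  next
    fix s assume s: "s \<in> pnodes q" "a \<cdot> Addr [b] = c \<cdot> Addr [s]" "d = r \<cdot> s"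
    then obtain v where "psrc q s = Some v" using mem_pnodes by blast
    moreover from this have "psrc (psubst t r q \<Upsilon>) d = Some v" using psrc_psubst_in s(3) by blast
    ultimately show ?thesis using s(2) that(2) by auto
  qed
  moreover have "\<exists>\<Delta> w. sequent \<Delta> (psubst t r q \<Upsilon>) w \<and>
      (\<forall>f. psrc (PAssign (fmupd c q m)) \<epsilon> = Some f \<longrightarrow> (\<exists>\<Delta>'. sequent \<Delta>' f w))"
  proof -
    \<comment> \<open>Grafting takes place above the root, so the root label, and with it (Glob1),
      is inherited from \<open>m\<close>.\<close>
    have "c \<noteq> \<epsilon>" using leaf by auto
    then have "psrc (PAssign (fmupd c q m)) \<epsilon> = psrc (PAssign m) \<epsilon>" by simp
    then show ?thesis using reg(1) target unfolding regular_def by (metis popet.distinct(9))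
  qed
  ultimately show ?thesis unfolding regular_def using dim by blast
qed

text \<open>The target \<open>t\<close> has dimension \<open>n\<close>; substitutivity there shows
  that the new target is derivable and has the same target as \<open>t\<close>. This gives both its
  dimension and (Glob1).\<close>

lemma regular_step:
  assumes N: "regular_upto n" and S: "substitutive_upto n"
  shows "sequent \<Gamma> p t \<Longrightarrow> preopetope (Suc n) p \<Longrightarrow> regular \<Gamma> p t"
proof (induct rule: sequent_graft_induct)
  case (graft \<Gamma> m t c r \<Upsilon> q u n' a b f)
  have "preopetope n q" using preopetope_src[OF graft(13), of c q] by simp
  then have n': "n' = n" using preopetope_unique graft(8) by blast
  note pm = graft(6)[unfolded n'] and pq = graft(8)[unfolded n']
  have reg: "regular \<Gamma> (PAssign m) t" using graft(2)[OF pm] .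
  have t: "preopetope n t" using regular_dim[OF reg pm] .
  have tl: "treelike (PAssign m)" using sequent_treelike graft(1) by blast
  have ru: "psrc t r = Some u" using regular_source[OF reg, of a b r f] graft by auto
  have sub: "substitution t r q \<Upsilon> u"
    using substitutionI[OF N order_refl t pq regular_target_treelike[OF reg] graft(4) ru] by simp
  have target: "\<exists>\<Delta>'. sequent \<Delta>' (psubst t r q \<Upsilon>) w" if "sequent \<Delta> t w" for \<Delta> w
    using S t pq that graft(4) ru unfolding substitutive_upto_def by blast
  obtain \<Delta> w where "sequent \<Delta> (psubst t r q \<Upsilon>) w" using regular_target[OF reg] target by blast
  then obtain j where j: "preopetope j (psubst t r q \<Upsilon>)" using sequent_preopetope by blast
  then have "preopetope n (psubst t r q \<Upsilon>)" using substitution.psubst_dim[OF sub t pq j] by simp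
  then have dim: "preopetope k (psubst t r q \<Upsilon>)" if "preopetope (Suc k) (PAssign (fmupd c q m))" for k
    using preopetope_unique[OF that graft(13)] by simp
  show ?case using regular_graft[OF reg tl graft(3) sub dim target] .
qed (use regular_point regular_pcorolla regular_degen in blast)+

theorem regular_and_substitutive: "regular_upto n \<and> substitutive_upto n"
proof (induction n)
  case 0
  \<comment> \<open>In dimension 0 there is only the point, which has no node to substitute
    for.\<close>
  have "p = PPoint" if "preopetope 0 p" for p using that by cases auto
  moreover have "\<not> (preopetope 0 t \<and> psrc t r = Some u)" for t r u
    using preopetope_src[of 0 t r u] by auto
  ultimately show ?case
    unfolding regular_upto_def substitutive_upto_def
    by (metis le_zero_eq sequent_PPoint regular_point)
next
  case (Suc n)
  have N: "regular_upto (Suc n)"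
    unfolding regular_upto_def
    using regular_step Suc.IH regular_uptoD by (metis le_Suc_eq)
  moreover have "substitutive_upto (Suc n)"
    unfolding substitutive_upto_def
  proof (intro allI impI)
    fix n' \<Gamma> t w \<Upsilon> q u r
    assume h: "n' \<le> Suc n" "preopetope n' t" "preopetope n' q" "sequent \<Gamma> t w" "sequent \<Upsilon> q u" "psrc t r = Some u"
    show "sequent ((\<lambda>(c, d). (readdress r \<Upsilon> c, d)) ` \<Gamma>) (psubst t r q \<Upsilon>) w"
    proof (cases "n' = Suc n")
      case True
      then show ?thesis using substitutive_step[OF N _ _ h(5,4)] Suc.IH h by blast
    next
      case False
      then have "n' \<le> n" using h(1) by simp
      then show ?thesis using Suc.IH h(2-6) unfolding substitutive_upto_def by blast
    qed
  qed
  ultimately show ?case by blast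
qed

section \<open>Derivable sequents in all dimensions\<close>

lemma sequent_regular: "sequent \<Gamma> p t \<Longrightarrow> regular \<Gamma> p t"
  using regular_and_substitutive regular_uptoD sequent_preopetope by blast

lemma sequent_unique: "sequent \<Gamma> p t \<Longrightarrow> sequent \<Gamma>' p t' \<Longrightarrow> \<Gamma>' = \<Gamma> \<and> t' = t"
  using regular_and_substitutive sequent_unique_upto sequent_preopetope by blast

lemma sequent_substitution:
  assumes "preopetope n t" "preopetope n q" "sequent \<Delta> t w" "sequent \<Upsilon> q u" "psrc t r = Some u"
  shows "substitution t r q \<Upsilon> u"
  using substitutionI[OF _ order_refl assms(1,2) sequent_treelike assms(4,5)] assms(3)
    regular_and_substitutive by blast

lemma sequent_graft_step:
  assumes "preopetope (Suc n) (PAssign m)" "sequent \<Gamma> (PAssign m) t" "(c, r) \<in> \<Gamma>"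
    "preopetope n q" "sequent \<Upsilon> q u" "psrc t r = Some u"
  shows "sequent (graft_graph \<Gamma> c r \<Upsilon> q) (PAssign (fmupd c q m)) (psubst t r q \<Upsilon>)"
  using graft_step[OF _ order_refl assms] regular_and_substitutive by blast

section \<open>Opetopes as trees\<close>

lemma opetope_OPoint_iff [simp]: "opetope n OPoint \<longleftrightarrow> n = 0"
  by (auto elim: opetope.cases intro: opetope_point)

lemma opetope_OArrow_iff [simp]: "opetope n OArrow \<longleftrightarrow> n = Suc 0"
  by (auto elim: opetope.cases intro: opetope_arrow[simplified])

lemma opetope_OEdge_iff: "opetope n (OEdge \<phi>) \<longleftrightarrow> (\<exists>k. n = Suc (Suc k) \<and> opetope k \<phi>)"
proof
  assume "opetope n (OEdge \<phi>)"
  then show "\<exists>k. n = Suc (Suc k) \<and> opetope k \<phi>" by cases auto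
qed (auto intro: opetope_edge[simplified])

lemma opetope_ONode_iff:
  "opetope n (ONode \<psi> ts) \<longleftrightarrow> (\<exists>k. n = Suc (Suc k) \<and> opetope (Suc k) \<psi>) \<and> fmdom' ts = nodes \<psi> \<and>
     (\<forall>q c. fmlookup ts q = Some c \<longrightarrow> opetope n c \<and> root_edge c (src \<psi> q))" (is "_ \<longleftrightarrow> ?R")
proof
  assume "opetope n (ONode \<psi> ts)"
  then show ?R by cases auto
next
  assume ?R
  then obtain k where "n = k + 2" "opetope (k + 1) \<psi>" by auto
  then show "opetope n (ONode \<psi> ts)" using \<open>?R\<close> opetope_node[of k \<psi> ts] by simp
qed

lemma opetope_0_iff: "opetope 0 \<omega> \<longleftrightarrow> \<omega> = OPoint"
  by (auto elim: opetope.cases)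

lemma opetope_1_iff: "opetope (Suc 0) \<omega> \<longleftrightarrow> \<omega> = OArrow"
  by (auto elim: opetope.cases)

lemma opetope_tree_cases:
  assumes "opetope (Suc (Suc n)) \<omega>"
  obtains \<phi> where "\<omega> = OEdge \<phi>" | \<psi> ts where "\<omega> = ONode \<psi> ts"
  using assms by (cases \<omega>) auto

lemma root_edge_OEdge_iff [simp]: "root_edge (OEdge \<phi>) x \<longleftrightarrow> x = \<phi>"
  by (auto elim: root_edge.cases intro: root_edge_edge)

lemma root_edge_ONode_iff: "root_edge (ONode \<psi> ts) x \<longleftrightarrow> (\<exists>V. target \<psi> x V)"
  by (auto elim: root_edge.cases intro: root_edge_node)

lemma opetope_dim_unique: "opetope n \<omega> \<Longrightarrow> opetope m \<omega> \<Longrightarrow> n = m"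
proof (induction \<omega> arbitrary: n m)
  case (OEdge \<phi>)
  then show ?case by (auto simp: opetope_OEdge_iff)
next
  case (ONode \<psi> ts)
  obtain k j where "n = Suc (Suc k)" "opetope (Suc k) \<psi>" "m = Suc (Suc j)" "opetope (Suc j) \<psi>"
    using ONode.prems unfolding opetope_ONode_iff by blast
  then show ?case using ONode.IH(1)[of "Suc k" "Suc j"] by simp
qed auto

section \<open>Subtrees of opetopes\<close>

lemma subtree_append: "subtree \<omega> (a @ b) = Option.bind (subtree \<omega> a) (\<lambda>c. subtree c b)"
proof (induction \<omega> a rule: subtree.induct)
  case (2 \<psi> ts q a)
  then show ?case by (cases "fmlookup ts q") auto
qed auto

lemma subtree_leaf [simp]: "subtree (OEdge \<phi>) a = Some c \<longleftrightarrow> a = [] \<and> c = OEdge \<phi>"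
  by (cases a) auto

lemma subtree_opetope:
  "opetope (Suc (Suc n)) \<omega> \<Longrightarrow> subtree \<omega> a = Some c \<Longrightarrow> opetope (Suc (Suc n)) c"
proof (induction a arbitrary: \<omega>)
  case (Cons q a)
  then show ?case
    by (cases rule: opetope_tree_cases[OF Cons.prems(1)]) (auto simp: opetope_ONode_iff bind_eq_Some_conv)
qed simp

lemma mem_nodes_tree:
  "opetope (Suc (Suc n)) \<omega> \<Longrightarrow> Addr a \<in> nodes \<omega> \<longleftrightarrow> (\<exists>\<psi> ts. subtree \<omega> a = Some (ONode \<psi> ts))"
  by (auto simp: nodes_def)

lemma src_tree:
  "opetope (Suc (Suc n)) \<omega> \<Longrightarrow> subtree \<omega> a = Some (ONode \<psi> ts) \<Longrightarrow> src \<omega> (Addr a) = \<psi>"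
  by (auto simp: src_def)

lemma mem_leaves: "Addr a \<in> leaves \<omega> \<longleftrightarrow> (\<exists>\<phi>. subtree \<omega> a = Some (OEdge \<phi>))"
  by (auto simp: leaves_def)

lemma subtree_snoc:
  "subtree \<omega> (a @ [q]) = Some c \<Longrightarrow> \<exists>\<psi> ts. subtree \<omega> a = Some (ONode \<psi> ts) \<and> fmlookup ts q = Some c"
proof -
  assume "subtree \<omega> (a @ [q]) = Some c"
  then obtain d where "subtree \<omega> a = Some d" "subtree d [q] = Some c"
    by (auto simp: subtree_append bind_eq_Some_conv)
  then show ?thesis by (cases d) (auto simp: bind_eq_Some_conv)
qed

text \<open>A leaf standing on a node takes its label from that node; hence an encoding by node
  labels loses nothing.\<close>

lemma subtree_leaf_label:
  assumes "opetope (Suc (Suc n)) \<omega>" "subtree \<omega> (a @ [q]) = Some (OEdge \<phi>)"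
  shows "\<exists>\<psi> ts. subtree \<omega> a = Some (ONode \<psi> ts) \<and> q \<in> nodes \<psi> \<and> \<phi> = src \<psi> q"
proof -
  obtain \<psi> ts where s: "subtree \<omega> a = Some (ONode \<psi> ts)" "fmlookup ts q = Some (OEdge \<phi>)"
    using subtree_snoc assms(2) by blast
  then have "opetope (Suc (Suc n)) (ONode \<psi> ts)" using subtree_opetope assms(1) by blast
  then have "root_edge (OEdge \<phi>) (src \<psi> q)" "q \<in> nodes \<psi>"
    using s(2) unfolding opetope_ONode_iff by (blast, metis fmdom'I)
  then show ?thesis using s(1) by simp
qed

section \<open>The preopetope of an opetope\<close>

text \<open>A structural recursion replacing \<open>encodes\<close>, whose rules follow an order of
  grafting. Branches enter with their input prefixed; a branch that is an edge contributes nothing,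
  since \<open>psrc\<close> of a \<open>PDegen\<close> is empty.\<close>

primrec popet_of :: "opet \<Rightarrow> popet" where
  "popet_of OPoint = PPoint"
| "popet_of OArrow = pcorolla PPoint"
| "popet_of (OEdge \<phi>) = PDegen (popet_of \<phi>)"
| "popet_of (ONode \<psi> ts) = PAssign (fmap_of_graph (insert (\<epsilon>, popet_of \<psi>)
     {(Addr [q] \<cdot> a, v) | q a v p. fmlookup (fmmap popet_of ts) q = Some p \<and> psrc p a = Some v}))"

lemma psrc_popet_of_ONode:
  "psrc (popet_of (ONode \<psi> ts)) a = Some v \<longleftrightarrow> (a = \<epsilon> \<and> v = popet_of \<psi>) \<or>
     (\<exists>q b c. a = Addr [q] \<cdot> b \<and> fmlookup ts q = Some c \<and> psrc (popet_of c) b = Some v)"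
proof -
  let ?T = "{(Addr [q] \<cdot> a, v) | q a v p. fmlookup (fmmap popet_of ts) q = Some p \<and> psrc p a = Some v}"
  have "?T \<subseteq> (\<lambda>(q, a). (Addr [q] \<cdot> a, the (psrc (the (fmlookup (fmmap popet_of ts) q)) a))) `
      (SIGMA q:fmdom' ts. pnodes (the (fmlookup (fmmap popet_of ts) q)))"
    by (force simp: mem_pnodes fmlookup_dom'_iff image_iff)
  then have "finite ?T" by (rule finite_subset) simp
  then have "finite (insert (\<epsilon>, popet_of \<psi>) ?T)" by simp
  moreover have "v = v'" if "(k, v) \<in> insert (\<epsilon>, popet_of \<psi>) ?T" "(k, v') \<in> insert (\<epsilon>, popet_of \<psi>) ?T" for k v v'
    using that by auto
  ultimately have "psrc (popet_of (ONode \<psi> ts)) a = Some v \<longleftrightarrow> (a, v) \<in> insert (\<epsilon>, popet_of \<psi>) ?T"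
    unfolding popet_of.simps psrc.simps by (rule fmap_of_graph_lookup)
  then show ?thesis by auto
qed

lemma psrc_popet_of_subtree:
  "opetope (Suc (Suc n)) \<omega> \<Longrightarrow> psrc (popet_of \<omega>) (Addr a) = Some v \<longleftrightarrow>
    (\<exists>\<psi> ts. subtree \<omega> a = Some (ONode \<psi> ts) \<and> v = popet_of \<psi>)"
proof (induction a arbitrary: \<omega>)
  case Nil
  show ?case
  proof (cases rule: opetope_tree_cases[OF Nil])
    case (2 \<psi> ts)
    then show ?thesis unfolding 2 psrc_popet_of_ONode by auto
  qed auto
next
  case (Cons q a)
  show ?case
  proof (cases rule: opetope_tree_cases[OF Cons.prems])
    case (2 \<psi> ts)
    have "psrc (popet_of \<omega>) (Addr (q # a)) = Some v \<longleftrightarrow>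
        (\<exists>c. fmlookup ts q = Some c \<and> psrc (popet_of c) (Addr a) = Some v)"
    proof -
      have "Addr (q # a) = Addr [q'] \<cdot> b \<longleftrightarrow> q' = q \<and> b = Addr a" for q' b
        by (cases b) auto
      then show ?thesis unfolding 2 psrc_popet_of_ONode by auto
    qed
    also have "\<dots> \<longleftrightarrow> (\<exists>c. fmlookup ts q = Some c \<and> (\<exists>\<psi> ts. subtree c a = Some (ONode \<psi> ts) \<and> v = popet_of \<psi>))"
      using Cons.IH Cons.prems unfolding 2 opetope_ONode_iff by blast
    finally show ?thesis unfolding 2 by (auto simp: bind_eq_Some_conv)
  qed auto
qed

lemma nodes_popet_of: "opetope n \<omega> \<Longrightarrow> nodes \<omega> = pnodes (popet_of \<omega>)"
proof -
  assume \<omega>: "opetope n \<omega>"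
  consider "n = 0" | "n = Suc 0" | k where "n = Suc (Suc k)" by (metis not0_implies_Suc)
  then show ?thesis
  proof cases
    case 1
    have "subtree OPoint a \<noteq> Some (ONode \<psi> ts)" for a \<psi> ts by (cases a) auto
    then show ?thesis using 1 \<omega> by (simp add: opetope_0_iff nodes_def)
  next
    case 2
    then show ?thesis using \<omega> by (simp add: opetope_1_iff nodes_def)
  next
    case (3 k)
    have "Addr a \<in> nodes \<omega> \<longleftrightarrow> Addr a \<in> pnodes (popet_of \<omega>)" for a
      unfolding mem_pnodes using mem_nodes_tree psrc_popet_of_subtree \<omega> 3 by blast
    then show ?thesis by (metis addr.exhaust set_eqI)
  qed
qed

lemma psrc_popet_of:
  assumes "opetope n \<omega>" "p \<in> nodes \<omega>"
  shows "psrc (popet_of \<omega>) p = Some (popet_of (src \<omega> p))"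
proof -
  have "n \<noteq> 0"
  proof
    assume "n = 0"
    then show False using assms nodes_popet_of[OF assms(1)] by (simp add: opetope_0_iff)
  qed
  then consider "n = Suc 0" | k where "n = Suc (Suc k)" by (metis not0_implies_Suc)
  then show ?thesis
  proof cases
    case 1
    then show ?thesis using assms by (simp add: opetope_1_iff nodes_def src_def)
  next
    case (2 k)
    obtain a where p: "p = Addr a" by (cases p)
    then obtain \<psi> ts where "subtree \<omega> a = Some (ONode \<psi> ts)"
      using mem_nodes_tree assms 2 by blast
    then show ?thesis using psrc_popet_of_subtree src_tree assms(1) 2 p by blast
  qed
qed

lemma src_opetope:
  assumes "opetope (Suc n) \<omega>" "p \<in> nodes \<omega>"
  shows "opetope n (src \<omega> p)"
proof (cases n)
  case 0
  then show ?thesis using assms by (simp add: opetope_1_iff src_def)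
next
  case (Suc k)
  obtain a where p: "p = Addr a" by (cases p)
  then obtain \<psi> ts where s: "subtree \<omega> a = Some (ONode \<psi> ts)"
    using mem_nodes_tree assms Suc by blast
  then have "opetope (Suc n) (ONode \<psi> ts)" using subtree_opetope assms(1) Suc by blast
  then show ?thesis using src_tree[OF _ s] assms(1) Suc p by (auto simp: opetope_ONode_iff)
qed

text \<open>A leaf of the code is an input of a node with no node on top. In the tree such an input
  carries some branch by the typing of children, and this branch can only be an edge.\<close>

lemma leaves_popet_of:
  assumes "opetope n \<omega>"
  shows "leaves \<omega> = pleaves (popet_of \<omega>)"
proof -
  consider "n = 0" | "n = Suc 0" | k where "n = Suc (Suc k)" by (metis not0_implies_Suc)
  then show ?thesis
  proof cases
    case 1
    have "subtree OPoint a \<noteq> Some (OEdge \<phi>)" for a \<phi> by (cases a) auto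
    then show ?thesis using 1 assms by (simp add: opetope_0_iff leaves_def)
  next
    case 2
    have "subtree OArrow a \<noteq> Some (OEdge \<phi>)" for a \<phi> by (cases a) auto
    then show ?thesis using 2 assms by (auto simp: opetope_1_iff leaves_def split: if_splits)
  next
    case (3 k)
    note \<omega> = assms[unfolded 3]
    from \<omega> show ?thesis
    proof (cases rule: opetope_tree_cases)
      case (1 \<phi>)
      then show ?thesis by (auto simp: leaves_def)
    next
      case (2 \<psi> ts)
      then obtain m where m: "popet_of \<omega> = PAssign m" by simp
      have "Addr a \<in> leaves \<omega> \<longleftrightarrow> Addr a \<in> pleaves (PAssign m)" for a
      proof
        assume "Addr a \<in> leaves \<omega>"
        then obtain \<phi> where \<phi>: "subtree \<omega> a = Some (OEdge \<phi>)" by (auto simp: mem_leaves)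
        then have "a \<noteq> []" using 2 by auto
        then obtain b q where b: "a = b @ [q]" by (metis rev_exhaust)
        then obtain \<chi> us where \<chi>: "subtree \<omega> b = Some (ONode \<chi> us)" "q \<in> nodes \<chi>"
          using subtree_leaf_label[OF \<omega>] \<phi> by blast
        have f: "fmlookup m (Addr b) = Some (popet_of \<chi>)"
          using psrc_popet_of_subtree[OF \<omega>, of b] \<chi> m by auto
        have "opetope (Suc k) \<chi>" using subtree_opetope[OF \<omega> \<chi>(1)] by (auto simp: opetope_ONode_iff)
        then have "q \<in> pnodes (popet_of \<chi>)" using nodes_popet_of \<chi>(2) by blast
        moreover have "Addr b \<cdot> Addr [q] \<notin> fmdom' m"
          using psrc_popet_of_subtree[OF \<omega>, of a] \<phi> m b by (auto simp: fmlookup_dom'_iff)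
        ultimately show "Addr a \<in> pleaves (PAssign m)"
          using pleavesI[OF f, of q] b by simp
      next
        assume "Addr a \<in> pleaves (PAssign m)"
        then obtain p q f where p: "Addr a = p \<cdot> Addr [q]" "fmlookup m p = Some f" "q \<in> pnodes f" "Addr a \<notin> fmdom' m"
          by auto
        obtain b where b: "p = Addr b" by (cases p)
        then obtain \<chi> us where \<chi>: "subtree \<omega> b = Some (ONode \<chi> us)" "f = popet_of \<chi>"
          using psrc_popet_of_subtree[OF \<omega>, of b] p(2) m by auto
        have o: "opetope (Suc (Suc k)) (ONode \<chi> us)" using subtree_opetope[OF \<omega> \<chi>(1)] .
        then have "q \<in> fmdom' us" using nodes_popet_of \<chi>(2) p(3) unfolding opetope_ONode_iff by blast
        then obtain c where c: "fmlookup us q = Some c" by (auto simp: fmlookup_dom'_iff)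
        then have sub: "subtree \<omega> a = Some c" using \<chi>(1) p(1) b by (simp add: subtree_append)
        have "opetope (Suc (Suc k)) c" using o c unfolding opetope_ONode_iff by blast
        then show "Addr a \<in> leaves \<omega>"
        proof (cases rule: opetope_tree_cases)
          case (1 \<phi>)
          then show ?thesis using sub by (auto simp: mem_leaves)
        next
          case (2 \<xi> vs)
          then have "psrc (popet_of \<omega>) (Addr a) = Some (popet_of \<xi>)"
            using psrc_popet_of_subtree[OF \<omega>, of a] sub by auto
          then show ?thesis using p(4) m by (auto dest: fmdom'I)
        qed
      qed
      then show ?thesis unfolding m by (metis addr.exhaust set_eqI)
    qed
  qed
qed

text \<open>The labels of edges standing on a node are prescribed by that node, so nodes and their
  labels determine the tree; for a tree that is a single edge the label is kept by
  \<open>PDegen\<close>.\<close>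

lemma popet_of_inject: "opetope n \<omega> \<Longrightarrow> opetope m \<omega>' \<Longrightarrow> popet_of \<omega> = popet_of \<omega>' \<Longrightarrow> \<omega> = \<omega>'"
proof (induction \<omega> arbitrary: n m \<omega>')
  case OPoint
  then show ?case by (cases \<omega>') auto
next
  case OArrow
  show ?case
  proof (cases \<omega>')
    \<comment> \<open>A node labelled by the point would have the same code as
      \<open>OArrow\<close>; it is excluded because node labels have positive dimension.\<close>
    case (ONode \<psi> ts)
    have "psrc (popet_of (ONode \<psi> ts)) \<epsilon> = Some PPoint" using OArrow ONode by (metis popet_of.simps(2) fmupd_lookup psrc.simps(1))
    then have "popet_of \<psi> = PPoint" unfolding psrc_popet_of_ONode by auto
    then have "\<psi> = OPoint" by (cases \<psi>) auto
    then show ?thesis using OArrow(2) ONode by (auto simp: opetope_ONode_iff)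
  qed (use OArrow in auto)
next
  case (OEdge \<phi>)
  then show ?case by (cases \<omega>') (auto simp: opetope_OEdge_iff)
next
  case (ONode \<psi> ts)
  have psi: "opetope (n - 1) \<psi>" using ONode.prems(1) by (auto simp: opetope_ONode_iff)
  have eps: "psrc (popet_of (ONode \<psi> ts)) \<epsilon> = Some (popet_of \<psi>)" unfolding psrc_popet_of_ONode by simp
  show ?case
  proof (cases \<omega>')
    case OArrow
    then have "popet_of \<psi> = PPoint" using eps ONode.prems(3) by simp
    then have "\<psi> = OPoint" using ONode.IH(1)[OF psi, of 0 OPoint] by simp
    then show ?thesis using ONode.prems(1) by (auto simp: opetope_ONode_iff)
  next
    case \<omega>': (ONode \<psi>' ts')
    have "opetope (m - 1) \<psi>'" using ONode.prems(2) \<omega>' by (auto simp: opetope_ONode_iff)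
    moreover have "popet_of \<psi> = popet_of \<psi>'"
      using eps unfolding ONode.prems(3) \<omega>' psrc_popet_of_ONode by simp
    ultimately have \<psi>: "\<psi>' = \<psi>" using ONode.IH(1)[OF psi] by blast
    have src: "psrc (popet_of c) b = Some v \<longleftrightarrow> psrc (popet_of c') b = Some v"
      if "fmlookup ts q = Some c" "fmlookup ts' q = Some c'" for q c c' b v
    proof -
      have "psrc (popet_of c) b = Some v \<longleftrightarrow> psrc (popet_of (ONode \<psi> ts)) (Addr [q] \<cdot> b) = Some v"
        unfolding psrc_popet_of_ONode using that by auto
      also have "\<dots> \<longleftrightarrow> psrc (popet_of c') b = Some v"
        unfolding ONode.prems(3) \<omega>' psrc_popet_of_ONode using that by auto
      finally show ?thesis .
    qed
    obtain k j where n: "n = Suc (Suc k)" "m = Suc (Suc j)"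
      using ONode.prems(1,2) unfolding \<omega>' opetope_ONode_iff by blast
    have "fmlookup ts q = fmlookup ts' q" for q
    proof (cases "q \<in> nodes \<psi>")
      case True
      then obtain c c' where c: "fmlookup ts q = Some c" "fmlookup ts' q = Some c'"
        using ONode.prems(1,2) unfolding \<omega>' \<psi> opetope_ONode_iff by (metis fmlookup_dom'_iff)
      have o: "opetope n c" "root_edge c (src \<psi> q)" "opetope m c'" "root_edge c' (src \<psi> q)"
        using ONode.prems(1,2) c unfolding \<omega>' \<psi> opetope_ONode_iff by blast+
      \<comment> \<open>Branches with nodes agree by the induction hypothesis; two bare edges agree
        because both carry the label \<open>src \<psi> q\<close>.\<close>
      have "c = c'"
      proof (cases "\<exists>\<chi> us. c = ONode \<chi> us")
        case True
        then obtain \<chi> us where \<chi>: "c = ONode \<chi> us" by blast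
        then have "psrc (popet_of c) \<epsilon> \<noteq> None" using psrc_popet_of_ONode by auto
        then have "psrc (popet_of c') \<epsilon> \<noteq> None" using src[OF c] by (metis option.exhaust)
        then obtain \<chi>' us' where "c' = ONode \<chi>' us'" using o(3) n(2) by (cases c') auto
        then have "popet_of c = popet_of c'"
          using popet_eqI[OF src[OF c]] \<chi> by auto
        then show ?thesis using ONode.IH(2)[of c n m c'] o c(1) by (auto intro: fmran'I)
      next
        case False
        then obtain \<phi> where \<phi>: "c = OEdge \<phi>" using o(1) n(1) by (cases c) auto
        have "c' \<noteq> ONode \<chi> us" for \<chi> us
          using src[OF c, of \<epsilon> "popet_of \<chi>"] \<phi> psrc_popet_of_ONode[of \<chi> us \<epsilon>] by auto
        then obtain \<phi>' where "c' = OEdge \<phi>'" using o(3) n(2) by (cases c') auto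
        then show ?thesis using o(2,4) \<phi> by simp
      qed
      then show ?thesis using c by simp
    next
      case False
      then show ?thesis
        using ONode.prems(1,2) unfolding \<omega>' \<psi> opetope_ONode_iff by (metis fmdom'_notD)
    qed
    then show ?thesis using \<omega>' \<psi> by (auto intro: fmap_ext)
  qed (use ONode.prems in auto)
qed

section \<open>Grafting and gluing of trees\<close>

lemma plug_same: "subtree \<omega> l = Some c \<Longrightarrow> plug \<omega> l c = \<omega>"
proof (induction \<omega> l rule: subtree.induct)
  case (2 \<psi> ts q a)
  then obtain d where "fmlookup ts q = Some d" "subtree d a = Some c" by (auto simp: bind_eq_Some_conv)
  moreover from this have "plug d a c = d" using 2 by simp
  moreover from this calculation have "fmupd q d ts = ts" by (intro fmap_ext) auto
  ultimately show ?case by simp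
qed auto

lemma plug_plug: "subtree \<omega> l = Some c \<Longrightarrow> plug (plug \<omega> l X) (l @ a) Y = plug \<omega> l (plug X a Y)"
proof (induction \<omega> l rule: subtree.induct)
  case (2 \<psi> ts q b)
  then obtain d where d: "fmlookup ts q = Some d" "subtree d b = Some c" by (auto simp: bind_eq_Some_conv)
  then have "plug (plug d b X) (b @ a) Y = plug d b (plug X a Y)" using 2 by simp
  then show ?case using d(1) by (auto intro: fmap_ext)
qed auto

lemma subtree_plug: "subtree \<omega> l = Some c \<Longrightarrow> subtree (plug \<omega> l X) (l @ a) = subtree X a"
proof (induction \<omega> l rule: subtree.induct)
  case (2 \<psi> ts q b)
  then obtain d where d: "fmlookup ts q = Some d" "subtree d b = Some c" by (auto simp: bind_eq_Some_conv)
  then have "subtree (plug d b X) (b @ a) = subtree X a" using 2 by simp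
  then show ?case using d(1) by simp
qed auto

text \<open>Only the label \<open>\<chi>\<close> is preserved in this form: the nodes below
  \<open>l\<close> keep their labels, but their branches change.\<close>

lemma subtree_plug_outside:
  "\<forall>z. b \<noteq> l @ z \<Longrightarrow> (\<exists>us. subtree (plug \<omega> l X) b = Some (ONode \<chi> us)) \<longleftrightarrow> (\<exists>us. subtree \<omega> b = Some (ONode \<chi> us))"
proof (induction \<omega> l arbitrary: b rule: subtree.induct)
  case (2 \<psi> ts q a)
  show ?case
  proof (cases "fmlookup ts q")
    case (Some d)
    show ?thesis
    proof (cases b)
      case Nil
      then show ?thesis using Some by auto
    next
      case (Cons q' b')
      show ?thesis
      proof (cases "q' = q")
        case True
        then have "\<forall>z. b' \<noteq> a @ z" using 2(2) Cons by auto
        then show ?thesis using 2(1)[OF Some] Some Cons True by simp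
      next
        case False
        then show ?thesis using Some Cons by simp
      qed
    qed
  qed simp
qed auto

lemma plug_ONode:
  "l \<noteq> [] \<Longrightarrow> \<exists>ts'. plug (ONode \<psi> ts) l X = ONode \<psi> ts'"
  by (cases l) (auto split: option.split)

text \<open>The node below the replaced subtree checks nothing but the root edge, so it suffices
  that \<open>X\<close> has every root edge that \<open>c\<close> has.\<close>

lemma plug_opetope:
  "opetope (Suc (Suc n)) \<omega> \<Longrightarrow> subtree \<omega> l = Some c \<Longrightarrow> opetope (Suc (Suc n)) X \<Longrightarrow>
    (\<And>x. root_edge c x \<Longrightarrow> root_edge X x) \<Longrightarrow>
    opetope (Suc (Suc n)) (plug \<omega> l X) \<and> (\<forall>x. root_edge \<omega> x \<longrightarrow> root_edge (plug \<omega> l X) x)"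
proof (induction l arbitrary: \<omega>)
  case (Cons q l)
  show ?case
  proof (cases rule: opetope_tree_cases[OF Cons.prems(1)])
    case (2 \<psi> ts)
    then obtain d where d: "fmlookup ts q = Some d" "subtree d l = Some c"
      using Cons.prems(2) by (auto simp: bind_eq_Some_conv)
    have o: "opetope (Suc n) \<psi>" "fmdom' ts = nodes \<psi>"
      "\<And>q c. fmlookup ts q = Some c \<Longrightarrow> opetope (Suc (Suc n)) c \<and> root_edge c (src \<psi> q)"
      using Cons.prems(1) unfolding 2 opetope_ONode_iff by auto
    have IH: "opetope (Suc (Suc n)) (plug d l X)" "root_edge (plug d l X) (src \<psi> q)"
      using Cons.IH[of d] o(3)[OF d(1)] d(2) Cons.prems(3,4) by blast+
    have "opetope (Suc (Suc n)) (ONode \<psi> (fmupd q (plug d l X) ts))"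
      unfolding opetope_ONode_iff using o IH fmdom'I[OF d(1)] by auto
    then show ?thesis unfolding 2 using d(1) by (simp add: root_edge_ONode_iff)
  qed (use Cons.prems in auto)
qed auto

section \<open>Corollas and their grafting\<close>

lemma fmlookup_fmap_of_set:
  assumes "finite A"
  shows "fmlookup (fmap_of_graph {(q, f q) | q. q \<in> A}) q = (if q \<in> A then Some (f q) else None)"
proof -
  have "fmlookup (fmap_of_graph {(q, f q) | q. q \<in> A}) q = Some v \<longleftrightarrow> (q, v) \<in> {(q, f q) | q. q \<in> A}" for v
    using assms by (intro fmap_of_graph_lookup) auto
  then show ?thesis by (cases "fmlookup (fmap_of_graph {(q, f q) | q. q \<in> A}) q") auto
qed

lemma finite_nodes: "opetope n \<psi> \<Longrightarrow> finite (nodes \<psi>)"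
  using nodes_popet_of by simp

lemma corolla_opetope:
  assumes "opetope (Suc n) \<psi>"
  shows "opetope (Suc (Suc n)) (corolla \<psi>)"
proof -
  note lookup = fmlookup_fmap_of_set[OF finite_nodes[OF assms], of "\<lambda>q. OEdge (src \<psi> q)"]
  have "opetope (Suc (Suc n)) (OEdge (src \<psi> q))" if "q \<in> nodes \<psi>" for q
    using src_opetope[OF assms that] by (simp add: opetope_OEdge_iff)
  then show ?thesis
    unfolding corolla_def opetope_ONode_iff using assms lookup
    by (auto simp: fmlookup_dom'_iff split: if_splits)
qed

lemma corolla_ONode: "\<exists>ts. corolla \<psi> = ONode \<psi> ts"
  by (simp add: corolla_def)

lemma root_edge_corolla: "root_edge (corolla \<psi>) x \<longleftrightarrow> (\<exists>V. target \<psi> x V)"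
  by (simp add: corolla_def root_edge_ONode_iff)

lemma subtree_corolla:
  assumes "opetope n \<psi>"
  shows "subtree (corolla \<psi>) a = Some (ONode \<chi> us) \<longleftrightarrow> a = [] \<and> ONode \<chi> us = corolla \<psi>"
proof (cases a)
  case (Cons q b)
  then show ?thesis
    using fmlookup_fmap_of_set[OF finite_nodes[OF assms], of "\<lambda>q. OEdge (src \<psi> q)" q]
    by (auto simp: corolla_def bind_eq_Some_conv split: if_splits)
qed (auto simp: corolla_def)

lemma popet_of_corolla:
  assumes "opetope (Suc n) \<psi>"
  shows "popet_of (corolla \<psi>) = pcorolla (popet_of \<psi>)"
proof -
  obtain m where m: "popet_of (corolla \<psi>) = PAssign m" by (simp add: corolla_def)
  have "psrc (popet_of (corolla \<psi>)) a = Some v \<longleftrightarrow> psrc (pcorolla (popet_of \<psi>)) a = Some v" for a v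
  proof -
    obtain l where a: "a = Addr l" by (cases a)
    have "ONode \<chi> us = corolla \<psi> \<longleftrightarrow> \<chi> = \<psi> \<and> ONode \<psi> us = corolla \<psi>" for \<chi> us
      by (auto simp: corolla_def)
    then have "psrc (popet_of (corolla \<psi>)) a = Some v \<longleftrightarrow> l = [] \<and> v = popet_of \<psi>"
      unfolding a psrc_popet_of_subtree[OF corolla_opetope[OF assms]] subtree_corolla[OF assms]
      using corolla_ONode[of \<psi>] by metis
    then show ?thesis using a by auto
  qed
  then show ?thesis using popet_eqI[OF _ m refl] by blast
qed

text \<open>Edges contribute no entries to the code, so of the grafted corolla only its node at
  \<open>l\<close> is seen.\<close>

lemma popet_of_graft:
  assumes \<nu>: "opetope (Suc (Suc n)) \<nu>" "popet_of \<nu> = PAssign m" and l: "subtree \<nu> l = Some (OEdge \<phi>)"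
    and \<psi>: "opetope (Suc n) \<psi>" and p: "opetope (Suc (Suc n)) (plug \<nu> l (corolla \<psi>))"
  shows "popet_of (plug \<nu> l (corolla \<psi>)) = PAssign (fmupd (Addr l) (popet_of \<psi>) m)"
proof -
  obtain \<chi> us where "\<nu> = ONode \<chi> us"
    using \<nu> by (cases rule: opetope_tree_cases[OF \<nu>(1)]) auto
  moreover from this have "l \<noteq> []" using l by auto
  ultimately obtain ts' where "plug \<nu> l (corolla \<psi>) = ONode \<chi> ts'" using plug_ONode by metis
  then obtain m' where m': "popet_of (plug \<nu> l (corolla \<psi>)) = PAssign m'" by simp
  have eq: "psrc (popet_of (plug \<nu> l (corolla \<psi>))) a = Some v \<longleftrightarrow>
      psrc (PAssign (fmupd (Addr l) (popet_of \<psi>) m)) a = Some v" for a v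
  proof -
    obtain b where a: "a = Addr b" by (cases a)
    have L: "psrc (popet_of (plug \<nu> l (corolla \<psi>))) a = Some v \<longleftrightarrow>
        (\<exists>\<chi> us. subtree (plug \<nu> l (corolla \<psi>)) b = Some (ONode \<chi> us) \<and> v = popet_of \<chi>)"
      unfolding a using psrc_popet_of_subtree[OF p] .
    have R: "fmlookup m (Addr b) = Some v \<longleftrightarrow> (\<exists>\<chi> us. subtree \<nu> b = Some (ONode \<chi> us) \<and> v = popet_of \<chi>)"
      using psrc_popet_of_subtree[OF \<nu>(1), of b v] \<nu>(2) by simp
    show ?thesis
    proof (cases "\<exists>z. b = l @ z")
      case True
      then obtain z where z: "b = l @ z" by blast
      have "psrc (popet_of (plug \<nu> l (corolla \<psi>))) a = Some v \<longleftrightarrow> z = [] \<and> v = popet_of \<psi>"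
        unfolding L z subtree_plug[OF l] subtree_corolla[OF \<psi>] using corolla_ONode[of \<psi>]
        by (metis opet.inject(2))
      moreover have "fmlookup m (Addr b) \<noteq> Some v" if "z \<noteq> []"
      proof -
        have "subtree \<nu> b \<noteq> Some (ONode \<chi> us)" for \<chi> us
          using that unfolding z subtree_append l by simp
        then show ?thesis using R by blast
      qed
      ultimately show ?thesis using a z by auto
    next
      case False
      then show ?thesis unfolding L using subtree_plug_outside[of b l \<nu> "corolla \<psi>"] R a by auto
    qed
  qed
  show ?thesis using popet_eqI[OF eq m' refl] .
qed

text \<open>Opetopes are generated by grafting corollas: a tree is filled in branch by branch.\<close>

lemma graft_branches:
  assumes \<psi>: "opetope (Suc n) \<psi>" and c: "opetope (Suc (Suc n)) (ONode \<psi> ts)"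
    and K: "subtree K l = Some d"
    and K_op: "\<And>us. opetope (Suc (Suc n)) (ONode \<psi> us) \<Longrightarrow>
       opetope (Suc (Suc n)) (plug K l (ONode \<psi> us)) \<and> (\<exists>\<chi> vs. plug K l (ONode \<psi> us) = ONode \<chi> vs)"
    and base: "Q (plug K l (corolla \<psi>))"
    and step: "\<And>q b \<nu> l. fmlookup ts q = Some b \<Longrightarrow> opetope (Suc (Suc n)) \<nu> \<Longrightarrow> \<exists>\<chi> vs. \<nu> = ONode \<chi> vs \<Longrightarrow>
       Q \<nu> \<Longrightarrow> subtree \<nu> l = Some (OEdge (src \<psi> q)) \<Longrightarrow> Q (plug \<nu> l b)"
  shows "Q (plug K l (ONode \<psi> ts))"
proof -
  have fin: "finite (nodes \<psi>)" using finite_nodes[OF \<psi>] .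
  have ts: "fmdom' ts = nodes \<psi>"
    "\<And>q c. fmlookup ts q = Some c \<Longrightarrow> opetope (Suc (Suc n)) c \<and> root_edge c (src \<psi> q)"
    using c unfolding opetope_ONode_iff by blast+
  \<comment> \<open>Inputs in \<open>S\<close> already carry their branch from \<open>ts\<close>,
    the others a bare edge. \<open>S\<close> grows from the empty set, which gives the corolla, to
    all inputs.\<close>
  define fill where "fill S = fmap_of_graph {(q, if q \<in> S then the (fmlookup ts q) else OEdge (src \<psi> q)) | q. q \<in> nodes \<psi>}" for S
  have lookup: "fmlookup (fill S) q =
      (if q \<in> nodes \<psi> then Some (if q \<in> S then the (fmlookup ts q) else OEdge (src \<psi> q)) else None)" for S q
    unfolding fill_def by (rule fmlookup_fmap_of_set[OF fin])
  have op: "opetope (Suc (Suc n)) (ONode \<psi> (fill S))" for S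
  proof -
    have "opetope (Suc (Suc n)) (OEdge (src \<psi> q))" if "q \<in> nodes \<psi>" for q
      using src_opetope[OF \<psi> that] by (simp add: opetope_OEdge_iff)
    moreover have "fmlookup ts q = Some (the (fmlookup ts q))" if "q \<in> nodes \<psi>" for q
      using that unfolding ts(1)[symmetric] fmlookup_dom'_iff by auto
    ultimately show ?thesis
      unfolding opetope_ONode_iff using \<psi> ts(2) lookup
      by (auto simp: fmlookup_dom'_iff split: if_splits)
  qed
  have "Q (plug K l (ONode \<psi> (fill S)))" if "finite S" "S \<subseteq> nodes \<psi>" for S
    using that
  proof (induction S rule: finite_induct)
    case empty
    have "ONode \<psi> (fill {}) = corolla \<psi>" unfolding corolla_def fill_def by simp
    then show ?case using base by simp
  next
    case (insert q S)
    then have q: "q \<in> nodes \<psi>" by simp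
    then obtain b where b: "fmlookup ts q = Some b" using ts(1) by (metis fmlookup_dom'_iff)
    let ?\<nu> = "plug K l (ONode \<psi> (fill S))"
    have "subtree ?\<nu> (l @ [q]) = Some (OEdge (src \<psi> q))"
      unfolding subtree_plug[OF K] using lookup q insert by simp
    then have "Q (plug ?\<nu> (l @ [q]) b)" using step[OF b] K_op[OF op] insert by simp
    moreover have "plug ?\<nu> (l @ [q]) b = plug K l (ONode \<psi> (fill (insert q S)))"
    proof -
      have "fmupd q b (fill S) = fill (insert q S)"
        by (rule fmap_ext) (use lookup q b in auto)
      then show ?thesis unfolding plug_plug[OF K] using lookup q by simp
    qed
    ultimately show ?case by simp
  qed
  moreover have "fill (nodes \<psi>) = ts"
  proof (rule fmap_ext)
    fix q show "fmlookup (fill (nodes \<psi>)) q = fmlookup ts q"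
      using lookup ts(1) by (cases "fmlookup ts q") (auto simp: fmlookup_dom'_iff dest: fmdom'_notI)
  qed
  ultimately show ?thesis using fin by auto
qed

text \<open>The graft case provides the tree-theoretic premises of \<open>target_graft\<close>, so
  that targets and sequents can be constructed along this induction.\<close>

lemma opetope_graft_induct [consumes 1, case_names edge corolla graft]:
  assumes "opetope (Suc (Suc n)) \<omega>"
    and edge: "\<And>\<phi>. opetope n \<phi> \<Longrightarrow> Q (OEdge \<phi>)"
    and cor: "\<And>\<psi>. opetope (Suc n) \<psi> \<Longrightarrow> Q (corolla \<psi>)"
    and graft: "\<And>\<nu> \<chi> ts l \<psi> \<phi> V. opetope (Suc (Suc n)) \<nu> \<Longrightarrow> \<nu> = ONode \<chi> ts \<Longrightarrow> Q \<nu> \<Longrightarrow>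
      subtree \<nu> l = Some (OEdge \<phi>) \<Longrightarrow> opetope (Suc n) \<psi> \<Longrightarrow> target \<psi> \<phi> V \<Longrightarrow>
      opetope (Suc (Suc n)) (plug \<nu> l (corolla \<psi>)) \<Longrightarrow> Q (plug \<nu> l (corolla \<psi>))"
  shows "Q \<omega>"
proof -
  \<comment> \<open>Generalized over the tree \<open>\<nu>\<close> under construction: a branch
    \<open>c\<close> is grafted on it corolla by corolla, by induction on \<open>c\<close>.\<close>
  have branch: "opetope (Suc (Suc n)) c \<Longrightarrow> root_edge c \<phi> \<Longrightarrow> opetope (Suc (Suc n)) \<nu> \<Longrightarrow>
      \<exists>\<chi> vs. \<nu> = ONode \<chi> vs \<Longrightarrow> Q \<nu> \<Longrightarrow> subtree \<nu> l = Some (OEdge \<phi>) \<Longrightarrow> Q (plug \<nu> l c)" for c \<phi> \<nu> l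
  proof (induction c arbitrary: \<phi> \<nu> l)
    case (OEdge \<phi>')
    then show ?case using plug_same by simp
  next
    case (ONode \<psi> ts)
    obtain V where V: "target \<psi> \<phi> V" using ONode.prems(2) root_edge_ONode_iff by blast
    have \<psi>: "opetope (Suc n) \<psi>" using ONode.prems(1) unfolding opetope_ONode_iff by auto
    have re: "root_edge (ONode \<psi> us) \<phi>" for us using V root_edge_ONode_iff by blast
    show ?case
    proof (rule graft_branches[OF \<psi> ONode.prems(1) ONode.prems(6)])
      fix us assume us: "opetope (Suc (Suc n)) (ONode \<psi> us)"
      obtain \<chi> vs where \<nu>: "\<nu> = ONode \<chi> vs" using ONode.prems(4) by blast
      then have l: "l \<noteq> []" using ONode.prems(6) by auto
      have "\<exists>ts'. plug \<nu> l (ONode \<psi> us) = ONode \<chi> ts'" unfolding \<nu> using l by (rule plug_ONode)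
      moreover have "opetope (Suc (Suc n)) (plug \<nu> l (ONode \<psi> us))"
        using plug_opetope[OF ONode.prems(3,6) us] re by simp
      ultimately show "opetope (Suc (Suc n)) (plug \<nu> l (ONode \<psi> us)) \<and>
          (\<exists>\<chi> vs. plug \<nu> l (ONode \<psi> us) = ONode \<chi> vs)" by blast
    next
      have "opetope (Suc (Suc n)) (plug \<nu> l (corolla \<psi>))"
        using plug_opetope[OF ONode.prems(3,6) corolla_opetope[OF \<psi>]] V root_edge_corolla by auto
      then show "Q (plug \<nu> l (corolla \<psi>))"
        using graft ONode.prems \<psi> V by blast
    next
      fix q b \<nu>' l'
      assume b: "fmlookup ts q = Some b" and \<nu>': "opetope (Suc (Suc n)) \<nu>'" "\<exists>\<chi> vs. \<nu>' = ONode \<chi> vs"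
        "Q \<nu>'" "subtree \<nu>' l' = Some (OEdge (src \<psi> q))"
      have "b \<in> fmran' ts" using b by (rule fmran'I)
      moreover have "opetope (Suc (Suc n)) b" "root_edge b (src \<psi> q)"
        using ONode.prems(1) b unfolding opetope_ONode_iff by blast+
      ultimately show "Q (plug \<nu>' l' b)" using ONode.IH(2) \<nu>' by blast
    qed
  qed auto
  show ?thesis
  proof (cases rule: opetope_tree_cases[OF assms(1)])
    case (1 \<phi>)
    then show ?thesis using edge assms(1) by (auto simp: opetope_OEdge_iff)
  next
    case (2 \<psi> ts)
    have o: "opetope (Suc (Suc n)) (ONode \<psi> ts)" using assms(1) 2 by simp
    then have \<psi>: "opetope (Suc n) \<psi>" unfolding opetope_ONode_iff by auto
    \<comment> \<open>\<open>plug\<close> at the empty address discards its first argument;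
      \<open>OPoint\<close> only fills the place.\<close>
    have "Q (plug OPoint [] (ONode \<psi> ts))"
    proof (rule graft_branches[OF \<psi> o])
      fix q b \<nu>' l'
      assume "fmlookup ts q = Some b" and \<nu>': "opetope (Suc (Suc n)) \<nu>'" "\<exists>\<chi> vs. \<nu>' = ONode \<chi> vs"
        "Q \<nu>'" "subtree \<nu>' l' = Some (OEdge (src \<psi> q))"
      then have "opetope (Suc (Suc n)) b" "root_edge b (src \<psi> q)"
        using o unfolding opetope_ONode_iff by blast+
      then show "Q (plug \<nu>' l' b)" using branch \<nu>' by blast
    qed (use cor[OF \<psi>] in auto)
    then show ?thesis using 2 by simp
  qed
qed

section \<open>Gluing trees on the leaves of a tree\<close>

lemma glue_ONode_lookup:
  "\<exists>us. glue (ONode \<psi> ts) f = ONode \<psi> us \<and>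
    (\<forall>q. fmlookup us q = map_option (\<lambda>c. glue c (\<lambda>a. f (q # a))) (fmlookup ts q))"
  by (simp add: option.map_comp comp_def)

lemma subtree_glue_node:
  "subtree \<psi> a = Some (ONode \<chi> us) \<Longrightarrow> \<exists>us'. subtree (glue \<psi> f) a = Some (ONode \<chi> us')"
proof (induction \<psi> a arbitrary: f rule: subtree.induct)
  case (1 \<omega>)
  then show ?case by simp
next
  case (2 \<psi> ts q a)
  then obtain c where c: "fmlookup ts q = Some c" "subtree c a = Some (ONode \<chi> us)" by (auto simp: bind_eq_Some_conv)
  then show ?case using 2(1)[OF c] by simp
qed auto

lemma subtree_glue_leaf:
  "subtree \<psi> k = Some (OEdge \<phi>) \<Longrightarrow> subtree (glue \<psi> f) (k @ a) = subtree (f k) a"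
proof (induction \<psi> k arbitrary: f rule: subtree.induct)
  case (2 \<psi> ts q b)
  then obtain c where c: "fmlookup ts q = Some c" "subtree c b = Some (OEdge \<phi>)" by (auto simp: bind_eq_Some_conv)
  then show ?case using 2(1)[OF c] by simp
qed auto

lemma subtree_glue_cases:
  assumes "opetope (Suc (Suc n)) \<psi>" "subtree (glue \<psi> f) a = Some (ONode \<chi> us)"
  shows "(\<exists>us'. subtree \<psi> a = Some (ONode \<chi> us')) \<or>
    (\<exists>k \<phi> b. a = k @ b \<and> subtree \<psi> k = Some (OEdge \<phi>) \<and> subtree (f k) b = Some (ONode \<chi> us))"
  using assms
proof (induction \<psi> arbitrary: a f rule: opet.induct)
  case OPoint
  then show ?case by simp
next
  case OArrow
  then show ?case by simp
next
  case (OEdge \<phi>)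
  then show ?case by auto
next
  case (ONode \<psi> ts)
  show ?case
  proof (cases a)
    case Nil
    then show ?thesis using ONode.prems(2) by simp
  next
    case (Cons q a')
    then obtain c where c: "fmlookup ts q = Some c"
      "subtree (glue c (\<lambda>a. f (q # a))) a' = Some (ONode \<chi> us)"
      using ONode.prems(2) by (auto simp: bind_eq_Some_conv)
    have "opetope (Suc (Suc n)) c" using ONode.prems(1) c(1) unfolding opetope_ONode_iff by blast
    from ONode.IH(2)[OF fmran'I[OF c(1)] this c(2)] show ?thesis
    proof (elim disjE exE conjE)
      fix us' assume "subtree c a' = Some (ONode \<chi> us')"
      then show ?thesis using c(1) Cons by simp
    next
      fix k \<phi> b assume k: "a' = k @ b" "subtree c k = Some (OEdge \<phi>)" "subtree (f (q # k)) b = Some (ONode \<chi> us)"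
      have "a = (q # k) @ b" "subtree (ONode \<psi> ts) (q # k) = Some (OEdge \<phi>)" using k c(1) Cons by simp_all
      then show ?thesis using k(3) by blast
    qed
  qed
qed

lemma glue_opetope:
  "opetope (Suc (Suc n)) \<psi> \<Longrightarrow>
    (\<And>k \<phi>. subtree \<psi> k = Some (OEdge \<phi>) \<Longrightarrow> opetope (Suc (Suc n)) (f k) \<and> root_edge (f k) \<phi>) \<Longrightarrow>
    opetope (Suc (Suc n)) (glue \<psi> f) \<and> (\<forall>x. root_edge \<psi> x \<longrightarrow> root_edge (glue \<psi> f) x)"
proof (induction \<psi> arbitrary: f)
  case (ONode \<psi> ts)
  have o: "opetope (Suc n) \<psi>" "fmdom' ts = nodes \<psi>"
    "\<And>q c. fmlookup ts q = Some c \<Longrightarrow> opetope (Suc (Suc n)) c \<and> root_edge c (src \<psi> q)"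
    using ONode.prems(1) unfolding opetope_ONode_iff by auto
  obtain us where us: "glue (ONode \<psi> ts) f = ONode \<psi> us"
    "\<And>q. fmlookup us q = map_option (\<lambda>c. glue c (\<lambda>a. f (q # a))) (fmlookup ts q)"
    using glue_ONode_lookup by metis
  have "opetope (Suc (Suc n)) d \<and> root_edge d (src \<psi> q)" if d: "fmlookup us q = Some d" for q d
  proof -
    obtain c where c: "fmlookup ts q = Some c" "d = glue c (\<lambda>a. f (q # a))"
      using d unfolding us(2) by auto
    have "opetope (Suc (Suc n)) (f (q # k)) \<and> root_edge (f (q # k)) \<phi>" if "subtree c k = Some (OEdge \<phi>)" for k \<phi>
      using ONode.prems(2)[of "q # k" \<phi>] that c(1) by simp
    then show ?thesis
      unfolding c(2) using ONode.IH(2)[OF fmran'I[OF c(1)], of "\<lambda>a. f (q # a)"] o(3)[OF c(1)] by blast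
  qed
  moreover have "fmdom' us = nodes \<psi>"
    unfolding o(2)[symmetric] by (auto simp: fmlookup_dom'_iff us(2))
  ultimately have "opetope (Suc (Suc n)) (ONode \<psi> us)" unfolding opetope_ONode_iff using o(1) by blast
  then show ?case unfolding us(1) by (simp add: root_edge_ONode_iff)
qed auto

section \<open>Targets of opetopes\<close>

text \<open>That the code of an opetope is a preopetope at all follows later from its derivability;
  what is fixed here is the only dimension it can have.\<close>

lemma opetope_popet_dim: "opetope n \<omega> \<Longrightarrow> preopetope j (popet_of \<omega>) \<Longrightarrow> j = n"
proof (induction \<omega> arbitrary: n j rule: opet.induct)
  case OArrow
  then show ?case using preopetope_src[of j "pcorolla PPoint" \<epsilon> PPoint] by auto
next
  case (OEdge \<phi>)
  then obtain k j' where "n = Suc (Suc k)" "opetope k \<phi>" "j = Suc (Suc j')" "preopetope j' (popet_of \<phi>)"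
    unfolding opetope_OEdge_iff popet_of.simps preopetope_PDegen_iff by blast
  then show ?case using OEdge.IH by simp
next
  case (ONode \<psi> ts)
  then obtain k where k: "n = Suc (Suc k)" "opetope (Suc k) \<psi>" unfolding opetope_ONode_iff by blast
  have "psrc (popet_of (ONode \<psi> ts)) \<epsilon> = Some (popet_of \<psi>)" unfolding psrc_popet_of_ONode by simp
  then obtain i where "j = Suc i" "preopetope i (popet_of \<psi>)" using preopetope_src ONode.prems(2) by blast
  then show ?case using ONode.IH(1)[OF k(2)] k(1) by simp
qed simp

lemma sequent_popet_of_dim: "opetope n \<omega> \<Longrightarrow> sequent \<Gamma> (popet_of \<omega>) t \<Longrightarrow> preopetope n (popet_of \<omega>)"
  using sequent_preopetope opetope_popet_dim by blast

text \<open>Derivability of the code, agreement of tree targets with sequents, and existence of a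
  target support each other across dimensions and are carried by one induction.\<close>

definition coherent :: "nat \<Rightarrow> bool" where
  "coherent n \<longleftrightarrow> (\<forall>\<omega>. opetope n \<omega> \<longrightarrow> (\<exists>\<Gamma> t. sequent \<Gamma> (popet_of \<omega>) t) \<and>
     (\<forall>\<tau> W. target \<omega> \<tau> W \<longrightarrow> (\<exists>k. n = Suc k \<and> opetope k \<tau>) \<and> sequent W (popet_of \<omega>) (popet_of \<tau>)) \<and>
     (n \<noteq> 0 \<longrightarrow> (\<exists>\<tau> W. target \<omega> \<tau> W)))"

lemma coherentD:
  assumes "coherent n" "opetope n \<omega>"
  shows "\<exists>\<Gamma> t. sequent \<Gamma> (popet_of \<omega>) t"
    and "target \<omega> \<tau> W \<Longrightarrow> \<exists>k. n = Suc k \<and> opetope k \<tau>"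
    and "target \<omega> \<tau> W \<Longrightarrow> sequent W (popet_of \<omega>) (popet_of \<tau>)"
    and "n \<noteq> 0 \<Longrightarrow> \<exists>\<tau> W. target \<omega> \<tau> W"
  using assms unfolding coherent_def by blast+

lemma regular_root:
  "regular \<Gamma> p t \<Longrightarrow> psrc p \<epsilon> = Some f \<Longrightarrow> \<exists>\<Delta> w \<Delta>'. sequent \<Delta> t w \<and> sequent \<Delta>' f w"
  unfolding regular_def by (cases p) auto

text \<open>Both operations put the branch on the input \<open>e\<close> of the removed node on the
  leaf of \<open>\<psi>\<close> matched with \<open>e\<close>. The result is well typed because
  regularity of the sequent of \<open>\<psi>\<close> makes the leaf labels and the root edge agree
  with those of the removed node.\<close>

lemma substitute_opetope:
  assumes C: "coherent (Suc k)" and \<tau>: "opetope (Suc (Suc k)) \<tau>" "sequent \<Delta> (popet_of \<tau>) w"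
    and \<psi>: "opetope (Suc (Suc k)) \<psi>" "sequent V (popet_of \<psi>) (popet_of \<phi>)" and \<phi>: "opetope (Suc k) \<phi>"
    and r: "psrc (popet_of \<tau>) r = Some (popet_of \<phi>)"
  shows "opetope (Suc (Suc k)) (substitute \<tau> r \<psi> V) \<and>
    popet_of (substitute \<tau> r \<psi> V) = psubst (popet_of \<tau>) r (popet_of \<psi>) V"
proof -
  obtain l where l: "r = Addr l" by (cases r)
  obtain \<phi>' ts where "subtree \<tau> l = Some (ONode \<phi>' ts)" "popet_of \<phi>' = popet_of \<phi>"
    using r psrc_popet_of_subtree[OF \<tau>(1), of l] l by auto
  moreover from this have "opetope (Suc k) \<phi>'"
    using subtree_opetope[OF \<tau>(1), of l "ONode \<phi>' ts"] by (simp add: opetope_ONode_iff)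
  ultimately have ts: "subtree \<tau> l = Some (ONode \<phi> ts)" using popet_of_inject \<phi> by blast
  then have o: "opetope (Suc (Suc k)) (ONode \<phi> ts)" using subtree_opetope[OF \<tau>(1)] by blast
  interpret substitution "popet_of \<tau>" r "popet_of \<psi>" V "popet_of \<phi>"
    using sequent_substitution[OF _ _ \<tau>(2) \<psi>(2) r] sequent_popet_of_dim \<tau> \<psi> by blast
  have reg: "regular V (popet_of \<psi>) (popet_of \<phi>)" using sequent_regular[OF \<psi>(2)] .
  \<comment> \<open>\<open>f k'\<close> is the branch of the removed node that belongs on the leaf
    \<open>k'\<close> of \<open>\<psi>\<close>.\<close>
  define f where "f k' = the (fmlookup ts (THE e. (Addr k', e) \<in> V))" for k'
  have f: "\<exists>c. fmlookup ts e = Some c \<and> f k' = c \<and> opetope (Suc (Suc k)) c \<and> root_edge c (src \<phi> e) \<and> e \<in> nodes \<phi>"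
    if "(Addr k', e) \<in> V" for k' e
  proof -
    have "(THE e. (Addr k', e) \<in> V) = e" using that regular_fst_unique[OF reg] by blast
    moreover have "e \<in> nodes \<phi>" using regular_node[OF reg that] nodes_popet_of \<phi> by blast
    moreover from this obtain c where "fmlookup ts e = Some c"
      using o unfolding opetope_ONode_iff by (metis fmlookup_dom'_iff)
    ultimately show ?thesis using o unfolding f_def opetope_ONode_iff by auto
  qed
  \<comment> \<open>(Glob2) for \<open>\<psi>\<close>: a leaf carries the label of the input matched
    with it, so the branch fits.\<close>
  have leaf: "\<exists>e. (Addr k', e) \<in> V \<and> \<phi>' = src \<phi> e" if k': "subtree \<psi> k' = Some (OEdge \<phi>')" for k' \<phi>'
  proof -
    have "Addr k' \<in> fst ` V" using k' fst_eq leaves_popet_of[OF \<psi>(1)] mem_leaves by blast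
    then obtain e where e: "(Addr k', e) \<in> V" by auto
    then have "e \<in> nodes \<phi>" using f by blast
    then have src: "psrc (popet_of \<phi>) e = Some (popet_of (src \<phi> e))" "opetope k (src \<phi> e)"
      using psrc_popet_of src_opetope \<phi> by blast+
    have "opetope (Suc (Suc k)) (OEdge \<phi>')" using subtree_opetope[OF \<psi>(1) k'] .
    then have \<phi>': "opetope k \<phi>'" by (auto simp: opetope_OEdge_iff)
    have "popet_of \<phi>' = popet_of (src \<phi> e)"
    proof (cases k' rule: rev_cases)
      case Nil
      then have "sequent V (PDegen (popet_of \<phi>')) (popet_of \<phi>)" using k' \<psi>(2) by simp
      then show ?thesis using sequent_PDegen e src by fastforce
    next
      case (snoc b q)
      obtain \<chi> us where \<chi>: "subtree \<psi> b = Some (ONode \<chi> us)" "q \<in> nodes \<chi>" "\<phi>' = src \<chi> q"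
        using subtree_leaf_label[OF \<psi>(1)] k' snoc by blast
      have "opetope (Suc k) \<chi>" using subtree_opetope[OF \<psi>(1) \<chi>(1)] by (auto simp: opetope_ONode_iff)
      then have "psrc (popet_of \<chi>) q = Some (popet_of \<phi>')" using psrc_popet_of \<chi>(2,3) by blast
      moreover have "psrc (popet_of \<psi>) (Addr b) = Some (popet_of \<chi>)"
        using psrc_popet_of_subtree[OF \<psi>(1)] \<chi>(1) by blast
      ultimately show ?thesis using regular_source[OF reg, of "Addr b" q e] e src(1) snoc by simp
    qed
    then show ?thesis using popet_of_inject \<phi>' src(2) e by blast
  qed
  \<comment> \<open>(Glob1) for \<open>\<psi>\<close>: its root edge has the label of the output
    edge of the removed node, namely the target of \<open>\<phi>\<close>. For an edge
    \<open>\<psi>\<close> this is read off the corolla that is its target.\<close>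
  have root: "root_edge \<psi> x" if x: "root_edge (ONode \<phi> ts) x" for x
  proof -
    obtain V\<^sub>1 where V\<^sub>1: "target \<phi> x V\<^sub>1" using x root_edge_ONode_iff by blast
    then have x: "opetope k x" "sequent V\<^sub>1 (popet_of \<phi>) (popet_of x)" using coherentD[OF C \<phi>] by blast+
    show ?thesis
    proof (cases rule: opetope_tree_cases[OF \<psi>(1)])
      case (1 \<phi>')
      then have "popet_of \<phi> = pcorolla (popet_of \<phi>')" using \<psi>(2) sequent_PDegen by simp
      then have "popet_of x = popet_of \<phi>'" using sequent_pcorolla x(2) by simp
      moreover have "opetope k \<phi>'" using \<psi>(1) 1 by (auto simp: opetope_OEdge_iff)
      ultimately show ?thesis using popet_of_inject x(1) 1 by auto
    next
      case (2 \<chi> us)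
      then have \<chi>: "opetope (Suc k) \<chi>" using \<psi>(1) by (auto simp: opetope_ONode_iff)
      obtain x' V\<^sub>2 where V\<^sub>2: "target \<chi> x' V\<^sub>2" using coherentD(4)[OF C \<chi>] by blast
      then have x': "opetope k x'" "sequent V\<^sub>2 (popet_of \<chi>) (popet_of x')" using coherentD[OF C \<chi>] by blast+
      have "psrc (popet_of \<psi>) \<epsilon> = Some (popet_of \<chi>)" unfolding 2 psrc_popet_of_ONode by simp
      then obtain \<Delta> w \<Delta>' where "sequent \<Delta> (popet_of \<phi>) w" "sequent \<Delta>' (popet_of \<chi>) w"
        using regular_root[OF reg] by blast
      then have "popet_of x = popet_of x'" using sequent_unique x(2) x'(2) by blast
      then show ?thesis using popet_of_inject x(1) x'(1) V\<^sub>2 2 root_edge_ONode_iff by blast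
    qed
  qed
  define X where "X = glue \<psi> f"
  have X: "opetope (Suc (Suc k)) X" "\<And>x. root_edge \<psi> x \<Longrightarrow> root_edge X x"
    using glue_opetope[OF \<psi>(1), of f] leaf f unfolding X_def by blast+
  define \<sigma> where "\<sigma> = plug \<tau> l X"
  have \<sigma>: "substitute \<tau> r \<psi> V = \<sigma>"
    unfolding substitute_def \<sigma>_def X_def f_def using ts l by simp
  have \<sigma>_op: "opetope (Suc (Suc k)) \<sigma>" "\<And>x. root_edge \<tau> x \<Longrightarrow> root_edge \<sigma> x"
    using plug_opetope[OF \<tau>(1) ts X(1)] X(2) root unfolding \<sigma>_def by blast+
  have sub_below: "subtree \<sigma> (l @ a) = subtree X a" for a unfolding \<sigma>_def by (rule subtree_plug[OF ts])
  have sub_leaf: "subtree X (k' @ a) = subtree c a" if "subtree \<psi> k' = Some (OEdge \<phi>')" "(Addr k', e) \<in> V" "fmlookup ts e = Some c"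
    for k' \<phi>' e c a
    using subtree_glue_leaf[OF that(1)] f[OF that(2)] that(3) unfolding X_def by auto
  have sub_\<tau>: "subtree \<tau> (l @ e # a) = subtree c a" if "fmlookup ts e = Some c" for e c a
    using ts that by (simp add: subtree_append)
  have eq: "psrc (popet_of \<sigma>) a = Some v \<longleftrightarrow> psrc (psubst (popet_of \<tau>) r (popet_of \<psi>) V) a = Some v" for a v
  proof
    assume v: "psrc (popet_of \<sigma>) a = Some v"
    obtain b where a: "a = Addr b" by (cases a)
    obtain \<chi> us where \<chi>: "subtree \<sigma> b = Some (ONode \<chi> us)" "v = popet_of \<chi>"
      using v psrc_popet_of_subtree[OF \<sigma>_op(1)] unfolding a by blast
    show "psrc (psubst (popet_of \<tau>) r (popet_of \<psi>) V) a = Some v"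
    proof (cases "\<exists>s. b = l @ s")
      case True
      then obtain s where s: "b = l @ s" by blast
      then have "subtree (glue \<psi> f) s = Some (ONode \<chi> us)" using \<chi>(1) sub_below X_def by simp
      from subtree_glue_cases[OF \<psi>(1) this] show ?thesis
      proof (elim disjE exE conjE)
        fix us' assume "subtree \<psi> s = Some (ONode \<chi> us')"
        then have "psrc (popet_of \<psi>) (Addr s) = Some v" using psrc_popet_of_subtree[OF \<psi>(1)] \<chi>(2) by blast
        then show ?thesis using psrc_psubst_in[of "Addr s" v] a s l by simp
      next
        fix k' \<phi>' z assume z: "s = k' @ z" "subtree \<psi> k' = Some (OEdge \<phi>')" "subtree (f k') z = Some (ONode \<chi> us)"
        obtain e where e: "(Addr k', e) \<in> V" using leaf z(2) by blast
        obtain c where c: "fmlookup ts e = Some c" "f k' = c" using f[OF e] by blast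
        then have "subtree \<tau> (l @ e # z) = Some (ONode \<chi> us)" using sub_\<tau> z(3) by simp
        then have "psrc (popet_of \<tau>) (Addr (l @ e # z)) = Some v" using psrc_popet_of_subtree[OF \<tau>(1)] \<chi>(2) by blast
        moreover have "\<rho> (Addr (l @ e # z)) = a"
          using readdress_in[OF inj_snd e, of r "Addr z"] a s z(1) l by simp
        ultimately show ?thesis using psrc_psubst_out[of "Addr (l @ e # z)" v] l by simp
      qed
    next
      case False
      then obtain us' where "subtree \<tau> b = Some (ONode \<chi> us')"
        using \<chi>(1) subtree_plug_outside[of b l \<tau> X \<chi>] unfolding \<sigma>_def by blast
      then have "psrc (popet_of \<tau>) a = Some v" using psrc_popet_of_subtree[OF \<tau>(1)] \<chi>(2) a by blast
      moreover have "a \<noteq> r \<cdot> z" for z using False a l by (cases z) auto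
      moreover from this have "a \<noteq> r" by (metis acat_nil(2))
      moreover have "\<rho> a = a" using calculation(2) by (intro readdress_out)
      ultimately show ?thesis using psrc_psubst_out[of a v] by simp
    qed
  next
    assume "psrc (psubst (popet_of \<tau>) r (popet_of \<psi>) V) a = Some v"
    then show "psrc (popet_of \<sigma>) a = Some v"
      unfolding psrc_psubst
    proof (elim disjE exE conjE)
      fix s assume s: "a = r \<cdot> s" "psrc (popet_of \<psi>) s = Some v"
      obtain s' where s': "s = Addr s'" by (cases s)
      obtain \<chi> us where \<chi>: "subtree \<psi> s' = Some (ONode \<chi> us)" "v = popet_of \<chi>"
        using s(2) psrc_popet_of_subtree[OF \<psi>(1)] unfolding s' by blast
      then obtain us' where "subtree \<sigma> (l @ s') = Some (ONode \<chi> us')"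
        using subtree_glue_node[OF \<chi>(1), of f] sub_below X_def by auto
      then show ?thesis using psrc_popet_of_subtree[OF \<sigma>_op(1), of "l @ s'"] \<chi>(2) s(1) s' l by auto
    next
      fix b assume b: "a = \<rho> b" "b \<noteq> r" "psrc (popet_of \<tau>) b = Some v"
      have "b \<in> pedges (popet_of \<tau>)" using psrc_pnodes[OF b(3)] by (simp add: pedges_def)
      then show ?thesis
      proof (cases rule: position)
        case 1
        then show ?thesis using b(2) by simp
      next
        case (2 x e z)
        obtain k' z' where kz: "x = Addr k'" "z = Addr z'" by (metis addr.exhaust)
        have e: "(Addr k', e) \<in> V" using 2(1) kz by simp
        obtain c where c: "fmlookup ts e = Some c" using f[OF e] by blast
        obtain \<phi>' where \<phi>': "subtree \<psi> k' = Some (OEdge \<phi>')"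
          using leaf_fst[OF e] leaves_popet_of[OF \<psi>(1)] mem_leaves by blast
        have "b = Addr (l @ e # z')" using 2(2) kz l by simp
        then obtain \<chi> us where \<chi>: "subtree \<tau> (l @ e # z') = Some (ONode \<chi> us)" "v = popet_of \<chi>"
          using b(3) psrc_popet_of_subtree[OF \<tau>(1)] by blast
        then have "subtree \<sigma> (l @ k' @ z') = Some (ONode \<chi> us)"
          using sub_below sub_leaf[OF \<phi>' e c] sub_\<tau>[OF c] by simp
        moreover have "a = Addr (l @ k' @ z')" using b(1) 2(3) kz l by simp
        ultimately show ?thesis using psrc_popet_of_subtree[OF \<sigma>_op(1)] \<chi>(2) by blast
      next
        case 3
        obtain b' where b': "b = Addr b'" by (cases b)
        then have "\<forall>z. b' \<noteq> l @ z" using 3(1)[of "Addr z" for z] l by auto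
        moreover obtain \<chi> us where \<chi>: "subtree \<tau> b' = Some (ONode \<chi> us)" "v = popet_of \<chi>"
          using b(3) psrc_popet_of_subtree[OF \<tau>(1)] unfolding b' by blast
        ultimately obtain us' where "subtree \<sigma> b' = Some (ONode \<chi> us')"
          using subtree_plug_outside[of b' l \<tau> X \<chi>] unfolding \<sigma>_def by blast
        then show ?thesis using psrc_popet_of_subtree[OF \<sigma>_op(1)] \<chi>(2) b(1) 3(2) b' by auto
      qed
    qed
  qed
  have "popet_of \<sigma> = psubst (popet_of \<tau>) r (popet_of \<psi>) V"
  proof (cases rule: psubst_cases)
    case (1 m)
    then obtain a v where "psrc (popet_of \<sigma>) a = Some v" unfolding pnodes_nonempty eq by blast
    then obtain m' where "popet_of \<sigma> = PAssign m'" by (cases "popet_of \<sigma>") auto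
    then show ?thesis using popet_eqI[OF eq _ 1(1)] by blast
  next
    \<comment> \<open>The result is degenerate and sources no longer decide. The two edge labels
      \<open>\<phi>'\<close> and \<open>\<phi>''\<close> agree because both equal the label of the
      root edge of \<open>\<tau>\<close>.\<close>
    case (2 g)
    have no: "psrc (popet_of \<sigma>) \<epsilon> \<noteq> Some v" for v unfolding eq 2(1) unfolding 2(2) by simp
    obtain \<phi>'' where \<phi>'': "\<sigma> = OEdge \<phi>''"
    proof (cases rule: opetope_tree_cases[OF \<sigma>_op(1)])
      case (2 \<chi> us)
      then have "psrc (popet_of \<sigma>) \<epsilon> = Some (popet_of \<chi>)" unfolding 2 psrc_popet_of_ONode by simp
      then show ?thesis using no by simp
    qed (use that in blast)
    obtain \<phi>' where \<phi>': "\<psi> = OEdge \<phi>'" using 2(2) by (cases rule: opetope_tree_cases[OF \<psi>(1)]) auto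
    have "l = []" using treelike_root[OF treelike_t] 2(4) l by auto
    then have \<tau>_eq: "\<tau> = ONode \<phi> ts" using ts by simp
    obtain x V\<^sub>1 where "target \<phi> x V\<^sub>1" using coherentD(4)[OF C \<phi>] by blast
    then have x: "root_edge \<tau> x" unfolding \<tau>_eq root_edge_ONode_iff by blast
    then have "x = \<phi>'" "x = \<phi>''" using root \<sigma>_op(2) \<phi>' \<phi>'' \<tau>_eq by auto
    then show ?thesis using 2(1) \<phi>' \<phi>'' by simp
  qed
  then show ?thesis using \<sigma> \<sigma>_op(1) by simp
qed

text \<open>In dimension 1 the only address is \<open>\<epsilon>\<close> and the only label is the
  point. This identifies the target of a 2-opetope with the arrow.\<close>

lemma sequent_dim_1:
  assumes "preopetope (Suc 0) t" "sequent \<Gamma> t w"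
  shows "t = pcorolla PPoint"
proof -
  have src: "f = PPoint" if "psrc t a = Some f" for a f
  proof -
    have "preopetope 0 f" using preopetope_src[OF assms(1) that] by auto
    then show ?thesis by cases auto
  qed
  obtain m where m: "t = PAssign m" using assms(1) by cases auto
  have ne: "pnodes t \<noteq> {}" and sub: "pnodes t \<subseteq> {\<epsilon>}" using assms(1) unfolding m preopetope_PAssign_iff by auto
  have "psrc t a = psrc (pcorolla PPoint) a" for a
  proof (cases "a = \<epsilon>")
    case True
    then have "a \<in> pnodes t" using ne sub by blast
    then show ?thesis using True src mem_pnodes by fastforce
  next
    case False
    then have "a \<notin> pnodes t" using sub by blast
    then have "psrc t a = None" using psrc_pnodes by (cases "psrc t a") auto
    then show ?thesis using False by simp
  qed
  then show ?thesis unfolding m by (simp add: PAssign_eqI)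
qed

lemma leaf_readdressed:
  assumes "opetope n \<nu>" "sequent \<Gamma> (popet_of \<nu>) t" "subtree \<nu> l = Some (OEdge \<phi>)"
  shows "\<exists>r. (Addr l, r) \<in> \<Gamma>"
proof -
  have "fst ` \<Gamma> = pleaves (popet_of \<nu>)" using sequent_regular[OF assms(2)] unfolding regular_def by blast
  moreover have "Addr l \<in> leaves \<nu>" using assms(3) mem_leaves by blast
  ultimately have "Addr l \<in> fst ` \<Gamma>" using leaves_popet_of[OF assms(1)] by simp
  then show ?thesis by auto
qed

text \<open>By regularity the label of the leaf \<open>l\<close> reappears as the source of
  \<open>t\<close> at \<open>r\<close>; it is the target of \<open>\<psi>\<close>, so the grafting
  step for sequents applies.\<close>

lemma sequent_popet_graft:
  assumes \<nu>: "opetope (Suc (Suc k)) \<nu>" "\<nu> = ONode \<chi> ts" "sequent \<Gamma> (popet_of \<nu>) t"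
    and l: "subtree \<nu> l = Some (OEdge \<phi>)" "(Addr l, r) \<in> \<Gamma>"
    and \<psi>: "opetope (Suc k) \<psi>" "sequent V (popet_of \<psi>) (popet_of \<phi>)"
    and p: "opetope (Suc (Suc k)) (plug \<nu> l (corolla \<psi>))"
  shows "psrc t r = Some (popet_of \<phi>)"
    and "sequent (graft_graph \<Gamma> (Addr l) r V (popet_of \<psi>)) (popet_of (plug \<nu> l (corolla \<psi>)))
      (psubst t r (popet_of \<psi>) V)"
proof -
  obtain m where m: "popet_of \<nu> = PAssign m" unfolding \<nu>(2) by simp
  have "l \<noteq> []" using l(1) \<nu>(2) by auto
  then obtain b q where bq: "l = b @ [q]" by (metis rev_exhaust)
  obtain \<xi> us where \<xi>: "subtree \<nu> b = Some (ONode \<xi> us)" "q \<in> nodes \<xi>" "\<phi> = src \<xi> q"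
    using subtree_leaf_label[OF \<nu>(1)] l(1) bq by blast
  have "opetope (Suc k) \<xi>" using subtree_opetope[OF \<nu>(1) \<xi>(1)] by (simp add: opetope_ONode_iff)
  then have "psrc (popet_of \<xi>) q = Some (popet_of \<phi>)" using psrc_popet_of \<xi>(2,3) by blast
  moreover have "psrc (popet_of \<nu>) (Addr b) = Some (popet_of \<xi>)"
    using psrc_popet_of_subtree[OF \<nu>(1)] \<xi>(1) by blast
  ultimately show r: "psrc t r = Some (popet_of \<phi>)"
    using regular_source[OF sequent_regular[OF \<nu>(3)], of "Addr b" q r] l(2) bq by simp
  show "sequent (graft_graph \<Gamma> (Addr l) r V (popet_of \<psi>)) (popet_of (plug \<nu> l (corolla \<psi>)))
      (psubst t r (popet_of \<psi>) V)"
    unfolding popet_of_graft[OF \<nu>(1) m l(1) \<psi>(1) p]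
    using sequent_graft_step[OF _ _ l(2) _ \<psi>(2) r, of "Suc k" m] \<nu>(3) m
      sequent_popet_of_dim[OF \<nu>(1,3)] sequent_popet_of_dim[OF \<psi>] by simp
qed

lemma plug_corolla_ONode: "\<exists>\<chi>' us. plug (ONode \<chi> ts) l (corolla \<psi>) = ONode \<chi>' us"
proof (cases "l = []")
  case True
  then show ?thesis using corolla_ONode[of \<psi>] by auto
next
  case False
  then show ?thesis using plug_ONode by blast
qed

lemma not_target_OPoint: "\<not> target OPoint \<tau> W"
proof
  assume "target OPoint \<tau> W"
  then show False
  proof cases
    case (target_corolla n)
    then show ?thesis using corolla_ONode[of \<tau>] by auto
  next
    case (target_graft n \<nu> \<chi> ts \<psi> l)
    then show ?thesis using plug_corolla_ONode[of \<chi> ts l \<psi>] by auto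
  qed auto
qed

lemma target_OArrow_iff: "target OArrow \<tau> W \<longleftrightarrow> \<tau> = OPoint \<and> W = {}"
proof
  assume "target OArrow \<tau> W"
  then show "\<tau> = OPoint \<and> W = {}"
  proof cases
    case (target_corolla n)
    then show ?thesis using corolla_ONode[of \<tau>] by auto
  next
    case (target_graft n \<nu> \<chi> ts \<psi> l)
    then show ?thesis using plug_corolla_ONode[of \<chi> ts l \<psi>] by auto
  qed auto
qed (auto intro: target_arrow)

lemma coherent_sequent:
  assumes C: "coherent k" "coherent (Suc k)" and \<omega>: "opetope (Suc (Suc k)) \<omega>"
  shows "\<exists>\<Gamma> t. sequent \<Gamma> (popet_of \<omega>) t"
  using \<omega>
proof (induct rule: opetope_graft_induct)
  case (edge \<phi>)
  then show ?case using coherentD(1)[OF C(1)] seq_degen by (metis popet_of.simps(3))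
next
  case (corolla \<psi>)
  then show ?case using coherentD(1)[OF C(2)] seq_shift unfolding popet_of_corolla[OF corolla] by blast
next
  case (graft \<nu> \<chi> ts l \<psi> \<phi> V)
  obtain \<Gamma> t where s: "sequent \<Gamma> (popet_of \<nu>) t" using graft(3) by blast
  obtain r where "(Addr l, r) \<in> \<Gamma>" using leaf_readdressed[OF graft(1) s graft(4)] by blast
  then show ?case
    using sequent_popet_graft(2)[OF graft(1,2) s graft(4) _ graft(5) coherentD(3)[OF C(2) graft(5,6)] graft(7)]
    by blast
qed

text \<open>The induction runs over the relation \<open>target\<close> alone, with trivial
  predicates for \<open>opetope\<close> and \<open>root_edge\<close>. The dimension is imposed
  inside the claim because the rules carry dimensions of their own, which are then shown to agree
  with it.\<close>

lemma coherent_target: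
  assumes C: "coherent k" "coherent (Suc k)"
  shows "target \<omega> \<tau> W \<Longrightarrow> opetope (Suc (Suc k)) \<omega> \<longrightarrow>
    opetope (Suc k) \<tau> \<and> sequent W (popet_of \<omega>) (popet_of \<tau>)"
proof (induct rule: opetope_root_edge_target.inducts(3)[where ?P1.0 = "\<lambda>_ _. True" and ?P2.0 = "\<lambda>_ _. True"])
  case (target_two \<omega>)
  show ?case
  proof
    assume o: "opetope (Suc (Suc k)) \<omega>"
    then have k: "k = 0" using target_two opetope_dim_unique[of 2 \<omega> "Suc (Suc k)"] by simp
    obtain \<Gamma> t where s: "sequent \<Gamma> (popet_of \<omega>) t" using coherent_sequent[OF C o] by blast
    have reg: "regular \<Gamma> (popet_of \<omega>) t" using sequent_regular[OF s] .
    have "preopetope (Suc 0) t" using regular_dim[OF reg] sequent_popet_of_dim[OF o s] k by simp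
    moreover have "popet_of \<omega> \<noteq> PPoint" using sequent_popet_of_dim[OF o s] by auto
    ultimately have t: "t = pcorolla PPoint" using regular_target[OF reg] sequent_dim_1 by blast
    \<comment> \<open>Both projections of \<open>\<Gamma>\<close> are known and
      \<open>\<epsilon>\<close> is the only possible image, so \<open>\<Gamma>\<close> is the set
      prescribed by \<open>target_two\<close>.\<close>
    have img: "fst ` \<Gamma> = leaves \<omega>" "snd ` \<Gamma> = {\<epsilon>}"
      using reg leaves_popet_of[OF o] t unfolding regular_def by simp_all
    have "\<Gamma> = {(l, \<epsilon>) | l. l \<in> leaves \<omega>}"
    proof (intro set_eqI iffI)
      fix z assume "z \<in> \<Gamma>"
      then have "fst z \<in> leaves \<omega>" "snd z \<in> {\<epsilon>}" unfolding img[symmetric] by (rule imageI)+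
      then show "z \<in> {(l, \<epsilon>) | l. l \<in> leaves \<omega>}" by (cases z) simp
    next
      fix z assume "z \<in> {(l, \<epsilon>) | l. l \<in> leaves \<omega>}"
      then obtain l where l: "z = (l, \<epsilon>)" "l \<in> fst ` \<Gamma>" unfolding img by blast
      then obtain d where d: "(l, d) \<in> \<Gamma>" unfolding mem_fst_image by blast
      then have "d \<in> snd ` \<Gamma>" unfolding mem_snd_image by blast
      then show "z \<in> \<Gamma>" unfolding img using d l by simp
    qed
    then show "opetope (Suc k) OArrow \<and> sequent {(l, \<epsilon>) | l. l \<in> leaves \<omega>} (popet_of \<omega>) (popet_of OArrow)"
      using s t k by simp
  qed
next
  case (target_edge n \<phi>)
  show ?case
  proof
    assume "opetope (Suc (Suc k)) (OEdge \<phi>)"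
    then have \<phi>: "opetope k \<phi>" by (auto simp: opetope_OEdge_iff)
    then have "n = k" using target_edge opetope_dim_unique by blast
    then obtain k' where k': "k = Suc k'" using target_edge by (cases k) auto
    then show "opetope (Suc k) (corolla \<phi>) \<and> sequent {(\<epsilon>, \<epsilon>)} (popet_of (OEdge \<phi>)) (popet_of (corolla \<phi>))"
      using corolla_opetope popet_of_corolla \<phi> coherentD(1)[OF C(1) \<phi>] seq_degen
      by (metis popet_of.simps(3))
  qed
next
  case (target_corolla n \<psi>)
  show ?case
  proof
    assume "opetope (Suc (Suc k)) (corolla \<psi>)"
    then have \<psi>: "opetope (Suc k) \<psi>" by (auto simp: opetope_ONode_iff corolla_def)
    obtain \<Gamma> t where "sequent \<Gamma> (popet_of \<psi>) t" using coherentD(1)[OF C(2) \<psi>] by blast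
    then show "opetope (Suc k) \<psi> \<and>
        sequent {(Addr [q], q) | q. q \<in> nodes \<psi>} (popet_of (corolla \<psi>)) (popet_of \<psi>)"
      using \<psi> seq_shift unfolding popet_of_corolla[OF \<psi>] nodes_popet_of[OF \<psi>] by blast
  qed
next
  case (target_graft n \<nu> \<chi> ts \<psi> l \<phi> V \<tau> W r)
  show ?case
  proof
    assume p: "opetope (Suc (Suc k)) (plug \<nu> l (corolla \<psi>))"
    have sl: "subtree \<nu> l = Some (OEdge \<phi>)" and \<nu>_eq: "\<nu> = ONode \<chi> ts" and V: "target \<psi> \<phi> V"
      and lr: "(Addr l, r) \<in> W" using target_graft by blast+
    have \<nu>n: "opetope (Suc n) \<nu>" "opetope n \<psi>" using target_graft by simp_all
    obtain j where j: "n = Suc j" using \<nu>n(1) unfolding \<nu>_eq opetope_ONode_iff by blast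
    \<comment> \<open>The dimension of the rule is identified through the corolla found inside the
      grafted tree.\<close>
    have "subtree (plug \<nu> l (corolla \<psi>)) (l @ []) = Some (corolla \<psi>)"
      unfolding subtree_plug[OF sl] by simp
    then have "opetope (Suc (Suc k)) (corolla \<psi>)" using subtree_opetope[OF p] by blast
    then have \<psi>: "opetope (Suc k) \<psi>" by (auto simp: opetope_ONode_iff corolla_def)
    then have n: "n = Suc k" using \<nu>n(2) opetope_dim_unique by blast
    have \<nu>: "opetope (Suc (Suc k)) \<nu>" using \<nu>n n by simp
    have \<tau>: "opetope (Suc k) \<tau>" "sequent W (popet_of \<nu>) (popet_of \<tau>)" using target_graft \<nu> by blast+
    obtain k' where k': "k = Suc k'" using target_graft n by (cases k) auto
    have sV: "sequent V (popet_of \<psi>) (popet_of \<phi>)" and \<phi>: "opetope k \<phi>"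
      using coherentD[OF C(2) \<psi>] V by blast+
    note graft = sequent_popet_graft[OF \<nu> \<nu>_eq \<tau>(2) sl lr \<psi> sV p]
    obtain \<Delta> w where w: "sequent \<Delta> (popet_of \<tau>) w" using coherentD(1)[OF C(2) \<tau>(1)] by blast
    have sub: "opetope (Suc k) (substitute \<tau> r \<psi> V)"
      "popet_of (substitute \<tau> r \<psi> V) = psubst (popet_of \<tau>) r (popet_of \<psi>) V"
      using substitute_opetope[OF C(1)[unfolded k'] \<tau>(1)[unfolded k'] w \<psi>[unfolded k'] sV \<phi>[unfolded k'] graft(1)] k'
      by simp_all
    have "graft_graph W (Addr l) r V (popet_of \<psi>) = {(Addr l \<cdot> Addr [q], r \<cdot> q) | q. q \<in> nodes \<psi>} \<union>
       {(l', readdress r V a) | l' a. (l', a) \<in> W \<and> l' \<noteq> Addr l}" (is "?L = ?R")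
    proof (intro set_eqI, clarify)
      fix x d
      have "(x, d') \<in> W \<Longrightarrow> (x, d') \<noteq> (Addr l, r) \<longleftrightarrow> x \<noteq> Addr l" for d'
        using regular_graft_graph_unique(1)[OF sequent_regular[OF \<tau>(2)] lr] .
      then show "(x, d) \<in> ?L \<longleftrightarrow> (x, d) \<in> ?R"
        unfolding mem_graft_graph nodes_popet_of[OF \<psi>] by blast
    qed
    then show "opetope (Suc k) (substitute \<tau> r \<psi> V) \<and>
        sequent ({(Addr l \<cdot> Addr [q], r \<cdot> q) | q. q \<in> nodes \<psi>} \<union>
          {(l', readdress r V a) | l' a. (l', a) \<in> W \<and> l' \<noteq> Addr l})
          (popet_of (plug \<nu> l (corolla \<psi>))) (popet_of (substitute \<tau> r \<psi> V))"
      using graft(2) sub by simp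
  qed
qed auto

text \<open>Existence of targets is left. \<open>target_edge\<close>, \<open>target_corolla\<close>
  and \<open>target_graft\<close> produce targets from dimension 3 on, while dimension 2 is covered
  by \<open>target_two\<close>; hence the cases on \<open>k\<close>.\<close>

lemma coherent_step:
  assumes C: "coherent k" "coherent (Suc k)"
  shows "coherent (Suc (Suc k))"
proof -
  have "\<exists>\<tau> W. target \<omega> \<tau> W" if \<omega>: "opetope (Suc (Suc k)) \<omega>" for \<omega>
  proof (cases k)
    case 0
    then show ?thesis using target_two[of \<omega>] \<omega> by (auto simp: numeral_2_eq_2)
  next
    case (Suc k')
    from \<omega> show ?thesis
    proof (induct rule: opetope_graft_induct)
      case (edge \<phi>)
      then show ?case using target_edge[of k \<phi>] Suc by auto
    next
      case (corolla \<psi>)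
      then show ?case using target_corolla[of "Suc k" \<psi>] Suc by auto
    next
      case (graft \<nu> \<chi> ts l \<psi> \<phi> V)
      then obtain \<tau> W where W: "target \<nu> \<tau> W" by blast
      then have "sequent W (popet_of \<nu>) (popet_of \<tau>)" using coherent_target[OF C W] graft(1) by blast
      then obtain r where "(Addr l, r) \<in> W" using leaf_readdressed[OF graft(1) _ graft(4)] by blast
      then show ?case
        using target_graft[of "Suc k" \<nu> \<chi> ts \<psi> l \<phi> V \<tau> W r] graft W Suc by auto
    qed
  qed
  then show ?thesis
    unfolding coherent_def using coherent_sequent[OF C] coherent_target[OF C] by blast
qed

text \<open>Trees of dimension \<open>n + 2\<close> have nodes in dimension \<open>n + 1\<close> and
  edges in dimension \<open>n\<close>, hence the induction with two hypotheses.\<close>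

theorem coherent_all: "coherent n"
proof (induction n rule: induct_nat_012)
  case 0
  then show ?case
    unfolding coherent_def using not_target_OPoint seq_point by (auto simp: opetope_0_iff)
next
  case 1
  have "sequent {} (pcorolla PPoint) PPoint" using seq_shift[OF seq_point] by simp
  then show ?case
    unfolding coherent_def by (auto simp: opetope_1_iff target_OArrow_iff intro: target_arrow)
next
  case (ge2 n)
  then show ?case using coherent_step by blast
qed

lemma sequent_popet_of: "opetope n \<omega> \<Longrightarrow> \<exists>\<Gamma> t. sequent \<Gamma> (popet_of \<omega>) t"
  using coherentD(1)[OF coherent_all] .

lemma opetope_preopetope: "opetope n \<omega> \<Longrightarrow> preopetope n (popet_of \<omega>)"
  using sequent_popet_of sequent_popet_of_dim by blast

lemma target_sequent:
  assumes "opetope n \<omega>" "target \<omega> \<tau> W"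
  shows "\<exists>k. n = Suc k \<and> opetope k \<tau>" and "sequent W (popet_of \<omega>) (popet_of \<tau>)"
  using coherentD(2,3)[OF coherent_all assms] .

text \<open>Different orders of grafting lead to sequents of one and the same preopetope; these are
  unique, and codes are injective.\<close>

lemma target_unique:
  assumes "opetope n \<omega>" "target \<omega> \<tau> W" "target \<omega> \<tau>' W'"
  shows "\<tau>' = \<tau>" and "W' = W"
proof -
  have s: "popet_of \<tau>' = popet_of \<tau>" "W' = W"
    using sequent_unique[OF target_sequent(2)[OF assms(1,2)] target_sequent(2)[OF assms(1,3)]] by blast+
  then show "W' = W" by simp
  show "\<tau>' = \<tau>"
    using popet_of_inject[OF _ _ s(1)] target_sequent(1)[OF assms(1,2)] target_sequent(1)[OF assms(1,3)] by blast
qed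

lemma tgt_target:
  assumes "opetope (Suc n) \<omega>"
  shows "\<exists>W. target \<omega> (tgt \<omega>) W \<and> (\<forall>l a. (l, a) \<in> W \<longrightarrow> wp \<omega> l = a)"
proof -
  obtain \<tau> W where W: "target \<omega> \<tau> W" using coherentD(4)[OF coherent_all assms] by blast
  have "tgt \<omega> = \<tau>"
    unfolding tgt_def using W target_unique(1)[OF assms W] by blast
  moreover have "wp \<omega> l = a" if "(l, a) \<in> W" for l a
    unfolding wp_def
  proof (rule the_equality)
    show "\<exists>\<tau> W. target \<omega> \<tau> W \<and> (l, a) \<in> W" using W that by blast
  next
    fix b assume "\<exists>\<tau> W. target \<omega> \<tau> W \<and> (l, b) \<in> W"
    then have "(l, b) \<in> W" using target_unique(2)[OF assms W] by blast
    then show "b = a" using regular_fst_unique[OF sequent_regular[OF target_sequent(2)[OF assms W]]] that by blast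
  qed
  ultimately show ?thesis using W by blast
qed

lemma tgt_opetope: "opetope (Suc n) \<omega> \<Longrightarrow> opetope n (tgt \<omega>)"
  using tgt_target target_sequent(1) by blast

lemma tgt_eqI: "opetope n \<omega> \<Longrightarrow> target \<omega> \<tau> W \<Longrightarrow> tgt \<omega> = \<tau>"
  using tgt_target target_unique(1) target_sequent(1) by metis

lemma sequent_tgt:
  assumes "opetope (Suc n) \<omega>" "sequent W (popet_of \<omega>) t"
  shows "t = popet_of (tgt \<omega>)" and "(l, a) \<in> W \<Longrightarrow> wp \<omega> l = a"
proof -
  obtain W' where W': "target \<omega> (tgt \<omega>) W'" "\<forall>l a. (l, a) \<in> W' \<longrightarrow> wp \<omega> l = a"
    using tgt_target[OF assms(1)] by blast
  have "W = W' \<and> t = popet_of (tgt \<omega>)"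
    using sequent_unique[OF target_sequent(2)[OF assms(1) W'(1)] assms(2)] .
  then show "t = popet_of (tgt \<omega>)" "(l, a) \<in> W \<Longrightarrow> wp \<omega> l = a" using W'(2) by blast+
qed

section \<open>The code is onto the derivable preopetopes and equals \<open>enc\<close>\<close>

lemma popet_of_surj: "sequent \<Gamma> p t \<Longrightarrow> \<exists>n \<omega>. opetope n \<omega> \<and> popet_of \<omega> = p"
proof (induct rule: sequent_graft_induct)
  case point
  have "opetope 0 OPoint" "popet_of OPoint = PPoint" by simp_all
  then show ?case by blast
next
  case (degen \<Gamma> p t)
  then obtain n \<phi> where "opetope n \<phi>" "popet_of \<phi> = p" by blast
  then have "opetope (n + 2) (OEdge \<phi>)" "popet_of (OEdge \<phi>) = PDegen p"
    by (simp_all add: opetope_OEdge_iff)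
  then show ?case by blast
next
  case (shift \<Gamma> p t)
  then obtain n \<phi> where \<phi>: "opetope n \<phi>" "popet_of \<phi> = p" by blast
  show ?case
  proof (cases n)
    case 0
    then have "popet_of OArrow = pcorolla p" using \<phi> by (simp add: opetope_0_iff)
    then show ?thesis using opetope_arrow by blast
  next
    case (Suc k)
    then show ?thesis using corolla_opetope popet_of_corolla \<phi> by metis
  qed
next
  case (graft \<Gamma> m t c r \<Upsilon> q u n a b f)
  obtain j \<nu> i \<psi> where \<nu>: "opetope j \<nu>" "popet_of \<nu> = PAssign m" and \<psi>: "opetope i \<psi>" "popet_of \<psi> = q"
    using graft(2,5) by blast
  obtain k where k: "n = Suc k" using graft(7) by (cases n) auto
  have "j = Suc n" using opetope_preopetope[OF \<nu>(1)] graft(6) \<nu>(2) preopetope_unique by metis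
  then have \<nu>_op: "opetope (Suc (Suc k)) \<nu>" using \<nu>(1) k by simp
  have "i = n" using opetope_preopetope[OF \<psi>(1)] graft(8) \<psi>(2) preopetope_unique by metis
  then have \<psi>_op: "opetope (Suc k) \<psi>" using \<psi>(1) k by simp
  obtain l where c: "c = Addr l" by (cases c)
  have "c \<in> leaves \<nu>" using leaves_popet_of[OF \<nu>(1)] \<nu>(2) graft(10) by simp
  then obtain \<phi> where l: "subtree \<nu> l = Some (OEdge \<phi>)" using mem_leaves c by blast
  obtain \<chi> ts where \<nu>_node: "\<nu> = ONode \<chi> ts"
    using \<nu>(2) by (cases rule: opetope_tree_cases[OF \<nu>_op]) auto
  have "opetope (Suc (Suc k)) (OEdge \<phi>)" using subtree_opetope[OF \<nu>_op l] .
  then have \<phi>: "opetope k \<phi>" by (auto simp: opetope_OEdge_iff)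
  have "popet_of \<phi> = u"
  proof -
    obtain a' where a': "a = Addr a'" by (cases a)
    then have "l = a' @ [b]" using graft(9) c by simp
    then obtain \<xi> us where \<xi>: "subtree \<nu> a' = Some (ONode \<xi> us)" "b \<in> nodes \<xi>" "\<phi> = src \<xi> b"
      using subtree_leaf_label[OF \<nu>_op] l by blast
    have "opetope (Suc k) \<xi>" using subtree_opetope[OF \<nu>_op \<xi>(1)] by (simp add: opetope_ONode_iff)
    then have "psrc (popet_of \<xi>) b = Some (popet_of \<phi>)" using psrc_popet_of \<xi>(2,3) by blast
    moreover have "psrc (popet_of \<nu>) a = Some (popet_of \<xi>)"
      using psrc_popet_of_subtree[OF \<nu>_op] \<xi>(1) a' by blast
    ultimately show ?thesis using \<nu>(2) graft(11,12) by simp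
  qed
  moreover have "u = popet_of (tgt \<psi>)" using sequent_tgt(1)[OF \<psi>_op] graft(4) \<psi>(2) by simp
  \<comment> \<open>The side condition of the sequent rule becomes the agreement of edge labels that
    grafting of trees requires.\<close>
  ultimately have "\<phi> = tgt \<psi>" using popet_of_inject[OF \<phi> tgt_opetope[OF \<psi>_op]] by simp
  then have "root_edge (corolla \<psi>) \<phi>" using tgt_target[OF \<psi>_op] root_edge_corolla by blast
  then have p: "opetope (Suc (Suc k)) (plug \<nu> l (corolla \<psi>))"
    using plug_opetope[OF \<nu>_op l corolla_opetope[OF \<psi>_op]] by simp
  then show ?case using popet_of_graft[OF \<nu>_op \<nu>(2) l \<psi>_op p] \<psi>(2) c by metis
qed

lemma encodes_popet_of: "opetope n \<omega> \<Longrightarrow> encodes \<omega> (popet_of \<omega>)"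
proof (induction n arbitrary: \<omega> rule: induct_nat_012)
  case 0
  then show ?case by (simp add: opetope_0_iff encodes.intros)
next
  case 1
  then show ?case by (simp add: opetope_1_iff encodes.intros)
next
  case (ge2 n)
  from ge2.prems show ?case
  proof (induct rule: opetope_graft_induct)
    case (edge \<phi>)
    then show ?case using ge2.IH(1) encodes.intros(3) by simp
  next
    case (corolla \<psi>)
    then show ?case using ge2.IH(2) encodes.intros(4) popet_of_corolla by metis
  next
    case (graft \<nu> \<chi> ts l \<psi> \<phi> V)
    obtain m where m: "popet_of \<nu> = PAssign m" unfolding graft(2) by simp
    show ?case
      unfolding popet_of_graft[OF graft(1) m graft(4,5,7)]
      using graft m ge2.IH(2) tgt_eqI by (intro encodes.intros(5)) auto
  qed
qed

text \<open>\<open>encodes\<close> does not demand well-typed trees, so in the graft case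
  \<open>\<nu>\<close> has to be recognized as an opetope from the grafted tree.\<close>

lemma encodes_unique: "encodes \<omega> p \<Longrightarrow> opetope n \<omega> \<Longrightarrow> p = popet_of \<omega>"
proof (induction arbitrary: n rule: encodes.induct)
  case (3 \<phi> f)
  then show ?case by (auto simp: opetope_OEdge_iff)
next
  case (4 \<psi> f)
  then obtain k where "opetope (Suc k) \<psi>" by (auto simp: opetope_ONode_iff corolla_def)
  then show ?case using 4 popet_of_corolla by simp
next
  case (5 \<nu> m l \<psi> f)
  let ?p = "plug \<nu> l (corolla \<psi>)"
  have top: "subtree ?p (l @ []) = Some (corolla \<psi>)" unfolding subtree_plug[OF 5(2)] by simp
  obtain k where k: "n = Suc (Suc k)"
  proof -
    have "?p \<noteq> OPoint" "?p \<noteq> OArrow" using top corolla_ONode[of \<psi>] by (cases l; auto)+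
    then have "\<not> opetope 0 ?p" "\<not> opetope (Suc 0) ?p" unfolding opetope_0_iff opetope_1_iff by blast+
    then have "n \<noteq> 0" "n \<noteq> Suc 0" using 5(6) by metis+
    then show ?thesis using that by (metis not0_implies_Suc)
  qed
  have p: "opetope (Suc (Suc k)) ?p" using 5(6) k by simp
  then have "opetope (Suc (Suc k)) (corolla \<psi>)" using subtree_opetope top by blast
  then have \<psi>: "opetope (Suc k) \<psi>" by (auto simp: opetope_ONode_iff corolla_def)
  have \<phi>: "opetope k (tgt \<psi>)" using tgt_opetope[OF \<psi>] .
  \<comment> \<open>Putting the bare edge back in place of the corolla recovers
    \<open>\<nu>\<close>.\<close>
  have "plug ?p (l @ []) (OEdge (tgt \<psi>)) = \<nu>"
    unfolding plug_plug[OF 5(2)] using plug_same[OF 5(2)] by simp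
  moreover have "opetope (Suc (Suc k)) (plug ?p (l @ []) (OEdge (tgt \<psi>)))"
    using plug_opetope[OF p top, of "OEdge (tgt \<psi>)"] \<phi> tgt_eqI[OF \<psi>]
    by (auto simp: opetope_OEdge_iff root_edge_corolla)
  ultimately have \<nu>: "opetope (Suc (Suc k)) \<nu>" by simp
  then show ?case
    using popet_of_graft[OF \<nu> 5(4)[OF \<nu>, symmetric] 5(2) \<psi> p] 5(5)[OF \<psi>] by simp
qed simp_all

lemma enc_eq: "opetope n \<omega> \<Longrightarrow> enc \<omega> = popet_of \<omega>"
  unfolding enc_def using encodes_popet_of encodes_unique by blast

section \<open>The opetopic identities\<close>

text \<open>Guarantees that the two composites in (Inner) start from the same opetope. The
  identities below do this for the other relations, so that every relation can be evaluated in a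
  presheaf.\<close>

lemma src_inner:
  assumes \<omega>: "opetope (Suc (Suc n)) \<omega>" and p: "p \<in> nodes \<omega>" "p \<cdot> Addr [q] \<in> nodes \<omega>"
  shows "q \<in> nodes (src \<omega> p)" and "tgt (src \<omega> (p \<cdot> Addr [q])) = src (src \<omega> p) q"
proof -
  let ?\<psi> = "src \<omega> p" and ?\<chi> = "src \<omega> (p \<cdot> Addr [q])"
  have o: "opetope (Suc n) ?\<psi>" "opetope (Suc n) ?\<chi>" using src_opetope \<omega> p by blast+
  obtain \<Gamma> t where "sequent \<Gamma> (popet_of \<omega>) t" using sequent_popet_of[OF \<omega>] by blast
  then obtain \<Upsilon> u where u: "sequent \<Upsilon> (popet_of ?\<chi>) u" "psrc (popet_of ?\<psi>) q = Some u"
    using sequent_inner psrc_popet_of[OF \<omega>] p by blast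
  then show q: "q \<in> nodes ?\<psi>" using psrc_pnodes nodes_popet_of[OF o(1)] by blast
  have "popet_of (tgt ?\<chi>) = popet_of (src ?\<psi> q)"
    using sequent_tgt(1)[OF o(2) u(1)] psrc_popet_of[OF o(1) q] u(2) by simp
  then show "tgt ?\<chi> = src ?\<psi> q"
    using popet_of_inject[OF tgt_opetope[OF o(2)] src_opetope[OF o(1) q]] by blast
qed

lemma nondegenerate_root:
  assumes "opetope (Suc (Suc n)) \<omega>" "\<not> degenerate \<omega>"
  shows "\<epsilon> \<in> nodes \<omega>"
  using assms mem_nodes_tree[OF assms(1), of "[]"]
  by (cases rule: opetope_tree_cases[OF assms(1)]) (auto simp: degenerate_def)

lemma tgt_tgt:
  assumes \<omega>: "opetope (Suc (Suc n)) \<omega>" "\<not> degenerate \<omega>"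
  shows "tgt (tgt \<omega>) = tgt (src \<omega> \<epsilon>)"
proof -
  have e: "\<epsilon> \<in> nodes \<omega>" using nondegenerate_root[OF \<omega>] .
  have o: "opetope (Suc n) (tgt \<omega>)" "opetope (Suc n) (src \<omega> \<epsilon>)"
    using tgt_opetope src_opetope e \<omega>(1) by blast+
  obtain \<Gamma> t where s: "sequent \<Gamma> (popet_of \<omega>) t" using sequent_popet_of[OF \<omega>(1)] by blast
  obtain \<Delta> w \<Delta>' where "sequent \<Delta> t w" "sequent \<Delta>' (popet_of (src \<omega> \<epsilon>)) w"
    using regular_root[OF sequent_regular[OF s] psrc_popet_of[OF \<omega>(1) e]] by blast
  then have "popet_of (tgt (tgt \<omega>)) = popet_of (tgt (src \<omega> \<epsilon>))"
    using sequent_tgt(1) o sequent_tgt(1)[OF \<omega>(1) s] by metis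
  then show ?thesis using popet_of_inject tgt_opetope o by blast
qed

text \<open>Regularity of the sequent of \<open>\<omega>\<close> at the pair formed by the leaf and
  its readdressing, translated back from codes to trees.\<close>

lemma src_tgt:
  assumes \<omega>: "opetope (Suc (Suc n)) \<omega>" and p: "p \<in> nodes \<omega>" "p \<cdot> Addr [q] \<in> leaves \<omega>"
  shows "q \<in> nodes (src \<omega> p)" and "wp \<omega> (p \<cdot> Addr [q]) \<in> nodes (tgt \<omega>)"
    and "src (tgt \<omega>) (wp \<omega> (p \<cdot> Addr [q])) = src (src \<omega> p) q"
proof -
  let ?\<psi> = "src \<omega> p"
  have o: "opetope (Suc n) (tgt \<omega>)" "opetope (Suc n) ?\<psi>"
    using tgt_opetope src_opetope p(1) \<omega>(1) by blast+
  obtain \<Gamma> where s: "sequent \<Gamma> (popet_of \<omega>) (popet_of (tgt \<omega>))"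
    using sequent_popet_of[OF \<omega>] sequent_tgt(1)[OF \<omega>] by blast
  have reg: "regular \<Gamma> (popet_of \<omega>) (popet_of (tgt \<omega>))" using sequent_regular[OF s] .
  obtain r where r: "(p \<cdot> Addr [q], r) \<in> \<Gamma>"
  proof -
    have "fst ` \<Gamma> = leaves \<omega>" using reg leaves_popet_of[OF \<omega>] unfolding regular_def by simp
    then show ?thesis using p(2) mem_fst_image that by metis
  qed
  have wp: "wp \<omega> (p \<cdot> Addr [q]) = r" using sequent_tgt(2)[OF \<omega> s r] .
  have rn: "r \<in> nodes (tgt \<omega>)" using regular_node[OF reg r] nodes_popet_of[OF o(1)] by simp
  then show "wp \<omega> (p \<cdot> Addr [q]) \<in> nodes (tgt \<omega>)" using wp by simp
  have eq: "psrc (popet_of ?\<psi>) q = Some (popet_of (src (tgt \<omega>) r))"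
    using regular_source[OF reg r psrc_popet_of[OF \<omega> p(1)]] psrc_popet_of[OF o(1) rn] by simp
  then show q: "q \<in> nodes ?\<psi>" using psrc_pnodes nodes_popet_of[OF o(2)] by blast
  show "src (tgt \<omega>) (wp \<omega> (p \<cdot> Addr [q])) = src ?\<psi> q"
    using popet_of_inject[OF src_opetope[OF o(1) rn] src_opetope[OF o(2) q]] eq psrc_popet_of[OF o(2) q] wp by simp
qed

text \<open>On trees the target is the arrow if \<open>\<phi>\<close> is the point and a corolla
  otherwise; on codes both cases look alike.\<close>

lemma popet_of_tgt_OEdge:
  assumes "opetope (Suc (Suc n)) (OEdge \<phi>)"
  shows "popet_of (tgt (OEdge \<phi>)) = pcorolla (popet_of \<phi>)"
proof -
  obtain \<Gamma> t where s: "sequent \<Gamma> (popet_of (OEdge \<phi>)) t" using sequent_popet_of[OF assms] by blast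
  then show ?thesis using sequent_tgt(1)[OF assms s] sequent_PDegen by auto
qed

lemma tgt_OEdge:
  assumes "opetope (Suc (Suc n)) (OEdge \<phi>)"
  shows "nodes (tgt (OEdge \<phi>)) = {\<epsilon>}" and "src (tgt (OEdge \<phi>)) \<epsilon> = \<phi>" and "tgt (tgt (OEdge \<phi>)) = \<phi>"
proof -
  have \<phi>: "opetope n \<phi>" using assms by (auto simp: opetope_OEdge_iff)
  have o: "opetope (Suc n) (tgt (OEdge \<phi>))" using tgt_opetope[OF assms] .
  note t = popet_of_tgt_OEdge[OF assms]
  show n: "nodes (tgt (OEdge \<phi>)) = {\<epsilon>}" using nodes_popet_of[OF o] t by simp
  have "popet_of (src (tgt (OEdge \<phi>)) \<epsilon>) = popet_of \<phi>" using psrc_popet_of[OF o, of \<epsilon>] n t by simp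
  then show "src (tgt (OEdge \<phi>)) \<epsilon> = \<phi>" using popet_of_inject[OF src_opetope[OF o] \<phi>] n by blast
  obtain \<Delta> w where "sequent \<Delta> (popet_of (tgt (OEdge \<phi>))) w" using sequent_popet_of[OF o] by blast
  then have "popet_of (tgt (tgt (OEdge \<phi>))) = popet_of \<phi>"
    using sequent_tgt(1)[OF o] sequent_pcorolla t by metis
  then show "tgt (tgt (OEdge \<phi>)) = \<phi>" using popet_of_inject[OF tgt_opetope[OF o] \<phi>] by blast
qed

section \<open>Categories\<close>

lemma category_hom:
  assumes "is_category C"
  shows "a \<in> Obj C \<Longrightarrow> in_hom C (Ident C a) a a"
    and "in_hom C f a b \<Longrightarrow> in_hom C g b c \<Longrightarrow> in_hom C (Comp C g f) a c"
    and "in_hom C f a b \<Longrightarrow> Comp C f (Ident C a) = f"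
    and "in_hom C f a b \<Longrightarrow> Comp C (Ident C b) f = f"
    and "in_hom C f a b \<Longrightarrow> in_hom C g b c \<Longrightarrow> in_hom C h c d \<Longrightarrow>
      Comp C (Comp C h g) f = Comp C h (Comp C g f)"
    and "in_hom C f a b \<Longrightarrow> a \<in> Obj C \<and> b \<in> Obj C"
proof -
  note ax = assms[unfolded is_category_def]
  show "a \<in> Obj C \<Longrightarrow> in_hom C (Ident C a) a a" using ax by blast
  show "in_hom C f a b \<Longrightarrow> in_hom C g b c \<Longrightarrow> in_hom C (Comp C g f) a c" using ax by blast
  show "in_hom C f a b \<Longrightarrow> Comp C f (Ident C a) = f" using ax by blast
  show "in_hom C f a b \<Longrightarrow> Comp C (Ident C b) f = f" using ax by blast
  have "in_hom C f a b \<Longrightarrow> in_hom C g b c \<Longrightarrow> in_hom C h c d \<Longrightarrow>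
      Comp C h (Comp C g f) = Comp C (Comp C h g) f" using ax by blast
  then show "in_hom C f a b \<Longrightarrow> in_hom C g b c \<Longrightarrow> in_hom C h c d \<Longrightarrow>
      Comp C (Comp C h g) f = Comp C h (Comp C g f)" by simp
  show "in_hom C f a b \<Longrightarrow> a \<in> Obj C \<and> b \<in> Obj C" using ax unfolding in_hom_def by blast
qed

lemma functor_hom:
  assumes "is_functor C D F"
  shows "a \<in> Obj C \<Longrightarrow> on_obj F a \<in> Obj D"
    and "a \<in> Obj C \<Longrightarrow> on_mor F (Ident C a) = Ident D (on_obj F a)"
    and "in_hom C f a b \<Longrightarrow> in_hom D (on_mor F f) (on_obj F a) (on_obj F b)"
    and "in_hom C f a b \<Longrightarrow> in_hom C g b c \<Longrightarrow> on_mor F (Comp C g f) = Comp D (on_mor F g) (on_mor F f)"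
  using assms unfolding is_functor_def by blast+

text \<open>Full, faithful and essentially surjective functors. Essential surjectivity is stated
  with an explicit inverse, so that isomorphism and inverse can be chosen together.\<close>

locale fully_faithful_surjective =
  fixes C :: "('o, 'm) cat" and D :: "('p, 'n) cat" and F :: "('o, 'm, 'p, 'n) functr"
  assumes C: "is_category C" and D: "is_category D" and F: "is_functor C D F"
    and full: "a \<in> Obj C \<Longrightarrow> b \<in> Obj C \<Longrightarrow> in_hom D h (on_obj F a) (on_obj F b) \<Longrightarrow>
      \<exists>f. in_hom C f a b \<and> on_mor F f = h"
    and faithful: "in_hom C f a b \<Longrightarrow> in_hom C g a b \<Longrightarrow> on_mor F f = on_mor F g \<Longrightarrow> f = g"
    and surjective: "d \<in> Obj D \<Longrightarrow> \<exists>c e e'. c \<in> Obj C \<and> in_hom D e (on_obj F c) d \<and> in_hom D e' d (on_obj F c) \<and>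
      Comp D e' e = Ident D (on_obj F c) \<and> Comp D e e' = Ident D d"
begin

lemmas compC = category_hom(2)[OF C]
lemmas compD = category_hom(2)[OF D]
lemmas idD = category_hom(3,4)[OF D]
lemmas assocD = category_hom(5)[OF D]

definition pre :: "'p \<Rightarrow> 'o \<times> 'n \<times> 'n" where
  "pre d = (SOME (c, e, e'). c \<in> Obj C \<and> in_hom D e (on_obj F c) d \<and> in_hom D e' d (on_obj F c) \<and>
      Comp D e' e = Ident D (on_obj F c) \<and> Comp D e e' = Ident D d)"

definition "ob d = fst (pre d)"
definition "out d = fst (snd (pre d))"
definition "into d = snd (snd (pre d))"

lemma pre:
  assumes "d \<in> Obj D"
  shows "ob d \<in> Obj C" and "in_hom D (out d) (on_obj F (ob d)) d" and "in_hom D (into d) d (on_obj F (ob d))"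
    and "Comp D (into d) (out d) = Ident D (on_obj F (ob d))" and "Comp D (out d) (into d) = Ident D d"
proof -
  have "case pre d of (c, e, e') \<Rightarrow> c \<in> Obj C \<and> in_hom D e (on_obj F c) d \<and> in_hom D e' d (on_obj F c) \<and>
      Comp D e' e = Ident D (on_obj F c) \<and> Comp D e e' = Ident D d"
    unfolding pre_def by (rule someI_ex) (use surjective[OF assms] in auto)
  then show "ob d \<in> Obj C" "in_hom D (out d) (on_obj F (ob d)) d" "in_hom D (into d) d (on_obj F (ob d))"
    "Comp D (into d) (out d) = Ident D (on_obj F (ob d))" "Comp D (out d) (into d) = Ident D d"
    unfolding ob_def out_def into_def by (auto simp: case_prod_unfold)
qed

definition lift :: "'o \<Rightarrow> 'o \<Rightarrow> 'n \<Rightarrow> 'm" where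
  "lift a b h = (SOME f. in_hom C f a b \<and> on_mor F f = h)"

lemma lift:
  assumes "a \<in> Obj C" "b \<in> Obj C" "in_hom D h (on_obj F a) (on_obj F b)"
  shows "in_hom C (lift a b h) a b" "on_mor F (lift a b h) = h"
  using someI_ex[OF full[OF assms]] unfolding lift_def by blast+

text \<open>Transport of \<open>h\<close> along the chosen isomorphisms to a morphism between
  objects in the image of \<open>F\<close>, where fullness can lift it.\<close>

definition conj :: "'n \<Rightarrow> 'n" where
  "conj h = Comp D (into (Cod D h)) (Comp D h (out (Dom D h)))"

lemma conj:
  assumes "in_hom D h d d'"
  shows "in_hom D (conj h) (on_obj F (ob d)) (on_obj F (ob d'))"
    and "Comp D (out d') (conj h) = Comp D h (out d)"
    and "Comp D (conj h) (into d) = Comp D (into d') h"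
proof -
  have d: "d \<in> Obj D" "d' \<in> Obj D" "Dom D h = d" "Cod D h = d'"
    using category_hom(6)[OF D assms] assms unfolding in_hom_def by blast+
  note p = pre[OF d(1)] and p' = pre[OF d(2)]
  have 1: "in_hom D (Comp D h (out d)) (on_obj F (ob d)) d'" using compD[OF p(2) assms] .
  then show h: "in_hom D (conj h) (on_obj F (ob d)) (on_obj F (ob d'))"
    unfolding conj_def d using compD p'(3) by blast
  have "Comp D (out d') (conj h) = Comp D (Comp D (out d') (into d')) (Comp D h (out d))"
    unfolding conj_def d using assocD[OF 1 p'(3) p'(2)] by simp
  then show "Comp D (out d') (conj h) = Comp D h (out d)" using p'(5) idD(2)[OF 1] by simp
  have "Comp D (conj h) (into d) = Comp D (into d') (Comp D (Comp D h (out d)) (into d))"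
    unfolding conj_def d using assocD[OF p(3) 1 p'(3)] by simp
  also have "Comp D (Comp D h (out d)) (into d) = h"
    using assocD[OF p(3,2) assms] p(5) idD(1)[OF assms] by simp
  finally show "Comp D (conj h) (into d) = Comp D (into d') h" .
qed

definition G :: "('p, 'n, 'o, 'm) functr" where
  "G = \<lparr>on_obj = ob, on_mor = (\<lambda>h. lift (ob (Dom D h)) (ob (Cod D h)) (conj h))\<rparr>"

lemma G_mor:
  assumes "in_hom D h d d'"
  shows "in_hom C (on_mor G h) (ob d) (ob d')" "on_mor F (on_mor G h) = conj h"
proof -
  have d: "d \<in> Obj D" "d' \<in> Obj D" "Dom D h = d" "Cod D h = d'"
    using category_hom(6)[OF D assms] assms unfolding in_hom_def by blast+
  show "in_hom C (on_mor G h) (ob d) (ob d')" "on_mor F (on_mor G h) = conj h"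
    unfolding G_def d functr.simps using lift[OF pre(1)[OF d(1)] pre(1)[OF d(2)] conj(1)[OF assms]] d by simp_all
qed

lemma conj_ident: "d \<in> Obj D \<Longrightarrow> conj (Ident D d) = Ident D (on_obj F (ob d))"
  using category_hom(1)[OF D, of d] pre[of d] idD(2) unfolding conj_def in_hom_def by metis

lemma conj_comp:
  assumes f: "in_hom D f a b" and g: "in_hom D g b c"
  shows "conj (Comp D g f) = Comp D (conj g) (conj f)"
proof -
  have gf: "in_hom D (Comp D g f) a c" using compD[OF f g] .
  have o: "a \<in> Obj D" "b \<in> Obj D" "c \<in> Obj D" using category_hom(6)[OF D] f g by blast+
  note pa = pre[OF o(1)] and pb = pre[OF o(2)] and pc = pre[OF o(3)]
  have "Comp D (conj g) (conj f) = Comp D (Comp D (conj g) (into b)) (Comp D f (out a))"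
  proof -
    have "conj f = Comp D (into b) (Comp D f (out a))" using f unfolding conj_def in_hom_def by simp
    then show ?thesis using assocD[OF compD[OF pa(2) f] pb(3) conj(1)[OF g]] by simp
  qed
  also have "\<dots> = Comp D (Comp D (into c) g) (Comp D f (out a))" using conj(3)[OF g] by simp
  also have "\<dots> = Comp D (into c) (Comp D g (Comp D f (out a)))" using assocD[OF compD[OF pa(2) f] g pc(3)] .
  also have "\<dots> = Comp D (into c) (Comp D (Comp D g f) (out a))" using assocD[OF pa(2) f g] by simp
  also have "\<dots> = conj (Comp D g f)" using gf unfolding conj_def in_hom_def by simp
  finally show ?thesis by simp
qed

text \<open>Each equation holds after applying \<open>F\<close>, and \<open>F\<close> is
  faithful.\<close>

lemma G_functor: "is_functor D C G"
  unfolding is_functor_def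
proof (intro conjI ballI allI impI)
  fix d assume d: "d \<in> Obj D"
  show o: "on_obj G d \<in> Obj C" using pre(1)[OF d] by (simp add: G_def)
  have i: "in_hom D (Ident D d) d d" using category_hom(1)[OF D d] .
  have "on_mor F (on_mor G (Ident D d)) = on_mor F (Ident C (ob d))"
    using G_mor(2)[OF i] conj_ident[OF d] functor_hom(2)[OF F pre(1)[OF d]] by simp
  then show "on_mor G (Ident D d) = Ident C (on_obj G d)"
    using faithful[OF G_mor(1)[OF i] category_hom(1)[OF C pre(1)[OF d]]] by (simp add: G_def)
next
  fix h d d' assume "in_hom D h d d'"
  then show "in_hom C (on_mor G h) (on_obj G d) (on_obj G d')" using G_mor(1) by (simp add: G_def)
next
  fix f g a b c assume f: "in_hom D f a b" and g: "in_hom D g b c"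
  note gf = compD[OF f g]
  have "on_mor F (on_mor G (Comp D g f)) = on_mor F (Comp C (on_mor G g) (on_mor G f))"
    using G_mor[OF f] G_mor[OF g] G_mor[OF gf] conj_comp[OF f g] functor_hom(4)[OF F] by simp
  then show "on_mor G (Comp D g f) = Comp C (on_mor G g) (on_mor G f)"
    using faithful[OF G_mor(1)[OF gf] compC[OF G_mor(1)[OF f] G_mor(1)[OF g]]] by blast
qed

text \<open>The component at \<open>a\<close> lifts the chosen isomorphism from
  \<open>on_obj F a\<close> back to its representative; its inverse lifts \<open>out\<close>. Both
  inverse laws and naturality are checked in \<open>D\<close> and reflected by faithfulness.\<close>

lemma unit:
  "is_nat_iso C C id_functor (comp_functor G F) (\<lambda>a. lift a (ob (on_obj F a)) (into (on_obj F a)))"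
proof -
  define \<eta> where "\<eta> a = lift a (ob (on_obj F a)) (into (on_obj F a))" for a
  have \<eta>: "in_hom C (\<eta> a) a (ob (on_obj F a))" "on_mor F (\<eta> a) = into (on_obj F a)" if "a \<in> Obj C" for a
    using lift[OF that pre(1) pre(3)] functor_hom(1)[OF F that] unfolding \<eta>_def by blast+
  have iso: "is_iso C (\<eta> a)" if a: "a \<in> Obj C" for a
  proof -
    have o: "on_obj F a \<in> Obj D" using functor_hom(1)[OF F a] .
    define \<theta> where "\<theta> = lift (ob (on_obj F a)) a (out (on_obj F a))"
    have \<theta>: "in_hom C \<theta> (ob (on_obj F a)) a" "on_mor F \<theta> = out (on_obj F a)"
      using lift[OF pre(1)[OF o] a pre(2)[OF o]] unfolding \<theta>_def by blast+
    have "Comp C \<theta> (\<eta> a) = Ident C a"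
    proof (rule faithful[OF compC[OF \<eta>(1)[OF a] \<theta>(1)] category_hom(1)[OF C a]])
      show "on_mor F (Comp C \<theta> (\<eta> a)) = on_mor F (Ident C a)"
        using functor_hom(4)[OF F \<eta>(1)[OF a] \<theta>(1)] \<theta>(2) \<eta>(2)[OF a] pre(5)[OF o] functor_hom(2)[OF F a] by simp
    qed
    moreover have "Comp C (\<eta> a) \<theta> = Ident C (ob (on_obj F a))"
    proof (rule faithful[OF compC[OF \<theta>(1) \<eta>(1)[OF a]] category_hom(1)[OF C pre(1)[OF o]]])
      show "on_mor F (Comp C (\<eta> a) \<theta>) = on_mor F (Ident C (ob (on_obj F a)))"
        using functor_hom(4)[OF F \<theta>(1) \<eta>(1)[OF a]] \<theta>(2) \<eta>(2)[OF a] pre(4)[OF o] functor_hom(2)[OF F pre(1)[OF o]] by simp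
    qed
    ultimately show ?thesis unfolding is_iso_def using \<eta>(1)[OF a] \<theta>(1) unfolding in_hom_def by auto
  qed
  have "is_nat_iso C C id_functor (comp_functor G F) \<eta>"
    unfolding is_nat_iso_def is_nat_trans_def id_functor_def comp_functor_def functr.simps
  proof (intro conjI ballI allI impI)
    fix a assume a: "a \<in> Obj C"
    then show "in_hom C (\<eta> a) a ((on_obj G \<circ> on_obj F) a)" using \<eta>(1) by (simp add: G_def)
    show "is_iso C (\<eta> a)" using iso[OF a] .
  next
    fix f a b assume f: "in_hom C f a b"
    have o: "a \<in> Obj C" "b \<in> Obj C" using category_hom(6)[OF C f] by blast+
    note Ff = functor_hom(3)[OF F f]
    have "Comp C (\<eta> b) f = Comp C (on_mor G (on_mor F f)) (\<eta> a)"
    proof (rule faithful[OF compC[OF f \<eta>(1)[OF o(2)]] compC[OF \<eta>(1)[OF o(1)] G_mor(1)[OF Ff]]])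
      show "on_mor F (Comp C (\<eta> b) f) = on_mor F (Comp C (on_mor G (on_mor F f)) (\<eta> a))"
        using functor_hom(4)[OF F f \<eta>(1)[OF o(2)]] functor_hom(4)[OF F \<eta>(1)[OF o(1)] G_mor(1)[OF Ff]]
          \<eta>(2) o G_mor(2)[OF Ff] conj(3)[OF Ff] by simp
    qed
    then show "Comp C (\<eta> b) f = Comp C ((on_mor G \<circ> on_mor F) f) (\<eta> a)" by simp
  qed
  then show ?thesis unfolding \<eta>_def .
qed

lemma counit: "is_nat_iso D D (comp_functor F G) id_functor out"
  unfolding is_nat_iso_def is_nat_trans_def id_functor_def comp_functor_def functr.simps
proof (intro conjI ballI allI impI)
  fix d assume d: "d \<in> Obj D"
  then show o: "in_hom D (out d) ((on_obj F \<circ> on_obj G) d) d" using pre(2) by (simp add: G_def)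
  show "is_iso D (out d)"
    unfolding is_iso_def using pre[OF d] unfolding in_hom_def by auto
next
  fix h d d' assume h: "in_hom D h d d'"
  then show "Comp D (out d') ((on_mor F \<circ> on_mor G) h) = Comp D h (out d)"
    using G_mor(2)[OF h] conj(2)[OF h] by simp
qed

theorem equivalence: "is_equivalence C D F"
  unfolding is_equivalence_def using C D F G_functor unit counit by blast

end

section \<open>Opposite categories, full subcategories, sets and functor categories\<close>

lemma op_cat_simps [simp]:
  "Obj (op_cat C) = Obj C" "Mor (op_cat C) = Mor C" "Dom (op_cat C) = Cod C" "Cod (op_cat C) = Dom C"
  "Ident (op_cat C) = Ident C" "Comp (op_cat C) g f = Comp C f g"
  by (simp_all add: op_cat_def)

lemma in_hom_op [simp]: "in_hom (op_cat C) f a b \<longleftrightarrow> in_hom C f b a"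
  by (auto simp: in_hom_def)

lemma is_category_op:
  assumes "is_category C"
  shows "is_category (op_cat C)"
  unfolding is_category_def
proof (intro conjI allI ballI impI)
  fix f assume "f \<in> Mor (op_cat C)"
  then have "in_hom C f (Dom C f) (Cod C f)" by (simp add: in_hom_def)
  then show "Dom (op_cat C) f \<in> Obj (op_cat C)" "Cod (op_cat C) f \<in> Obj (op_cat C)"
    using category_hom(6)[OF assms] by auto
qed (use category_hom[OF assms] in auto)

lemma full_subcat_simps [simp]:
  "Obj (full_subcat C P) = {a \<in> Obj C. P a}" "Dom (full_subcat C P) = Dom C" "Cod (full_subcat C P) = Cod C"
  "Ident (full_subcat C P) = Ident C" "Comp (full_subcat C P) = Comp C"
  by (simp_all add: full_subcat_def)

lemma in_hom_full_subcat: "in_hom (full_subcat C P) f a b \<longleftrightarrow> in_hom C f a b \<and> P a \<and> P b"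
  by (auto simp: in_hom_def full_subcat_def)

lemma is_category_full_subcat:
  assumes "is_category C"
  shows "is_category (full_subcat C P)"
  unfolding is_category_def
proof (intro conjI allI ballI impI)
  fix f assume "f \<in> Mor (full_subcat C P)"
  then have "in_hom (full_subcat C P) f (Dom C f) (Cod C f)" by (simp add: in_hom_def)
  then show "Dom (full_subcat C P) f \<in> Obj (full_subcat C P)" "Cod (full_subcat C P) f \<in> Obj (full_subcat C P)"
    unfolding in_hom_full_subcat using category_hom(6)[OF assms] by auto
qed (use category_hom[OF assms] in \<open>auto simp: in_hom_full_subcat\<close>)

lemma set_cat_simps [simp]:
  "Obj set_cat = UNIV" "(A, f, B) \<in> Mor set_cat \<longleftrightarrow> f \<in> A \<rightarrow>\<^sub>E B" "Dom set_cat (A, f, B) = A"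
  "Cod set_cat (A, f, B) = B" "Ident set_cat A = (A, \<lambda>x\<in>A. x, A)"
  "Comp set_cat (B, g, D) (A, f, B') = (A, compose A g f, D)"
  by (auto simp: set_cat_def)

lemma in_hom_set_cat: "in_hom set_cat h A B \<longleftrightarrow> (\<exists>f. h = (A, f, B) \<and> f \<in> A \<rightarrow>\<^sub>E B)"
  by (cases h) (auto simp: in_hom_def)

lemma is_category_set_cat: "is_category set_cat"
  unfolding is_category_def
proof (intro conjI allI ballI impI)
  fix f a b assume "in_hom set_cat f a b"
  then obtain f' where f: "f = (a, f', b)" "f' \<in> a \<rightarrow>\<^sub>E b" unfolding in_hom_set_cat by blast
  show "Comp set_cat f (Ident set_cat a) = f"
    using f by (auto simp: compose_def PiE_def extensional_def fun_eq_iff)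
  show "Comp set_cat (Ident set_cat b) f = f"
    using f by (auto simp: compose_def PiE_def extensional_def fun_eq_iff)
next
  fix f g h a b c d
  assume "in_hom set_cat f a b" "in_hom set_cat g b c" "in_hom set_cat h c d"
  then show "Comp set_cat h (Comp set_cat g f) = Comp set_cat (Comp set_cat h g) f"
    unfolding in_hom_set_cat by (auto simp: compose_def fun_eq_iff)
next
  fix f g a b c
  assume "in_hom set_cat f a b" "in_hom set_cat g b c"
  then show "in_hom set_cat (Comp set_cat g f) a c"
    unfolding in_hom_set_cat by (auto simp: compose_def PiE_iff)
next
  fix a show "in_hom set_cat (Ident set_cat a) a a" unfolding in_hom_set_cat by auto
qed simp_all

lemma functor_cat_simps:
  "Obj (functor_cat C D) = {F. is_functor C D F \<and> on_obj F \<in> extensional (Obj C) \<and> on_mor F \<in> extensional (Mor C)}"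
  "(F, \<eta>, G) \<in> Mor (functor_cat C D) \<longleftrightarrow> F \<in> Obj (functor_cat C D) \<and> G \<in> Obj (functor_cat C D) \<and>
     is_nat_trans C D F G \<eta> \<and> \<eta> \<in> extensional (Obj C)"
  "Dom (functor_cat C D) (F, \<eta>, G) = F" "Cod (functor_cat C D) (F, \<eta>, G) = G"
  "Ident (functor_cat C D) F = (F, \<lambda>a\<in>Obj C. Ident D (on_obj F a), F)"
  "Comp (functor_cat C D) (G, \<theta>, H) (F, \<eta>, G') = (F, \<lambda>a\<in>Obj C. Comp D (\<theta> a) (\<eta> a), H)"
  unfolding functor_cat_def Let_def by auto

lemma in_hom_functor_cat:
  "in_hom (functor_cat C D) h F G \<longleftrightarrow> F \<in> Obj (functor_cat C D) \<and> G \<in> Obj (functor_cat C D) \<and>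
    (\<exists>\<eta>. h = (F, \<eta>, G) \<and> is_nat_trans C D F G \<eta> \<and> \<eta> \<in> extensional (Obj C))"
  by (cases h) (auto simp: in_hom_def functor_cat_simps(2-4))

lemma is_category_functor_cat:
  assumes C: "\<And>f a b. in_hom C f a b \<Longrightarrow> a \<in> Obj C \<and> b \<in> Obj C" and D: "is_category D"
  shows "is_category (functor_cat C D)"
  unfolding is_category_def
proof (intro conjI allI ballI impI)
  fix f assume "f \<in> Mor (functor_cat C D)"
  then show "Dom (functor_cat C D) f \<in> Obj (functor_cat C D)" "Cod (functor_cat C D) f \<in> Obj (functor_cat C D)"
    by (cases f, simp add: functor_cat_simps(2-4))+
next
  fix F assume F: "F \<in> Obj (functor_cat C D)"
  then have f: "is_functor C D F" by (simp add: functor_cat_simps(1))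
  have "is_nat_trans C D F F (\<lambda>a\<in>Obj C. Ident D (on_obj F a))"
    unfolding is_nat_trans_def
  proof (intro conjI ballI allI impI)
    fix h a b assume h: "in_hom C h a b"
    then show "Comp D ((\<lambda>a\<in>Obj C. Ident D (on_obj F a)) b) (on_mor F h) =
        Comp D (on_mor F h) ((\<lambda>a\<in>Obj C. Ident D (on_obj F a)) a)"
      using C[OF h] category_hom(3,4)[OF D functor_hom(3)[OF f h]] by simp
  qed (use category_hom(1)[OF D] functor_hom(1)[OF f] in simp)
  then show "in_hom (functor_cat C D) (Ident (functor_cat C D) F) F F"
    unfolding in_hom_functor_cat functor_cat_simps(5) using F by simp
next
  fix f g F G H assume f: "in_hom (functor_cat C D) f F G" and g: "in_hom (functor_cat C D) g G H"
  obtain \<eta> where \<eta>: "f = (F, \<eta>, G)" "is_nat_trans C D F G \<eta>" using f unfolding in_hom_functor_cat by blast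
  obtain \<theta> where \<theta>: "g = (G, \<theta>, H)" "is_nat_trans C D G H \<theta>" using g unfolding in_hom_functor_cat by blast
  have fctr: "is_functor C D F" "is_functor C D G" "is_functor C D H"
    using f g unfolding in_hom_functor_cat functor_cat_simps(1) by blast+
  have \<eta>h: "in_hom D (\<eta> a) (on_obj F a) (on_obj G a)" if "a \<in> Obj C" for a
    using \<eta>(2) that unfolding is_nat_trans_def by blast
  have \<theta>h: "in_hom D (\<theta> a) (on_obj G a) (on_obj H a)" if "a \<in> Obj C" for a
    using \<theta>(2) that unfolding is_nat_trans_def by blast
  have "is_nat_trans C D F H (\<lambda>a\<in>Obj C. Comp D (\<theta> a) (\<eta> a))"
    unfolding is_nat_trans_def
  proof (intro conjI ballI allI impI)
    fix a assume "a \<in> Obj C"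
    then show "in_hom D ((\<lambda>a\<in>Obj C. Comp D (\<theta> a) (\<eta> a)) a) (on_obj F a) (on_obj H a)"
      using category_hom(2)[OF D \<eta>h \<theta>h] by simp
  next
    fix h a b assume h: "in_hom C h a b"
    have o: "a \<in> Obj C" "b \<in> Obj C" using C[OF h] by blast+
    note Fh = functor_hom(3)[OF fctr(1) h] and Gh = functor_hom(3)[OF fctr(2) h] and Hh = functor_hom(3)[OF fctr(3) h]
    have n: "Comp D (\<eta> b) (on_mor F h) = Comp D (on_mor G h) (\<eta> a)"
      "Comp D (\<theta> b) (on_mor G h) = Comp D (on_mor H h) (\<theta> a)"
      using \<eta>(2) \<theta>(2) h unfolding is_nat_trans_def by blast+
    have "Comp D (Comp D (\<theta> b) (\<eta> b)) (on_mor F h) = Comp D (\<theta> b) (Comp D (\<eta> b) (on_mor F h))"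
      using category_hom(5)[OF D Fh \<eta>h[OF o(2)] \<theta>h[OF o(2)]] .
    also have "\<dots> = Comp D (Comp D (\<theta> b) (on_mor G h)) (\<eta> a)"
      unfolding n(1) using category_hom(5)[OF D \<eta>h[OF o(1)] Gh \<theta>h[OF o(2)]] by simp
    also have "\<dots> = Comp D (on_mor H h) (Comp D (\<theta> a) (\<eta> a))"
      unfolding n(2) using category_hom(5)[OF D \<eta>h[OF o(1)] \<theta>h[OF o(1)] Hh] .
    finally show "Comp D ((\<lambda>a\<in>Obj C. Comp D (\<theta> a) (\<eta> a)) b) (on_mor F h) =
        Comp D (on_mor H h) ((\<lambda>a\<in>Obj C. Comp D (\<theta> a) (\<eta> a)) a)" using o by simp
  qed
  then show "in_hom (functor_cat C D) (Comp (functor_cat C D) g f) F H"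
    using f g unfolding in_hom_functor_cat \<eta>(1) \<theta>(1) functor_cat_simps(6) by auto
next
  fix f F G assume f: "in_hom (functor_cat C D) f F G"
  obtain \<eta> where \<eta>: "f = (F, \<eta>, G)" "is_nat_trans C D F G \<eta>" "\<eta> \<in> extensional (Obj C)"
    using f unfolding in_hom_functor_cat by blast
  have \<eta>h: "in_hom D (\<eta> a) (on_obj F a) (on_obj G a)" if "a \<in> Obj C" for a
    using \<eta>(2) that unfolding is_nat_trans_def by blast
  show "Comp (functor_cat C D) f (Ident (functor_cat C D) F) = f"
    unfolding \<eta>(1) functor_cat_simps(5,6) using category_hom(3)[OF D \<eta>h] \<eta>(3)
    by (auto simp: fun_eq_iff extensional_def)
  show "Comp (functor_cat C D) (Ident (functor_cat C D) G) f = f"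
    unfolding \<eta>(1) functor_cat_simps(5,6) using category_hom(4)[OF D \<eta>h] \<eta>(3)
    by (auto simp: fun_eq_iff extensional_def)
next
  fix f g h F G H K assume f: "in_hom (functor_cat C D) f F G" and g: "in_hom (functor_cat C D) g G H"
    and h: "in_hom (functor_cat C D) h H K"
  obtain \<eta> where \<eta>: "f = (F, \<eta>, G)" "is_nat_trans C D F G \<eta>" using f unfolding in_hom_functor_cat by blast
  obtain \<theta> where \<theta>: "g = (G, \<theta>, H)" "is_nat_trans C D G H \<theta>" using g unfolding in_hom_functor_cat by blast
  obtain \<xi> where \<xi>: "h = (H, \<xi>, K)" "is_nat_trans C D H K \<xi>" using h unfolding in_hom_functor_cat by blast
  have "Comp D (\<xi> a) (Comp D (\<theta> a) (\<eta> a)) = Comp D (Comp D (\<xi> a) (\<theta> a)) (\<eta> a)" if "a \<in> Obj C" for a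
    using category_hom(5)[OF D] \<eta>(2) \<theta>(2) \<xi>(2) that unfolding is_nat_trans_def by metis
  then show "Comp (functor_cat C D) h (Comp (functor_cat C D) g f) =
      Comp (functor_cat C D) (Comp (functor_cat C D) h g) f"
    unfolding \<eta>(1) \<theta>(1) \<xi>(1) functor_cat_simps(6) by auto
qed

section \<open>The category of opetopes\<close>

lemma is_path_Nil: "is_path \<alpha> [] \<omega> \<longleftrightarrow> \<alpha> = \<omega> \<and> (\<exists>n. opetope n \<omega>)"
  by (auto elim: is_path.cases intro: is_path.intros)

lemma is_path_Cons: "is_path \<alpha> (g # u) \<omega> \<longleftrightarrow> gen_ok g \<and> gen_cod g = \<omega> \<and> is_path \<alpha> u (gen_dom g)"
  by (auto elim: is_path.cases intro: is_path.intros)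

text \<open>Generators raise the dimension by exactly one. Besides typing, this is what makes faces
  strictly smaller when cells are added in order of dimension.\<close>

lemma gen_ok_dim:
  assumes "gen_ok g"
  shows "\<exists>n. opetope (Suc n) (gen_cod g) \<and> opetope n (gen_dom g)"
proof (cases g)
  case (GTgt \<omega>)
  then obtain n where "n \<ge> 1" "opetope n \<omega>" using assms by auto
  then obtain k where "opetope (Suc k) \<omega>" by (cases n) auto
  then show ?thesis using GTgt tgt_opetope by auto
next
  case (GSrc \<omega> p)
  then obtain n where "n \<ge> 1" "opetope n \<omega>" "p \<in> nodes \<omega>" using assms by auto
  then obtain k where "opetope (Suc k) \<omega>" by (cases n) auto
  then show ?thesis using GSrc src_opetope \<open>p \<in> nodes \<omega>\<close> by auto
qed

lemma is_path_opetope: "is_path \<alpha> u \<omega> \<Longrightarrow> (\<exists>n. opetope n \<alpha>) \<and> (\<exists>n. opetope n \<omega>)"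
  by (induction rule: is_path.induct) (use gen_ok_dim in blast)+

lemma is_path_append: "is_path \<beta> u \<omega> \<Longrightarrow> is_path \<alpha> v \<beta> \<Longrightarrow> is_path \<alpha> (u @ v) \<omega>"
  by (induction u arbitrary: \<omega>) (auto simp: is_path_Nil is_path_Cons)

lemma is_path_appendD: "is_path \<alpha> (u @ v) \<omega> \<Longrightarrow> \<exists>\<beta>. is_path \<beta> u \<omega> \<and> is_path \<alpha> v \<beta>"
proof (induction u arbitrary: \<omega>)
  case Nil
  then show ?case using is_path_opetope is_path_Nil by fastforce
next
  case (Cons g u)
  then show ?case by (auto simp: is_path_Cons)
qed

lemma path_eq_is_path: "path_eq \<alpha> \<omega> u v \<Longrightarrow> is_path \<alpha> u \<omega> \<and> is_path \<alpha> v \<omega>"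
  by (induction rule: path_eq.induct) auto

lemma path_eq_append_left: "path_eq \<alpha> \<beta> v v' \<Longrightarrow> is_path \<beta> u \<omega> \<Longrightarrow> path_eq \<alpha> \<omega> (u @ v) (u @ v')"
proof (induction rule: path_eq.induct)
  case (path_eq_refl v)
  then show ?case using is_path_append path_eq.path_eq_refl by blast
next
  case (path_eq_rel r r' a b)
  have "path_eq \<alpha> \<omega> ((u @ a) @ r @ b) ((u @ a) @ r' @ b)"
    using path_eq_rel is_path_append[OF path_eq_rel(4)] by (intro path_eq.path_eq_rel) auto
  then show ?case by simp
qed (blast intro: path_eq.path_eq_sym path_eq.path_eq_trans)+

lemma path_eq_append_right: "path_eq \<beta> \<omega> u u' \<Longrightarrow> is_path \<alpha> v \<beta> \<Longrightarrow> path_eq \<alpha> \<omega> (u @ v) (u' @ v)"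
proof (induction rule: path_eq.induct)
  case (path_eq_refl u)
  then show ?case using is_path_append path_eq.path_eq_refl by blast
next
  case (path_eq_rel r r' a b)
  have "path_eq \<alpha> \<omega> (a @ r @ (b @ v)) (a @ r' @ (b @ v))"
    using path_eq_rel(1) is_path_append[OF path_eq_rel(2,4)] is_path_append[OF path_eq_rel(3,4)]
    by (intro path_eq.path_eq_rel) auto
  then show ?case by simp
qed (blast intro: path_eq.path_eq_sym path_eq.path_eq_trans)+

lemma path_eq_append:
  "path_eq \<beta> \<omega> u u' \<Longrightarrow> path_eq \<alpha> \<beta> v v' \<Longrightarrow> path_eq \<alpha> \<omega> (u @ v) (u' @ v')"
  using path_eq_append_left path_eq_append_right path_eq_is_path path_eq_trans by meson

text \<open>The morphism of \<open>opet_cat\<close> represented by a path; reasoning about morphisms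
  is done on representatives.\<close>

definition path_class :: "opet \<Rightarrow> opet \<Rightarrow> gen list \<Rightarrow> opet_mor" where
  "path_class \<alpha> \<omega> u = (\<alpha>, {v. path_eq \<alpha> \<omega> u v}, \<omega>)"

lemma opet_cat_simps [simp]:
  "Obj opet_cat = {\<omega>. \<exists>n. opetope n \<omega>}" "Dom opet_cat (path_class \<alpha> \<omega> u) = \<alpha>"
  "Cod opet_cat (path_class \<alpha> \<omega> u) = \<omega>" "Ident opet_cat \<omega> = path_class \<omega> \<omega> []"
  by (simp_all add: opet_cat_def path_class_def)

lemma Mor_opet_cat: "f \<in> Mor opet_cat \<longleftrightarrow> (\<exists>\<alpha> \<omega> u. is_path \<alpha> u \<omega> \<and> f = path_class \<alpha> \<omega> u)"
  unfolding opet_cat_def path_class_def cat.simps quotient_def Image_def by auto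

lemma in_hom_opet_cat: "in_hom opet_cat f \<alpha> \<omega> \<longleftrightarrow> (\<exists>u. is_path \<alpha> u \<omega> \<and> f = path_class \<alpha> \<omega> u)"
  unfolding in_hom_def Mor_opet_cat by auto

lemma path_class_eq:
  assumes "path_eq \<alpha> \<omega> u v"
  shows "path_class \<alpha> \<omega> u = path_class \<alpha> \<omega> v"
proof -
  have "path_eq \<alpha> \<omega> u w \<longleftrightarrow> path_eq \<alpha> \<omega> v w" for w
    using assms path_eq_sym path_eq_trans by blast
  then show ?thesis unfolding path_class_def by presburger
qed

text \<open>Composition is defined through all pairs of representatives; that \<open>path_eq\<close>
  is a congruence for concatenation reduces it to one pair.\<close>

lemma Comp_opet_cat:
  assumes "is_path \<beta> u \<omega>" "is_path \<alpha> v \<beta>"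
  shows "Comp opet_cat (path_class \<beta> \<omega> u) (path_class \<alpha> \<beta> v) = path_class \<alpha> \<omega> (u @ v)"
proof -
  have "(\<exists>u'\<in>{u'. path_eq \<beta> \<omega> u u'}. \<exists>v'\<in>{v'. path_eq \<alpha> \<beta> v v'}. path_eq \<alpha> \<omega> (u' @ v') w) \<longleftrightarrow>
      path_eq \<alpha> \<omega> (u @ v) w" for w
  proof
    assume "\<exists>u'\<in>{u'. path_eq \<beta> \<omega> u u'}. \<exists>v'\<in>{v'. path_eq \<alpha> \<beta> v v'}. path_eq \<alpha> \<omega> (u' @ v') w"
    then show "path_eq \<alpha> \<omega> (u @ v) w" using path_eq_append path_eq_trans by blast
  next
    assume "path_eq \<alpha> \<omega> (u @ v) w"
    then show "\<exists>u'\<in>{u'. path_eq \<beta> \<omega> u u'}. \<exists>v'\<in>{v'. path_eq \<alpha> \<beta> v v'}. path_eq \<alpha> \<omega> (u' @ v') w"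
      using path_eq_refl assms by blast
  qed
  then show ?thesis unfolding path_class_def by (simp add: opet_cat_def)
qed

lemma opet_rel_shape: "opet_rel u v \<Longrightarrow> \<exists>\<omega> g h g' h'. u = [g, h] \<and> v = [g', h'] \<and> gen_cod g = \<omega> \<and> gen_cod g' = \<omega>"
  by (erule opet_rel.cases) auto

section \<open>Presheaves on opetopes\<close>

abbreviation presheaf :: "'a presheaf \<Rightarrow> bool" where
  "presheaf X \<equiv> is_functor (op_cat opet_cat) set_cat X"

text \<open>The underlying map of the action. By contravariance a path from \<open>\<alpha>\<close>
  to \<open>\<omega>\<close> acts from the cells over \<open>\<omega>\<close> to those over
  \<open>\<alpha>\<close>.\<close>

definition act :: "'a presheaf \<Rightarrow> opet \<Rightarrow> opet \<Rightarrow> gen list \<Rightarrow> 'a \<Rightarrow> 'a" where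
  "act X \<alpha> \<omega> u = fst (snd (on_mor X (path_class \<alpha> \<omega> u)))"

abbreviation gact :: "'a presheaf \<Rightarrow> gen \<Rightarrow> 'a \<Rightarrow> 'a" where
  "gact X g \<equiv> act X (gen_dom g) (gen_cod g) [g]"

lemma presheaf_mor:
  assumes "presheaf X" "is_path \<alpha> u \<omega>"
  shows "on_mor X (path_class \<alpha> \<omega> u) = (on_obj X \<omega>, act X \<alpha> \<omega> u, on_obj X \<alpha>)"
    and "act X \<alpha> \<omega> u \<in> on_obj X \<omega> \<rightarrow>\<^sub>E on_obj X \<alpha>"
proof -
  have "in_hom (op_cat opet_cat) (path_class \<alpha> \<omega> u) \<omega> \<alpha>" using assms(2) in_hom_opet_cat by auto
  then have "in_hom set_cat (on_mor X (path_class \<alpha> \<omega> u)) (on_obj X \<omega>) (on_obj X \<alpha>)"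
    by (rule functor_hom(3)[OF assms(1)])
  then obtain f where f: "on_mor X (path_class \<alpha> \<omega> u) = (on_obj X \<omega>, f, on_obj X \<alpha>)"
    "f \<in> on_obj X \<omega> \<rightarrow>\<^sub>E on_obj X \<alpha>"
    unfolding in_hom_set_cat by blast
  then show "on_mor X (path_class \<alpha> \<omega> u) = (on_obj X \<omega>, act X \<alpha> \<omega> u, on_obj X \<alpha>)"
    "act X \<alpha> \<omega> u \<in> on_obj X \<omega> \<rightarrow>\<^sub>E on_obj X \<alpha>" unfolding act_def by simp_all
qed

lemma act_in: "presheaf X \<Longrightarrow> is_path \<alpha> u \<omega> \<Longrightarrow> x \<in> on_obj X \<omega> \<Longrightarrow> act X \<alpha> \<omega> u x \<in> on_obj X \<alpha>"
  using presheaf_mor(2) PiE_mem by metis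

lemma act_Nil:
  assumes "presheaf X" "opetope n \<omega>" "x \<in> on_obj X \<omega>"
  shows "act X \<omega> \<omega> [] x = x"
proof -
  have "on_mor X (path_class \<omega> \<omega> []) = Ident set_cat (on_obj X \<omega>)"
    using functor_hom(2)[OF assms(1), of \<omega>] assms(2) by auto
  then show ?thesis unfolding act_def using assms(3) by simp
qed

lemma act_append:
  assumes "presheaf X" "is_path \<beta> u \<omega>" "is_path \<alpha> v \<beta>" "x \<in> on_obj X \<omega>"
  shows "act X \<alpha> \<omega> (u @ v) x = act X \<alpha> \<beta> v (act X \<beta> \<omega> u x)"
proof -
  have h: "in_hom (op_cat opet_cat) (path_class \<beta> \<omega> u) \<omega> \<beta>" "in_hom (op_cat opet_cat) (path_class \<alpha> \<beta> v) \<beta> \<alpha>"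
    using assms(2,3) in_hom_opet_cat by auto
  have "on_mor X (path_class \<alpha> \<omega> (u @ v)) =
      Comp set_cat (on_mor X (path_class \<alpha> \<beta> v)) (on_mor X (path_class \<beta> \<omega> u))"
    using functor_hom(4)[OF assms(1) h] Comp_opet_cat[OF assms(2,3)] by simp
  also have "\<dots> = (on_obj X \<omega>, compose (on_obj X \<omega>) (act X \<alpha> \<beta> v) (act X \<beta> \<omega> u), on_obj X \<alpha>)"
    using presheaf_mor(1)[OF assms(1)] assms(2,3) by simp
  finally show ?thesis using assms(4) unfolding act_def[of X \<alpha> \<omega> "u @ v"] by (simp add: compose_def)
qed

lemma act_eq: "path_eq \<alpha> \<omega> u v \<Longrightarrow> act X \<alpha> \<omega> u = act X \<alpha> \<omega> v"
  unfolding act_def using path_class_eq by metis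

lemma is_path_gen: "gen_ok g \<Longrightarrow> is_path (gen_dom g) [g] (gen_cod g)"
  using gen_ok_dim by (auto simp: is_path_Cons is_path_Nil)

lemma gact_in: "presheaf X \<Longrightarrow> gen_ok g \<Longrightarrow> x \<in> on_obj X (gen_cod g) \<Longrightarrow> gact X g x \<in> on_obj X (gen_dom g)"
  by (rule act_in[OF _ is_path_gen])

lemma act_Cons:
  assumes "presheaf X" "is_path \<alpha> (g # u) \<omega>" "x \<in> on_obj X \<omega>"
  shows "act X \<alpha> \<omega> (g # u) x = act X \<alpha> (gen_dom g) u (gact X g x)"
proof -
  have g: "gen_ok g" "gen_cod g = \<omega>" "is_path \<alpha> u (gen_dom g)" using assms(2) is_path_Cons by blast+
  then show ?thesis using act_append[OF assms(1) is_path_gen[OF g(1)] g(3)] assms(3) by simp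
qed

text \<open>\<open>opet_rel\<close> relates bare lists of generators. The hypotheses
  \<open>fits\<close> turn both lists into parallel paths, as \<open>path_eq_rel\<close>
  requires.\<close>

lemma gact_rel:
  assumes X: "presheaf X" and rel: "opet_rel [g, h] [g', h']" and x: "x \<in> on_obj X (gen_cod g)"
    and ok: "gen_ok g" "gen_ok h" "gen_ok g'" "gen_ok h'"
    and fits: "gen_cod h = gen_dom g" "gen_cod h' = gen_dom g'" "gen_cod g' = gen_cod g" "gen_dom h' = gen_dom h"
  shows "gact X h (gact X g x) = gact X h' (gact X g' x)"
proof -
  have p: "is_path (gen_dom h) [g, h] (gen_cod g)" "is_path (gen_dom h) [g', h'] (gen_cod g)"
    using ok fits gen_ok_dim by (auto simp: is_path_Cons is_path_Nil)
  have "path_eq (gen_dom h) (gen_cod g) ([] @ [g, h] @ []) ([] @ [g', h'] @ [])"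
    using rel p by (intro path_eq_rel) auto
  then have "act X (gen_dom h) (gen_cod g) [g, h] x = act X (gen_dom h) (gen_cod g) [g', h'] x"
    using act_eq by (metis append_Nil append_Nil2)
  moreover have "act X (gen_dom h) (gen_cod g) [g, h] x = gact X h (gact X g x)"
    using act_Cons[OF X p(1) x] fits by simp
  moreover have "act X (gen_dom h) (gen_cod g) [g', h'] x = gact X h' (gact X g' x)"
    using act_Cons[OF X p(2) x] fits by simp
  ultimately show ?thesis by simp
qed

text \<open>Generators suffice: every morphism is represented by a path, and naturality squares
  compose along it.\<close>

lemma nat_trans_act:
  assumes X: "presheaf X" and Y: "presheaf Y"
    and maps: "\<And>n \<omega> x. opetope n \<omega> \<Longrightarrow> x \<in> on_obj X \<omega> \<Longrightarrow> \<eta> \<omega> x \<in> on_obj Y \<omega>"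
    and comm: "\<And>g x. gen_ok g \<Longrightarrow> x \<in> on_obj X (gen_cod g) \<Longrightarrow> \<eta> (gen_dom g) (gact X g x) = gact Y g (\<eta> (gen_cod g) x)"
  shows "is_path \<alpha> u \<omega> \<Longrightarrow> x \<in> on_obj X \<omega> \<Longrightarrow> \<eta> \<alpha> (act X \<alpha> \<omega> u x) = act Y \<alpha> \<omega> u (\<eta> \<omega> x)"
proof (induction u arbitrary: \<omega> x)
  case Nil
  then show ?case using act_Nil[OF X] act_Nil[OF Y] maps unfolding is_path_Nil by metis
next
  case (Cons g u)
  have g: "gen_ok g" "gen_cod g = \<omega>" "is_path \<alpha> u (gen_dom g)" using Cons.prems(1) is_path_Cons by blast+
  obtain n where "opetope n \<omega>" using gen_ok_dim g(1,2) by blast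
  then have y: "\<eta> \<omega> x \<in> on_obj Y \<omega>" using maps Cons.prems(2) by blast
  have x: "gact X g x \<in> on_obj X (gen_dom g)" using gact_in[OF X g(1)] Cons.prems(2) g(2) by simp
  have "\<eta> \<alpha> (act X \<alpha> \<omega> (g # u) x) = act Y \<alpha> (gen_dom g) u (\<eta> (gen_dom g) (gact X g x))"
    using act_Cons[OF X Cons.prems] Cons.IH[OF g(3) x] by simp
  also have "\<dots> = act Y \<alpha> \<omega> (g # u) (\<eta> \<omega> x)"
    using comm[OF g(1)] act_Cons[OF Y Cons.prems(1) y] Cons.prems(2) g(2) by simp
  finally show ?case .
qed

lemma nat_transI:
  assumes X: "presheaf X" and Y: "presheaf Y"
    and maps: "\<And>n \<omega> x. opetope n \<omega> \<Longrightarrow> x \<in> on_obj X \<omega> \<Longrightarrow> \<eta> \<omega> x \<in> on_obj Y \<omega>"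
    and comm: "\<And>g x. gen_ok g \<Longrightarrow> x \<in> on_obj X (gen_cod g) \<Longrightarrow> \<eta> (gen_dom g) (gact X g x) = gact Y g (\<eta> (gen_cod g) x)"
  shows "is_nat_trans (op_cat opet_cat) set_cat X Y
    (\<lambda>\<omega>\<in>Obj opet_cat. (on_obj X \<omega>, \<lambda>x\<in>on_obj X \<omega>. \<eta> \<omega> x, on_obj Y \<omega>))"
  unfolding is_nat_trans_def
proof (intro conjI ballI allI impI)
  fix \<omega> assume "\<omega> \<in> Obj (op_cat opet_cat)"
  then show "in_hom set_cat ((\<lambda>\<omega>\<in>Obj opet_cat. (on_obj X \<omega>, \<lambda>x\<in>on_obj X \<omega>. \<eta> \<omega> x, on_obj Y \<omega>)) \<omega>)
      (on_obj X \<omega>) (on_obj Y \<omega>)"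
    unfolding in_hom_set_cat using maps by auto
next
  fix f \<omega> \<alpha> assume "in_hom (op_cat opet_cat) f \<omega> \<alpha>"
  then obtain u where u: "is_path \<alpha> u \<omega>" "f = path_class \<alpha> \<omega> u" using in_hom_opet_cat by auto
  have o: "\<omega> \<in> Obj opet_cat" "\<alpha> \<in> Obj opet_cat" using is_path_opetope[OF u(1)] by auto
  then have "compose (on_obj X \<omega>) (\<lambda>x\<in>on_obj X \<alpha>. \<eta> \<alpha> x) (act X \<alpha> \<omega> u) =
      compose (on_obj X \<omega>) (act Y \<alpha> \<omega> u) (\<lambda>x\<in>on_obj X \<omega>. \<eta> \<omega> x)"
    using nat_trans_act[OF assms u(1)] act_in[OF X u(1)] by (auto simp: compose_def fun_eq_iff)
  then show "Comp set_cat ((\<lambda>\<omega>\<in>Obj opet_cat. (on_obj X \<omega>, \<lambda>x\<in>on_obj X \<omega>. \<eta> \<omega> x, on_obj Y \<omega>)) \<alpha>) (on_mor X f) =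
      Comp set_cat (on_mor Y f) ((\<lambda>\<omega>\<in>Obj opet_cat. (on_obj X \<omega>, \<lambda>x\<in>on_obj X \<omega>. \<eta> \<omega> x, on_obj Y \<omega>)) \<omega>)"
    using o presheaf_mor(1)[OF X u(1)] presheaf_mor(1)[OF Y u(1)] u(2) by simp
qed

lemma nat_transD:
  assumes X: "presheaf X" and Y: "presheaf Y" and \<theta>: "is_nat_trans (op_cat opet_cat) set_cat X Y \<theta>"
  shows "opetope n \<omega> \<Longrightarrow> \<theta> \<omega> = (on_obj X \<omega>, fst (snd (\<theta> \<omega>)), on_obj Y \<omega>)"
    and "opetope n \<omega> \<Longrightarrow> fst (snd (\<theta> \<omega>)) \<in> on_obj X \<omega> \<rightarrow>\<^sub>E on_obj Y \<omega>"
    and "gen_ok g \<Longrightarrow> x \<in> on_obj X (gen_cod g) \<Longrightarrow>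
      fst (snd (\<theta> (gen_dom g))) (gact X g x) = gact Y g (fst (snd (\<theta> (gen_cod g))) x)"
proof -
  have 1: "\<exists>f. \<theta> \<omega> = (on_obj X \<omega>, f, on_obj Y \<omega>) \<and> f \<in> on_obj X \<omega> \<rightarrow>\<^sub>E on_obj Y \<omega>" if "opetope n \<omega>" for n \<omega>
    using \<theta> that unfolding is_nat_trans_def in_hom_set_cat by auto
  show eq: "\<theta> \<omega> = (on_obj X \<omega>, fst (snd (\<theta> \<omega>)), on_obj Y \<omega>)" if "opetope n \<omega>" for n \<omega>
    using 1[OF that] by (metis fst_conv snd_conv)
  show "fst (snd (\<theta> \<omega>)) \<in> on_obj X \<omega> \<rightarrow>\<^sub>E on_obj Y \<omega>" if "opetope n \<omega>" for n \<omega>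
    using 1[OF that] by auto
  assume g: "gen_ok g" "x \<in> on_obj X (gen_cod g)"
  note p = is_path_gen[OF g(1)]
  obtain n where n: "opetope (Suc n) (gen_cod g)" "opetope n (gen_dom g)" using gen_ok_dim g(1) by blast
  let ?f = "path_class (gen_dom g) (gen_cod g) [g]"
  have "in_hom (op_cat opet_cat) ?f (gen_cod g) (gen_dom g)" using p in_hom_opet_cat by auto
  then have "Comp set_cat (\<theta> (gen_dom g)) (on_mor X ?f) = Comp set_cat (on_mor Y ?f) (\<theta> (gen_cod g))"
    using \<theta> unfolding is_nat_trans_def by blast
  moreover obtain fd fc where f: "\<theta> (gen_dom g) = (on_obj X (gen_dom g), fd, on_obj Y (gen_dom g))"
    "\<theta> (gen_cod g) = (on_obj X (gen_cod g), fc, on_obj Y (gen_cod g))"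
    using 1[OF n(1)] 1[OF n(2)] by blast
  ultimately have "compose (on_obj X (gen_cod g)) fd (gact X g) = compose (on_obj X (gen_cod g)) (gact Y g) fc"
    using presheaf_mor(1)[OF X p] presheaf_mor(1)[OF Y p] by simp
  then have "compose (on_obj X (gen_cod g)) fd (gact X g) x = compose (on_obj X (gen_cod g)) (gact Y g) fc x" by simp
  then show "fst (snd (\<theta> (gen_dom g))) (gact X g x) = gact Y g (fst (snd (\<theta> (gen_cod g))) x)"
    using g(2) f by (simp add: compose_def)
qed

lemma opetopic_sets_simps:
  "X \<in> Obj opetopic_sets \<longleftrightarrow> presheaf X \<and> on_obj X \<in> extensional (Obj opet_cat) \<and> on_mor X \<in> extensional (Mor opet_cat)"
  unfolding opetopic_sets_def functor_cat_simps by simp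

lemma in_hom_fin_opetopic_sets:
  "in_hom fin_opetopic_sets h X Y \<longleftrightarrow> X \<in> Obj fin_opetopic_sets \<and> Y \<in> Obj fin_opetopic_sets \<and>
    (\<exists>\<eta>. h = (X, \<eta>, Y) \<and> is_nat_trans (op_cat opet_cat) set_cat X Y \<eta> \<and> \<eta> \<in> extensional (Obj opet_cat))"
  unfolding fin_opetopic_sets_def in_hom_full_subcat unfolding opetopic_sets_def in_hom_functor_cat by auto

lemma is_category_fin_opetopic_sets: "is_category fin_opetopic_sets"
  unfolding fin_opetopic_sets_def opetopic_sets_def
proof (intro is_category_full_subcat is_category_functor_cat is_category_set_cat)
  fix f \<omega> \<alpha> assume "in_hom (op_cat opet_cat) f \<omega> \<alpha>"
  then show "\<omega> \<in> Obj (op_cat opet_cat) \<and> \<alpha> \<in> Obj (op_cat opet_cat)"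
    using in_hom_opet_cat is_path_opetope by auto
qed

section \<open>Contexts\<close>

lemma pd_shape_PdDegen: "pd_shape \<Gamma> (PdDegen x) p \<longleftrightarrow> (\<exists>q. p = PDegen q \<and> var_shape \<Gamma> x q)"
  by (auto elim: pd_shape.cases intro: var_shape_pd_shape.intros)

lemma pd_shape_PdGraft: "pd_shape \<Gamma> (PdGraft m) p \<longleftrightarrow> (\<exists>k. p = PAssign k \<and> fmdom' m = fmdom' k \<and>
    (\<forall>a x f. fmlookup m a = Some x \<longrightarrow> fmlookup k a = Some f \<longrightarrow> var_shape \<Gamma> x f))"
  by (auto elim: pd_shape.cases intro: var_shape_pd_shape.intros)

lemma var_shape_iff: "var_shape \<Gamma> x p \<longleftrightarrow> (\<Gamma> x = Some TPoint \<and> p = PPoint) \<or>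
    (\<exists>P z. \<Gamma> x = Some (TArrow P z) \<and> pd_shape \<Gamma> P p)"
  by (auto elim: var_shape.cases intro: var_shape_pd_shape.intros)

lemma not_pd_shape_PPoint [simp]: "\<not> pd_shape \<Gamma> P PPoint"
  by (cases P) (auto simp: pd_shape_PdDegen pd_shape_PdGraft)

lemma map_le_Some: "\<Gamma> \<subseteq>\<^sub>m \<Gamma>' \<Longrightarrow> \<Gamma> x = Some T \<Longrightarrow> \<Gamma>' x = Some T"
  unfolding map_le_def by (metis domI)

lemma shape_mono:
  shows "var_shape \<Gamma> x p \<Longrightarrow> \<Gamma> \<subseteq>\<^sub>m \<Gamma>' \<Longrightarrow> var_shape \<Gamma>' x p"
    and "pd_shape \<Gamma> P p \<Longrightarrow> \<Gamma> \<subseteq>\<^sub>m \<Gamma>' \<Longrightarrow> pd_shape \<Gamma>' P p"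
proof (induction rule: var_shape_pd_shape.inducts)
  case (1 x)
  show ?case using map_le_Some[OF 1(2,1)] by (rule var_shape_pd_shape.intros(1))
next
  case (2 x P z p)
  show ?case using map_le_Some[OF 2(4,1)] 2(3)[OF 2(4)] by (rule var_shape_pd_shape.intros(2))
next
  case (3 x p)
  show ?case using 3(2)[OF 3(3)] by (rule var_shape_pd_shape.intros(3))
next
  case (4 m k)
  show ?case using 4 by (intro var_shape_pd_shape.intros(4)) blast+
qed

lemma shape_unique:
  shows "var_shape \<Gamma> x p \<Longrightarrow> var_shape \<Gamma> x p' \<Longrightarrow> p' = p"
    and "pd_shape \<Gamma> P p \<Longrightarrow> pd_shape \<Gamma> P p' \<Longrightarrow> p' = p"
proof (induction arbitrary: p' and p' rule: var_shape_pd_shape.inducts)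
  case (1 x)
  then show ?case by (auto simp: var_shape_iff)
next
  case (2 x P z p)
  then show ?case by (auto simp: var_shape_iff[of _ x])
next
  case (3 x p)
  obtain q where "p' = PDegen q" "var_shape \<Gamma> x q" using 3(3) unfolding pd_shape_PdDegen by blast
  then show ?case using 3(2) by blast
next
  case (4 m k)
  obtain k' where k': "p' = PAssign k'" "fmdom' m = fmdom' k'"
    "\<And>a x f. fmlookup m a = Some x \<Longrightarrow> fmlookup k' a = Some f \<Longrightarrow> var_shape \<Gamma> x f"
    using 4(3) unfolding pd_shape_PdGraft by blast
  have "fmlookup k' a = fmlookup k a" for a
  proof (cases "a \<in> fmdom' m")
    case True
    then obtain x f f' where "fmlookup m a = Some x" "fmlookup k a = Some f" "fmlookup k' a = Some f'"
      using 4(1) k'(2) by (metis fmlookup_dom'_iff)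
    then show ?thesis using 4(2) k'(3) by metis
  next
    case False
    then show ?thesis using 4(1) k'(2) by (metis fmdom'_notD)
  qed
  then show ?case unfolding k'(1) by (auto intro: fmap_ext)
qed

lemma shape_ctx_mor:
  assumes "is_ctx_mor \<Upsilon> \<sigma> \<Gamma>"
  shows "var_shape \<Gamma> x p \<Longrightarrow> var_shape \<Upsilon> (\<sigma> x) p"
    and "pd_shape \<Gamma> P p \<Longrightarrow> pd_shape \<Upsilon> (map_pd \<sigma> P) p"
proof (induction rule: var_shape_pd_shape.inducts)
  case (1 x)
  then have "\<Upsilon> (\<sigma> x) = Some TPoint" using assms unfolding is_ctx_mor_def by fastforce
  then show ?case by (rule var_shape_pd_shape.intros(1))
next
  case (2 x P z p)
  have "\<Upsilon> (\<sigma> x) = Some (map_ty \<sigma> (TArrow P z))" using assms 2(1) unfolding is_ctx_mor_def by blast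
  then have "\<Upsilon> (\<sigma> x) = Some (TArrow (map_pd \<sigma> P) (\<sigma> z))" by simp
  then show ?case using 2(3) by (rule var_shape_pd_shape.intros(2))
next
  case (3 x p)
  show ?case unfolding pd.map(1) using 3(2) by (rule var_shape_pd_shape.intros(3))
next
  case (4 m k)
  have "fmdom' (fmmap \<sigma> m) = fmdom' k" using 4(1) by simp
  moreover have "\<forall>a y f. fmlookup (fmmap \<sigma> m) a = Some y \<longrightarrow> fmlookup k a = Some f \<longrightarrow> var_shape \<Upsilon> y f"
    using 4(2) by auto
  ultimately show ?case unfolding pd.map(2) by (rule var_shape_pd_shape.intros(4))
qed

text \<open>The premises of the context rules as conditions on the typing of one variable. They are
  monotone in the context, so they can be read in the final context rather than in the one where the
  variable was introduced. The degenerate case carries no dimension bound, since a degenerate shape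
  has dimension at least 2.\<close>

definition wf_faces :: "'v ctx \<Rightarrow> 'v pd \<Rightarrow> 'v \<Rightarrow> popet \<Rightarrow> (addr \<times> addr) set \<Rightarrow> bool" where
  "wf_faces \<Gamma> P x p W \<longleftrightarrow> (case P of
     PdDegen z \<Rightarrow> z \<in> dom \<Gamma> \<and> \<Gamma> x = Some (TArrow (PdGraft (fmupd \<epsilon> z fmempty)) z)
   | PdGraft m \<Rightarrow> fmran' m \<subseteq> dom \<Gamma> \<and>
       (\<forall>a b xi xj. fmlookup m a = Some xi \<longrightarrow> fmlookup m (a \<cdot> Addr [b]) = Some xj \<longrightarrow>
         (\<exists>z. var_tgt \<Gamma> xj = Some z \<and> var_src \<Gamma> b xi = Some z)) \<and>
       (\<forall>n. preopetope (Suc (Suc n)) p \<longrightarrow>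
         (\<exists>x0 z. fmlookup m \<epsilon> = Some x0 \<and> var_tgt \<Gamma> x0 = Some z \<and> var_tgt \<Gamma> x = Some z) \<and>
         (\<forall>a b r. a \<in> fmdom' m \<longrightarrow> (a \<cdot> Addr [b], r) \<in> W \<longrightarrow>
           (\<exists>xa z. fmlookup m a = Some xa \<and> var_src \<Gamma> b xa = Some z \<and> var_src \<Gamma> r x = Some z))))"

definition wf_arrow :: "'v ctx \<Rightarrow> 'v pd \<Rightarrow> 'v \<Rightarrow> bool" where
  "wf_arrow \<Gamma> P x \<longleftrightarrow> (\<exists>p W t. pd_shape \<Gamma> P p \<and> sequent W p t \<and> x \<in> dom \<Gamma> \<and> var_shape \<Gamma> x t \<and> wf_faces \<Gamma> P x p W)"

text \<open>What remains of a derivation when the order of introduction is forgotten; faces and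
  their identities are studied from this alone.\<close>

definition wf_ctxt :: "'v ctx \<Rightarrow> bool" where
  "wf_ctxt \<Gamma> \<longleftrightarrow> finite (dom \<Gamma>) \<and> (\<forall>y P x. \<Gamma> y = Some (TArrow P x) \<longrightarrow> wf_arrow \<Gamma> P x)"

lemma var_tgt_mono: "\<Gamma> \<subseteq>\<^sub>m \<Gamma>' \<Longrightarrow> var_tgt \<Gamma> x = Some z \<Longrightarrow> var_tgt \<Gamma>' x = Some z"
  using map_le_Some[of \<Gamma> \<Gamma>' x] unfolding var_tgt_def by (cases "\<Gamma> x") auto

lemma var_src_mono: "\<Gamma> \<subseteq>\<^sub>m \<Gamma>' \<Longrightarrow> var_src \<Gamma> a x = Some z \<Longrightarrow> var_src \<Gamma>' a x = Some z"
  using map_le_Some[of \<Gamma> \<Gamma>' x] unfolding var_src_def by (cases "\<Gamma> x") auto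

lemma wf_faces_mono:
  assumes le: "\<Gamma> \<subseteq>\<^sub>m \<Gamma>'" and wf: "wf_faces \<Gamma> P x p W"
  shows "wf_faces \<Gamma>' P x p W"
proof (cases P)
  case (PdDegen z)
  then have "z \<in> dom \<Gamma>" "\<Gamma> x = Some (TArrow (PdGraft (fmupd \<epsilon> z fmempty)) z)"
    using wf unfolding wf_faces_def by simp_all
  then show ?thesis using map_le_Some[OF le] PdDegen unfolding wf_faces_def by (simp, blast)
next
  case (PdGraft m)
  have dom: "dom \<Gamma> \<subseteq> dom \<Gamma>'" using le map_le_implies_dom_le by blast
  note h = wf[unfolded wf_faces_def PdGraft pd.case]
  note mono = var_tgt_mono[OF le] var_src_mono[OF le]
  show ?thesis
    unfolding wf_faces_def PdGraft pd.case
  proof (intro conjI allI impI)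
    show "fmran' m \<subseteq> dom \<Gamma>'" using h dom by blast
  next
    fix a b xi xj assume "fmlookup m a = Some xi" "fmlookup m (a \<cdot> Addr [b]) = Some xj"
    then obtain z where "var_tgt \<Gamma> xj = Some z" "var_src \<Gamma> b xi = Some z" using h by blast
    then show "\<exists>z. var_tgt \<Gamma>' xj = Some z \<and> var_src \<Gamma>' b xi = Some z" using mono by blast
  next
    fix n assume "preopetope (Suc (Suc n)) p"
    then obtain x0 z where "fmlookup m \<epsilon> = Some x0" "var_tgt \<Gamma> x0 = Some z" "var_tgt \<Gamma> x = Some z" using h by blast
    then show "\<exists>x0 z. fmlookup m \<epsilon> = Some x0 \<and> var_tgt \<Gamma>' x0 = Some z \<and> var_tgt \<Gamma>' x = Some z" using mono by blast
  next
    fix n a b r assume "preopetope (Suc (Suc n)) p" "a \<in> fmdom' m" "(a \<cdot> Addr [b], r) \<in> W"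
    then obtain xa z where "fmlookup m a = Some xa" "var_src \<Gamma> b xa = Some z" "var_src \<Gamma> r x = Some z" using h by blast
    then show "\<exists>xa z. fmlookup m a = Some xa \<and> var_src \<Gamma>' b xa = Some z \<and> var_src \<Gamma>' r x = Some z" using mono by blast
  qed
qed

lemma wf_arrow_mono:
  assumes le: "\<Gamma> \<subseteq>\<^sub>m \<Gamma>'" and wf: "wf_arrow \<Gamma> P x"
  shows "wf_arrow \<Gamma>' P x"
proof -
  have "dom \<Gamma> \<subseteq> dom \<Gamma>'" using le map_le_implies_dom_le by blast
  then show ?thesis
    using wf shape_mono[OF _ le] wf_faces_mono[OF le] unfolding wf_arrow_def by blast
qed

lemma wf_ctxt_update:
  assumes \<Gamma>: "wf_ctxt \<Gamma>" and y: "y \<notin> dom \<Gamma>" and T: "\<And>P x. T = TArrow P x \<Longrightarrow> wf_arrow \<Gamma> P x"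
  shows "wf_ctxt (\<Gamma>(y \<mapsto> T))"
proof -
  have le: "\<Gamma> \<subseteq>\<^sub>m \<Gamma>(y \<mapsto> T)" using y by (auto simp: map_le_def)
  have "wf_arrow (\<Gamma>(y \<mapsto> T)) P x" if "(\<Gamma>(y \<mapsto> T)) z = Some (TArrow P x)" for z P x
  proof (cases "z = y")
    case True
    then show ?thesis using that T wf_arrow_mono[OF le] by simp
  next
    case False
    then show ?thesis using that \<Gamma> wf_arrow_mono[OF le] unfolding wf_ctxt_def by simp
  qed
  then show ?thesis using \<Gamma> unfolding wf_ctxt_def by simp
qed

lemma sequent_nondegenerate_dim: "sequent W (PDegen p) t \<Longrightarrow> \<exists>n\<ge>2. preopetope n (PDegen p)"
proof -
  assume "sequent W (PDegen p) t"
  then obtain n where n: "preopetope n (PDegen p)" using sequent_preopetope by blast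
  then have "n \<ge> 2" unfolding preopetope_PDegen_iff by auto
  then show ?thesis using n by blast
qed

lemma ctxt_wf:
  shows "ctxt V \<Gamma> \<Longrightarrow> wf_ctxt \<Gamma> \<and> dom \<Gamma> \<subseteq> V"
    and "pasting V \<Gamma> P \<Longrightarrow> wf_ctxt \<Gamma> \<and> dom \<Gamma> \<subseteq> V \<and> (case P of PdDegen z \<Rightarrow> z \<in> dom \<Gamma>
      | PdGraft m \<Rightarrow> fmran' m \<subseteq> dom \<Gamma> \<and>
       (\<forall>a b xi xj. fmlookup m a = Some xi \<longrightarrow> fmlookup m (a \<cdot> Addr [b]) = Some xj \<longrightarrow>
         (\<exists>z. var_tgt \<Gamma> xj = Some z \<and> var_src \<Gamma> b xi = Some z)))"
proof (induction rule: ctxt_pasting.inducts)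
  case ctxt_empty
  then show ?case by (simp add: wf_ctxt_def)
next
  case (ctxt_point \<Gamma> x)
  have "wf_ctxt (\<Gamma>(x \<mapsto> TPoint))" using ctxt_point by (intro wf_ctxt_update) auto
  moreover have "dom (\<Gamma>(x \<mapsto> TPoint)) \<subseteq> V" using ctxt_point by auto
  ultimately show ?case by blast
next
  case (pasting_degen \<Gamma> x)
  then show ?case by simp
next
  case (pasting_graft \<Gamma> k m)
  then show ?case by simp
next
  case (ctxt_shift \<Gamma> P p W t x y)
  have shape: "pd_shape \<Gamma> P p" and seq: "sequent W p t" by fact+
  have IH: "wf_ctxt \<Gamma> \<and> dom \<Gamma> \<subseteq> V \<and> (case P of PdDegen z \<Rightarrow> z \<in> dom \<Gamma>
      | PdGraft m \<Rightarrow> fmran' m \<subseteq> dom \<Gamma> \<and>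
       (\<forall>a b xi xj. fmlookup m a = Some xi \<longrightarrow> fmlookup m (a \<cdot> Addr [b]) = Some xj \<longrightarrow>
         (\<exists>z. var_tgt \<Gamma> xj = Some z \<and> var_src \<Gamma> b xi = Some z)))" by fact
  have glob: "\<forall>n m. n \<ge> 2 \<longrightarrow> preopetope n p \<longrightarrow> P = PdGraft m \<longrightarrow>
       (\<exists>x0 z. fmlookup m \<epsilon> = Some x0 \<and> var_tgt \<Gamma> x0 = Some z \<and> var_tgt \<Gamma> x = Some z) \<and>
       (\<forall>a b r. a \<in> fmdom' m \<longrightarrow> (a \<cdot> Addr [b], r) \<in> W \<longrightarrow>
         (\<exists>xa z. fmlookup m a = Some xa \<and> var_src \<Gamma> b xa = Some z \<and> var_src \<Gamma> r x = Some z))" by fact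
  have degen: "\<forall>n z. n \<ge> 2 \<longrightarrow> preopetope n p \<longrightarrow> P = PdDegen z \<longrightarrow>
       (\<exists>a. \<Gamma> x = Some (TArrow (PdGraft (fmupd \<epsilon> a fmempty)) a) \<and> z = a)" by fact
  have "wf_faces \<Gamma> P x p W"
  proof (cases P)
    case (PdDegen z)
    then obtain q where "p = PDegen q" using shape by (auto simp: pd_shape_PdDegen)
    \<comment> \<open>The degeneracy condition of the rule is guarded by a dimension bound, which a
      degenerate shape always meets.\<close>
    then obtain n where "n \<ge> 2" "preopetope n p" using sequent_nondegenerate_dim seq by blast
    then show ?thesis using degen IH PdDegen unfolding wf_faces_def by auto
  next
    case (PdGraft m)
    have "(\<exists>x0 z. fmlookup m \<epsilon> = Some x0 \<and> var_tgt \<Gamma> x0 = Some z \<and> var_tgt \<Gamma> x = Some z) \<and>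
        (\<forall>a b r. a \<in> fmdom' m \<longrightarrow> (a \<cdot> Addr [b], r) \<in> W \<longrightarrow>
          (\<exists>xa z. fmlookup m a = Some xa \<and> var_src \<Gamma> b xa = Some z \<and> var_src \<Gamma> r x = Some z))"
      if "preopetope (Suc (Suc n)) p" for n
      using glob[rule_format, of "Suc (Suc n)" m] that PdGraft by simp
    then show ?thesis using IH PdGraft unfolding wf_faces_def by simp
  qed
  moreover have "x \<in> dom \<Gamma>" "var_shape \<Gamma> x t" by fact+
  ultimately have "wf_arrow \<Gamma> P x" unfolding wf_arrow_def using shape seq by blast
  then have "wf_ctxt (\<Gamma>(y \<mapsto> TArrow P x))" using ctxt_shift by (intro wf_ctxt_update) auto
  moreover have "dom (\<Gamma>(y \<mapsto> TArrow P x)) \<subseteq> V" using ctxt_shift by auto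
  ultimately show ?case by blast
qed

section \<open>Variables over opetopes and their faces\<close>

lemma wf_ctxt_vars:
  assumes "wf_ctxt \<Gamma>" "\<Gamma> x = Some T"
  shows "set_ty T \<subseteq> dom \<Gamma>"
proof (cases T)
  case (TArrow P z)
  then have "wf_arrow \<Gamma> P z" using assms unfolding wf_ctxt_def by simp
  then show ?thesis unfolding wf_arrow_def wf_faces_def TArrow by (cases P) auto
qed simp

lemma mem_strat_set: "opetope n \<omega> \<Longrightarrow> x \<in> strat_set \<Gamma> \<omega> \<longleftrightarrow> x \<in> dom \<Gamma> \<and> var_shape \<Gamma> x (popet_of \<omega>)"
  unfolding strat_set_def by (simp add: enc_eq)

lemma strat_set_unique:
  assumes "opetope n \<omega>" "opetope m \<omega>'" "x \<in> strat_set \<Gamma> \<omega>" "x \<in> strat_set \<Gamma> \<omega>'"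
  shows "\<omega> = \<omega>'"
  using assms shape_unique(1) popet_of_inject mem_strat_set by metis

text \<open>The shape of a variable is derivable, and each derivable preopetope is the code of an
  opetope. With \<open>strat_set_unique\<close>, the sets of variables over the opetopes are
  disjoint and cover the context.\<close>

lemma strat_set_exists:
  assumes "wf_ctxt \<Gamma>" "x \<in> dom \<Gamma>"
  shows "\<exists>n \<omega>. opetope n \<omega> \<and> x \<in> strat_set \<Gamma> \<omega>"
proof -
  obtain T where T: "\<Gamma> x = Some T" using assms(2) by blast
  have "\<exists>n \<omega>. opetope n \<omega> \<and> var_shape \<Gamma> x (popet_of \<omega>)"
  proof (cases T)
    case TPoint
    then have "var_shape \<Gamma> x PPoint" using T by (simp add: var_shape_pd_shape.intros(1))
    then have "opetope 0 OPoint \<and> var_shape \<Gamma> x (popet_of OPoint)" by simp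
    then show ?thesis by blast
  next
    case (TArrow P z)
    then have "wf_arrow \<Gamma> P z" using assms T unfolding wf_ctxt_def by simp
    then obtain p W t where p: "pd_shape \<Gamma> P p" "sequent W p t" unfolding wf_arrow_def by blast
    have "var_shape \<Gamma> x p" using T p(1) unfolding TArrow by (rule var_shape_pd_shape.intros(2))
    then show ?thesis using popet_of_surj[OF p(2)] by blast
  qed
  then obtain n \<omega> where \<omega>: "opetope n \<omega>" "var_shape \<Gamma> x (popet_of \<omega>)" by blast
  then have "x \<in> strat_set \<Gamma> \<omega>" using assms(2) by (simp add: mem_strat_set)
  then show ?thesis using \<omega>(1) by blast
qed

lemma strat_set_OPoint: "x \<in> strat_set \<Gamma> OPoint \<longleftrightarrow> \<Gamma> x = Some TPoint"
  using mem_strat_set[of 0 OPoint x \<Gamma>] by (auto simp: var_shape_iff)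

text \<open>\<open>wf_arrow\<close> only provides some shape and some sequent; uniqueness of shapes
  and of sequents identifies them with the codes of \<open>\<omega>\<close> and of its
  target.\<close>

lemma strat_set_arrow:
  assumes wf: "wf_ctxt \<Gamma>" and \<omega>: "opetope (Suc n) \<omega>" and x: "x \<in> strat_set \<Gamma> \<omega>"
  obtains P z W where "\<Gamma> x = Some (TArrow P z)" "pd_shape \<Gamma> P (popet_of \<omega>)"
    "sequent W (popet_of \<omega>) (popet_of (tgt \<omega>))" "z \<in> strat_set \<Gamma> (tgt \<omega>)" "wf_faces \<Gamma> P z (popet_of \<omega>) W"
proof -
  have s: "var_shape \<Gamma> x (popet_of \<omega>)" using x by (simp add: mem_strat_set[OF \<omega>])
  have "popet_of \<omega> \<noteq> PPoint" using opetope_preopetope[OF \<omega>] by auto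
  then obtain P z where P: "\<Gamma> x = Some (TArrow P z)" "pd_shape \<Gamma> P (popet_of \<omega>)"
    using s unfolding var_shape_iff[of \<Gamma> x] by blast
  then have "wf_arrow \<Gamma> P z" using wf unfolding wf_ctxt_def by blast
  then obtain p W t where w: "pd_shape \<Gamma> P p" "sequent W p t" "z \<in> dom \<Gamma>" "var_shape \<Gamma> z t" "wf_faces \<Gamma> P z p W"
    unfolding wf_arrow_def by blast
  have p: "p = popet_of \<omega>" using shape_unique(2) P(2) w(1) by blast
  then have t: "t = popet_of (tgt \<omega>)" using sequent_tgt(1)[OF \<omega>] w(2) by blast
  then have "z \<in> strat_set \<Gamma> (tgt \<omega>)" using w(3,4) unfolding t by (simp add: mem_strat_set[OF tgt_opetope[OF \<omega>]])
  then show ?thesis using that P w p t by blast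
qed

lemma strat_set_graft:
  assumes wf: "wf_ctxt \<Gamma>" and \<omega>: "opetope (Suc n) \<omega>" and x: "x \<in> strat_set \<Gamma> \<omega>" and p: "nodes \<omega> \<noteq> {}"
  obtains m z W where "\<Gamma> x = Some (TArrow (PdGraft m) z)" "fmdom' m = nodes \<omega>"
    "\<And>p y. fmlookup m p = Some y \<Longrightarrow> y \<in> strat_set \<Gamma> (src \<omega> p)"
    "sequent W (popet_of \<omega>) (popet_of (tgt \<omega>))" "z \<in> strat_set \<Gamma> (tgt \<omega>)" "wf_faces \<Gamma> (PdGraft m) z (popet_of \<omega>) W"
proof (rule strat_set_arrow[OF wf \<omega> x])
  fix P z W assume P: "\<Gamma> x = Some (TArrow P z)" "pd_shape \<Gamma> P (popet_of \<omega>)"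
    "sequent W (popet_of \<omega>) (popet_of (tgt \<omega>))" "z \<in> strat_set \<Gamma> (tgt \<omega>)" "wf_faces \<Gamma> P z (popet_of \<omega>) W"
  have ne: "pnodes (popet_of \<omega>) \<noteq> {}" using p nodes_popet_of[OF \<omega>] by simp
  obtain m where m: "P = PdGraft m"
  proof (cases P)
    case (PdDegen y)
    then show ?thesis using P(2) ne by (auto simp: pd_shape_PdDegen)
  qed
  obtain k where k: "popet_of \<omega> = PAssign k" "fmdom' m = fmdom' k"
    "\<And>a x f. fmlookup m a = Some x \<Longrightarrow> fmlookup k a = Some f \<Longrightarrow> var_shape \<Gamma> x f"
    using P(2) unfolding m pd_shape_PdGraft by blast
  have d: "fmdom' m = nodes \<omega>" using k(1,2) nodes_popet_of[OF \<omega>] by simp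
  have "y \<in> strat_set \<Gamma> (src \<omega> a)" if y: "fmlookup m a = Some y" for a y
  proof -
    have a: "a \<in> nodes \<omega>" using y d by (metis fmdom'I)
    then have "fmlookup k a = Some (popet_of (src \<omega> a))" using psrc_popet_of[OF \<omega>] k(1) by simp
    then have "var_shape \<Gamma> y (popet_of (src \<omega> a))" using k(3) y by blast
    moreover have "y \<in> dom \<Gamma>" using P(5) y unfolding wf_faces_def m by (auto intro: fmran'I)
    ultimately show ?thesis by (simp add: mem_strat_set[OF src_opetope[OF \<omega> a]])
  qed
  then show ?thesis using that P d unfolding m by blast
qed

lemma gen_act_tgt:
  assumes wf: "wf_ctxt \<Gamma>" and \<omega>: "opetope (Suc n) \<omega>" and x: "x \<in> strat_set \<Gamma> \<omega>"
  shows "var_tgt \<Gamma> x = Some (gen_act \<Gamma> (GTgt \<omega>) x)" and "gen_act \<Gamma> (GTgt \<omega>) x \<in> strat_set \<Gamma> (tgt \<omega>)"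
  by (rule strat_set_arrow[OF assms]; simp add: var_tgt_def)+

lemma gen_act_src:
  assumes wf: "wf_ctxt \<Gamma>" and \<omega>: "opetope (Suc n) \<omega>" and x: "x \<in> strat_set \<Gamma> \<omega>" and p: "p \<in> nodes \<omega>"
  shows "var_src \<Gamma> p x = Some (gen_act \<Gamma> (GSrc \<omega> p) x)" and "gen_act \<Gamma> (GSrc \<omega> p) x \<in> strat_set \<Gamma> (src \<omega> p)"
proof -
  have ne: "nodes \<omega> \<noteq> {}" using p by blast
  obtain m z W where m: "\<Gamma> x = Some (TArrow (PdGraft m) z)" "fmdom' m = nodes \<omega>"
    "\<And>p y. fmlookup m p = Some y \<Longrightarrow> y \<in> strat_set \<Gamma> (src \<omega> p)"
    using strat_set_graft[OF wf \<omega> x ne] by metis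
  obtain y where "fmlookup m p = Some y" using m(2) p by (metis fmlookup_dom'_iff)
  then show "var_src \<Gamma> p x = Some (gen_act \<Gamma> (GSrc \<omega> p) x)" "gen_act \<Gamma> (GSrc \<omega> p) x \<in> strat_set \<Gamma> (src \<omega> p)"
    using m by (simp_all add: var_src_def)
qed

lemma gen_act_in:
  assumes "wf_ctxt \<Gamma>" "gen_ok g" "x \<in> strat_set \<Gamma> (gen_cod g)"
  shows "gen_act \<Gamma> g x \<in> strat_set \<Gamma> (gen_dom g)"
proof -
  obtain n where n: "opetope (Suc n) (gen_cod g)" using gen_ok_dim assms(2) by blast
  show ?thesis
  proof (cases g)
    case (GTgt \<omega>)
    then show ?thesis using gen_act_tgt(2)[OF assms(1) n assms(3)] by simp
  next
    case (GSrc \<omega> p)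
    then show ?thesis using gen_act_src(2)[OF assms(1) n assms(3), of p] assms(2) by simp
  qed
qed

lemma path_act_in:
  assumes "wf_ctxt \<Gamma>"
  shows "is_path \<alpha> u \<omega> \<Longrightarrow> x \<in> strat_set \<Gamma> \<omega> \<Longrightarrow> path_act \<Gamma> u x \<in> strat_set \<Gamma> \<alpha>"
  by (induction u arbitrary: \<omega> x) (use gen_act_in[OF assms] in \<open>auto simp: is_path_Nil is_path_Cons simp del: gen_act.simps\<close>)

lemma path_act_append: "path_act \<Gamma> (u @ v) x = path_act \<Gamma> v (path_act \<Gamma> u x)"
  by (induction u arbitrary: x) auto

lemma two_le_Suc: "2 \<le> (n::nat) \<Longrightarrow> \<exists>k. n = Suc (Suc k)"
  by (metis add_2_eq_Suc le_Suc_ex)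

text \<open>Each relation of the category of opetopes is one of the conditions in
  \<open>wf_faces\<close>, read off the type of \<open>x\<close>.\<close>

lemma path_act_rel:
  assumes wf: "wf_ctxt \<Gamma>" and rel: "opet_rel u v" and x: "x \<in> strat_set \<Gamma> (gen_cod (hd u))"
  shows "path_act \<Gamma> u x = path_act \<Gamma> v x"
  using rel
proof cases
  case (Inner n \<omega> p q)
  obtain k where "n = Suc (Suc k)" using two_le_Suc[OF \<open>n \<ge> 2\<close>] by blast
  then have \<omega>: "opetope (Suc (Suc k)) \<omega>" using Inner by simp
  have x: "x \<in> strat_set \<Gamma> \<omega>" using x Inner by simp
  have ne: "nodes \<omega> \<noteq> {}" using Inner by blast
  obtain m z W where m: "\<Gamma> x = Some (TArrow (PdGraft m) z)" "fmdom' m = nodes \<omega>"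
    "wf_faces \<Gamma> (PdGraft m) z (popet_of \<omega>) W"
    using strat_set_graft[OF wf \<omega> x ne] by metis
  obtain xi xj where xs: "fmlookup m p = Some xi" "fmlookup m (p \<cdot> Addr [q]) = Some xj"
    using m(2) Inner by (metis fmlookup_dom'_iff)
  then obtain y where "var_tgt \<Gamma> xj = Some y" "var_src \<Gamma> q xi = Some y"
    using m(3) unfolding wf_faces_def pd.case by blast
  then show ?thesis using Inner xs m(1) by (simp add: var_src_def[of _ _ x])
next
  case (Glob1 n \<omega>)
  obtain k where "n = Suc (Suc k)" using two_le_Suc[OF \<open>n \<ge> 2\<close>] by blast
  then have \<omega>: "opetope (Suc (Suc k)) \<omega>" using Glob1 by simp
  have x: "x \<in> strat_set \<Gamma> \<omega>" using x Glob1 by simp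
  have ne: "nodes \<omega> \<noteq> {}" using nondegenerate_root[OF \<omega>] Glob1 by blast
  obtain m z W where m: "\<Gamma> x = Some (TArrow (PdGraft m) z)" "wf_faces \<Gamma> (PdGraft m) z (popet_of \<omega>) W"
    using strat_set_graft[OF wf \<omega> x ne] by metis
  then obtain x0 y where "fmlookup m \<epsilon> = Some x0" "var_tgt \<Gamma> x0 = Some y" "var_tgt \<Gamma> z = Some y"
    using opetope_preopetope[OF \<omega>] unfolding wf_faces_def pd.case by blast
  then show ?thesis using Glob1 m(1) by (simp add: var_src_def[of _ _ x] var_tgt_def[of _ x])
next
  case (Glob2 n \<omega> p q)
  obtain k where "n = Suc (Suc k)" using two_le_Suc[OF \<open>n \<ge> 2\<close>] by blast
  then have \<omega>: "opetope (Suc (Suc k)) \<omega>" using Glob2 by simp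
  have x: "x \<in> strat_set \<Gamma> \<omega>" using x Glob2 by simp
  have ne: "nodes \<omega> \<noteq> {}" using Glob2 by blast
  obtain m z W where m: "\<Gamma> x = Some (TArrow (PdGraft m) z)" "fmdom' m = nodes \<omega>"
    "sequent W (popet_of \<omega>) (popet_of (tgt \<omega>))" "wf_faces \<Gamma> (PdGraft m) z (popet_of \<omega>) W"
    using strat_set_graft[OF wf \<omega> x ne] by metis
  have "fst ` W = leaves \<omega>" using sequent_regular[OF m(3)] leaves_popet_of[OF \<omega>] unfolding regular_def by simp
  then obtain r where r: "(p \<cdot> Addr [q], r) \<in> W" using Glob2 mem_fst_image by metis
  then obtain xa y where "fmlookup m p = Some xa" "var_src \<Gamma> q xa = Some y" "var_src \<Gamma> r z = Some y"
    using m(2,4) Glob2 opetope_preopetope[OF \<omega>] unfolding wf_faces_def pd.case by blast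
  then show ?thesis
    using Glob2 m(1) sequent_tgt(2)[OF \<omega> m(3) r] by (simp add: var_src_def[of _ _ x] var_tgt_def[of _ x])
next
  case (Degen n \<omega>)
  obtain k where "n = Suc (Suc k)" using two_le_Suc[OF \<open>n \<ge> 2\<close>] by blast
  then have \<omega>: "opetope (Suc (Suc k)) \<omega>" using Degen by simp
  obtain \<phi> where \<phi>: "\<omega> = OEdge \<phi>" using Degen by (auto simp: degenerate_def)
  have x: "x \<in> strat_set \<Gamma> \<omega>" using x Degen by simp
  obtain P z W where P: "\<Gamma> x = Some (TArrow P z)" "pd_shape \<Gamma> P (popet_of \<omega>)" "wf_faces \<Gamma> P z (popet_of \<omega>) W"
    using strat_set_arrow[OF wf \<omega> x] by metis
  obtain y where y: "P = PdDegen y" using P(2) \<phi> by (cases P) (auto simp: pd_shape_PdGraft)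
  then have "\<Gamma> z = Some (TArrow (PdGraft (fmupd \<epsilon> y fmempty)) y)" using P(3) unfolding wf_faces_def by simp
  then show ?thesis using Degen P(1) by (simp add: var_src_def var_tgt_def)
qed

lemma path_act_eq:
  assumes wf: "wf_ctxt \<Gamma>"
  shows "path_eq \<alpha> \<omega> u v \<Longrightarrow> x \<in> strat_set \<Gamma> \<omega> \<Longrightarrow> path_act \<Gamma> u x = path_act \<Gamma> v x"
proof (induction rule: path_eq.induct)
  case (path_eq_rel u v a b)
  obtain \<beta> where \<beta>: "is_path \<beta> a \<omega>" "is_path \<alpha> (u @ b) \<beta>" using is_path_appendD path_eq_rel(2) by blast
  obtain g h where u: "u = [g, h]" using opet_rel_shape[OF path_eq_rel(1)] by blast
  then have "gen_cod (hd u) = \<beta>" using \<beta>(2) by (simp add: is_path_Cons)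
  then have "path_act \<Gamma> u (path_act \<Gamma> a x) = path_act \<Gamma> v (path_act \<Gamma> a x)"
    using path_act_rel[OF wf path_eq_rel(1)] path_act_in[OF wf \<beta>(1) path_eq_rel(4)] by simp
  then show ?case by (simp add: path_act_append)
qed auto

section \<open>The stratification functor\<close>

lemma strat_obj_on_obj [simp]: "opetope n \<omega> \<Longrightarrow> on_obj (strat_obj \<Gamma>) \<omega> = strat_set \<Gamma> \<omega>"
  unfolding strat_obj_def by auto

text \<open>The choice of a representative in \<open>strat_obj\<close> is harmless because
  equivalent paths act alike.\<close>

lemma strat_obj_on_mor:
  assumes wf: "wf_ctxt \<Gamma>" and u: "is_path \<alpha> u \<omega>"
  shows "on_mor (strat_obj \<Gamma>) (path_class \<alpha> \<omega> u) =
    (strat_set \<Gamma> \<omega>, \<lambda>x\<in>strat_set \<Gamma> \<omega>. path_act \<Gamma> u x, strat_set \<Gamma> \<alpha>)"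
proof -
  define v where "v = (SOME v. v \<in> {v. path_eq \<alpha> \<omega> u v})"
  have "v \<in> {v. path_eq \<alpha> \<omega> u v}"
    unfolding v_def by (rule someI[of _ u]) (simp add: path_eq_refl[OF u])
  then have "path_act \<Gamma> v x = path_act \<Gamma> u x" if "x \<in> strat_set \<Gamma> \<omega>" for x
    using path_act_eq[OF wf _ that] by simp
  moreover have "path_class \<alpha> \<omega> u \<in> Mor opet_cat" unfolding Mor_opet_cat using u by blast
  moreover from this have "on_mor (strat_obj \<Gamma>) (path_class \<alpha> \<omega> u) =
      (strat_set \<Gamma> \<omega>, \<lambda>x\<in>strat_set \<Gamma> \<omega>. path_act \<Gamma> v x, strat_set \<Gamma> \<alpha>)"
    unfolding strat_obj_def v_def path_class_def by simp
  ultimately show ?thesis by (simp cong: restrict_cong)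
qed

lemma presheaf_strat_obj:
  assumes wf: "wf_ctxt \<Gamma>"
  shows "presheaf (strat_obj \<Gamma>)"
  unfolding is_functor_def
proof (intro conjI ballI allI impI)
  fix \<omega> assume "\<omega> \<in> Obj (op_cat opet_cat)"
  then obtain n where n: "opetope n \<omega>" by auto
  then have "is_path \<omega> [] \<omega>" by (auto simp: is_path_Nil)
  then show "on_mor (strat_obj \<Gamma>) (Ident (op_cat opet_cat) \<omega>) = Ident set_cat (on_obj (strat_obj \<Gamma>) \<omega>)"
    using strat_obj_on_mor[OF wf] n by simp
next
  fix f \<omega> \<alpha> assume "in_hom (op_cat opet_cat) f \<omega> \<alpha>"
  then obtain u where u: "is_path \<alpha> u \<omega>" "f = path_class \<alpha> \<omega> u" using in_hom_opet_cat by auto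
  obtain n m where "opetope n \<alpha>" "opetope m \<omega>" using is_path_opetope[OF u(1)] by blast
  then show "in_hom set_cat (on_mor (strat_obj \<Gamma>) f) (on_obj (strat_obj \<Gamma>) \<omega>) (on_obj (strat_obj \<Gamma>) \<alpha>)"
    unfolding in_hom_set_cat u(2) strat_obj_on_mor[OF wf u(1)] using path_act_in[OF wf u(1)] by auto
next
  fix f g \<omega> \<beta> \<alpha> assume "in_hom (op_cat opet_cat) f \<omega> \<beta>" "in_hom (op_cat opet_cat) g \<beta> \<alpha>"
  then obtain u v where u: "is_path \<beta> u \<omega>" "f = path_class \<beta> \<omega> u" and v: "is_path \<alpha> v \<beta>" "g = path_class \<alpha> \<beta> v"
    using in_hom_opet_cat by auto
  have "compose (strat_set \<Gamma> \<omega>) (\<lambda>x\<in>strat_set \<Gamma> \<beta>. path_act \<Gamma> v x) (\<lambda>x\<in>strat_set \<Gamma> \<omega>. path_act \<Gamma> u x) =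
      (\<lambda>x\<in>strat_set \<Gamma> \<omega>. path_act \<Gamma> (u @ v) x)"
    using path_act_in[OF wf u(1)] by (auto simp: compose_def path_act_append fun_eq_iff)
  then show "on_mor (strat_obj \<Gamma>) (Comp (op_cat opet_cat) g f) =
      Comp set_cat (on_mor (strat_obj \<Gamma>) g) (on_mor (strat_obj \<Gamma>) f)"
    unfolding u(2) v(2) using Comp_opet_cat[OF u(1) v(1)] strat_obj_on_mor[OF wf] u(1) v(1)
      is_path_append[OF u(1) v(1)] by simp
qed simp

lemma gact_strat_obj:
  assumes "wf_ctxt \<Gamma>" "gen_ok g" "x \<in> strat_set \<Gamma> (gen_cod g)"
  shows "gact (strat_obj \<Gamma>) g x = gen_act \<Gamma> g x"
  unfolding act_def strat_obj_on_mor[OF assms(1) is_path_gen[OF assms(2)]] using assms(3) by simp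

text \<open>A variable lies over only one opetope, so the set of all cells injects into the finite
  domain of the context.\<close>

lemma strat_obj_fin:
  assumes wf: "wf_ctxt \<Gamma>"
  shows "strat_obj \<Gamma> \<in> Obj fin_opetopic_sets"
proof -
  let ?E = "SIGMA \<omega>:Obj opet_cat. on_obj (strat_obj \<Gamma>) \<omega>"
  have "inj_on snd ?E"
    by (rule inj_onI) (auto dest: strat_set_unique)
  moreover have "snd ` ?E \<subseteq> dom \<Gamma>" by (auto simp: strat_set_def)
  moreover have "finite (dom \<Gamma>)" using wf unfolding wf_ctxt_def by blast
  ultimately have "finite ?E" using inj_on_finite by blast
  moreover have "strat_obj \<Gamma> \<in> Obj opetopic_sets"
    unfolding opetopic_sets_simps using presheaf_strat_obj[OF wf] by (simp add: strat_obj_def)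
  ultimately show ?thesis unfolding fin_opetopic_sets_def by simp
qed

section \<open>Morphisms of contexts as maps of presheaves\<close>

lemma is_ctx_mor_cong:
  assumes "wf_ctxt \<Gamma>" "is_ctx_mor \<Upsilon> \<sigma> \<Gamma>" "\<And>x. x \<in> dom \<Gamma> \<Longrightarrow> \<sigma> x = \<sigma>' x"
  shows "is_ctx_mor \<Upsilon> \<sigma>' \<Gamma>"
  unfolding is_ctx_mor_def
proof (intro allI impI)
  fix x T assume x: "\<Gamma> x = Some T"
  \<comment> \<open>Types mention only variables of the context, so the values of
    \<open>\<sigma>\<close> elsewhere do not matter. This allows extensional
    representatives.\<close>
  have "map_ty \<sigma> T = map_ty \<sigma>' T"
    using wf_ctxt_vars[OF assms(1) x] assms(3) by (intro ty.map_cong0) blast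
  moreover have "\<sigma> x = \<sigma>' x" using x assms(3) by blast
  moreover have "\<Upsilon> (\<sigma> x) = Some (map_ty \<sigma> T)" using assms(2) x unfolding is_ctx_mor_def by blast
  ultimately show "\<Upsilon> (\<sigma>' x) = Some (map_ty \<sigma>' T)" by simp
qed

lemma is_ctx_mor_dom: "is_ctx_mor \<Upsilon> \<sigma> \<Gamma> \<Longrightarrow> x \<in> dom \<Gamma> \<Longrightarrow> \<sigma> x \<in> dom \<Upsilon>"
  unfolding is_ctx_mor_def by blast

lemma is_ctx_mor_id: "is_ctx_mor \<Gamma> (\<lambda>x. x) \<Gamma>"
  unfolding is_ctx_mor_def by (simp add: ty.map_ident)

lemma is_ctx_mor_comp: "is_ctx_mor \<Upsilon> \<sigma> \<Gamma> \<Longrightarrow> is_ctx_mor \<Gamma> \<tau> \<Delta> \<Longrightarrow> is_ctx_mor \<Upsilon> (\<sigma> \<circ> \<tau>) \<Delta>"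
  unfolding is_ctx_mor_def by (simp add: ty.map_comp)

lemma ctx_cat_simps:
  "Obj (ctx_cat V) = {\<Gamma>. ctxt V \<Gamma>}"
  "(\<Upsilon>, \<sigma>, \<Gamma>) \<in> Mor (ctx_cat V) \<longleftrightarrow> ctxt V \<Upsilon> \<and> ctxt V \<Gamma> \<and> is_ctx_mor \<Upsilon> \<sigma> \<Gamma> \<and> \<sigma> \<in> extensional (dom \<Gamma>)"
  "Dom (ctx_cat V) (\<Upsilon>, \<sigma>, \<Gamma>) = \<Upsilon>" "Cod (ctx_cat V) (\<Upsilon>, \<sigma>, \<Gamma>) = \<Gamma>"
  "Ident (ctx_cat V) \<Gamma> = (\<Gamma>, \<lambda>x\<in>dom \<Gamma>. x, \<Gamma>)"
  "Comp (ctx_cat V) (\<Gamma>, \<tau>, \<Delta>) (\<Upsilon>, \<sigma>, \<Gamma>') = (\<Upsilon>, \<lambda>x\<in>dom \<Delta>. \<sigma> (\<tau> x), \<Delta>)"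
  unfolding ctx_cat_def by auto

lemma in_hom_ctx_cat: "in_hom (ctx_cat V) f \<Upsilon> \<Gamma> \<longleftrightarrow>
    (\<exists>\<sigma>. f = (\<Upsilon>, \<sigma>, \<Gamma>) \<and> ctxt V \<Upsilon> \<and> ctxt V \<Gamma> \<and> is_ctx_mor \<Upsilon> \<sigma> \<Gamma> \<and> \<sigma> \<in> extensional (dom \<Gamma>))"
  by (cases f) (auto simp: in_hom_def ctx_cat_simps(2-4))

lemma is_category_ctx_cat: "is_category (ctx_cat V)"
  unfolding is_category_def
proof (intro conjI allI ballI impI)
  fix f assume "f \<in> Mor (ctx_cat V)"
  then show "Dom (ctx_cat V) f \<in> Obj (ctx_cat V)" "Cod (ctx_cat V) f \<in> Obj (ctx_cat V)"
    by (cases f, simp add: ctx_cat_simps(1-4))+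
next
  fix \<Gamma> assume "\<Gamma> \<in> Obj (ctx_cat V)"
  then have \<Gamma>: "ctxt V \<Gamma>" by (simp add: ctx_cat_simps(1))
  then have "is_ctx_mor \<Gamma> (\<lambda>x\<in>dom \<Gamma>. x) \<Gamma>"
    using is_ctx_mor_cong[OF _ is_ctx_mor_id] ctxt_wf(1) by fastforce
  then show "in_hom (ctx_cat V) (Ident (ctx_cat V) \<Gamma>) \<Gamma> \<Gamma>"
    unfolding in_hom_ctx_cat ctx_cat_simps(5) using \<Gamma> by simp
next
  fix f g \<Upsilon> \<Gamma> \<Delta> assume "in_hom (ctx_cat V) f \<Upsilon> \<Gamma>" "in_hom (ctx_cat V) g \<Gamma> \<Delta>"
  then obtain \<sigma> \<tau> where f: "f = (\<Upsilon>, \<sigma>, \<Gamma>)" "ctxt V \<Upsilon>" "is_ctx_mor \<Upsilon> \<sigma> \<Gamma>"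
    and g: "g = (\<Gamma>, \<tau>, \<Delta>)" "ctxt V \<Delta>" "is_ctx_mor \<Gamma> \<tau> \<Delta>"
    unfolding in_hom_ctx_cat by blast
  have "is_ctx_mor \<Upsilon> (\<lambda>x\<in>dom \<Delta>. \<sigma> (\<tau> x)) \<Delta>"
    using is_ctx_mor_cong[OF _ is_ctx_mor_comp[OF f(3) g(3)]] ctxt_wf(1)[OF g(2)] by simp
  then show "in_hom (ctx_cat V) (Comp (ctx_cat V) g f) \<Upsilon> \<Delta>"
    unfolding in_hom_ctx_cat f(1) g(1) ctx_cat_simps(6) using f(2) g(2) by simp
next
  fix f \<Upsilon> \<Gamma> assume "in_hom (ctx_cat V) f \<Upsilon> \<Gamma>"
  then obtain \<sigma> where f: "f = (\<Upsilon>, \<sigma>, \<Gamma>)" "is_ctx_mor \<Upsilon> \<sigma> \<Gamma>" "\<sigma> \<in> extensional (dom \<Gamma>)"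
    unfolding in_hom_ctx_cat by blast
  show "Comp (ctx_cat V) f (Ident (ctx_cat V) \<Upsilon>) = f"
    unfolding f(1) ctx_cat_simps(5,6) using is_ctx_mor_dom[OF f(2)] f(3)
    by (auto simp: fun_eq_iff extensional_def)
  show "Comp (ctx_cat V) (Ident (ctx_cat V) \<Gamma>) f = f"
    unfolding f(1) ctx_cat_simps(5,6) using f(3) by (auto simp: fun_eq_iff extensional_def)
next
  fix f g h \<Upsilon> \<Gamma> \<Delta> \<Xi>
  assume "in_hom (ctx_cat V) f \<Upsilon> \<Gamma>" "in_hom (ctx_cat V) g \<Gamma> \<Delta>" "in_hom (ctx_cat V) h \<Delta> \<Xi>"
  then obtain \<sigma> \<tau> \<upsilon> where f: "f = (\<Upsilon>, \<sigma>, \<Gamma>)" and g: "g = (\<Gamma>, \<tau>, \<Delta>)"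
    and h: "h = (\<Delta>, \<upsilon>, \<Xi>)" "is_ctx_mor \<Delta> \<upsilon> \<Xi>"
    unfolding in_hom_ctx_cat by blast
  show "Comp (ctx_cat V) h (Comp (ctx_cat V) g f) = Comp (ctx_cat V) (Comp (ctx_cat V) h g) f"
    unfolding f g h(1) ctx_cat_simps(6) using is_ctx_mor_dom[OF h(2)] by (auto simp: fun_eq_iff)
qed

lemma strat_set_mor:
  assumes "is_ctx_mor \<Upsilon> \<sigma> \<Gamma>" "opetope n \<omega>" "x \<in> strat_set \<Gamma> \<omega>"
  shows "\<sigma> x \<in> strat_set \<Upsilon> \<omega>"
  using assms(3) shape_ctx_mor(1)[OF assms(1)] is_ctx_mor_dom[OF assms(1)]
  by (simp add: mem_strat_set[OF assms(2)])

lemma ctx_mor_faces: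
  assumes "is_ctx_mor \<Upsilon> \<sigma> \<Gamma>"
  shows "var_tgt \<Gamma> x = Some z \<Longrightarrow> var_tgt \<Upsilon> (\<sigma> x) = Some (\<sigma> z)"
    and "var_src \<Gamma> p x = Some z \<Longrightarrow> var_src \<Upsilon> p (\<sigma> x) = Some (\<sigma> z)"
proof -
  have *: "\<Upsilon> (\<sigma> x) = Some (map_ty \<sigma> T)" if "\<Gamma> x = Some T" for T
    using assms that unfolding is_ctx_mor_def by blast
  show "var_tgt \<Gamma> x = Some z \<Longrightarrow> var_tgt \<Upsilon> (\<sigma> x) = Some (\<sigma> z)"
    unfolding var_tgt_def using * by (auto split: option.splits ty.splits)
  show "var_src \<Gamma> p x = Some z \<Longrightarrow> var_src \<Upsilon> p (\<sigma> x) = Some (\<sigma> z)"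
    unfolding var_src_def using * by (auto split: option.splits ty.splits pd.splits)
qed

lemma ctx_mor_gen_act:
  assumes \<sigma>: "is_ctx_mor \<Upsilon> \<sigma> \<Gamma>" and wf: "wf_ctxt \<Gamma>" and g: "gen_ok g" and x: "x \<in> strat_set \<Gamma> (gen_cod g)"
  shows "\<sigma> (gen_act \<Gamma> g x) = gen_act \<Upsilon> g (\<sigma> x)"
proof -
  obtain n where n: "opetope (Suc n) (gen_cod g)" using gen_ok_dim g by blast
  show ?thesis
  proof (cases g)
    case (GTgt \<omega>)
    then show ?thesis
      using ctx_mor_faces(1)[OF \<sigma>] gen_act_tgt(1)[OF wf n x] by simp
  next
    case (GSrc \<omega> p)
    then show ?thesis
      using ctx_mor_faces(2)[OF \<sigma>] gen_act_src(1)[OF wf n x, of p] g by simp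
  qed
qed

text \<open>Puts the components into the form produced by \<open>nat_transI\<close>.\<close>

lemma strat_mor_eq: "strat_mor (\<Upsilon>, \<sigma>, \<Gamma>) = (strat_obj \<Gamma>,
    \<lambda>\<omega>\<in>Obj opet_cat. (on_obj (strat_obj \<Gamma>) \<omega>, \<lambda>x\<in>on_obj (strat_obj \<Gamma>) \<omega>. \<sigma> x, on_obj (strat_obj \<Upsilon>) \<omega>),
    strat_obj \<Upsilon>)"
  unfolding strat_mor_def prod.case by (rule arg_cong[where f = "\<lambda>t. (_, t, _)"], rule restrict_ext) auto

lemma strat_mor_hom:
  assumes "wf_ctxt \<Upsilon>" "wf_ctxt \<Gamma>" "is_ctx_mor \<Upsilon> \<sigma> \<Gamma>"
  shows "in_hom fin_opetopic_sets (strat_mor (\<Upsilon>, \<sigma>, \<Gamma>)) (strat_obj \<Gamma>) (strat_obj \<Upsilon>)"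
proof -
  have "is_nat_trans (op_cat opet_cat) set_cat (strat_obj \<Gamma>) (strat_obj \<Upsilon>)
    (\<lambda>\<omega>\<in>Obj opet_cat. (on_obj (strat_obj \<Gamma>) \<omega>, \<lambda>x\<in>on_obj (strat_obj \<Gamma>) \<omega>. \<sigma> x, on_obj (strat_obj \<Upsilon>) \<omega>))"
  proof (rule nat_transI[OF presheaf_strat_obj[OF assms(2)] presheaf_strat_obj[OF assms(1)], where \<eta> = "\<lambda>_. \<sigma>"])
    fix n \<omega> x assume "opetope n \<omega>" "x \<in> on_obj (strat_obj \<Gamma>) \<omega>"
    then show "\<sigma> x \<in> on_obj (strat_obj \<Upsilon>) \<omega>" using strat_set_mor[OF assms(3)] by simp
  next
    fix g x assume g: "gen_ok g" "x \<in> on_obj (strat_obj \<Gamma>) (gen_cod g)"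
    obtain n where n: "opetope (Suc n) (gen_cod g)" using gen_ok_dim g(1) by blast
    have x: "x \<in> strat_set \<Gamma> (gen_cod g)" using g(2) n by simp
    show "\<sigma> (gact (strat_obj \<Gamma>) g x) = gact (strat_obj \<Upsilon>) g (\<sigma> x)"
      unfolding gact_strat_obj[OF assms(2) g(1) x] gact_strat_obj[OF assms(1) g(1) strat_set_mor[OF assms(3) n x]]
      using ctx_mor_gen_act[OF assms(3,2) g(1) x] .
  qed
  then show ?thesis
    unfolding in_hom_fin_opetopic_sets strat_mor_eq
    using strat_obj_fin[OF assms(1)] strat_obj_fin[OF assms(2)] by simp
qed

lemma fin_opetopic_sets_simps:
  "Ident fin_opetopic_sets X = (X, \<lambda>\<omega>\<in>Obj opet_cat. Ident set_cat (on_obj X \<omega>), X)"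
  "Comp fin_opetopic_sets (Y, \<theta>, Z) (X, \<eta>, Y') = (X, \<lambda>\<omega>\<in>Obj opet_cat. Comp set_cat (\<theta> \<omega>) (\<eta> \<omega>), Z)"
  unfolding fin_opetopic_sets_def opetopic_sets_def full_subcat_simps functor_cat_simps by simp_all

lemma is_functor_stratification: "is_functor (op_cat (ctx_cat V)) fin_opetopic_sets stratification"
  unfolding is_functor_def stratification_def functr.simps
proof (intro conjI ballI allI impI)
  fix \<Gamma> assume "\<Gamma> \<in> Obj (op_cat (ctx_cat V))"
  then have wf: "wf_ctxt \<Gamma>" using ctxt_wf(1) by (auto simp: ctx_cat_simps(1))
  show "strat_obj \<Gamma> \<in> Obj fin_opetopic_sets" using strat_obj_fin[OF wf] .
  have "dom \<Gamma> \<inter> strat_set \<Gamma> \<omega> = strat_set \<Gamma> \<omega>" for \<omega> by (auto simp: strat_set_def)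
  then show "strat_mor (Ident (op_cat (ctx_cat V)) \<Gamma>) = Ident fin_opetopic_sets (strat_obj \<Gamma>)"
    unfolding op_cat_simps ctx_cat_simps(5) fin_opetopic_sets_simps(1) strat_mor_eq
    by (simp, intro restrict_ext) auto
next
  fix f \<Gamma> \<Upsilon> assume "in_hom (op_cat (ctx_cat V)) f \<Gamma> \<Upsilon>"
  then obtain \<sigma> where f: "f = (\<Upsilon>, \<sigma>, \<Gamma>)" "ctxt V \<Upsilon>" "ctxt V \<Gamma>" "is_ctx_mor \<Upsilon> \<sigma> \<Gamma>"
    unfolding in_hom_op in_hom_ctx_cat by blast
  then show "in_hom fin_opetopic_sets (strat_mor f) (strat_obj \<Gamma>) (strat_obj \<Upsilon>)"
    using strat_mor_hom[OF _ _ f(4)] ctxt_wf(1) by blast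
next
  fix f g \<Gamma> \<Upsilon> \<Xi> assume "in_hom (op_cat (ctx_cat V)) f \<Gamma> \<Upsilon>" "in_hom (op_cat (ctx_cat V)) g \<Upsilon> \<Xi>"
  then obtain \<sigma> \<tau> where f: "f = (\<Upsilon>, \<sigma>, \<Gamma>)" "is_ctx_mor \<Upsilon> \<sigma> \<Gamma>" and g: "g = (\<Xi>, \<tau>, \<Upsilon>)"
    unfolding in_hom_op in_hom_ctx_cat by blast
  have "(\<lambda>x\<in>dom \<Gamma> \<inter> strat_set \<Gamma> \<omega>. \<tau> (\<sigma> x)) =
      compose (strat_set \<Gamma> \<omega>) (\<lambda>x\<in>strat_set \<Upsilon> \<omega>. \<tau> x) (\<lambda>x\<in>strat_set \<Gamma> \<omega>. \<sigma> x)" if "opetope n \<omega>" for n \<omega>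
    using strat_set_mor[OF f(2) that] by (auto simp: compose_def fun_eq_iff strat_set_def)
  then show "strat_mor (Comp (op_cat (ctx_cat V)) g f) = Comp fin_opetopic_sets (strat_mor g) (strat_mor f)"
    unfolding op_cat_simps f(1) g ctx_cat_simps(6) strat_mor_eq fin_opetopic_sets_simps(2)
    by (simp, intro restrict_ext) auto
qed

text \<open>Every variable lies over some opetope, and the component there shows the value of
  \<open>\<sigma>\<close> on it.\<close>

lemma stratification_faithful:
  assumes f: "in_hom (op_cat (ctx_cat V)) f \<Gamma> \<Upsilon>" and g: "in_hom (op_cat (ctx_cat V)) g \<Gamma> \<Upsilon>"
    and eq: "strat_mor f = strat_mor g"
  shows "f = g"
proof -
  obtain \<sigma> where \<sigma>: "f = (\<Upsilon>, \<sigma>, \<Gamma>)" "ctxt V \<Gamma>" "\<sigma> \<in> extensional (dom \<Gamma>)"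
    using f unfolding in_hom_op in_hom_ctx_cat by blast
  obtain \<tau> where \<tau>: "g = (\<Upsilon>, \<tau>, \<Gamma>)" "\<tau> \<in> extensional (dom \<Gamma>)"
    using g unfolding in_hom_op in_hom_ctx_cat by blast
  have wf: "wf_ctxt \<Gamma>" using ctxt_wf(1)[OF \<sigma>(2)] by blast
  have "\<sigma> x = \<tau> x" if x: "x \<in> dom \<Gamma>" for x
  proof -
    obtain n \<omega> where \<omega>: "opetope n \<omega>" "x \<in> strat_set \<Gamma> \<omega>" using strat_set_exists[OF wf x] by blast
    have "\<exists>n. opetope n \<omega>" using \<omega>(1) by blast
    then have "fst (snd (fst (snd (strat_mor (\<Upsilon>, \<rho>, \<Gamma>))) \<omega>)) x = \<rho> x" for \<rho>
      unfolding strat_mor_eq using \<omega> by simp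
    from this[of \<sigma>] this[of \<tau>] show ?thesis using eq unfolding \<sigma>(1) \<tau>(1) by simp
  qed
  then have "\<sigma> = \<tau>" using \<sigma>(3) \<tau>(2) extensionalityI by blast
  then show ?thesis using \<sigma>(1) \<tau>(1) by simp
qed

text \<open>Naturality gives compatibility with sources and targets, and these determine the type of
  a variable. For a degenerate type the variable of its pasting diagram is recovered as the target
  of the target.\<close>

lemma stratification_full:
  assumes \<Gamma>: "ctxt V \<Gamma>" and \<Upsilon>: "ctxt V \<Upsilon>" and h: "in_hom fin_opetopic_sets h (strat_obj \<Gamma>) (strat_obj \<Upsilon>)"
  shows "\<exists>f. in_hom (op_cat (ctx_cat V)) f \<Gamma> \<Upsilon> \<and> strat_mor f = h"
proof -
  have wf: "wf_ctxt \<Gamma>" "wf_ctxt \<Upsilon>" using ctxt_wf(1) \<Gamma> \<Upsilon> by blast+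
  note P = presheaf_strat_obj[OF wf(1)] presheaf_strat_obj[OF wf(2)]
  obtain \<theta> where \<theta>: "h = (strat_obj \<Gamma>, \<theta>, strat_obj \<Upsilon>)" "\<theta> \<in> extensional (Obj opet_cat)"
    and nat: "is_nat_trans (op_cat opet_cat) set_cat (strat_obj \<Gamma>) (strat_obj \<Upsilon>) \<theta>"
    using h unfolding in_hom_fin_opetopic_sets by blast
  note nt = nat_transD[OF P nat]
  \<comment> \<open>\<open>SOME\<close> picks the only opetope over which \<open>x\<close>
    lies.\<close>
  define \<sigma> where "\<sigma> = (\<lambda>x\<in>dom \<Gamma>. fst (snd (\<theta> (SOME \<omega>. (\<exists>n. opetope n \<omega>) \<and> x \<in> strat_set \<Gamma> \<omega>))) x)"
  have \<sigma>: "\<sigma> x = fst (snd (\<theta> \<omega>)) x" if "opetope n \<omega>" "x \<in> strat_set \<Gamma> \<omega>" for n \<omega> x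
  proof -
    have "x \<in> dom \<Gamma>" using that(2) by (simp add: strat_set_def)
    moreover have "(SOME \<omega>. (\<exists>n. opetope n \<omega>) \<and> x \<in> strat_set \<Gamma> \<omega>) = \<omega>"
    proof (rule some_equality)
      show "(\<exists>n. opetope n \<omega>) \<and> x \<in> strat_set \<Gamma> \<omega>" using that by blast
    next
      fix \<omega>' assume "(\<exists>n. opetope n \<omega>') \<and> x \<in> strat_set \<Gamma> \<omega>'"
      then show "\<omega>' = \<omega>" using strat_set_unique[OF _ that(1) _ that(2)] by blast
    qed
    ultimately show ?thesis unfolding \<sigma>_def by simp
  qed
  have maps: "\<sigma> x \<in> strat_set \<Upsilon> \<omega>" if "opetope n \<omega>" "x \<in> strat_set \<Gamma> \<omega>" for n \<omega> x
    using nt(2)[OF that(1)] that \<sigma>[OF that] by auto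
  have comm: "\<sigma> (gen_act \<Gamma> g x) = gen_act \<Upsilon> g (\<sigma> x)" if g: "gen_ok g" and x: "x \<in> strat_set \<Gamma> (gen_cod g)" for g x
  proof -
    obtain n where n: "opetope (Suc n) (gen_cod g)" "opetope n (gen_dom g)" using gen_ok_dim g by blast
    have "\<sigma> (gen_act \<Gamma> g x) = fst (snd (\<theta> (gen_dom g))) (gact (strat_obj \<Gamma>) g x)"
      using \<sigma>[OF n(2) gen_act_in[OF wf(1) g x]] gact_strat_obj[OF wf(1) g x] by simp
    also have "\<dots> = gact (strat_obj \<Upsilon>) g (\<sigma> x)" using nt(3)[OF g, of x] x n(1) \<sigma>[OF n(1) x] by simp
    also have "\<dots> = gen_act \<Upsilon> g (\<sigma> x)" using gact_strat_obj[OF wf(2) g maps[OF n(1) x]] .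
    finally show ?thesis .
  qed
  have mor: "is_ctx_mor \<Upsilon> \<sigma> \<Gamma>"
    unfolding is_ctx_mor_def
  proof (intro allI impI)
    fix x T assume T: "\<Gamma> x = Some T"
    obtain n \<omega> where \<omega>: "opetope n \<omega>" "x \<in> strat_set \<Gamma> \<omega>" using strat_set_exists[OF wf(1)] T by blast
    note \<sigma>x = maps[OF \<omega>]
    show "\<Upsilon> (\<sigma> x) = Some (map_ty \<sigma> T)"
    proof (cases n)
      case 0
      then have "\<omega> = OPoint" using \<omega>(1) by (simp add: opetope_0_iff)
      then show ?thesis using \<sigma>x \<omega>(2) T by (simp add: strat_set_OPoint)
    next
      case (Suc k)
      then have \<omega>k: "opetope (Suc k) \<omega>" using \<omega>(1) by simp
      obtain P z where P: "\<Gamma> x = Some (TArrow P z)" "pd_shape \<Gamma> P (popet_of \<omega>)"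
        using strat_set_arrow[OF wf(1) \<omega>k \<omega>(2)] by metis
      obtain P' z' W' where P': "\<Upsilon> (\<sigma> x) = Some (TArrow P' z')" "pd_shape \<Upsilon> P' (popet_of \<omega>)"
        and z': "wf_faces \<Upsilon> P' z' (popet_of \<omega>) W'"
        using strat_set_arrow[OF wf(2) \<omega>k \<sigma>x] by metis
      have gt: "gen_ok (GTgt \<omega>)" using \<omega>k by (auto intro: exI[of _ "Suc k"])
      have z: "\<sigma> z = z'" using comm[OF gt, of x] \<omega>(2) P(1) P'(1) by (simp add: var_tgt_def)
      have "P' = map_pd \<sigma> P"
      proof (cases P)
        case (PdDegen y)
        then obtain p where "popet_of \<omega> = PDegen p" using P(2) by (auto simp: pd_shape_PdDegen)
        then obtain \<phi> where \<phi>: "\<omega> = OEdge \<phi>" by (cases \<omega>) auto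
        obtain y' where y': "P' = PdDegen y'" using P'(2) \<phi> by (cases P') (auto simp: pd_shape_PdGraft)
        obtain j where j: "k = Suc j" using \<omega>k unfolding \<phi> opetope_OEdge_iff by blast
        obtain Q w W where Q: "\<Gamma> x = Some (TArrow Q w)" "w \<in> strat_set \<Gamma> (tgt \<omega>)" "wf_faces \<Gamma> Q w (popet_of \<omega>) W"
          using strat_set_arrow[OF wf(1) \<omega>k \<omega>(2)] by metis
        have Qw: "Q = PdDegen y" "w = z" using Q(1) P(1) PdDegen by simp_all
        have zs: "z \<in> strat_set \<Gamma> (tgt \<omega>)" "\<Gamma> z = Some (TArrow (PdGraft (fmupd \<epsilon> y fmempty)) y)"
          using Q(2,3) Qw unfolding wf_faces_def by simp_all
        have zs': "\<Upsilon> z' = Some (TArrow (PdGraft (fmupd \<epsilon> y' fmempty)) y')"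
          using z' y' unfolding wf_faces_def by simp
        have "gen_ok (GTgt (tgt \<omega>))" using tgt_opetope[OF \<omega>k] j by (auto intro: exI[of _ "Suc j"])
        \<comment> \<open>This rests on the identification of the degenerate variable with the
          target of the target: a degenerate opetope has no source that would show it.\<close>
        then have "\<sigma> y = y'" using comm[of "GTgt (tgt \<omega>)" z] zs zs' z by (simp add: var_tgt_def)
        then show ?thesis using PdDegen y' by simp
      next
        case (PdGraft m)
        then obtain q where q: "popet_of \<omega> = PAssign q" "fmdom' m = fmdom' q" using P(2) by (auto simp: pd_shape_PdGraft)
        obtain m' where m': "P' = PdGraft m'" "fmdom' m' = fmdom' q"
          using P'(2) q(1) by (cases P') (auto simp: pd_shape_PdGraft pd_shape_PdDegen)
        have nodes: "nodes \<omega> = fmdom' m" using nodes_popet_of[OF \<omega>k] q by simp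
        have "fmlookup m' p = fmlookup (fmmap \<sigma> m) p" for p
        proof (cases "p \<in> nodes \<omega>")
          case True
          then obtain y y' where y: "fmlookup m p = Some y" "fmlookup m' p = Some y'"
            using nodes m'(2) q(2) by (metis fmlookup_dom'_iff)
          have gs: "gen_ok (GSrc \<omega> p)" using \<omega>k True by (auto intro: exI[of _ "Suc k"])
          have "\<sigma> y = y'" using comm[OF gs, of x] \<omega>(2) P(1) P'(1) PdGraft m'(1) y by (simp add: var_src_def)
          then show ?thesis using y by simp
        next
          case False
          then have "fmlookup m p = None" "fmlookup m' p = None"
            using nodes m'(2) q(2) fmdom'_notD by metis+
          then show ?thesis by simp
        qed
        then have "m' = fmmap \<sigma> m" by (rule fmap_ext)
        then show ?thesis using PdGraft m'(1) by simp
      qed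
      then show ?thesis using P(1) P'(1) T z by simp
    qed
  qed
  have ext: "\<sigma> \<in> extensional (dom \<Gamma>)" unfolding \<sigma>_def by simp
  have "in_hom (op_cat (ctx_cat V)) (\<Upsilon>, \<sigma>, \<Gamma>) \<Gamma> \<Upsilon>"
    unfolding in_hom_op in_hom_ctx_cat using \<Gamma> \<Upsilon> mor ext by blast
  moreover have "strat_mor (\<Upsilon>, \<sigma>, \<Gamma>) = h"
  proof -
    have "(\<lambda>\<omega>\<in>Obj opet_cat. (on_obj (strat_obj \<Gamma>) \<omega>, \<lambda>x\<in>on_obj (strat_obj \<Gamma>) \<omega>. \<sigma> x, on_obj (strat_obj \<Upsilon>) \<omega>)) = \<theta>"
    proof (rule extensionalityI)
      fix \<omega> assume "\<omega> \<in> Obj opet_cat"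
      then obtain n where n: "opetope n \<omega>" by auto
      have "(\<lambda>x\<in>strat_set \<Gamma> \<omega>. \<sigma> x) = fst (snd (\<theta> \<omega>))"
        using nt(2)[OF n] \<sigma>[OF n] n by (intro extensionalityI[where A = "strat_set \<Gamma> \<omega>"]) (auto simp: PiE_def)
      then show "(\<lambda>\<omega>\<in>Obj opet_cat. (on_obj (strat_obj \<Gamma>) \<omega>, \<lambda>x\<in>on_obj (strat_obj \<Gamma>) \<omega>. \<sigma> x,
          on_obj (strat_obj \<Upsilon>) \<omega>)) \<omega> = \<theta> \<omega>"
        using nt(1)[OF n] n by auto
    qed (use \<theta>(2) in auto)
    then show ?thesis unfolding strat_mor_eq \<theta>(1) by simp
  qed
  ultimately show ?thesis by blast
qed

section \<open>Every finite opetopic set is a stratification\<close>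

lemma popet_of_nondegenerate:
  assumes "opetope (Suc n) \<omega>" "\<not> degenerate \<omega>"
  obtains k where "popet_of \<omega> = PAssign k"
  using assms by (cases \<omega>) (auto simp: degenerate_def)

lemma nodes_OEdge [simp]: "nodes (OEdge \<phi>) = {}"
proof -
  have "subtree (OEdge \<phi>) a \<noteq> Some (ONode \<psi> ts)" for a \<psi> ts by (cases a) auto
  then show ?thesis by (simp add: nodes_def)
qed

definition family_mor :: "'a presheaf \<Rightarrow> (opet \<Rightarrow> 'a \<Rightarrow> 'a) \<Rightarrow> 'a presheaf \<Rightarrow> 'a presheaf_mor" where
  "family_mor X \<eta> Y = (X, \<lambda>\<omega>\<in>Obj opet_cat. (on_obj X \<omega>, \<lambda>x\<in>on_obj X \<omega>. \<eta> \<omega> x, on_obj Y \<omega>), Y)"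

lemma family_mor_hom:
  assumes X: "X \<in> Obj fin_opetopic_sets" and Y: "Y \<in> Obj fin_opetopic_sets"
    and maps: "\<And>n \<omega> x. opetope n \<omega> \<Longrightarrow> x \<in> on_obj X \<omega> \<Longrightarrow> \<eta> \<omega> x \<in> on_obj Y \<omega>"
    and comm: "\<And>g x. gen_ok g \<Longrightarrow> x \<in> on_obj X (gen_cod g) \<Longrightarrow> \<eta> (gen_dom g) (gact X g x) = gact Y g (\<eta> (gen_cod g) x)"
  shows "in_hom fin_opetopic_sets (family_mor X \<eta> Y) X Y"
proof -
  have "presheaf X" "presheaf Y"
    using X Y unfolding fin_opetopic_sets_def full_subcat_simps by (auto simp: opetopic_sets_simps)
  from nat_transI[OF this maps comm] show ?thesis
    unfolding in_hom_fin_opetopic_sets family_mor_def using X Y by simp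
qed

lemma family_mor_inverse:
  assumes "\<And>n \<omega> x. opetope n \<omega> \<Longrightarrow> x \<in> on_obj X \<omega> \<Longrightarrow> \<eta> \<omega> x \<in> on_obj Y \<omega>"
    and "\<And>n \<omega> x. opetope n \<omega> \<Longrightarrow> x \<in> on_obj X \<omega> \<Longrightarrow> \<theta> \<omega> (\<eta> \<omega> x) = x"
  shows "Comp fin_opetopic_sets (family_mor Y \<theta> X) (family_mor X \<eta> Y) = Ident fin_opetopic_sets X"
proof -
  have "compose (on_obj X \<omega>) (restrict (\<theta> \<omega>) (on_obj Y \<omega>)) (restrict (\<eta> \<omega>) (on_obj X \<omega>)) = (\<lambda>x\<in>on_obj X \<omega>. x)"
    if "opetope n \<omega>" for n \<omega>
    unfolding compose_def using assms[OF that] by (intro restrict_ext) simp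
  then show ?thesis
    unfolding family_mor_def fin_opetopic_sets_simps by (simp, intro restrict_ext) auto
qed

text \<open>Cells over different opetopes may be the same element of \<open>'a\<close>, so names are
  given to pairs of an opetope and a cell.\<close>

locale cell_naming =
  fixes X :: "'a presheaf" and V :: "'a set" and \<iota> :: "opet \<times> 'a \<Rightarrow> 'a"
  assumes X: "presheaf X"
    and inj: "inj_on \<iota> (SIGMA \<omega>:Obj opet_cat. on_obj X \<omega>)"
    and vars: "\<iota> ` (SIGMA \<omega>:Obj opet_cat. on_obj X \<omega>) \<subseteq> V"
begin

definition cells :: "(opet \<times> 'a) set" where
  "cells = (SIGMA \<omega>:Obj opet_cat. on_obj X \<omega>)"

lemma mem_cells: "opetope n \<omega> \<Longrightarrow> (\<omega>, x) \<in> cells \<longleftrightarrow> x \<in> on_obj X \<omega>"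
  unfolding cells_def by auto

abbreviation face :: "gen \<Rightarrow> 'a \<Rightarrow> opet \<times> 'a" where
  "face g x \<equiv> (gen_dom g, gact X g x)"

text \<open>A degenerate cell has no sources, so the variable of its pasting diagram is the name of
  the target of its target, as the degeneracy condition on contexts demands.\<close>

definition cell_pd :: "opet \<Rightarrow> 'a \<Rightarrow> 'a pd" where
  "cell_pd \<omega> x = (if degenerate \<omega> then PdDegen (\<iota> (face (GTgt (tgt \<omega>)) (gact X (GTgt \<omega>) x)))
     else PdGraft (fmap_of_graph {(p, \<iota> (face (GSrc \<omega> p) x)) | p. p \<in> nodes \<omega>}))"

definition cell_ty :: "opet \<Rightarrow> 'a \<Rightarrow> 'a ty" where
  "cell_ty \<omega> x = (if \<omega> = OPoint then TPoint else TArrow (cell_pd \<omega> x) (\<iota> (face (GTgt \<omega>) x)))"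

definition cell_ctx :: "(opet \<times> 'a) set \<Rightarrow> 'a ctx" where
  "cell_ctx S v = (if v \<in> \<iota> ` S then Some (case_prod cell_ty (inv_into cells \<iota> v)) else None)"

text \<open>Closure under faces makes the types in \<open>cell_ctx S\<close> refer to variables of
  \<open>cell_ctx S\<close>; for degenerate cells a face of a face is mentioned, which is covered
  too.\<close>

definition closed_cells :: "(opet \<times> 'a) set \<Rightarrow> bool" where
  "closed_cells S \<longleftrightarrow> S \<subseteq> cells \<and> (\<forall>g x. gen_ok g \<longrightarrow> (gen_cod g, x) \<in> S \<longrightarrow> face g x \<in> S)"

lemma inv_cells: "(\<omega>, x) \<in> cells \<Longrightarrow> inv_into cells \<iota> (\<iota> (\<omega>, x)) = (\<omega>, x)"
  using inj unfolding cells_def by (rule inv_into_f_f)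

lemma dom_cell_ctx [simp]: "dom (cell_ctx S) = \<iota> ` S"
  by (auto simp: cell_ctx_def dom_def)

lemma cell_ctx_cell:
  assumes "closed_cells S" "(\<omega>, x) \<in> S"
  shows "cell_ctx S (\<iota> (\<omega>, x)) = Some (cell_ty \<omega> x)"
proof -
  have "(\<omega>, x) \<in> cells" using assms unfolding closed_cells_def by blast
  then show ?thesis using assms(2) by (simp add: cell_ctx_def inv_cells)
qed

lemma cell_ctx_empty: "cell_ctx {} = Map.empty"
  by (simp add: cell_ctx_def fun_eq_iff)

lemma cell_ctx_insert:
  assumes "(\<omega>, x) \<in> cells"
  shows "cell_ctx (insert (\<omega>, x) S) = (cell_ctx S)(\<iota> (\<omega>, x) \<mapsto> cell_ty \<omega> x)"
  using inv_cells[OF assms] by (auto simp: cell_ctx_def fun_eq_iff)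

lemma cell_dim:
  assumes "closed_cells S" "(\<omega>, x) \<in> S"
  obtains n where "opetope n \<omega>" "x \<in> on_obj X \<omega>"
  using assms unfolding closed_cells_def cells_def by auto

lemma closed_face: "closed_cells S \<Longrightarrow> (gen_cod g, x) \<in> S \<Longrightarrow> gen_ok g \<Longrightarrow> face g x \<in> S"
  unfolding closed_cells_def by blast

lemma gen_ok_Suc: "opetope (Suc n) \<omega> \<Longrightarrow> gen_ok (GTgt \<omega>)"
    "opetope (Suc n) \<omega> \<Longrightarrow> p \<in> nodes \<omega> \<Longrightarrow> gen_ok (GSrc \<omega> p)"
  by (auto intro: exI[of _ "Suc n"])

lemma cell_pd_graft:
  assumes "opetope n \<omega>" "\<not> degenerate \<omega>"
  obtains m where "cell_pd \<omega> x = PdGraft m" "fmdom' m = nodes \<omega>"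
    "\<And>p. fmlookup m p = (if p \<in> nodes \<omega> then Some (\<iota> (face (GSrc \<omega> p) x)) else None)"
proof -
  define m where "m = fmap_of_graph {(p, \<iota> (face (GSrc \<omega> p) x)) | p. p \<in> nodes \<omega>}"
  have l: "fmlookup m p = (if p \<in> nodes \<omega> then Some (\<iota> (face (GSrc \<omega> p) x)) else None)" for p
    unfolding m_def by (rule fmlookup_fmap_of_set[OF finite_nodes[OF assms(1)]])
  have "fmdom' m = nodes \<omega>" by (rule set_eqI) (simp add: fmlookup_dom'_iff l)
  moreover have "cell_pd \<omega> x = PdGraft m" using assms(2) unfolding cell_pd_def m_def by simp
  ultimately show thesis using that l by blast
qed

lemma var_tgt_cell:
  assumes "closed_cells S" "(\<omega>, x) \<in> S" "opetope (Suc n) \<omega>"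
  shows "var_tgt (cell_ctx S) (\<iota> (\<omega>, x)) = Some (\<iota> (face (GTgt \<omega>) x))"
  using cell_ctx_cell[OF assms(1,2)] assms(3) by (auto simp: var_tgt_def cell_ty_def)

lemma var_src_cell:
  assumes "closed_cells S" "(\<omega>, x) \<in> S" "opetope (Suc n) \<omega>" "p \<in> nodes \<omega>"
  shows "var_src (cell_ctx S) p (\<iota> (\<omega>, x)) = Some (\<iota> (face (GSrc \<omega> p) x))"
proof -
  have "\<not> degenerate \<omega>" using assms(4) by (auto simp: degenerate_def)
  from cell_pd_graft[OF assms(3) this] obtain m where
    "cell_pd \<omega> x = PdGraft m" "fmlookup m p = Some (\<iota> (face (GSrc \<omega> p) x))"
    using assms(4) by metis
  then show ?thesis
    using cell_ctx_cell[OF assms(1,2)] assms(3) by (auto simp: var_src_def cell_ty_def)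
qed

text \<open>The target of a degenerate opetope has a single node, and (Degen) makes the source and
  the target of the cell \<open>y\<close> coincide; hence \<open>y\<close> has the type of a
  loop.\<close>

lemma degen_faces:
  assumes \<omega>: "opetope (Suc n) \<omega>" "\<omega> = OEdge \<phi>" and x: "x \<in> on_obj X \<omega>"
  defines "y \<equiv> gact X (GTgt \<omega>) x"
  shows "gen_ok (GTgt (tgt \<omega>))" "y \<in> on_obj X (tgt \<omega>)" "tgt (tgt \<omega>) = \<phi>"
    "cell_ty (tgt \<omega>) y = TArrow (PdGraft (fmupd \<epsilon> (\<iota> (face (GTgt (tgt \<omega>)) y)) fmempty)) (\<iota> (face (GTgt (tgt \<omega>)) y))"
proof -
  obtain k where k: "n = Suc k" using \<omega> by (auto simp: opetope_OEdge_iff)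
  have o: "opetope (Suc (Suc k)) \<omega>" "opetope (Suc k) (tgt \<omega>)" using \<omega>(1) tgt_opetope k by blast+
  note t = tgt_OEdge[OF o(1)[unfolded \<omega>(2)], folded \<omega>(2)]
  show ok: "gen_ok (GTgt (tgt \<omega>))" using gen_ok_Suc(1)[OF o(2)] .
  show "y \<in> on_obj X (tgt \<omega>)" unfolding y_def using gact_in[OF X gen_ok_Suc(1)[OF \<omega>(1)]] x by simp
  show "tgt (tgt \<omega>) = \<phi>" using t(3) .
  have nd: "\<not> degenerate (tgt \<omega>)" using t(1) by (auto simp: degenerate_def)
  have "opet_rel [GTgt \<omega>, GTgt (tgt \<omega>)] [GTgt \<omega>, GSrc (tgt \<omega>) \<epsilon>]"
    using opet_rel.Degen[OF o(1)] \<omega>(2) by (simp add: degenerate_def)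
  then have "gact X (GTgt (tgt \<omega>)) y = gact X (GSrc (tgt \<omega>) \<epsilon>) y" unfolding y_def
    by (rule gact_rel[OF X]) (use x ok gen_ok_Suc(1)[OF \<omega>(1)] gen_ok_Suc(2)[OF o(2)] t in simp_all)
  then have f: "face (GTgt (tgt \<omega>)) y = face (GSrc (tgt \<omega>) \<epsilon>) y" using t(2,3) by simp
  obtain m where m: "cell_pd (tgt \<omega>) y = PdGraft m"
    "\<And>p. fmlookup m p = (if p \<in> nodes (tgt \<omega>) then Some (\<iota> (face (GSrc (tgt \<omega>) p) y)) else None)"
    using cell_pd_graft[OF o(2) nd] by metis
  have "m = fmupd \<epsilon> (\<iota> (face (GTgt (tgt \<omega>)) y)) fmempty"
    unfolding f by (rule fmap_ext) (simp add: m(2) t(1))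
  moreover have "tgt \<omega> \<noteq> OPoint" using o(2) by auto
  ultimately show "cell_ty (tgt \<omega>) y = TArrow (PdGraft (fmupd \<epsilon> (\<iota> (face (GTgt (tgt \<omega>)) y)) fmempty))
      (\<iota> (face (GTgt (tgt \<omega>)) y))"
    unfolding cell_ty_def m(1) by simp
qed

text \<open>Only the faces of the cell are assumed to be in \<open>S\<close>, so the lemma serves
  for cells of \<open>S\<close> and for a cell about to be added. \<open>shapes\<close> is bounded
  by the dimension to fit the induction of \<open>var_shape_cell\<close>.\<close>

lemma pd_shape_cell_pd:
  assumes S: "closed_cells S" and \<omega>: "opetope (Suc n) \<omega>" and x: "x \<in> on_obj X \<omega>"
    and faces: "\<And>g. gen_ok g \<Longrightarrow> gen_cod g = \<omega> \<Longrightarrow> face g x \<in> S"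
    and shapes: "\<And>k \<alpha> y. k \<le> n \<Longrightarrow> opetope k \<alpha> \<Longrightarrow> (\<alpha>, y) \<in> S \<Longrightarrow> var_shape (cell_ctx S) (\<iota> (\<alpha>, y)) (popet_of \<alpha>)"
  shows "pd_shape (cell_ctx S) (cell_pd \<omega> x) (popet_of \<omega>)"
proof (cases "degenerate \<omega>")
  case True
  then obtain \<phi> where \<phi>: "\<omega> = OEdge \<phi>" by (auto simp: degenerate_def)
  obtain k where k: "n = Suc k" "opetope k \<phi>" using \<omega> \<phi> by (auto simp: opetope_OEdge_iff)
  note d = degen_faces[OF \<omega> \<phi> x]
  have "face (GTgt \<omega>) x \<in> S" using faces[OF gen_ok_Suc(1)[OF \<omega>]] by simp
  then have "face (GTgt (tgt \<omega>)) (gact X (GTgt \<omega>) x) \<in> S"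
    using closed_face[OF S _ d(1)] by simp
  then have "var_shape (cell_ctx S) (\<iota> (face (GTgt (tgt \<omega>)) (gact X (GTgt \<omega>) x))) (popet_of \<phi>)"
    using shapes[OF _ k(2)] k(1) d(3) by simp
  then show ?thesis using True \<phi> by (simp add: cell_pd_def pd_shape_PdDegen)
next
  case False
  obtain m where m: "cell_pd \<omega> x = PdGraft m" "fmdom' m = nodes \<omega>"
    "\<And>p. fmlookup m p = (if p \<in> nodes \<omega> then Some (\<iota> (face (GSrc \<omega> p) x)) else None)"
    using cell_pd_graft[OF \<omega> False, of x] by metis
  obtain k where k: "popet_of \<omega> = PAssign k" using popet_of_nondegenerate[OF \<omega> False] .
  have "var_shape (cell_ctx S) v f" if h: "fmlookup m p = Some v" "fmlookup k p = Some f" for p v f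
  proof -
    have p: "p \<in> nodes \<omega>" and v: "v = \<iota> (face (GSrc \<omega> p) x)"
      using h(1) unfolding m(3) by (simp_all split: if_splits)
    have "f = popet_of (src \<omega> p)" using psrc_popet_of[OF \<omega> p] h(2) k by simp
    moreover have "face (GSrc \<omega> p) x \<in> S" using faces[OF gen_ok_Suc(2)[OF \<omega> p]] by simp
    ultimately show ?thesis using shapes[OF le_refl src_opetope[OF \<omega> p]] v by simp
  qed
  moreover have "fmdom' m = fmdom' k" using m(2) nodes_popet_of[OF \<omega>] k by simp
  ultimately show ?thesis unfolding m(1) k pd_shape_PdGraft by blast
qed

lemma var_shape_cell:
  assumes S: "closed_cells S"
  shows "opetope n \<omega> \<Longrightarrow> (\<omega>, x) \<in> S \<Longrightarrow> var_shape (cell_ctx S) (\<iota> (\<omega>, x)) (popet_of \<omega>)"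
proof (induction n arbitrary: \<omega> x rule: less_induct)
  case (less n)
  note c = cell_ctx_cell[OF S less.prems(2)]
  have x: "x \<in> on_obj X \<omega>" using cell_dim[OF S less.prems(2)] by blast
  show ?case
  proof (cases n)
    case 0
    then have "\<omega> = OPoint" using less.prems(1) by (simp add: opetope_0_iff)
    then show ?thesis using c by (simp add: cell_ty_def var_shape_iff)
  next
    case (Suc k)
    have \<omega>: "opetope (Suc k) \<omega>" using less.prems(1) Suc by simp
    have "pd_shape (cell_ctx S) (cell_pd \<omega> x) (popet_of \<omega>)"
    proof (rule pd_shape_cell_pd[OF S \<omega> x])
      fix g assume "gen_ok g" "gen_cod g = \<omega>"
      then show "face g x \<in> S" using closed_face[OF S _ \<open>gen_ok g\<close>] less.prems(2) by simp
    next
      fix j \<alpha> y assume "j \<le> k" "opetope j \<alpha>" "(\<alpha>, y) \<in> S"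
      then show "var_shape (cell_ctx S) (\<iota> (\<alpha>, y)) (popet_of \<alpha>)" using less.IH[of j \<alpha> y] Suc by simp
    qed
    moreover have "cell_ty \<omega> x = TArrow (cell_pd \<omega> x) (\<iota> (face (GTgt \<omega>) x))"
      using \<omega> by (auto simp: cell_ty_def)
    ultimately show ?thesis using c var_shape_pd_shape.intros(2) by metis
  qed
qed

lemma pasting_cell_pd:
  assumes S: "closed_cells S" and ctxt: "ctxt V (cell_ctx S)" and \<omega>: "opetope (Suc n) \<omega>" and x: "x \<in> on_obj X \<omega>"
    and faces: "\<And>g. gen_ok g \<Longrightarrow> gen_cod g = \<omega> \<Longrightarrow> face g x \<in> S"
  shows "pasting V (cell_ctx S) (cell_pd \<omega> x)"
proof (cases "degenerate \<omega>")
  case True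
  then obtain \<phi> where \<phi>: "\<omega> = OEdge \<phi>" by (auto simp: degenerate_def)
  note d = degen_faces[OF \<omega> \<phi> x]
  have "face (GTgt \<omega>) x \<in> S" using faces[OF gen_ok_Suc(1)[OF \<omega>]] by simp
  then have "face (GTgt (tgt \<omega>)) (gact X (GTgt \<omega>) x) \<in> S" using closed_face[OF S _ d(1)] by simp
  then show ?thesis using True pasting_degen[OF ctxt] by (simp add: cell_pd_def)
next
  case False
  obtain m where m: "cell_pd \<omega> x = PdGraft m" "fmdom' m = nodes \<omega>"
    "\<And>p. fmlookup m p = (if p \<in> nodes \<omega> then Some (\<iota> (face (GSrc \<omega> p) x)) else None)"
    using cell_pd_graft[OF \<omega> False, of x] by metis
  obtain k where k: "popet_of \<omega> = PAssign k" using popet_of_nondegenerate[OF \<omega> False] .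
  have src: "face (GSrc \<omega> p) x \<in> S" if p: "p \<in> nodes \<omega>" for p using faces[OF gen_ok_Suc(2)[OF \<omega> p]] by simp
  show ?thesis unfolding m(1)
  proof (rule pasting_graft[OF ctxt])
    show "valid_popet (PAssign k)" unfolding valid_popet_def k[symmetric] using sequent_popet_of[OF \<omega>] by blast
    show "fmran' m \<subseteq> dom (cell_ctx S)"
      using src unfolding fmran'_def ran_def by (auto simp: m(3) split: if_splits)
    show "pd_shape (cell_ctx S) (PdGraft m) (PAssign k)"
      using pd_shape_cell_pd[OF S \<omega> x faces] var_shape_cell[OF S] unfolding m(1) k by blast
    show "\<forall>p q xi xj. fmlookup m p = Some xi \<longrightarrow> fmlookup m (p \<cdot> Addr [q]) = Some xj \<longrightarrow>
       (\<exists>z. var_tgt (cell_ctx S) xj = Some z \<and> var_src (cell_ctx S) q xi = Some z)"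
    proof (intro allI impI)
      fix p q xi xj assume "fmlookup m p = Some xi" "fmlookup m (p \<cdot> Addr [q]) = Some xj"
      then have p: "p \<in> nodes \<omega>" "p \<cdot> Addr [q] \<in> nodes \<omega>" and xi: "xi = \<iota> (face (GSrc \<omega> p) x)"
        and xj: "xj = \<iota> (face (GSrc \<omega> (p \<cdot> Addr [q])) x)"
        unfolding m(3) by (simp_all split: if_splits)
      \<comment> \<open>The arrow has only the node address \<open>\<epsilon>\<close>, so two
        adjacent nodes force dimension at least 2, where the relation (Inner) is available.\<close>
      have "n \<noteq> 0"
      proof
        assume "n = 0"
        then have "nodes \<omega> = {\<epsilon>}" using \<omega> by (simp add: opetope_1_iff nodes_def)
        then show False using p(2) by (cases p) simp
      qed
      then obtain j where j: "n = Suc j" by (cases n) auto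
      have o: "opetope (Suc (Suc j)) \<omega>" using \<omega> j by simp
      note i = src_inner[OF o p]
      have os: "opetope (Suc j) (src \<omega> p)" "opetope (Suc j) (src \<omega> (p \<cdot> Addr [q]))"
        using src_opetope[OF o] p by blast+
      have "opet_rel [GSrc \<omega> p, GSrc (src \<omega> p) q] [GSrc \<omega> (p \<cdot> Addr [q]), GTgt (src \<omega> (p \<cdot> Addr [q]))]"
        by (rule opet_rel.Inner[OF o _ p]) simp
      then have eq: "gact X (GSrc (src \<omega> p) q) (gact X (GSrc \<omega> p) x) =
          gact X (GTgt (src \<omega> (p \<cdot> Addr [q]))) (gact X (GSrc \<omega> (p \<cdot> Addr [q])) x)"
        by (rule gact_rel[OF X]) (use x i p gen_ok_Suc(2)[OF o] gen_ok_Suc(2)[OF os(1)] gen_ok_Suc(1)[OF os(2)] in simp_all)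
      have "var_src (cell_ctx S) q xi = Some (\<iota> (face (GSrc (src \<omega> p) q) (gact X (GSrc \<omega> p) x)))"
        using var_src_cell[OF S src[OF p(1), unfolded gen_dom.simps] os(1) i(1)] xi by simp
      moreover have "var_tgt (cell_ctx S) xj = Some (\<iota> (face (GTgt (src \<omega> (p \<cdot> Addr [q]))) (gact X (GSrc \<omega> (p \<cdot> Addr [q])) x)))"
        using var_tgt_cell[OF S src[OF p(2), unfolded gen_dom.simps] os(2)] xj by simp
      ultimately show "\<exists>z. var_tgt (cell_ctx S) xj = Some z \<and> var_src (cell_ctx S) q xi = Some z"
        using eq i(2) by simp
    qed
  qed
qed

text \<open>The relations (Glob1) and (Glob2) of the category act on the cell \<open>x\<close> of
  the presheaf and yield the coincidences of names that the context rule asks for.\<close>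

lemma glob_cell_pd:
  assumes S: "closed_cells S" and \<omega>: "opetope (Suc (Suc n)) \<omega>" and x: "x \<in> on_obj X \<omega>"
    and faces: "\<And>g. gen_ok g \<Longrightarrow> gen_cod g = \<omega> \<Longrightarrow> face g x \<in> S"
    and W: "sequent W (popet_of \<omega>) (popet_of (tgt \<omega>))" and P: "cell_pd \<omega> x = PdGraft m"
  defines "t \<equiv> \<iota> (face (GTgt \<omega>) x)"
  shows "\<exists>x0 z. fmlookup m \<epsilon> = Some x0 \<and> var_tgt (cell_ctx S) x0 = Some z \<and> var_tgt (cell_ctx S) t = Some z"
    and "a \<in> fmdom' m \<Longrightarrow> (a \<cdot> Addr [b], r) \<in> W \<Longrightarrow>
      \<exists>xa z. fmlookup m a = Some xa \<and> var_src (cell_ctx S) b xa = Some z \<and> var_src (cell_ctx S) r t = Some z"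
proof -
  have nd: "\<not> degenerate \<omega>" using P by (auto simp: cell_pd_def)
  have m: "fmdom' m = nodes \<omega>"
    "\<And>p. fmlookup m p = (if p \<in> nodes \<omega> then Some (\<iota> (face (GSrc \<omega> p) x)) else None)"
    using cell_pd_graft[OF \<omega> nd, of x] P pd.inject(2) by metis+
  have src: "face (GSrc \<omega> p) x \<in> S" if p: "p \<in> nodes \<omega>" for p using faces[OF gen_ok_Suc(2)[OF \<omega> p]] by simp
  have tgt: "face (GTgt \<omega>) x \<in> S" using faces[OF gen_ok_Suc(1)[OF \<omega>]] by simp
  have ot: "opetope (Suc n) (tgt \<omega>)" using tgt_opetope[OF \<omega>] .
  have e: "\<epsilon> \<in> nodes \<omega>" using nondegenerate_root[OF \<omega> nd] .
  have oe: "opetope (Suc n) (src \<omega> \<epsilon>)" using src_opetope[OF \<omega> e] .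
  have "opet_rel [GTgt \<omega>, GTgt (tgt \<omega>)] [GSrc \<omega> \<epsilon>, GTgt (src \<omega> \<epsilon>)]"
    by (rule opet_rel.Glob1[OF \<omega> _ nd]) simp
  then have "gact X (GTgt (tgt \<omega>)) (gact X (GTgt \<omega>) x) = gact X (GTgt (src \<omega> \<epsilon>)) (gact X (GSrc \<omega> \<epsilon>) x)"
    by (rule gact_rel[OF X]) (use x e tgt_tgt[OF \<omega> nd] gen_ok_Suc(1)[OF \<omega>] gen_ok_Suc(2)[OF \<omega> e]
        gen_ok_Suc(1)[OF ot] gen_ok_Suc(1)[OF oe] in simp_all)
  moreover have "var_tgt (cell_ctx S) t = Some (\<iota> (face (GTgt (tgt \<omega>)) (gact X (GTgt \<omega>) x)))"
    using var_tgt_cell[OF S tgt[unfolded gen_dom.simps] ot] unfolding t_def by simp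
  moreover have "var_tgt (cell_ctx S) (\<iota> (face (GSrc \<omega> \<epsilon>) x)) = Some (\<iota> (face (GTgt (src \<omega> \<epsilon>)) (gact X (GSrc \<omega> \<epsilon>) x)))"
    using var_tgt_cell[OF S src[OF e, unfolded gen_dom.simps] oe] by simp
  ultimately show "\<exists>x0 z. fmlookup m \<epsilon> = Some x0 \<and> var_tgt (cell_ctx S) x0 = Some z \<and> var_tgt (cell_ctx S) t = Some z"
    using e tgt_tgt[OF \<omega> nd] by (simp add: m(2))
  assume h: "a \<in> fmdom' m" "(a \<cdot> Addr [b], r) \<in> W"
  have a: "a \<in> nodes \<omega>" using h(1) m(1) by simp
  have l: "a \<cdot> Addr [b] \<in> leaves \<omega>"
    unfolding leaves_popet_of[OF \<omega>] using regular_leaf[OF sequent_regular[OF W] h(2)] .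
  have r: "wp \<omega> (a \<cdot> Addr [b]) = r" using sequent_tgt(2)[OF \<omega> W h(2)] .
  note s = src_tgt[OF \<omega> a l, unfolded r]
  have oa: "opetope (Suc n) (src \<omega> a)" using src_opetope[OF \<omega> a] .
  have "opet_rel [GTgt \<omega>, GSrc (tgt \<omega>) r] [GSrc \<omega> a, GSrc (src \<omega> a) b]"
    using opet_rel.Glob2[OF \<omega> _ nd a l] r by simp
  then have "gact X (GSrc (tgt \<omega>) r) (gact X (GTgt \<omega>) x) = gact X (GSrc (src \<omega> a) b) (gact X (GSrc \<omega> a) x)"
    by (rule gact_rel[OF X]) (use x a s gen_ok_Suc(1)[OF \<omega>] gen_ok_Suc(2)[OF \<omega> a]
        gen_ok_Suc(2)[OF ot] gen_ok_Suc(2)[OF oa] in simp_all)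
  moreover have "var_src (cell_ctx S) r t = Some (\<iota> (face (GSrc (tgt \<omega>) r) (gact X (GTgt \<omega>) x)))"
    using var_src_cell[OF S tgt[unfolded gen_dom.simps] ot s(2)] unfolding t_def by simp
  moreover have "var_src (cell_ctx S) b (\<iota> (face (GSrc \<omega> a) x)) = Some (\<iota> (face (GSrc (src \<omega> a) b) (gact X (GSrc \<omega> a) x)))"
    using var_src_cell[OF S src[OF a, unfolded gen_dom.simps] oa s(1)] by simp
  ultimately show "\<exists>xa z. fmlookup m a = Some xa \<and> var_src (cell_ctx S) b xa = Some z \<and> var_src (cell_ctx S) r t = Some z"
    using a s(3) by (simp add: m(2))
qed

lemma ctxt_insert_cell:
  assumes S: "closed_cells S" and ctxt: "ctxt V (cell_ctx S)"
    and x: "(\<omega>, x) \<in> cells" "(\<omega>, x) \<notin> S"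
    and faces: "\<And>g. gen_ok g \<Longrightarrow> gen_cod g = \<omega> \<Longrightarrow> face g x \<in> S"
  shows "ctxt V (cell_ctx (insert (\<omega>, x) S))"
proof -
  obtain n where n: "opetope n \<omega>" "x \<in> on_obj X \<omega>" using x(1) unfolding cells_def by auto
  have "\<iota> (\<omega>, x) \<notin> \<iota> ` S"
    using inj_on_image_mem_iff[OF inj, of "(\<omega>, x)" S] x S unfolding closed_cells_def cells_def by blast
  moreover have "\<iota> (\<omega>, x) \<in> V" using vars x(1) unfolding cells_def by blast
  ultimately have fresh: "\<iota> (\<omega>, x) \<in> V" "\<iota> (\<omega>, x) \<notin> dom (cell_ctx S)" by simp_all
  show ?thesis
  proof (cases n)
    case 0
    then have "cell_ty \<omega> x = TPoint" using n(1) by (simp add: opetope_0_iff cell_ty_def)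
    then show ?thesis unfolding cell_ctx_insert[OF x(1)] using ctxt_point[OF ctxt fresh] by simp
  next
    case (Suc k)
    have \<omega>: "opetope (Suc k) \<omega>" using n(1) Suc by simp
    obtain W where W: "sequent W (popet_of \<omega>) (popet_of (tgt \<omega>))"
      using sequent_popet_of[OF \<omega>] sequent_tgt(1)[OF \<omega>] by metis
    \<comment> \<open>The premises of \<open>ctxt_shift\<close> quantify over dimensions of the
      shape; such a dimension can only be that of \<open>\<omega>\<close>.\<close>
    have dim: "\<exists>l. k = Suc l" if h: "j \<ge> 2" "preopetope j (popet_of \<omega>)" for j
    proof -
      have "j = Suc k" using preopetope_unique[OF h(2) opetope_preopetope[OF \<omega>]] .
      then show ?thesis using h(1) by (cases k) auto
    qed
    have tgt: "face (GTgt \<omega>) x \<in> S" using faces[OF gen_ok_Suc(1)[OF \<omega>]] by simp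
    have "cell_ty \<omega> x = TArrow (cell_pd \<omega> x) (\<iota> (face (GTgt \<omega>) x))"
      using \<omega> by (auto simp: cell_ty_def)
    moreover have "ctxt V ((cell_ctx S)(\<iota> (\<omega>, x) \<mapsto> TArrow (cell_pd \<omega> x) (\<iota> (face (GTgt \<omega>) x))))"
    proof (rule ctxt_shift[OF pasting_cell_pd[OF S ctxt \<omega> n(2) faces] _ W])
      show "pd_shape (cell_ctx S) (cell_pd \<omega> x) (popet_of \<omega>)"
        using pd_shape_cell_pd[OF S \<omega> n(2) faces] var_shape_cell[OF S] by blast
      show "\<iota> (face (GTgt \<omega>) x) \<in> dom (cell_ctx S)" using tgt by simp
      show "var_shape (cell_ctx S) (\<iota> (face (GTgt \<omega>) x)) (popet_of (tgt \<omega>))"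
        using var_shape_cell[OF S tgt_opetope[OF \<omega>]] tgt by simp
      show "\<forall>n m. n \<ge> 2 \<longrightarrow> preopetope n (popet_of \<omega>) \<longrightarrow> cell_pd \<omega> x = PdGraft m \<longrightarrow>
         (\<exists>x0 z. fmlookup m \<epsilon> = Some x0 \<and> var_tgt (cell_ctx S) x0 = Some z \<and>
            var_tgt (cell_ctx S) (\<iota> (face (GTgt \<omega>) x)) = Some z) \<and>
         (\<forall>a b r. a \<in> fmdom' m \<longrightarrow> (a \<cdot> Addr [b], r) \<in> W \<longrightarrow>
           (\<exists>xa z. fmlookup m a = Some xa \<and> var_src (cell_ctx S) b xa = Some z \<and>
              var_src (cell_ctx S) r (\<iota> (face (GTgt \<omega>) x)) = Some z))"
      proof (intro allI impI)
        fix j m assume h: "j \<ge> 2" "preopetope j (popet_of \<omega>)" and P: "cell_pd \<omega> x = PdGraft m"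
        obtain l where "k = Suc l" using dim[OF h] by blast
        then have o: "opetope (Suc (Suc l)) \<omega>" using \<omega> by simp
        note g = glob_cell_pd[OF S o n(2) faces W P]
        show "(\<exists>x0 z. fmlookup m \<epsilon> = Some x0 \<and> var_tgt (cell_ctx S) x0 = Some z \<and>
            var_tgt (cell_ctx S) (\<iota> (face (GTgt \<omega>) x)) = Some z) \<and>
         (\<forall>a b r. a \<in> fmdom' m \<longrightarrow> (a \<cdot> Addr [b], r) \<in> W \<longrightarrow>
           (\<exists>xa z. fmlookup m a = Some xa \<and> var_src (cell_ctx S) b xa = Some z \<and>
              var_src (cell_ctx S) r (\<iota> (face (GTgt \<omega>) x)) = Some z))"
          by (intro conjI allI impI g)
      qed
      show "\<forall>n z. n \<ge> 2 \<longrightarrow> preopetope n (popet_of \<omega>) \<longrightarrow> cell_pd \<omega> x = PdDegen z \<longrightarrow>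
         (\<exists>a. cell_ctx S (\<iota> (face (GTgt \<omega>) x)) = Some (TArrow (PdGraft (fmupd \<epsilon> a fmempty)) a) \<and> z = a)"
      proof (intro allI impI)
        fix z assume P: "cell_pd \<omega> x = PdDegen z"
        then obtain \<phi> where \<phi>: "\<omega> = OEdge \<phi>" by (auto simp: cell_pd_def degenerate_def split: if_splits)
        then have "z = \<iota> (face (GTgt (tgt \<omega>)) (gact X (GTgt \<omega>) x))"
          using P by (simp add: cell_pd_def degenerate_def)
        then show "\<exists>a. cell_ctx S (\<iota> (face (GTgt \<omega>) x)) = Some (TArrow (PdGraft (fmupd \<epsilon> a fmempty)) a) \<and> z = a"
          using cell_ctx_cell[OF S tgt] degen_faces(4)[OF \<omega> \<phi> n(2)] by simp
      qed
      show "\<iota> (\<omega>, x) \<in> V" "\<iota> (\<omega>, x) \<notin> dom (cell_ctx S)" using fresh .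
    qed
    ultimately show ?thesis unfolding cell_ctx_insert[OF x(1)] by simp
  qed
qed

text \<open>A cell of maximal dimension is not a face of any cell in \<open>S\<close>, since faces
  have strictly smaller dimension. Removing it leaves a closed set, and its own faces stay in
  it.\<close>

lemma ctxt_cell_ctx:
  assumes "finite S" "closed_cells S"
  shows "ctxt V (cell_ctx S)"
  using assms
proof (induction "card S" arbitrary: S)
  case 0
  then show ?case using ctxt_empty by (simp add: cell_ctx_empty)
next
  case (Suc k)
  define dim where "dim c = (THE n. opetope n (fst c))" for c :: "opet \<times> 'a"
  have dim: "dim (\<omega>, x) = n" if "opetope n \<omega>" for n \<omega> x
    unfolding dim_def using that opetope_dim_unique by (simp, intro the_equality) blast+
  have "S \<noteq> {}" using Suc.hyps(2) by auto
  then have "Max (dim ` S) \<in> dim ` S" using Suc.prems(1) by (intro Max_in) auto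
  then obtain c where c: "c \<in> S" "Max (dim ` S) = dim c" by (rule imageE) simp
  have max: "dim d \<le> dim c" if "d \<in> S" for d
    using Max_ge[of "dim ` S" "dim d"] Suc.prems(1) that c(2) by simp
  obtain \<omega> x where \<omega>x: "c = (\<omega>, x)" by (cases c)
  let ?S = "S - {(\<omega>, x)}"
  have face: "face g y \<in> ?S" if g: "gen_ok g" and y: "(gen_cod g, y) \<in> S" for g y
  proof -
    obtain n where n: "opetope (Suc n) (gen_cod g)" "opetope n (gen_dom g)" using gen_ok_dim[OF g] by blast
    have "Suc n \<le> dim (\<omega>, x)" using max[OF y] dim[OF n(1)] \<omega>x by simp
    then have "face g y \<noteq> (\<omega>, x)" using dim[OF n(2), of "gact X g y"] by force
    then show ?thesis using closed_face[OF Suc.prems(2) y g] by simp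
  qed
  have S: "closed_cells ?S" unfolding closed_cells_def
    using face Suc.prems(2) unfolding closed_cells_def by blast
  have "ctxt V (cell_ctx ?S)"
    using Suc.hyps(1)[of ?S] Suc.hyps(2) Suc.prems(1) S c(1) \<omega>x by simp
  moreover have "(\<omega>, x) \<in> cells" using c(1) \<omega>x Suc.prems(2) unfolding closed_cells_def by blast
  moreover have "face g x \<in> ?S" if "gen_ok g" "gen_cod g = \<omega>" for g using face[of g x] that c(1) \<omega>x by simp
  ultimately have "ctxt V (cell_ctx (insert (\<omega>, x) ?S))" using ctxt_insert_cell[OF S] by blast
  then show ?case using c(1) \<omega>x by (simp add: insert_absorb)
qed

lemma closed_cells: "closed_cells cells"
  unfolding closed_cells_def
proof (intro conjI allI impI)
  fix g x assume g: "gen_ok g" "(gen_cod g, x) \<in> cells"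
  obtain n where n: "opetope (Suc n) (gen_cod g)" "opetope n (gen_dom g)" using gen_ok_dim[OF g(1)] by blast
  show "face g x \<in> cells" using gact_in[OF X g(1)] g(2) by (simp add: mem_cells[OF n(1)] mem_cells[OF n(2)])
qed simp

lemma strat_set_cell_ctx:
  assumes "opetope n \<omega>"
  shows "strat_set (cell_ctx cells) \<omega> = (\<lambda>x. \<iota> (\<omega>, x)) ` on_obj X \<omega>"
proof (intro equalityI subsetI)
  fix v assume v: "v \<in> strat_set (cell_ctx cells) \<omega>"
  then have "v \<in> \<iota> ` cells" using dom_cell_ctx unfolding strat_set_def by blast
  then obtain \<alpha> x where x: "v = \<iota> (\<alpha>, x)" "(\<alpha>, x) \<in> cells" by auto
  obtain k where k: "opetope k \<alpha>" "x \<in> on_obj X \<alpha>" using cell_dim[OF closed_cells x(2)] .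
  have "v \<in> strat_set (cell_ctx cells) \<alpha>"
    using var_shape_cell[OF closed_cells k(1) x(2)] x by (simp add: mem_strat_set[OF k(1)])
  then have "\<alpha> = \<omega>" using strat_set_unique[OF k(1) assms _ v] by simp
  then show "v \<in> (\<lambda>x. \<iota> (\<omega>, x)) ` on_obj X \<omega>" using x(1) k(2) by blast
next
  fix v assume "v \<in> (\<lambda>x. \<iota> (\<omega>, x)) ` on_obj X \<omega>"
  then obtain x where x: "v = \<iota> (\<omega>, x)" "(\<omega>, x) \<in> cells" using mem_cells[OF assms] by blast
  then show "v \<in> strat_set (cell_ctx cells) \<omega>"
    using var_shape_cell[OF closed_cells assms x(2)] by (simp add: mem_strat_set[OF assms])
qed

lemma gen_act_cell:
  assumes "gen_ok g" "x \<in> on_obj X (gen_cod g)"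
  shows "gen_act (cell_ctx cells) g (\<iota> (gen_cod g, x)) = \<iota> (face g x)"
proof -
  obtain n where n: "opetope (Suc n) (gen_cod g)" using gen_ok_dim[OF assms(1)] by blast
  have x: "(gen_cod g, x) \<in> cells" using mem_cells[OF n] assms(2) by blast
  show ?thesis
  proof (cases g)
    case (GTgt \<omega>)
    then show ?thesis using var_tgt_cell[OF closed_cells x n] by simp
  next
    case (GSrc \<omega> p)
    then show ?thesis using var_src_cell[OF closed_cells x n, of p] assms(1) by simp
  qed
qed

definition cell_of :: "'a \<Rightarrow> 'a" where
  "cell_of v = snd (inv_into cells \<iota> v)"

lemma cell_of: "opetope n \<omega> \<Longrightarrow> x \<in> on_obj X \<omega> \<Longrightarrow> cell_of (\<iota> (\<omega>, x)) = x"
  unfolding cell_of_def using inv_cells mem_cells by simp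

text \<open>Naming a cell and reading the cell off its name are inverse to each other; both commute
  with the generators by \<open>gen_act_cell\<close>.\<close>

lemma isomorphic_strat_obj:
  assumes fin: "X \<in> Obj fin_opetopic_sets" "finite cells"
  shows "\<exists>\<Gamma> e e'. ctxt V \<Gamma> \<and> in_hom fin_opetopic_sets e (strat_obj \<Gamma>) X \<and>
    in_hom fin_opetopic_sets e' X (strat_obj \<Gamma>) \<and>
    Comp fin_opetopic_sets e' e = Ident fin_opetopic_sets (strat_obj \<Gamma>) \<and>
    Comp fin_opetopic_sets e e' = Ident fin_opetopic_sets X"
proof -
  define \<Gamma> where "\<Gamma> = cell_ctx cells"
  have \<Gamma>: "ctxt V \<Gamma>" unfolding \<Gamma>_def by (rule ctxt_cell_ctx[OF fin(2) closed_cells])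
  then have wf: "wf_ctxt \<Gamma>" using ctxt_wf(1) by blast
  have obj: "on_obj (strat_obj \<Gamma>) \<omega> = (\<lambda>x. \<iota> (\<omega>, x)) ` on_obj X \<omega>" if n: "opetope n \<omega>" for n \<omega>
    using strat_set_cell_ctx[OF n] n unfolding \<Gamma>_def by simp
  have act: "gact (strat_obj \<Gamma>) g (\<iota> (gen_cod g, x)) = \<iota> (face g x)"
    if g: "gen_ok g" and x: "x \<in> on_obj X (gen_cod g)" for g x
  proof -
    obtain n where n: "opetope (Suc n) (gen_cod g)" using gen_ok_dim[OF g] by blast
    have "\<iota> (gen_cod g, x) \<in> strat_set \<Gamma> (gen_cod g)" using obj[OF n] n x by simp
    then show ?thesis using gact_strat_obj[OF wf g] gen_act_cell[OF g x] unfolding \<Gamma>_def by simp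
  qed
  have e: "in_hom fin_opetopic_sets (family_mor (strat_obj \<Gamma>) (\<lambda>_. cell_of) X) (strat_obj \<Gamma>) X"
  proof (rule family_mor_hom[OF strat_obj_fin[OF wf] fin(1)])
    fix n \<omega> v assume n: "opetope n \<omega>" and v: "v \<in> on_obj (strat_obj \<Gamma>) \<omega>"
    obtain x where "v = \<iota> (\<omega>, x)" "x \<in> on_obj X \<omega>" using v unfolding obj[OF n] by (rule imageE)
    then show "cell_of v \<in> on_obj X \<omega>" using cell_of[OF n] by simp
  next
    fix g v assume g: "gen_ok g" and v: "v \<in> on_obj (strat_obj \<Gamma>) (gen_cod g)"
    obtain n where n: "opetope (Suc n) (gen_cod g)" "opetope n (gen_dom g)" using gen_ok_dim[OF g] by blast
    obtain x where x: "v = \<iota> (gen_cod g, x)" "x \<in> on_obj X (gen_cod g)"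
      using v unfolding obj[OF n(1)] by (rule imageE)
    show "cell_of (gact (strat_obj \<Gamma>) g v) = gact X g (cell_of v)"
      unfolding x(1) act[OF g x(2)] cell_of[OF n(1) x(2)] by (rule cell_of[OF n(2) gact_in[OF X g x(2)]])
  qed
  have e': "in_hom fin_opetopic_sets (family_mor X (\<lambda>\<omega> x. \<iota> (\<omega>, x)) (strat_obj \<Gamma>)) X (strat_obj \<Gamma>)"
    by (rule family_mor_hom[OF fin(1) strat_obj_fin[OF wf]]) (simp_all add: obj act del: strat_obj_on_obj)
  have "Comp fin_opetopic_sets (family_mor X (\<lambda>\<omega> x. \<iota> (\<omega>, x)) (strat_obj \<Gamma>)) (family_mor (strat_obj \<Gamma>) (\<lambda>_. cell_of) X) =
      Ident fin_opetopic_sets (strat_obj \<Gamma>)"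
  proof (rule family_mor_inverse)
    fix n \<omega> v assume n: "opetope n \<omega>" and v: "v \<in> on_obj (strat_obj \<Gamma>) \<omega>"
    obtain x where "v = \<iota> (\<omega>, x)" "x \<in> on_obj X \<omega>" using v unfolding obj[OF n] by (rule imageE)
    then show "cell_of v \<in> on_obj X \<omega>" "\<iota> (\<omega>, cell_of v) = v" using cell_of[OF n] by simp_all
  qed
  moreover have "Comp fin_opetopic_sets (family_mor (strat_obj \<Gamma>) (\<lambda>_. cell_of) X) (family_mor X (\<lambda>\<omega> x. \<iota> (\<omega>, x)) (strat_obj \<Gamma>)) =
      Ident fin_opetopic_sets X"
    by (rule family_mor_inverse) (simp_all add: obj cell_of del: strat_obj_on_obj)
  ultimately show ?thesis using \<Gamma> e e' by blast
qed

end

lemma stratification_surjective: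
  fixes V :: "'a set" and X :: "'a presheaf"
  assumes V: "infinite V" and obj: "X \<in> Obj fin_opetopic_sets"
  shows "\<exists>\<Gamma> e e'. ctxt V \<Gamma> \<and> in_hom fin_opetopic_sets e (strat_obj \<Gamma>) X \<and>
    in_hom fin_opetopic_sets e' X (strat_obj \<Gamma>) \<and>
    Comp fin_opetopic_sets e' e = Ident fin_opetopic_sets (strat_obj \<Gamma>) \<and>
    Comp fin_opetopic_sets e e' = Ident fin_opetopic_sets X"
proof -
  let ?E = "SIGMA \<omega>:Obj opet_cat. on_obj X \<omega>"
  have fin: "finite ?E" and p: "presheaf X"
    using obj unfolding fin_opetopic_sets_def full_subcat_simps by (auto simp: opetopic_sets_simps)
  \<comment> \<open>An infinite supply of variables contains distinct names for the finitely many
    cells.\<close>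
  obtain A where A: "A \<subseteq> V" "finite A" "card A = card ?E" using infinite_arbitrarily_large[OF V] by metis
  obtain \<iota> where "bij_betw \<iota> ?E A" using finite_same_card_bij[OF fin A(2)] A(3) by metis
  then interpret cell_naming X V \<iota>
    using p A(1) by unfold_locales (auto simp: bij_betw_def)
  show ?thesis using isomorphic_strat_obj[OF obj] fin unfolding cells_def by blast
qed

theorem theorem4p7p3:
  fixes Var :: "'a set"
  assumes "infinite Var"
  shows "is_equivalence (op_cat (ctx_cat Var)) (fin_opetopic_sets :: ('a presheaf, 'a presheaf_mor) cat)
    stratification"
proof -
  \<comment> \<open>Contravariance is absorbed by \<open>op_cat\<close>: a context morphism from
    \<open>\<Upsilon>\<close> to \<open>\<Gamma>\<close> counts as one from \<open>\<Gamma>\<close>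
    to \<open>\<Upsilon>\<close>.\<close>
  interpret fully_faithful_surjective "op_cat (ctx_cat Var)"
    "fin_opetopic_sets :: ('a presheaf, 'a presheaf_mor) cat" stratification
  proof
    show "is_category (op_cat (ctx_cat Var))" by (rule is_category_op[OF is_category_ctx_cat])
    show "is_category (fin_opetopic_sets :: ('a presheaf, 'a presheaf_mor) cat)"
      by (rule is_category_fin_opetopic_sets)
    show "is_functor (op_cat (ctx_cat Var)) fin_opetopic_sets stratification"
      by (rule is_functor_stratification)
  next
    fix \<Gamma> \<Upsilon> h
    assume "\<Gamma> \<in> Obj (op_cat (ctx_cat Var))" "\<Upsilon> \<in> Obj (op_cat (ctx_cat Var))"
      "in_hom fin_opetopic_sets h (on_obj stratification \<Gamma>) (on_obj stratification \<Upsilon>)"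
    then show "\<exists>f. in_hom (op_cat (ctx_cat Var)) f \<Gamma> \<Upsilon> \<and> on_mor stratification f = h"
      using stratification_full by (simp add: stratification_def ctx_cat_simps(1))
  next
    fix f g \<Gamma> \<Upsilon>
    assume "in_hom (op_cat (ctx_cat Var)) f \<Gamma> \<Upsilon>" "in_hom (op_cat (ctx_cat Var)) g \<Gamma> \<Upsilon>"
      "on_mor stratification f = on_mor stratification g"
    then show "f = g" using stratification_faithful by (simp add: stratification_def)
  next
    fix X :: "'a presheaf" assume "X \<in> Obj fin_opetopic_sets"
    from stratification_surjective[OF assms this]
    show "\<exists>\<Gamma> e e'. \<Gamma> \<in> Obj (op_cat (ctx_cat Var)) \<and>
        in_hom fin_opetopic_sets e (on_obj stratification \<Gamma>) X \<and>
        in_hom fin_opetopic_sets e' X (on_obj stratification \<Gamma>) \<and>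
        Comp fin_opetopic_sets e' e = Ident fin_opetopic_sets (on_obj stratification \<Gamma>) \<and>
        Comp fin_opetopic_sets e e' = Ident fin_opetopic_sets X"
      by (simp add: stratification_def ctx_cat_simps(1))
  qed
  show ?thesis by (rule equivalence)
qed

end
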